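(* Let $(\mathcal{B},\mathcal{L},\theta,\mathcal{I}_\alpha)$ be a generalized Boolean dynamical system, let $\partial E$ be its boundary path space, let $D$ be the diagonal subalgebra of $C^*(\mathcal{B},\mathcal{L},\theta,\mathcal{I}_\alpha)$ and let $\widehat{D}$ be the spectrum of $D$. Then, for each $\mu\in\partial E$, there exists a unique $\Phi(\mu)\in\widehat{D}$ such that for all $\alpha\in\mathcal{L}^*$ and $A\in\mathcal{I}_\alpha$, $$\Phi(\mu)(s_{\alpha,A}s_{\alpha,A}^* )=\begin{cases}1 & \text{if }\mu\in\mathcal{N}(\alpha,A),\\ 0&\text{otherwise.}\end{cases}$$ Moreover, the map $\Phi:\partial E\to\widehat{D}$, $\mu\mapsto\Phi(\mu)$, is a homeomorphism.
   Context: Boolean dynamical systems. A Boolean algebra is a relatively complemented distributive lattice $\mathcal{B}$ with least element $\emptyset$ (no greatest element is required), with meet $\cap$, join $\cup$, relative complement $\setminus$ and order $A\subseteq B \iff A\cap B=A$. An ideal of $\mathcal{B}$ is a non-empty subset closed under finite unions and downward closed; it is again a Boolean algebra. A filter is a non-empty, down-directed, upward closed subset not containing $\emptyset$; an ultrafilter is a maximal filter; $\widehat{\mathcal{B}}$ is the set of ultrafilters of $\mathcal{B}$. An action on $\mathcal{B}$ is a map $\mathcal{B}\to\mathcal{B}$ preserving $\cap,\cup,\setminus$ and sending $\emptyset$ to $\emptyset$. For a set $\mathcal{L}$, $\mathcal{L}^{\geq 1}$ is the set of non-empty finite words, $\mathcal{L}^*=\mathcal{L}^{\ge1}\cup\{\emptyset\}$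 ($\emptyset$ also denotes the empty word), $|\alpha|$ is the length of $\alpha$. A Boolean dynamical system is a triple $(\mathcal{B},\mathcal{L},\theta)$ with $\{\theta_\alpha\}_{\alpha\in\mathcal{L}}$ a family of actions on $\mathcal{B}$; $\theta_{\alpha_1\cdots\alpha_n}=\theta_{\alpha_n}\circ\cdots\circ\theta_{\alpha_1}$, $\theta_\emptyset=\mathrm{Id}$. For $B\in\mathcal{B}$, $\Delta_B=\{\alpha\in\mathcal{L}:\theta_\alpha(B)\ne\emptyset\}$; $A$ is regular if $0<|\Delta_B|<\infty$ for every $\emptyset\neq B\subseteq A$; $\mathcal{B}_{reg}$ is the set of regular elements (including $\emptyset$). $C^*$-algebra. A generalized Boolean dynamical system $(\mathcal{B},\mathcal{L},\theta,\mathcal{I}_\alpha)$ is a Boolean dynamical system together with ideals $\mathcal{I}_\alpha\subseteq\mathcal{B}$ ($\alpha\in\mathcal{L}$) such that $\theta_\alpha(\mathcal{B})\subseteq\mathcal{I}_\alpha$. A representation of it in a $C^*$-algebra consists of projections $\{P_A:A\in\mathcal{B}\}$ and partial isometries $\{S_{\alpha,B}:\alpha\in\mathcal{L},B\in\mathcal{I}_\alpha\}$ such that: (i) $P_\emptyset=0$, $P_{A\cap A'}=P_AP_{A'}$, $P_{A\cup A'}=P_A+P_{A'}-P_{A\cap A'}$; (ii) $P_AS_{\alpha,B}=S_{\alpha,B}P_{\theta_\alpha(A)}$; (iii) $S_{\alpha,B}^*S_{\alpha',B'}=\delta_{\alpha,\alpha'}P_{B\cap B'}$; (iv) $P_A=\sum_{\alpha\in\Delta_A}S_{\alpha,\theta_\alpha(A)}S_{\alpha,\theta_\alpha(A)}^*$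 for $A\in\mathcal{B}_{reg}$. $C^*(\mathcal{B},\mathcal{L},\theta,\mathcal{I}_\alpha)$ is the $C^*$-algebra generated by a universal representation $\{p_A,s_{\alpha,B}\}$. Put $\mathcal{I}_\emptyset=\mathcal{B}$ and, for $\alpha=\alpha_1\cdots\alpha_n$, $\mathcal{I}_\alpha=\{A\in\mathcal{B}: A\subseteq\theta_{\alpha_2\cdots\alpha_n}(B)\text{ for some }B\in\mathcal{I}_{\alpha_1}\}$. Put $s_{\emptyset,A}=p_A$ and, for $\alpha=\alpha_1\cdots\alpha_n$ and $A\in\mathcal{I}_\alpha$, $s_{\alpha,A}=s_{\alpha_1,B}s_{\alpha_2,\theta_{\alpha_2}(B)}s_{\alpha_3,\theta_{\alpha_2\alpha_3}(B)}\cdots s_{\alpha_n,A}$, where $B\in\mathcal{I}_{\alpha_1}$ satisfies $A\subseteq\theta_{\alpha_2\cdots\alpha_n}(B)$. The diagonal subalgebra $D$ is the (commutative) $C^*$-subalgebra generated by the commuting projections $s_{\alpha,A}s_{\alpha,A}^*$, $\alpha\in\mathcal{L}^*$, $A\in\mathcal{I}_\alpha$; $\widehat D$ is the space of nonzero homomorphisms $D\to\mathbb{C}$ with the topology of pointwise convergence. Boundary path space. $E^0=\widehat{\mathcal{B}}$ with basis of open sets $Z(A)=\{\xi\in\widehat{\mathcal{B}}:A\in\xi\}$, $A\in\mathcal{B}$. $F^0=E^0\cup\{\emptyset\}$, where $\emptyset$ (the empty subset of $\mathcal{B}$) is an isolated point if $\mathcal{B}$ has a greatest element, and otherwise is the point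 at infinity of the one-point compactification of $E^0$. For $\alpha\in\mathcal{L}$, $X_\alpha=\widehat{\mathcal{I}_\alpha}$ is the set of ultrafilters of $\mathcal{I}_\alpha$. $E^1=\{e^\alpha_\eta:\alpha\in\mathcal{L},\eta\in X_\alpha\}$ with the topology generated by the sets $Z^1(\alpha,B)=\{e^\alpha_\eta:\eta\in X_\alpha,\ B\in\eta\}$, $\alpha\in\mathcal{L}$, $B\in\mathcal{I}_\alpha$. Define $d:E^1\to E^0$, $d(e^\alpha_\eta)=\{C\in\mathcal{B}: C\supseteq A\text{ for some }A\in\eta\}$, and $r:E^1\to F^0$, $r(e^\alpha_\eta)=\{A\in\mathcal{B}:\theta_\alpha(A)\in\eta\}$. $E^n$ ($n\ge2$) is the set of $e_1\cdots e_n\in\prod_{i=1}^nE^1$ with $d(e_i)=r(e_{i+1})$ for $1\le i<n$, with the subspace topology; $E^*=\bigsqcup_{n\ge0}E^n$ with the disjoint union topology; $E^\infty$ is the set of infinite sequences $(e_i)_{i\ge1}$ in $E^1$ with $d(e_i)=r(e_{i+1})$ for all $i$. For $\mu=e_1\cdots e_n\in E^n$, $d(\mu)=d(e_n)$, $r(\mu)=r(e_1)$; for $\xi\in E^0$, $d(\xi)=r(\xi)=\xi$; for an infinite path, $r(\mu)=r(e_1)$. $|\mu|$ is the length, and $\mu_{[1,i]}$ is the initial sub-path of length $i$. Let $F^0_{sce}=F^0\setminus\overline{r(E^1)}$, $F^0_{fin}=\{v\in F^0: v\text{ has a neighborhood }V\text{ with }r^{-1}(V)\text{ compact}\}$, $F^0_{rg}=F^0_{fin}\setminus\overline{F^0_{sce}}$,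 $F^0_{sg}=F^0\setminus F^0_{rg}$, $E^0_{sg}=F^0_{sg}\cap E^0$. The boundary path space is $\partial E=E^\infty\sqcup\{\mu\in E^*:d(\mu)\in E^0_{sg}\}$. For $S\subset E^*$ let $\mathcal{Z}(S)=\{\mu\in\partial E: r(\mu)\in S\text{ or }\mu_{[1,i]}\in S\text{ for some }1\le i\le|\mu|\}$; the topology of $\partial E$ is generated by the sets $\mathcal{Z}(U)\cap\mathcal{Z}(K)^c$ with $U\subseteq E^*$ open and $K\subseteq E^*$ compact. Cylinder sets. For $\alpha\in\mathcal{L}^{\ge1}$ and $A\in\mathcal{I}_\alpha$, $\mathcal{N}(\alpha,A)$ is the set of $\mu=(e^{\beta_n}_{\eta_n})\in\partial E$ with $|\mu|\ge|\alpha|$, $\beta_1\cdots\beta_{|\alpha|}=\alpha$ and $A\in\eta_{|\alpha|}$; for $A\in\mathcal{B}$, $\mathcal{N}(\emptyset,A)=\{\mu\in\partial E:A\in r(\mu)\}$. (In particular $\mathcal{N}(\alpha,\emptyset)=\emptyset$.) *)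

theory Defs
  imports "HOL-Analysis.Analysis" "HOL-Algebra.Module" "HOL-Library.Extended_Nat"
begin

section \<open>Boolean algebras without a greatest element\<close>

text \<open>The whole type is the Boolean algebra. The two axioms say that \<open>x - y\<close> is the complement of
  \<open>inf x y\<close> in the interval from \<open>bot\<close> to \<open>x\<close>; the lemma recovers complements in all intervals.\<close>

class gen_boolean_algebra = distrib_lattice + bounded_lattice_bot + minus +
  assumes inf_diff_bot: "inf (x - y) y = bot"
    and sup_diff_inf: "sup (x - y) (inf x y) = x"

lemma relatively_complemented:
  fixes a b x :: "'b::gen_boolean_algebra"
  assumes "a \<le> x" "x \<le> b"
  shows "\<exists>y. inf x y = a \<and> sup x y = b"
proof (intro exI conjI)
  have "inf x (b - x) = bot"
    using inf_diff_bot[of b x] by (simp add: inf_commute)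
  then show "inf x (sup a (b - x)) = a"
    using assms by (simp add: inf_sup_distrib1 inf_absorb2)
  have "sup (b - x) x = b"
    using sup_diff_inf[of b x] assms by (simp add: inf_absorb2)
  then show "sup x (sup a (b - x)) = b"
    using assms by (metis sup.absorb2 sup_commute sup_left_commute)
qed

definition ba_ideal :: "'b::gen_boolean_algebra set \<Rightarrow> bool" where
  "ba_ideal I \<longleftrightarrow> I \<noteq> {} \<and> (\<forall>A\<in>I. \<forall>B\<in>I. sup A B \<in> I) \<and> (\<forall>A\<in>I. \<forall>B. B \<le> A \<longrightarrow> B \<in> I)"

text \<open>Filters and ultrafilters of an ideal \<open>I\<close>, which is regarded as a Boolean algebra in its own
  right; those of the ambient Boolean algebra are the ones of \<open>UNIV\<close>.\<close>

definition ba_filter :: "'b::gen_boolean_algebra set \<Rightarrow> 'b set \<Rightarrow> bool" where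
  "ba_filter I F \<longleftrightarrow> F \<noteq> {} \<and> F \<subseteq> I \<and> bot \<notin> F \<and>
     (\<forall>A\<in>F. \<forall>B\<in>F. \<exists>C\<in>F. C \<le> A \<and> C \<le> B) \<and> (\<forall>A\<in>F. \<forall>B\<in>I. A \<le> B \<longrightarrow> B \<in> F)"

definition ultrafilters :: "'b::gen_boolean_algebra set \<Rightarrow> 'b set set" where
  "ultrafilters I = {F. ba_filter I F \<and> (\<forall>F'. ba_filter I F' \<and> F \<subseteq> F' \<longrightarrow> F' = F)}"

definition ba_action :: "('b::gen_boolean_algebra \<Rightarrow> 'b) \<Rightarrow> bool" where
  "ba_action f \<longleftrightarrow> f bot = bot \<and> (\<forall>A B. f (inf A B) = inf (f A) (f B)) \<and>
     (\<forall>A B. f (sup A B) = sup (f A) (f B)) \<and> (\<forall>A B. f (A - B) = f A - f B)"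


section \<open>Generalized Boolean dynamical systems\<close>

record ('l, 'b) gbds =
  labels :: "'l set"
  act :: "'l \<Rightarrow> 'b \<Rightarrow> 'b"
  idl :: "'l \<Rightarrow> 'b set"

definition generalized_bds :: "('l, 'b::gen_boolean_algebra) gbds \<Rightarrow> bool" where
  "generalized_bds G \<longleftrightarrow>
     (\<forall>\<alpha>\<in>labels G. ba_action (act G \<alpha>) \<and> ba_ideal (idl G \<alpha>) \<and> range (act G \<alpha>) \<subseteq> idl G \<alpha>)"

text \<open>\<open>act_word G [\<alpha>\<^sub>1, \<dots>, \<alpha>\<^sub>n]\<close> applies the action of \<open>\<alpha>\<^sub>1\<close> first.\<close>

definition act_word :: "('l, 'b) gbds \<Rightarrow> 'l list \<Rightarrow> 'b \<Rightarrow> 'b" where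
  "act_word G w = fold (act G) w"

fun idl_word :: "('l, 'b::gen_boolean_algebra) gbds \<Rightarrow> 'l list \<Rightarrow> 'b set" where
  "idl_word G [] = UNIV"
| "idl_word G (\<alpha> # w) = {A. \<exists>B\<in>idl G \<alpha>. A \<le> act_word G w B}"

definition Delta :: "('l, 'b::gen_boolean_algebra) gbds \<Rightarrow> 'b \<Rightarrow> 'l set" where
  "Delta G B = {\<alpha> \<in> labels G. act G \<alpha> B \<noteq> bot}"

definition regular :: "('l, 'b::gen_boolean_algebra) gbds \<Rightarrow> 'b \<Rightarrow> bool" where
  "regular G A \<longleftrightarrow> (\<forall>B. B \<noteq> bot \<and> B \<le> A \<longrightarrow> finite (Delta G B) \<and> Delta G B \<noteq> {})"


section \<open>C*-algebras\<close>

text \<open>C*-algebras are carried by subsets of types, so that one can quantify over all C*-algebra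
  structures on a given type. They need not be unital: the field \<open>one\<close> inherited from the ring
  record is unconstrained and never used.\<close>

definition complex_ring :: "complex ring" where
  "complex_ring = \<lparr>carrier = UNIV, monoid.mult = (*), one = 1, zero = 0, add = (+)\<rparr>"

record 'c cstar = "(complex, 'c) module" +
  star :: "'c \<Rightarrow> 'c"
  nrm :: "'c \<Rightarrow> real"

locale cstar_algebra = Module.module complex_ring A for A :: "'c cstar" (structure) +
  assumes mult_closed: "\<lbrakk>x \<in> carrier A; y \<in> carrier A\<rbrakk> \<Longrightarrow> x \<otimes> y \<in> carrier A"
    and mult_assoc: "\<lbrakk>x \<in> carrier A; y \<in> carrier A; z \<in> carrier A\<rbrakk> \<Longrightarrow> (x \<otimes> y) \<otimes> z = x \<otimes> (y \<otimes> z)"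
    and mult_distrib_right:
      "\<lbrakk>x \<in> carrier A; y \<in> carrier A; z \<in> carrier A\<rbrakk> \<Longrightarrow> (x \<oplus> y) \<otimes> z = x \<otimes> z \<oplus> y \<otimes> z"
    and mult_distrib_left:
      "\<lbrakk>x \<in> carrier A; y \<in> carrier A; z \<in> carrier A\<rbrakk> \<Longrightarrow> x \<otimes> (y \<oplus> z) = x \<otimes> y \<oplus> x \<otimes> z"
    and smult_mult_left:
      "\<lbrakk>x \<in> carrier A; y \<in> carrier A\<rbrakk> \<Longrightarrow> (c \<odot> x) \<otimes> y = c \<odot> (x \<otimes> y)"
    and smult_mult_right:
      "\<lbrakk>x \<in> carrier A; y \<in> carrier A\<rbrakk> \<Longrightarrow> x \<otimes> (c \<odot> y) = c \<odot> (x \<otimes> y)"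
    and star_closed: "x \<in> carrier A \<Longrightarrow> star A x \<in> carrier A"
    and star_star: "x \<in> carrier A \<Longrightarrow> star A (star A x) = x"
    and star_add: "\<lbrakk>x \<in> carrier A; y \<in> carrier A\<rbrakk> \<Longrightarrow> star A (x \<oplus> y) = star A x \<oplus> star A y"
    and star_smult: "x \<in> carrier A \<Longrightarrow> star A (c \<odot> x) = cnj c \<odot> star A x"
    and star_mult: "\<lbrakk>x \<in> carrier A; y \<in> carrier A\<rbrakk> \<Longrightarrow> star A (x \<otimes> y) = star A y \<otimes> star A x"
    and nrm_nonneg: "x \<in> carrier A \<Longrightarrow> 0 \<le> nrm A x"
    and nrm_eq_0: "x \<in> carrier A \<Longrightarrow> nrm A x = 0 \<longleftrightarrow> x = \<zero>"
    and nrm_triangle: "\<lbrakk>x \<in> carrier A; y \<in> carrier A\<rbrakk> \<Longrightarrow> nrm A (x \<oplus> y) \<le> nrm A x + nrm A y"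
    and nrm_smult: "x \<in> carrier A \<Longrightarrow> nrm A (c \<odot> x) = cmod c * nrm A x"
    and nrm_mult: "\<lbrakk>x \<in> carrier A; y \<in> carrier A\<rbrakk> \<Longrightarrow> nrm A (x \<otimes> y) \<le> nrm A x * nrm A y"
    and cstar_identity: "x \<in> carrier A \<Longrightarrow> nrm A (star A x \<otimes> x) = (nrm A x)\<^sup>2"
    and complete:
      "\<lbrakk>\<And>n. X n \<in> carrier A; \<And>e. e > 0 \<Longrightarrow> \<exists>N. \<forall>m\<ge>N. \<forall>n\<ge>N. nrm A (X m \<ominus> X n) < e\<rbrakk>
        \<Longrightarrow> \<exists>x\<in>carrier A. (\<lambda>n. nrm A (X n \<ominus> x)) \<longlonglongrightarrow> 0"

definition cstar_subalgebra :: "'c cstar \<Rightarrow> 'c set \<Rightarrow> bool" where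
  "cstar_subalgebra A D \<longleftrightarrow> D \<subseteq> carrier A \<and> \<zero>\<^bsub>A\<^esub> \<in> D \<and>
     (\<forall>x\<in>D. \<forall>y\<in>D. x \<oplus>\<^bsub>A\<^esub> y \<in> D \<and> x \<otimes>\<^bsub>A\<^esub> y \<in> D) \<and>
     (\<forall>x\<in>D. star A x \<in> D \<and> (\<forall>c. c \<odot>\<^bsub>A\<^esub> x \<in> D)) \<and>
     (\<forall>x\<in>carrier A. (\<forall>e>0. \<exists>y\<in>D. nrm A (x \<ominus>\<^bsub>A\<^esub> y) < e) \<longrightarrow> x \<in> D)"

definition cstar_gen :: "'c cstar \<Rightarrow> 'c set \<Rightarrow> 'c set" where
  "cstar_gen A X = \<Inter>{D. cstar_subalgebra A D \<and> X \<subseteq> D}"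

definition star_hom :: "'c cstar \<Rightarrow> 'd cstar \<Rightarrow> ('c \<Rightarrow> 'd) \<Rightarrow> bool" where
  "star_hom A B f \<longleftrightarrow> f \<in> carrier A \<rightarrow> carrier B \<and>
     (\<forall>x\<in>carrier A. \<forall>y\<in>carrier A.
        f (x \<oplus>\<^bsub>A\<^esub> y) = f x \<oplus>\<^bsub>B\<^esub> f y \<and> f (x \<otimes>\<^bsub>A\<^esub> y) = f x \<otimes>\<^bsub>B\<^esub> f y) \<and>
     (\<forall>x\<in>carrier A. f (star A x) = star B (f x) \<and> (\<forall>c. f (c \<odot>\<^bsub>A\<^esub> x) = c \<odot>\<^bsub>B\<^esub> f x))"

definition projection :: "'c cstar \<Rightarrow> 'c \<Rightarrow> bool" where
  "projection A x \<longleftrightarrow> x \<in> carrier A \<and> star A x = x \<and> x \<otimes>\<^bsub>A\<^esub> x = x"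

definition partial_isometry :: "'c cstar \<Rightarrow> 'c \<Rightarrow> bool" where
  "partial_isometry A x \<longleftrightarrow> x \<in> carrier A \<and> x \<otimes>\<^bsub>A\<^esub> star A x \<otimes>\<^bsub>A\<^esub> x = x"

text \<open>Nonzero homomorphisms from a subalgebra \<open>D\<close> to the complex numbers, represented as functions
  that are \<open>undefined\<close> outside \<open>D\<close>, with the topology of pointwise convergence on \<open>D\<close>.\<close>

definition spectrum :: "'c cstar \<Rightarrow> 'c set \<Rightarrow> ('c \<Rightarrow> complex) set" where
  "spectrum A D = {\<phi> \<in> extensional D.
     (\<forall>x\<in>D. \<forall>y\<in>D. \<phi> (x \<oplus>\<^bsub>A\<^esub> y) = \<phi> x + \<phi> y \<and> \<phi> (x \<otimes>\<^bsub>A\<^esub> y) = \<phi> x * \<phi> y) \<and>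
     (\<forall>c. \<forall>x\<in>D. \<phi> (c \<odot>\<^bsub>A\<^esub> x) = c * \<phi> x) \<and> (\<exists>x\<in>D. \<phi> x \<noteq> 0)}"

definition spectrum_topology :: "'c cstar \<Rightarrow> 'c set \<Rightarrow> ('c \<Rightarrow> complex) topology" where
  "spectrum_topology A D = subtopology (product_topology (\<lambda>_. euclidean) D) (spectrum A D)"


section \<open>The C*-algebra of a generalized Boolean dynamical system\<close>

definition representation ::
  "('l, 'b::gen_boolean_algebra) gbds \<Rightarrow> 'c cstar \<Rightarrow> ('b \<Rightarrow> 'c) \<Rightarrow> ('l \<Rightarrow> 'b \<Rightarrow> 'c) \<Rightarrow> bool" where
  "representation G A P S \<longleftrightarrow>
     (\<forall>B. projection A (P B)) \<and>
     (\<forall>\<alpha>\<in>labels G. \<forall>B\<in>idl G \<alpha>. partial_isometry A (S \<alpha> B)) \<and>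
     P bot = \<zero>\<^bsub>A\<^esub> \<and>
     (\<forall>B B'. P (inf B B') = P B \<otimes>\<^bsub>A\<^esub> P B') \<and>
     (\<forall>B B'. P (sup B B') = P B \<oplus>\<^bsub>A\<^esub> P B' \<ominus>\<^bsub>A\<^esub> P (inf B B')) \<and>
     (\<forall>B. \<forall>\<alpha>\<in>labels G. \<forall>B'\<in>idl G \<alpha>. P B \<otimes>\<^bsub>A\<^esub> S \<alpha> B' = S \<alpha> B' \<otimes>\<^bsub>A\<^esub> P (act G \<alpha> B)) \<and>
     (\<forall>\<alpha>\<in>labels G. \<forall>\<alpha>'\<in>labels G. \<forall>B\<in>idl G \<alpha>. \<forall>B'\<in>idl G \<alpha>'.
        star A (S \<alpha> B) \<otimes>\<^bsub>A\<^esub> S \<alpha>' B' = (if \<alpha> = \<alpha>' then P (inf B B') else \<zero>\<^bsub>A\<^esub>)) \<and>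
     (\<forall>B. regular G B \<longrightarrow>
        P B = finsum A (\<lambda>\<alpha>. S \<alpha> (act G \<alpha> B) \<otimes>\<^bsub>A\<^esub> star A (S \<alpha> (act G \<alpha> B))) (Delta G B))"

text \<open>HOL cannot quantify over all types inside a formula, so the universal property is stated for
  C*-algebras carried by subsets of one fixed large type. This loses nothing: writing \<open>\<kappa>\<close> for the
  (infinite) cardinality of \<open>'l list \<times> 'b\<close>, a C*-algebra generated by a representation has at most
  \<open>\<kappa>\<close> many *-polynomials with coefficients in the Gaussian rationals, every element is the limit of
  a sequence of those, and so it has at most \<open>\<kappa>\<^sup>\<omega> \<le> 2\<^sup>\<kappa>\<close> elements. Hence it is isomorphic to
  a C*-algebra carried by a subset of \<open>test_type\<close>, whatever type it lives on originally.\<close>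

type_synonym ('l, 'b) test_type = "('l list \<times> 'b) set \<Rightarrow> ('l list \<times> 'b) set \<Rightarrow> complex"

definition universal_representation ::
  "('l, 'b::gen_boolean_algebra) gbds \<Rightarrow> 'c cstar \<Rightarrow> ('b \<Rightarrow> 'c) \<Rightarrow> ('l \<Rightarrow> 'b \<Rightarrow> 'c) \<Rightarrow> bool" where
  "universal_representation G A p s \<longleftrightarrow>
     cstar_algebra A \<and> representation G A p s \<and>
     cstar_gen A (range p \<union> {s \<alpha> B | \<alpha> B. \<alpha> \<in> labels G \<and> B \<in> idl G \<alpha>}) = carrier A \<and>
     (\<forall>(C :: ('l, 'b) test_type cstar) P S. cstar_algebra C \<and> representation G C P S \<longrightarrow>
        (\<exists>f. star_hom A C f \<and> (\<forall>B. f (p B) = P B) \<and>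
             (\<forall>\<alpha>\<in>labels G. \<forall>B\<in>idl G \<alpha>. f (s \<alpha> B) = S \<alpha> B)))"

text \<open>\<open>s_prod G A s B [\<alpha>\<^sub>1, \<dots>, \<alpha>\<^sub>n] C\<close> is the product of the \<open>s \<alpha>\<^sub>i (\<theta>\<^bsub>\<alpha>\<^sub>2\<dots>\<alpha>\<^sub>i\<^esub> B)\<close>
  for \<open>i < n\<close> and of \<open>s \<alpha>\<^sub>n C\<close>.\<close>

fun s_prod ::
  "('l, 'b) gbds \<Rightarrow> 'c cstar \<Rightarrow> ('l \<Rightarrow> 'b \<Rightarrow> 'c) \<Rightarrow> 'b \<Rightarrow> 'l list \<Rightarrow> 'b \<Rightarrow> 'c" where
  "s_prod G A s B [] C = undefined"
| "s_prod G A s B [\<alpha>] C = s \<alpha> C"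
| "s_prod G A s B (\<alpha> # \<beta> # w) C = s \<alpha> B \<otimes>\<^bsub>A\<^esub> s_prod G A s (act G \<beta> B) (\<beta> # w) C"

text \<open>The value does not depend on the element \<open>B\<close> that is chosen here.\<close>

fun s_word ::
  "('l, 'b::gen_boolean_algebra) gbds \<Rightarrow> 'c cstar \<Rightarrow> ('b \<Rightarrow> 'c) \<Rightarrow> ('l \<Rightarrow> 'b \<Rightarrow> 'c) \<Rightarrow>
    'l list \<Rightarrow> 'b \<Rightarrow> 'c" where
  "s_word G A p s [] C = p C"
| "s_word G A p s (\<alpha> # w) C =
     s_prod G A s (SOME B. B \<in> idl G \<alpha> \<and> C \<le> act_word G w B) (\<alpha> # w) C"

definition range_proj ::
  "('l, 'b::gen_boolean_algebra) gbds \<Rightarrow> 'c cstar \<Rightarrow> ('b \<Rightarrow> 'c) \<Rightarrow> ('l \<Rightarrow> 'b \<Rightarrow> 'c) \<Rightarrow>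
    'l list \<Rightarrow> 'b \<Rightarrow> 'c" where
  "range_proj G A p s w C = s_word G A p s w C \<otimes>\<^bsub>A\<^esub> star A (s_word G A p s w C)"

definition diagonal ::
  "('l, 'b::gen_boolean_algebra) gbds \<Rightarrow> 'c cstar \<Rightarrow> ('b \<Rightarrow> 'c) \<Rightarrow> ('l \<Rightarrow> 'b \<Rightarrow> 'c) \<Rightarrow> 'c set" where
  "diagonal G A p s =
     cstar_gen A {range_proj G A p s w C | w C. w \<in> lists (labels G) \<and> C \<in> idl_word G w}"


section \<open>The topological correspondence\<close>

definition E0 :: "'b::gen_boolean_algebra set topology" where
  "E0 = topology_generated_by {{\<xi> \<in> ultrafilters UNIV. A \<in> \<xi>} | A. True}"

text \<open>The extra point is the empty set, which is not an ultrafilter. In the second case the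
  one-point compactification from the library is transported along the bijection that sends the
  empty set to the point at infinity.\<close>

definition F0 :: "'b::gen_boolean_algebra set topology" where
  "F0 = (if \<exists>T::'b. \<forall>A. A \<le> T
     then topology_generated_by (insert {{}} {U. openin E0 U})
     else pullback_topology (insert {} (topspace E0)) (\<lambda>\<xi>. if \<xi> = {} then None else Some \<xi>)
            (Alexandroff_compactification E0))"

type_synonym ('l, 'b) edge = "'l \<times> 'b set"

definition E1 :: "('l, 'b::gen_boolean_algebra) gbds \<Rightarrow> ('l, 'b) edge topology" where
  "E1 G = topology_generated_by
     {{(\<beta>, \<eta>). \<beta> = \<alpha> \<and> \<eta> \<in> ultrafilters (idl G \<alpha>) \<and> B \<in> \<eta>} | \<alpha> B. \<alpha> \<in> labels G \<and> B \<in> idl G \<alpha>}"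

definition edge_d :: "('l, 'b::gen_boolean_algebra) edge \<Rightarrow> 'b set" where
  "edge_d e = {C. \<exists>A\<in>snd e. A \<le> C}"

definition edge_r :: "('l, 'b::gen_boolean_algebra) gbds \<Rightarrow> ('l, 'b) edge \<Rightarrow> 'b set" where
  "edge_r G e = {A. act G (fst e) A \<in> snd e}"

definition F0_sce :: "('l, 'b::gen_boolean_algebra) gbds \<Rightarrow> 'b set set" where
  "F0_sce G = topspace F0 - F0 closure_of (edge_r G ` topspace (E1 G))"

definition F0_fin :: "('l, 'b::gen_boolean_algebra) gbds \<Rightarrow> 'b set set" where
  "F0_fin G = {v \<in> topspace F0. \<exists>U V. openin F0 U \<and> v \<in> U \<and> U \<subseteq> V \<and> V \<subseteq> topspace F0 \<and>
     compactin (E1 G) {e \<in> topspace (E1 G). edge_r G e \<in> V}}"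

definition F0_rg :: "('l, 'b::gen_boolean_algebra) gbds \<Rightarrow> 'b set set" where
  "F0_rg G = F0_fin G - F0 closure_of F0_sce G"

definition E0_sg :: "('l, 'b::gen_boolean_algebra) gbds \<Rightarrow> 'b set set" where
  "E0_sg G = (topspace F0 - F0_rg G) \<inter> topspace E0"


section \<open>The boundary path space\<close>

text \<open>The list in \<open>FinPath\<close> is meant to be nonempty; the sequence in \<open>InfPath\<close> is indexed from 0.\<close>

datatype ('l, 'b) path =
    Vertex "'b set"
  | FinPath "('l, 'b) edge list"
  | InfPath "nat \<Rightarrow> ('l, 'b) edge"

fun path_length :: "('l, 'b) path \<Rightarrow> enat" where
  "path_length (Vertex \<xi>) = 0"
| "path_length (FinPath es) = enat (length es)"
| "path_length (InfPath f) = \<infinity>"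

fun path_edge :: "('l, 'b) path \<Rightarrow> nat \<Rightarrow> ('l, 'b) edge" where
  "path_edge (Vertex \<xi>) i = undefined"
| "path_edge (FinPath es) i = es ! i"
| "path_edge (InfPath f) i = f i"

definition path_prefix :: "nat \<Rightarrow> ('l, 'b) path \<Rightarrow> ('l, 'b) path" where
  "path_prefix n \<mu> = FinPath (map (path_edge \<mu>) [0..<n])"

fun path_r :: "('l, 'b::gen_boolean_algebra) gbds \<Rightarrow> ('l, 'b) path \<Rightarrow> 'b set" where
  "path_r G (Vertex \<xi>) = \<xi>"
| "path_r G (FinPath es) = edge_r G (hd es)"
| "path_r G (InfPath f) = edge_r G (f 0)"

fun path_d :: "('l, 'b::gen_boolean_algebra) path \<Rightarrow> 'b set" where
  "path_d (Vertex \<xi>) = \<xi>"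
| "path_d (FinPath es) = edge_d (last es)"
| "path_d (InfPath f) = undefined"

definition En_set :: "('l, 'b::gen_boolean_algebra) gbds \<Rightarrow> nat \<Rightarrow> ('l, 'b) edge list set" where
  "En_set G n = {es. length es = n \<and> set es \<subseteq> topspace (E1 G) \<and>
     (\<forall>i. Suc i < n \<longrightarrow> edge_d (es ! i) = edge_r G (es ! Suc i))}"

text \<open>Used for \<open>n \<ge> 1\<close>: the subspace topology inherited from the \<open>n\<close>-fold product of \<open>E1 G\<close>.\<close>

definition En :: "('l, 'b::gen_boolean_algebra) gbds \<Rightarrow> nat \<Rightarrow> ('l, 'b) edge list topology" where
  "En G n = pullback_topology (En_set G n) (\<lambda>es. \<lambda>i\<in>{..<n}. es ! i)
     (product_topology (\<lambda>_. E1 G) {..<n})"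

text \<open>The disjoint union of \<open>E0\<close> and all \<open>En G n\<close> with \<open>n \<ge> 1\<close>.\<close>

definition Estar :: "('l, 'b::gen_boolean_algebra) gbds \<Rightarrow> ('l, 'b) path topology" where
  "Estar G = topology_generated_by
     ({Vertex ` U | U. openin E0 U} \<union> {FinPath ` U | U n. n \<ge> 1 \<and> openin (En G n) U})"

definition Einf :: "('l, 'b::gen_boolean_algebra) gbds \<Rightarrow> ('l, 'b) path set" where
  "Einf G = {InfPath f | f. (\<forall>i. f i \<in> topspace (E1 G)) \<and>
     (\<forall>i. edge_d (f i) = edge_r G (f (Suc i)))}"

definition boundary_paths :: "('l, 'b::gen_boolean_algebra) gbds \<Rightarrow> ('l, 'b) path set" where
  "boundary_paths G = Einf G \<union> {\<mu> \<in> topspace (Estar G). path_d \<mu> \<in> E0_sg G}"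

definition ZZ :: "('l, 'b::gen_boolean_algebra) gbds \<Rightarrow> ('l, 'b) path set \<Rightarrow> ('l, 'b) path set" where
  "ZZ G S = {\<mu> \<in> boundary_paths G. Vertex (path_r G \<mu>) \<in> S \<or>
     (\<exists>i\<ge>1. enat i \<le> path_length \<mu> \<and> path_prefix i \<mu> \<in> S)}"

definition boundary_topology :: "('l, 'b::gen_boolean_algebra) gbds \<Rightarrow> ('l, 'b) path topology" where
  "boundary_topology G = topology_generated_by
     {ZZ G U \<inter> (boundary_paths G - ZZ G K) | U K. openin (Estar G) U \<and> compactin (Estar G) K}"

definition cylinder ::
  "('l, 'b::gen_boolean_algebra) gbds \<Rightarrow> 'l list \<Rightarrow> 'b \<Rightarrow> ('l, 'b) path set" where
  "cylinder G w A = (if w = [] then {\<mu> \<in> boundary_paths G. A \<in> path_r G \<mu>}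
     else {\<mu> \<in> boundary_paths G. enat (length w) \<le> path_length \<mu> \<and>
        map (\<lambda>i. fst (path_edge \<mu> i)) [0..<length w] = w \<and>
        A \<in> snd (path_edge \<mu> (length w - 1))})"

end

theory Submission
  imports Defs
begin

text \<open>
  The diagonal algebra is generated by the commuting projections \<open>e w A\<close>, the range projections of
  the partial isometries of words. The product of two of them is 0 unless one word is a prefix of the
  other, and then it is again such a projection. A character of the diagonal is therefore a 0-1
  valued function on the pairs \<open>(w, A)\<close>, and the relations say which functions are possible: the
  words that occur with value 1 are prefixes of a single word; for each of them the elements with
  value 1 form an ultrafilter of the ideal of the word; these ultrafilters match under the actions;
  and the relation for regular elements says that the word continues as long as a regular element
  has value 1. This is the notion of a \<open>path_filter\<close>, and the lemma \<open>ex_boundary_path\<close> reads such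
  data as a boundary path: the ultrafilters are its vertices, the letters label its edges, and it
  may stop only at a vertex without regular elements. By \<open>E0_sg_iff\<close> these are the singular
  vertices of the topological definition.

  It remains to see that every boundary path \<open>\<mu>\<close> comes from a character, which requires a lower bound for
  the norm of the universal algebra and hence a concrete representation. It acts on the square
  summable functions on the set of boundary paths: the operator of an element \<open>A\<close> projects onto the paths
  whose range contains \<open>A\<close>, and the operator of \<open>(\<alpha>, B)\<close> prepends an edge with label \<open>\<alpha>\<close>
  (\<open>representation_operators\<close>). There \<open>e w A\<close> is the indicator function of the cylinder of \<open>(w, A)\<close>
  (\<open>range_proj_ket\<close>), so the basis vector of \<open>\<mu>\<close> is a common eigenvector of the diagonal. Mapping an
  element to its eigenvalue is multiplicative, and it is bounded by the norm because a quasi-inverse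
  given by the Neumann series rules out the eigenvalue 1 for elements of norm less than 1. Hence it
  extends to the closure (\<open>ex_character\<close>, \<open>ex_path_character\<close>). The universal property refers to
  C*-algebras on a type of matrices with entries indexed by sets of pairs \<open>(w, A)\<close>. This type is
  large enough: a boundary path is determined by the cylinders that contain it (\<open>code_inj\<close>), and an
  operator with an adjoint by its matrix (\<open>inj_on_matrix\<close>).

  For the topologies, the space of finite paths is Hausdorff and has a base of compact open sets,
  from which it follows that the cylinders and their complements generate the topology of the
  boundary path space (\<open>boundary_topology_eq\<close>). On the other side characters have norm at most 1, so
  that continuity has to be checked at the generators only (\<open>continuous_characters\<close>), where it says
  that cylinders are open and closed.
\<close>

section \<open>Ultrafilters of generalized Boolean algebras\<close>

lemma diff_le: "x - y \<le> (x::'b::gen_boolean_algebra)"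
  by (metis sup_diff_inf sup_ge1)

lemma le_sup_diff: "x \<le> sup (x - y) (y::'b::gen_boolean_algebra)"
  by (metis inf_le2 order_refl sup.mono sup_diff_inf)

lemma diff_bot: "x - bot = (x::'b::gen_boolean_algebra)"
  by (metis inf_bot_right sup_bot_right sup_diff_inf)

text \<open>Without a greatest element there are no complements; this adjunction between relative
  complement and join takes over their role, and it determines the relative complement.\<close>

lemma diff_le_iff: "x - y \<le> z \<longleftrightarrow> x \<le> sup z (y::'b::gen_boolean_algebra)"
proof
  assume "x - y \<le> z"
  then show "x \<le> sup z y"
    using le_sup_diff[of x y] by (meson order_trans sup_mono order_refl)
next
  assume "x \<le> sup z y"
  then have "x - y \<le> sup z y"
    using diff_le order_trans by blast
  then have "x - y = sup (inf (x - y) z) (inf (x - y) y)"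
    by (metis inf.absorb1 inf_sup_distrib1)
  then show "x - y \<le> z"
    by (metis inf_diff_bot inf_le2 sup_bot_right)
qed

lemma ba_ideal_UNIV: "ba_ideal UNIV"
  by (simp add: ba_ideal_def)

lemma ba_ideal_inf: "ba_ideal I \<Longrightarrow> A \<in> I \<Longrightarrow> inf A B \<in> I"
  "ba_ideal I \<Longrightarrow> A \<in> I \<Longrightarrow> inf B A \<in> I"
  unfolding ba_ideal_def by (meson inf_le1 inf_le2)+

lemma ba_ideal_bot: "ba_ideal I \<Longrightarrow> bot \<in> I"
  unfolding ba_ideal_def by (meson bot_least ex_in_conv)

lemma ba_ideal_sup: "ba_ideal I \<Longrightarrow> A \<in> I \<Longrightarrow> B \<in> I \<Longrightarrow> sup A B \<in> I"
  unfolding ba_ideal_def by blast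

lemma ba_ideal_down: "ba_ideal I \<Longrightarrow> A \<in> I \<Longrightarrow> B \<le> A \<Longrightarrow> B \<in> I"
  unfolding ba_ideal_def by blast

lemma ba_filter_iff:
  assumes "ba_ideal I"
  shows "ba_filter I F \<longleftrightarrow> F \<noteq> {} \<and> F \<subseteq> I \<and> bot \<notin> F \<and>
     (\<forall>A\<in>F. \<forall>B\<in>F. inf A B \<in> F) \<and> (\<forall>A\<in>F. \<forall>B\<in>I. A \<le> B \<longrightarrow> B \<in> F)"
    (is "_ \<longleftrightarrow> ?R")
proof
  assume f: "ba_filter I F"
  have dir: "\<exists>C\<in>F. C \<le> A \<and> C \<le> B" if "A \<in> F" "B \<in> F" for A B
    using f that unfolding ba_filter_def by simp
  have up: "B \<in> F" if "A \<in> F" "B \<in> I" "A \<le> B" for A B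
    using f that unfolding ba_filter_def by metis
  have sub: "F \<noteq> {}" "F \<subseteq> I" "bot \<notin> F"
    using f unfolding ba_filter_def by simp_all
  have "inf A B \<in> F" if AB: "A \<in> F" "B \<in> F" for A B
  proof -
    obtain C where C: "C \<in> F" "C \<le> A" "C \<le> B" using dir[OF AB] by auto
    have "A \<in> I" using sub(2) AB(1) by auto
    then show ?thesis
      using up[OF C(1), of "inf A B"] C ba_ideal_inf(1)[OF assms] by simp
  qed
  then show ?R
    using sub up by auto
next
  assume R: ?R
  have "\<exists>C\<in>F. C \<le> A \<and> C \<le> B" if "A \<in> F" "B \<in> F" for A B
    by (rule bexI[of _ "inf A B"]) (use R that in simp_all)
  then show "ba_filter I F"
    unfolding ba_filter_def using R by simp
qed

lemma ba_filterD:
  assumes "ba_ideal I" "ba_filter I F"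
  shows "\<exists>A. A \<in> F" "A \<in> F \<Longrightarrow> A \<in> I" "bot \<notin> F" "A \<in> F \<Longrightarrow> B \<in> F \<Longrightarrow> inf A B \<in> F"
    "A \<in> F \<Longrightarrow> B \<in> I \<Longrightarrow> A \<le> B \<Longrightarrow> B \<in> F"
  using assms(2) unfolding ba_filter_iff[OF assms(1)] by auto

lemma ba_filterI:
  assumes "ba_ideal I" "\<exists>A. A \<in> F" "\<And>A. A \<in> F \<Longrightarrow> A \<in> I" "bot \<notin> F"
    "\<And>A B. A \<in> F \<Longrightarrow> B \<in> F \<Longrightarrow> inf A B \<in> F"
    "\<And>A B. A \<in> F \<Longrightarrow> B \<in> I \<Longrightarrow> A \<le> B \<Longrightarrow> B \<in> F"
  shows "ba_filter I F"
  unfolding ba_filter_iff[OF assms(1)]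
proof (intro conjI ballI impI subsetI)
  show "F \<noteq> {}" using assms(2) by auto
qed (rule assms(3-); assumption)+

text \<open>Otherwise the elements of \<open>I\<close> above some meet of \<open>A\<close> with an
  element of \<open>F\<close> would form a filter that properly contains \<open>F\<close>.\<close>

lemma ultrafilter_meets:
  assumes I: "ba_ideal I" and F: "F \<in> ultrafilters I" and A: "A \<in> I" "A \<notin> F"
  shows "\<exists>C\<in>F. inf A C = bot"
proof (rule ccontr)
  assume nb: "\<not> ?thesis"
  define F1 where "F1 = {X\<in>I. \<exists>C\<in>F. inf A C \<le> X}"
  have f: "ba_filter I F" and mx: "\<And>F'. ba_filter I F' \<Longrightarrow> F \<subseteq> F' \<Longrightarrow> F' = F"
    using F unfolding ultrafilters_def by auto
  note f' = ba_filterD[OF I f]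
  have sub: "F \<subseteq> F1"
    unfolding F1_def using f'(2) by (auto intro: inf_le2)
  obtain C0 where C0: "C0 \<in> F" using f'(1) by auto
  have "ba_filter I F1"
  proof (rule ba_filterI[OF I])
    show "\<exists>A. A \<in> F1" using sub C0 by auto
    show "bot \<notin> F1" using nb by (auto simp: F1_def le_bot)
    fix X Y assume X: "X \<in> F1"
    then show "X \<in> I" by (simp add: F1_def)
    {
      assume Y: "Y \<in> F1"
      from X Y obtain C D where CD: "C \<in> F" "D \<in> F" "inf A C \<le> X" "inf A D \<le> Y"
        unfolding F1_def by auto
      have "inf A (inf C D) \<le> inf A C" "inf A (inf C D) \<le> inf A D"
        by (rule inf_mono[OF order_refl], simp)+
      then have "inf A (inf C D) \<le> inf X Y"
        using CD(3,4) by (metis le_infI order_trans)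
      then show "inf X Y \<in> F1"
        using f'(4)[OF CD(1,2)] \<open>X \<in> I\<close> ba_ideal_inf[OF I] unfolding F1_def by auto
    }
    { assume "Y \<in> I" "X \<le> Y"
      then show "Y \<in> F1" using X unfolding F1_def by (auto intro: order_trans) }
  qed
  then have "F1 = F" using mx sub by simp
  moreover have "A \<in> F1" using A C0 unfolding F1_def by (auto intro: inf_le1)
  ultimately show False using A by simp
qed

text \<open>The relative complement splits every element of a filter along a given \<open>X\<close>,
  into a part below \<open>X\<close> and a part disjoint from \<open>X\<close>. Hence a prime filter
  has no proper extension, and maximality can be replaced by a condition on elements.\<close>

lemma ultrafilters_iff:
  assumes I: "ba_ideal I"
  shows "F \<in> ultrafilters I \<longleftrightarrow> ba_filter I F \<and> (\<forall>A\<in>I. \<forall>B\<in>I. sup A B \<in> F \<longrightarrow> A \<in> F \<or> B \<in> F)"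
    (is "_ \<longleftrightarrow> ?R")
proof
  assume F: "F \<in> ultrafilters I"
  then have f: "ba_filter I F" unfolding ultrafilters_def by auto
  note f' = ba_filterD[OF I f]
  have "A \<in> F \<or> B \<in> F" if AB: "A \<in> I" "B \<in> I" "sup A B \<in> F" for A B
  proof (rule ccontr)
    assume "\<not> ?thesis"
    then obtain C D where CD: "C \<in> F" "D \<in> F" "inf A C = bot" "inf B D = bot"
      using ultrafilter_meets[OF I F] AB by meson
    have "inf (sup A B) (inf C D) = sup (inf (inf A C) D) (inf C (inf B D))"
      by (simp add: inf_sup_distrib2 inf_sup_distrib1 ac_simps)
    also have "\<dots> = bot" using CD by simp
    finally show False using f'(3) f'(4)[OF AB(3) f'(4)[OF CD(1,2)]] by simp
  qed
  then show ?R using f by simp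
next
  assume R: ?R
  note f = ba_filterD[OF I conjunct1[OF R]]
  have "F' = F" if F': "ba_filter I F'" "F \<subseteq> F'" for F'
  proof -
    note f' = ba_filterD[OF I F'(1)]
    have "X \<in> F" if X: "X \<in> F'" for X
    proof -
      obtain A where A: "A \<in> F" using f(1) by auto
      have "sup (A - X) (inf A X) \<in> F" using A by (simp add: sup_diff_inf)
      then have "A - X \<in> F \<or> inf A X \<in> F"
        using R f(2)[OF A] ba_ideal_down[OF I, OF _ diff_le] ba_ideal_inf[OF I] by simp
      then show ?thesis
      proof
        assume "A - X \<in> F"
        then have "inf (A - X) X \<in> F'" using f'(4) F'(2) X by auto
        then show ?thesis using f'(3) by (simp add: inf_diff_bot)
      next
        assume "inf A X \<in> F"
        then show ?thesis using f(5) f'(2)[OF X] inf_le2 by metis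
      qed
    qed
    then show ?thesis using F' by auto
  qed
  then show "F \<in> ultrafilters I"
    using R unfolding ultrafilters_def by auto
qed

lemma ultrafilterD:
  assumes I: "ba_ideal I" and "F \<in> ultrafilters I"
  shows "\<exists>A. A \<in> F" "A \<in> F \<Longrightarrow> A \<in> I" "bot \<notin> F" "A \<in> F \<Longrightarrow> B \<in> F \<Longrightarrow> inf A B \<in> F"
    "A \<in> F \<Longrightarrow> B \<in> I \<Longrightarrow> A \<le> B \<Longrightarrow> B \<in> F"
    "A \<in> I \<Longrightarrow> B \<in> I \<Longrightarrow> sup A B \<in> F \<Longrightarrow> A \<in> F \<or> B \<in> F"
proof -
  have R: "ba_filter I F" "\<forall>A\<in>I. \<forall>B\<in>I. sup A B \<in> F \<longrightarrow> A \<in> F \<or> B \<in> F"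
    using assms ultrafilters_iff[OF I] by auto
  note f = ba_filterD[OF I R(1)]
  show "\<exists>A. A \<in> F" "A \<in> F \<Longrightarrow> A \<in> I" "bot \<notin> F" "A \<in> F \<Longrightarrow> B \<in> F \<Longrightarrow> inf A B \<in> F"
    "A \<in> F \<Longrightarrow> B \<in> I \<Longrightarrow> A \<le> B \<Longrightarrow> B \<in> F"
    by (rule f; assumption)+
  show "A \<in> I \<Longrightarrow> B \<in> I \<Longrightarrow> sup A B \<in> F \<Longrightarrow> A \<in> F \<or> B \<in> F" using R(2) by simp
qed

lemma ultrafilterI:
  assumes "ba_ideal I" "\<exists>A. A \<in> F" "\<And>A. A \<in> F \<Longrightarrow> A \<in> I" "bot \<notin> F"
    "\<And>A B. A \<in> F \<Longrightarrow> B \<in> F \<Longrightarrow> inf A B \<in> F"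
    "\<And>A B. A \<in> F \<Longrightarrow> B \<in> I \<Longrightarrow> A \<le> B \<Longrightarrow> B \<in> F"
    "\<And>A B. A \<in> I \<Longrightarrow> B \<in> I \<Longrightarrow> sup A B \<in> F \<Longrightarrow> A \<in> F \<or> B \<in> F"
  shows "F \<in> ultrafilters I"
proof -
  have "ba_filter I F" by (rule ba_filterI[OF assms(1-6)])
  then show ?thesis using assms(7) ultrafilters_iff[OF assms(1)] by simp
qed

lemma ultrafilter_extends:
  assumes I: "ba_ideal I" and F: "ba_filter I F"
  shows "\<exists>U\<in>ultrafilters I. F \<subseteq> U"
proof -
  let ?A = "{U. ba_filter I U \<and> F \<subseteq> U}"
  have "\<exists>M\<in>?A. \<forall>X\<in>?A. M \<subseteq> X \<longrightarrow> X = M"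
  proof (rule subset_Zorn_nonempty)
    show "?A \<noteq> {}" using F by auto
    fix C assume C: "C \<noteq> {}" "subset.chain ?A C"
    have fil: "\<And>X. X \<in> C \<Longrightarrow> ba_filter I X" and sub: "\<And>X. X \<in> C \<Longrightarrow> F \<subseteq> X"
      using C unfolding subset.chain_def by auto
    note f = ba_filterD[OF I fil]
    have "ba_filter I (\<Union>C)"
    proof (rule ba_filterI[OF I])
      obtain X0 where "X0 \<in> C" using C(1) by auto
      then show "\<exists>A. A \<in> \<Union>C" using f(1)[of X0] by auto
      show "bot \<notin> \<Union>C" using f(3) by auto
      fix A B assume "A \<in> \<Union>C"
      then obtain X where X: "X \<in> C" "A \<in> X" by auto
      then show "A \<in> I" using f(2) by auto
      {
        assume "B \<in> \<Union>C"
        then obtain Y where Y: "Y \<in> C" "B \<in> Y" by auto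
        have "X \<subseteq> Y \<or> Y \<subseteq> X"
          using C(2) X(1) Y(1) unfolding subset_chain_def by simp
        then obtain Z where Z: "Z \<in> C" "A \<in> Z" "B \<in> Z" using X Y by auto
        show "inf A B \<in> \<Union>C" using f(4)[OF Z] Z(1) by auto
      }
      { assume "B \<in> I" "A \<le> B"
        then show "B \<in> \<Union>C" using f(5)[OF X] X(1) by auto }
    qed
    then show "\<Union>C \<in> ?A" using C sub by auto
  qed
  then obtain M where "ba_filter I M" "F \<subseteq> M" "\<forall>X\<in>?A. M \<subseteq> X \<longrightarrow> X = M" by auto
  then show ?thesis unfolding ultrafilters_def by (intro bexI[of _ M]) auto
qed

lemma ultrafilter_exists:
  assumes I: "ba_ideal I" and A: "A \<in> I" "A \<noteq> bot"
  shows "\<exists>U\<in>ultrafilters I. A \<in> U"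
proof -
  have "ba_filter I {X\<in>I. A \<le> X}"
    by (rule ba_filterI[OF I]) (use A ba_ideal_inf[OF I] in \<open>auto simp: bot_unique\<close>)
  from ultrafilter_extends[OF I this] show ?thesis using A by auto
qed

lemma ultrafilter_UNIVD:
  assumes "F \<in> ultrafilters UNIV"
  shows "\<exists>A. A \<in> F" "bot \<notin> F" "A \<in> F \<Longrightarrow> B \<in> F \<Longrightarrow> inf A B \<in> F" "A \<in> F \<Longrightarrow> A \<le> B \<Longrightarrow> B \<in> F"
    "sup A B \<in> F \<Longrightarrow> A \<in> F \<or> B \<in> F"
  using ultrafilterD[OF ba_ideal_UNIV assms] by simp_all

lemma ultrafilter_UNIVI:
  assumes "\<exists>A. A \<in> F" "bot \<notin> F" "\<And>A B. A \<in> F \<Longrightarrow> B \<in> F \<Longrightarrow> inf A B \<in> F"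
    "\<And>A B. A \<in> F \<Longrightarrow> A \<le> B \<Longrightarrow> B \<in> F" "\<And>A B. sup A B \<in> F \<Longrightarrow> A \<in> F \<or> B \<in> F"
  shows "F \<in> ultrafilters UNIV"
  by (rule ultrafilterI[OF ba_ideal_UNIV]) (use assms in simp_all)

text \<open>The compactness of the Stone spectrum, in algebraic form. If no finite part of \<open>S\<close> sufficed,
  then the elements that cover \<open>A\<close> up to a finite part of \<open>S\<close> would form a filter, and an ultrafilter
  above it would avoid \<open>S\<close>.\<close>

lemma stone_compactness:
  fixes A :: "'b::gen_boolean_algebra"
  assumes cov: "\<And>\<xi>. \<xi> \<in> ultrafilters UNIV \<Longrightarrow> A \<in> \<xi> \<Longrightarrow> \<exists>B\<in>S. B \<in> \<xi>"
  shows "\<exists>T. finite T \<and> T \<subseteq> S \<and> (\<forall>\<xi>\<in>ultrafilters UNIV. A \<in> \<xi> \<longrightarrow> (\<exists>B\<in>T. B \<in> \<xi>))"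
proof (rule ccontr)
  assume no: "\<not> ?thesis"
  \<comment> \<open>The ideal of the elements covered by a finite part of \<open>S\<close>.\<close>
  define J where "J = {X::'b. \<exists>T. finite T \<and> T \<subseteq> S \<and>
    (\<forall>\<xi>\<in>ultrafilters UNIV. X \<in> \<xi> \<longrightarrow> (\<exists>B\<in>T. B \<in> \<xi>))}"
  have AJ: "A \<notin> J" using no unfolding J_def by blast
  have supJ: "sup X Y \<in> J" if XY: "X \<in> J" "Y \<in> J" for X Y
  proof -
    from XY(1) obtain T where T: "finite T" "T \<subseteq> S" "\<forall>\<xi>\<in>ultrafilters UNIV. X \<in> \<xi> \<longrightarrow> (\<exists>B\<in>T. B \<in> \<xi>)"
      unfolding J_def by auto
    from XY(2) obtain T' where T': "finite T'" "T' \<subseteq> S" "\<forall>\<xi>\<in>ultrafilters UNIV. Y \<in> \<xi> \<longrightarrow> (\<exists>B\<in>T'. B \<in> \<xi>)"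
      unfolding J_def by auto
    have "\<exists>B\<in>T \<union> T'. B \<in> \<xi>" if "\<xi> \<in> ultrafilters UNIV" "sup X Y \<in> \<xi>" for \<xi>
      using ultrafilter_UNIVD(5)[OF that] T(3) T'(3) that by auto
    then show ?thesis unfolding J_def using T T' by (auto intro!: exI[of _ "T \<union> T'"])
  qed
  have downJ: "X \<in> J" if Y: "Y \<in> J" "X \<le> Y" for X Y
  proof -
    from Y(1) obtain T where T: "finite T" "T \<subseteq> S" "\<forall>\<xi>\<in>ultrafilters UNIV. Y \<in> \<xi> \<longrightarrow> (\<exists>B\<in>T. B \<in> \<xi>)"
      unfolding J_def by auto
    have "\<forall>\<xi>\<in>ultrafilters UNIV. X \<in> \<xi> \<longrightarrow> (\<exists>B\<in>T. B \<in> \<xi>)"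
      using T(3) ultrafilter_UNIVD(4)[OF _ _ Y(2)] by auto
    then show ?thesis unfolding J_def using T by auto
  qed
  have SJ: "B \<in> J" if "B \<in> S" for B
    unfolding J_def using that by (auto intro!: exI[of _ "{B}"])
  have botJ: "bot \<in> J" unfolding J_def using ultrafilter_UNIVD(2) by auto
  have "ba_filter UNIV {X. A - X \<in> J}"
  proof (rule ba_filterI[OF ba_ideal_UNIV])
    have "A - A \<in> J" using downJ[OF botJ] by (simp add: diff_le_iff)
    then show "\<exists>X. X \<in> {X. A - X \<in> J}" by auto
    show "bot \<notin> {X. A - X \<in> J}" using AJ by (simp add: diff_bot)
    fix X Y assume X: "X \<in> {X. A - X \<in> J}"
    show "X \<in> UNIV" by simp
    {
      assume Y: "Y \<in> {X. A - X \<in> J}"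
      let ?U = "sup (A - X) (A - Y)"
      have "A \<le> sup ?U X" "A \<le> sup ?U Y"
        using diff_le_iff[of A X ?U] diff_le_iff[of A Y ?U] by simp_all
      then have "A \<le> sup ?U (inf X Y)" by (simp add: sup_inf_distrib1)
      then have "A - inf X Y \<le> ?U" by (simp add: diff_le_iff)
      then show "inf X Y \<in> {X. A - X \<in> J}" using supJ downJ X Y by auto
    }
    { assume "X \<le> Y"
      then have "A \<le> sup (A - X) Y"
        using le_sup_diff[of A X] by (meson order_refl order_trans sup_mono)
      then have "A - Y \<le> A - X" by (simp add: diff_le_iff)
      then show "Y \<in> {X. A - X \<in> J}" using downJ X by auto }
  qed
  from ultrafilter_extends[OF ba_ideal_UNIV this] obtain U
    where U: "U \<in> ultrafilters UNIV" "{X. A - X \<in> J} \<subseteq> U" by auto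
  have "A \<in> U" using U(2) downJ[OF botJ, of "A - A"] by (auto simp: diff_le_iff)
  then obtain B where B: "B \<in> S" "B \<in> U" using cov U(1) by auto
  have "A - (A - B) \<le> B" unfolding diff_le_iff using le_sup_diff[of A B] by (simp add: sup_commute)
  then have "A - (A - B) \<in> J" using SJ[OF B(1)] downJ by simp
  then have "A - B \<in> U" using U(2) by auto
  then have "inf (A - B) B \<in> U" using ultrafilter_UNIVD(3)[OF U(1)] B(2) by simp
  then show False using ultrafilter_UNIVD(2)[OF U(1)] by (simp add: inf_diff_bot)
qed

definition up_closure :: "'b::gen_boolean_algebra set \<Rightarrow> 'b set" where
  "up_closure F = {C. \<exists>A\<in>F. A \<le> C}"

lemma edge_d_eq: "edge_d e = up_closure (snd e)"
  by (simp add: edge_d_def up_closure_def)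

lemma up_closure_ultrafilter:
  assumes I: "ba_ideal I" and F: "F \<in> ultrafilters I"
  shows "up_closure F \<in> ultrafilters UNIV"
proof (rule ultrafilter_UNIVI)
  note R = ultrafilterD[OF I F]
  show "\<exists>A. A \<in> up_closure F" using R(1) unfolding up_closure_def by auto
  show "bot \<notin> up_closure F" using R(3) unfolding up_closure_def by (auto simp: bot_unique)
  fix A B
  show "A \<in> up_closure F \<or> B \<in> up_closure F" if AB: "sup A B \<in> up_closure F"
  proof -
    obtain C where C: "C \<in> F" "C \<le> sup A B" using AB unfolding up_closure_def by auto
    then have "sup (inf C A) (inf C B) \<in> F" by (metis inf.absorb1 inf_sup_distrib1)
    then have "inf C A \<in> F \<or> inf C B \<in> F"
      using R(6) R(2)[OF C(1)] ba_ideal_inf[OF I] by simp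
    then show ?thesis unfolding up_closure_def
      using inf_le2[of C A] inf_le2[of C B] by (metis (mono_tags) mem_Collect_eq)
  qed
  assume A: "A \<in> up_closure F"
  show "inf A B \<in> up_closure F" if B: "B \<in> up_closure F"
  proof -
    from A B obtain C D where CD: "C \<in> F" "D \<in> F" "C \<le> A" "D \<le> B" unfolding up_closure_def by auto
    show ?thesis unfolding up_closure_def using R(4)[OF CD(1,2)] inf_mono[OF CD(3,4)] by auto
  qed
  show "B \<in> up_closure F" if "A \<le> B"
    using A that unfolding up_closure_def by (auto intro: order_trans)
qed

lemma up_closure_Int:
  assumes I: "ba_ideal I" and F: "F \<in> ultrafilters I"
  shows "up_closure F \<inter> I = F"
  using ultrafilterD(2,5)[OF I F] unfolding up_closure_def by auto

lemma mem_up_closure_iff: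
  "ba_ideal I \<Longrightarrow> F \<in> ultrafilters I \<Longrightarrow> A \<in> I \<Longrightarrow> A \<in> up_closure F \<longleftrightarrow> A \<in> F"
  using up_closure_Int by auto

text \<open>The ultrafilters of an ideal correspond, by intersection, to the ultrafilters of the whole
  algebra that meet it. For this reason an edge amounts to its label together with its end vertex.\<close>

lemma ultrafilter_restrict:
  assumes I: "ba_ideal I" and F: "F \<in> ultrafilters UNIV" and ne: "F \<inter> I \<noteq> {}"
  shows "F \<inter> I \<in> ultrafilters I" "up_closure (F \<inter> I) = F"
proof -
  note R = ultrafilter_UNIVD[OF F]
  show "F \<inter> I \<in> ultrafilters I"
    by (rule ultrafilterI[OF I]) (use R ne ba_ideal_inf[OF I] in auto)
  obtain A where A: "A \<in> F" "A \<in> I" using ne by auto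
  have "X \<in> up_closure (F \<inter> I)" if "X \<in> F" for X
    unfolding up_closure_def using R(3)[OF A(1) that] ba_ideal_inf(1)[OF I A(2), of X] inf_le2[of A X]
    by (metis (mono_tags) IntI mem_Collect_eq)
  then show "up_closure (F \<inter> I) = F"
    using R(4) unfolding up_closure_def by auto
qed

lemma ultrafilter_eqI:
  assumes I: "ba_ideal I" and F: "F \<in> ultrafilters UNIV" "F' \<in> ultrafilters UNIV"
    and ne: "F \<inter> I \<noteq> {}" and eq: "\<And>A. A \<in> I \<Longrightarrow> A \<in> F \<longleftrightarrow> A \<in> F'"
  shows "F = F'"
proof -
  have "F \<inter> I = F' \<inter> I" using eq by auto
  then show ?thesis using ultrafilter_restrict(2)[OF I F(1) ne] ultrafilter_restrict(2)[OF I F(2)] ne by metis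
qed

lemma ultrafilters_eqI:
  assumes F: "F \<in> ultrafilters UNIV" "F' \<in> ultrafilters UNIV" and sub: "F \<subseteq> F'"
  shows "F = F'"
  using assms unfolding ultrafilters_def by auto

lemma ultrafilters_separate:
  assumes F: "F \<in> ultrafilters UNIV" "F' \<in> ultrafilters UNIV" and ne: "F \<noteq> F'"
  shows "\<exists>A\<in>F. \<exists>B\<in>F'. inf A B = bot"
proof -
  obtain A where A: "A \<in> F" "A \<notin> F'" using ultrafilters_eqI[OF F] ne by auto
  then show ?thesis using ultrafilter_meets[OF ba_ideal_UNIV F(2), of A] by auto
qed

lemma ba_action_mono: "ba_action f \<Longrightarrow> A \<le> B \<Longrightarrow> f A \<le> f B"
  unfolding ba_action_def by (metis inf.absorb_iff1)

text \<open>Actions induce only partial maps on ultrafilters: the preimage of an ultrafilter can be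
  empty.\<close>

lemma ultrafilter_preimage:
  assumes f: "ba_action f" and F: "F \<in> ultrafilters UNIV" and ne: "f A \<in> F"
  shows "{B. f B \<in> F} \<in> ultrafilters UNIV"
proof -
  note R = ultrafilter_UNIVD[OF F]
  have f': "f bot = bot" "\<And>A B. f (inf A B) = inf (f A) (f B)" "\<And>A B. f (sup A B) = sup (f A) (f B)"
    using f unfolding ba_action_def by auto
  show ?thesis
    by (rule ultrafilter_UNIVI) (use R ne f' ba_action_mono[OF f] in auto)
qed

lemma ultrafilter_lower_bound:
  assumes \<xi>: "\<xi> \<in> ultrafilters UNIV" and C: "C \<in> \<xi>"
  shows "(\<And>i. i < n \<Longrightarrow> f i \<in> \<xi>) \<Longrightarrow> \<exists>A\<in>\<xi>. A \<le> C \<and> (\<forall>i<(n::nat). A \<le> f i)"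
proof (induction n)
  case 0
  then show ?case using C by auto
next
  case (Suc n)
  then obtain A where A: "A \<in> \<xi>" "A \<le> C" "\<And>i. i < n \<Longrightarrow> A \<le> f i" by auto
  have "inf A (f n) \<in> \<xi>" using ultrafilter_UNIVD(3)[OF \<xi> A(1)] Suc.prems by simp
  moreover have "inf A (f n) \<le> C" using A(2) by (simp add: le_infI1)
  moreover have "inf A (f n) \<le> f i" if "i < Suc n" for i
    using that A(3)[of i] by (cases "i = n") (simp_all add: le_infI1)
  ultimately show ?case by blast
qed

section \<open>The vertex space, edges and regular vertices\<close>

lemma openin_topology_generated_by_base:
  assumes int: "\<And>X Y x. X \<in> S \<Longrightarrow> Y \<in> S \<Longrightarrow> x \<in> X \<Longrightarrow> x \<in> Y \<Longrightarrow> \<exists>Z\<in>S. x \<in> Z \<and> Z \<subseteq> X \<and> Z \<subseteq> Y"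
  shows "openin (topology_generated_by S) U \<longleftrightarrow> (\<forall>x\<in>U. \<exists>X\<in>S. x \<in> X \<and> X \<subseteq> U)"
proof
  assume "openin (topology_generated_by S) U"
  then have "generate_topology_on S U" by (rule openin_topology_generated_by)
  then show "\<forall>x\<in>U. \<exists>X\<in>S. x \<in> X \<and> X \<subseteq> U"
  proof induction
    case (Int a b)
    show ?case
    proof
      fix x assume x: "x \<in> a \<inter> b"
      then obtain X Y where "X \<in> S" "x \<in> X" "X \<subseteq> a" "Y \<in> S" "x \<in> Y" "Y \<subseteq> b"
        using Int.IH by (metis IntD1 IntD2)
      then show "\<exists>X\<in>S. x \<in> X \<and> X \<subseteq> a \<inter> b"
        using int[of X Y x] by (metis Int_greatest order_trans)
    qed
  next
    case (UN K)
    then show ?case by (metis Union_iff Union_upper order_trans)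
  qed auto
next
  assume R: "\<forall>x\<in>U. \<exists>X\<in>S. x \<in> X \<and> X \<subseteq> U"
  have "U = \<Union>{X\<in>S. X \<subseteq> U}" using R by auto
  moreover have "openin (topology_generated_by S) (\<Union>{X\<in>S. X \<subseteq> U})"
    by (rule openin_Union) (simp add: topology_generated_by_Basis)
  ultimately show "openin (topology_generated_by S) U" by simp
qed

lemma openin_topology_generated_by_mono:
  assumes "\<And>s. s \<in> S \<Longrightarrow> openin T s" "openin (topology_generated_by S) U"
  shows "openin T U"
  using generate_topology_on_coarsest[OF istopology_openin _ openin_topology_generated_by[OF assms(2)], of T] assms(1)
  by auto

lemma notin_closure_of_iff:
  "x \<in> topspace X \<Longrightarrow> x \<notin> X closure_of S \<longleftrightarrow> (\<exists>T. openin X T \<and> x \<in> T \<and> T \<inter> S = {})"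
  unfolding in_closure_of by blast

definition stone_set :: "'b::gen_boolean_algebra \<Rightarrow> 'b set set" where
  "stone_set A = {\<xi> \<in> ultrafilters UNIV. A \<in> \<xi>}"

lemma ultrafilter_inf_iff:
  assumes I: "ba_ideal I" and F: "F \<in> ultrafilters I" and AB: "A \<in> I" "B \<in> I"
  shows "inf A B \<in> F \<longleftrightarrow> A \<in> F \<and> B \<in> F"
proof (intro iffI conjI)
  assume i: "inf A B \<in> F"
  show "A \<in> F" by (rule ultrafilterD(5)[OF I F i AB(1) inf_le1])
  show "B \<in> F" by (rule ultrafilterD(5)[OF I F i AB(2) inf_le2])
next
  assume "A \<in> F \<and> B \<in> F"
  then show "inf A B \<in> F" using ultrafilterD(4)[OF I F] by simp
qed

lemma stone_set_inf: "stone_set (inf A B) = stone_set A \<inter> stone_set B"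
  unfolding stone_set_def
  using ultrafilter_inf_iff[OF ba_ideal_UNIV] by auto

lemma openin_E0_iff: "openin E0 U \<longleftrightarrow> (\<forall>\<xi>\<in>U. \<exists>A. \<xi> \<in> stone_set A \<and> stone_set A \<subseteq> U)"
proof -
  have "openin E0 U \<longleftrightarrow> (\<forall>x\<in>U. \<exists>X\<in>range stone_set. x \<in> X \<and> X \<subseteq> U)"
  proof -
    have eq: "E0 = topology_generated_by (range stone_set)"
      unfolding E0_def stone_set_def by (rule arg_cong[of _ _ topology_generated_by]) auto
    show ?thesis
      unfolding eq
    proof (rule openin_topology_generated_by_base)
      fix X Y and x :: "'a set" assume XY: "X \<in> range stone_set" "Y \<in> range stone_set" "x \<in> X" "x \<in> Y"
      then obtain A B where "X = stone_set A" "Y = stone_set B" by auto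
      then show "\<exists>Z\<in>range stone_set. x \<in> Z \<and> Z \<subseteq> X \<and> Z \<subseteq> Y"
        using XY by (intro bexI[of _ "stone_set (inf A B)"] rangeI) (simp add: stone_set_inf)
    qed
  qed
  then show ?thesis by simp
qed

lemma openin_E0_stone_set: "openin E0 (stone_set A)"
  unfolding openin_E0_iff by (meson order_refl)

lemma topspace_E0: "topspace E0 = ultrafilters UNIV"
proof -
  have "\<xi> \<in> topspace E0" if \<xi>: "\<xi> \<in> ultrafilters UNIV" for \<xi> :: "'a set"
  proof -
    obtain A where "A \<in> \<xi>" using ultrafilter_UNIVD(1)[OF \<xi>] by auto
    then have "\<xi> \<in> stone_set A" using \<xi> by (simp add: stone_set_def)
    then show ?thesis using openin_subset[OF openin_E0_stone_set] by auto
  qed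
  moreover have "\<xi> \<in> ultrafilters UNIV" if "\<xi> \<in> topspace E0" for \<xi> :: "'a set"
    using that openin_topspace[of E0] unfolding openin_E0_iff stone_set_def by auto
  ultimately show ?thesis by auto
qed

lemma empty_notin_E0: "{} \<notin> topspace E0"
  using ultrafilter_UNIVD(1) unfolding topspace_E0 by blast

text \<open>In both cases of the definition of \<open>F0\<close>, the space \<open>E0\<close> is an
  open subspace; neighbourhoods of ultrafilters in \<open>F0\<close> can therefore be tested by
  elements of the algebra.\<close>

lemma openin_F0_of_E0:
  assumes U: "openin E0 U" shows "openin F0 (U :: 'b::gen_boolean_algebra set set)"
proof (cases "\<exists>T::'b. \<forall>A. A \<le> T")
  case True
  then show ?thesis
    unfolding F0_def using U by (auto intro: topology_generated_by_Basis)
next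
  case False
  have sub: "U \<subseteq> topspace E0" using openin_subset[OF U] .
  then have ne: "{} \<notin> U" using empty_notin_E0 by auto
  show ?thesis
    unfolding F0_def if_not_P[OF False] openin_pullback_topology
    by (rule exI[of _ "Some ` U"]) (use U sub ne in \<open>auto split: if_splits\<close>)
qed

lemma openin_E0_of_F0:
  assumes U: "openin F0 (U :: 'b::gen_boolean_algebra set set)"
  shows "openin E0 (U \<inter> topspace E0)"
proof (cases "\<exists>T::'b. \<forall>A. A \<le> T")
  case True
  have "continuous_map E0 (F0 :: 'b set topology) id"
    unfolding F0_def if_P[OF True]
  proof (rule continuous_on_generated_topo)
    fix U :: "'b set set" assume "U \<in> insert {{}} {U. openin E0 U}"
    moreover have "{{}} \<inter> topspace (E0 :: 'b set topology) = {}" using empty_notin_E0 by auto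
    ultimately show "openin E0 (id -` U \<inter> topspace E0)" by auto
  qed (auto intro!: exI[of _ "topspace E0"])
  from openin_continuous_map_preimage[OF this U]
  have "openin E0 {x \<in> topspace E0. x \<in> U}" by simp
  moreover have "{x \<in> topspace E0. x \<in> U} = U \<inter> topspace E0" by auto
  ultimately show ?thesis by simp
next
  case False
  obtain V where V: "openin (Alexandroff_compactification E0) V"
    and UV: "U = (\<lambda>\<xi>. if \<xi> = {} then None else Some \<xi>) -` V \<inter> insert {} (topspace E0)"
    using U unfolding F0_def if_not_P[OF False] openin_pullback_topology by auto
  have eq: "U \<inter> topspace E0 = {\<xi> \<in> topspace E0. Some \<xi> \<in> V}"
    unfolding UV using empty_notin_E0 by (auto split: if_splits)
  from V[unfolded openin_Alexandroff_compactification]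
  show ?thesis
  proof
    assume "\<exists>W. openin E0 W \<and> V = Some ` W"
    then obtain W where W: "openin E0 W" "V = Some ` W" by auto
    then have "{\<xi> \<in> topspace E0. Some \<xi> \<in> V} = W" using openin_subset[OF W(1)] by auto
    then show ?thesis using eq W by simp
  next
    assume "\<exists>C. compactin E0 C \<and> closedin E0 C \<and> V = insert None (Some ` (topspace E0 - C))"
    then obtain C where C: "closedin E0 C" "V = insert None (Some ` (topspace E0 - C))" by auto
    then have "{\<xi> \<in> topspace E0. Some \<xi> \<in> V} = topspace E0 - C" by auto
    then show ?thesis using eq openin_diff[OF openin_topspace C(1)] by simp
  qed
qed

lemma topspace_E0_subset_F0: "topspace E0 \<subseteq> topspace F0"
  using openin_subset[OF openin_F0_of_E0[OF openin_topspace]] .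

lemma openin_F0_stone_set: "openin F0 (stone_set A)"
  by (rule openin_F0_of_E0[OF openin_E0_stone_set])

lemma F0_neighbourhood:
  assumes "openin F0 U" "\<xi> \<in> U" "\<xi> \<in> ultrafilters UNIV"
  shows "\<exists>A\<in>\<xi>. stone_set A \<subseteq> U"
  using openin_E0_of_F0[OF assms(1)] assms(2,3) unfolding openin_E0_iff topspace_E0 stone_set_def by auto

text \<open>A set whose points correspond to the ultrafilters containing \<open>A\<close>, and whose neighbourhoods
  are detected by elements of these ultrafilters, inherits compactness from the Stone spectrum.\<close>

lemma compactin_stone:
  fixes A :: "'b::gen_boolean_algebra"
  assumes K: "K \<subseteq> topspace X"
    and onto: "\<And>\<xi>. \<xi> \<in> ultrafilters UNIV \<Longrightarrow> A \<in> \<xi> \<Longrightarrow> \<exists>x\<in>K. e x = \<xi>"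
    and uf: "\<And>x. x \<in> K \<Longrightarrow> e x \<in> ultrafilters UNIV" "\<And>x. x \<in> K \<Longrightarrow> A \<in> e x"
    and nb: "\<And>x U. x \<in> K \<Longrightarrow> openin X U \<Longrightarrow> x \<in> U \<Longrightarrow> \<exists>B\<in>e x. \<forall>y\<in>K. B \<in> e y \<longrightarrow> y \<in> U"
  shows "compactin X K"
  unfolding compactin_def
proof (intro conjI allI impI)
  fix \<U> assume "(\<forall>U\<in>\<U>. openin X U) \<and> K \<subseteq> \<Union>\<U>"
  then have op: "\<And>U. U \<in> \<U> \<Longrightarrow> openin X U" and cov: "\<And>x. x \<in> K \<Longrightarrow> \<exists>U\<in>\<U>. x \<in> U" by auto
  define S where "S = {B. \<exists>U\<in>\<U>. \<forall>y\<in>K. B \<in> e y \<longrightarrow> y \<in> U}"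
  have "\<exists>B\<in>S. B \<in> \<xi>" if \<xi>: "\<xi> \<in> ultrafilters UNIV" "A \<in> \<xi>" for \<xi>
  proof -
    obtain x where x: "x \<in> K" "e x = \<xi>" using onto[OF \<xi>] by auto
    obtain U where U: "U \<in> \<U>" "x \<in> U" using cov[OF x(1)] by auto
    show ?thesis using nb[OF x(1) op[OF U(1)] U(2)] U(1) x(2) unfolding S_def by auto
  qed
  from stone_compactness[of A S, OF this] obtain T where
    T: "finite T" "T \<subseteq> S" "\<And>\<xi>. \<xi> \<in> ultrafilters UNIV \<Longrightarrow> A \<in> \<xi> \<Longrightarrow> \<exists>B\<in>T. B \<in> \<xi>"
    by auto
  have "\<forall>B\<in>T. \<exists>U. U \<in> \<U> \<and> (\<forall>y\<in>K. B \<in> e y \<longrightarrow> y \<in> U)" using T(2) unfolding S_def by auto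
  then obtain u where u: "\<And>B. B \<in> T \<Longrightarrow> u B \<in> \<U>" "\<And>B y. B \<in> T \<Longrightarrow> y \<in> K \<Longrightarrow> B \<in> e y \<Longrightarrow> y \<in> u B"
    by metis
  have "K \<subseteq> \<Union>(u ` T)"
  proof
    fix y assume y: "y \<in> K"
    then obtain B where "B \<in> T" "B \<in> e y" using T(3) uf by meson
    then show "y \<in> \<Union>(u ` T)" using u(2) y by auto
  qed
  then show "\<exists>\<F>. finite \<F> \<and> \<F> \<subseteq> \<U> \<and> K \<subseteq> \<Union>\<F>"
    using T(1) u(1) by (intro exI[of _ "u ` T"]) auto
qed (rule K)

locale gbds =
  fixes G :: "('l, 'b::gen_boolean_algebra) gbds"
  assumes gbds: "generalized_bds G"
begin

lemma act: "\<alpha> \<in> labels G \<Longrightarrow> ba_action (act G \<alpha>)"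
  and idl: "\<alpha> \<in> labels G \<Longrightarrow> ba_ideal (idl G \<alpha>)"
  and act_idl: "\<alpha> \<in> labels G \<Longrightarrow> act G \<alpha> A \<in> idl G \<alpha>"
  using gbds unfolding generalized_bds_def by auto

lemma act_bot: "\<alpha> \<in> labels G \<Longrightarrow> act G \<alpha> bot = bot"
  and act_inf: "\<alpha> \<in> labels G \<Longrightarrow> act G \<alpha> (inf A B) = inf (act G \<alpha> A) (act G \<alpha> B)"
  and act_sup: "\<alpha> \<in> labels G \<Longrightarrow> act G \<alpha> (sup A B) = sup (act G \<alpha> A) (act G \<alpha> B)"
  using act unfolding ba_action_def by auto

lemma act_mono: "\<alpha> \<in> labels G \<Longrightarrow> A \<le> B \<Longrightarrow> act G \<alpha> A \<le> act G \<alpha> B"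
  using ba_action_mono act by auto

definition edges :: "('l, 'b) edge set" where
  "edges = {e. fst e \<in> labels G \<and> snd e \<in> ultrafilters (idl G (fst e))}"

definition edge_set :: "'l \<Rightarrow> 'b \<Rightarrow> ('l, 'b) edge set" where
  "edge_set \<alpha> B = {e \<in> edges. fst e = \<alpha> \<and> B \<in> snd e}"

lemma openin_E1_iff:
  "openin (E1 G) U \<longleftrightarrow> (\<forall>e\<in>U. \<exists>\<alpha>\<in>labels G. \<exists>B\<in>idl G \<alpha>. e \<in> edge_set \<alpha> B \<and> edge_set \<alpha> B \<subseteq> U)"
proof -
  let ?S = "{edge_set \<alpha> B | \<alpha> B. \<alpha> \<in> labels G \<and> B \<in> idl G \<alpha>}"
  have es: "edge_set \<alpha> B = {(\<beta>, \<eta>). \<beta> = \<alpha> \<and> \<eta> \<in> ultrafilters (idl G \<alpha>) \<and> B \<in> \<eta>}" if "\<alpha> \<in> labels G" for \<alpha> B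
    using that unfolding edge_set_def edges_def by auto
  have "{{(\<beta>, \<eta>). \<beta> = \<alpha> \<and> \<eta> \<in> ultrafilters (idl G \<alpha>) \<and> B \<in> \<eta>} | \<alpha> B. \<alpha> \<in> labels G \<and> B \<in> idl G \<alpha>} = ?S"
    using es by blast
  then have eq: "E1 G = topology_generated_by ?S"
    unfolding E1_def by simp
  have "openin (E1 G) U \<longleftrightarrow> (\<forall>e\<in>U. \<exists>X\<in>?S. e \<in> X \<and> X \<subseteq> U)"
    unfolding eq
  proof (rule openin_topology_generated_by_base)
    fix X Y x assume XY: "X \<in> ?S" "Y \<in> ?S" "x \<in> X" "x \<in> Y"
    then obtain \<alpha> \<beta> A B where X: "X = edge_set \<alpha> A" "\<alpha> \<in> labels G" "A \<in> idl G \<alpha>"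
      and Y: "Y = edge_set \<beta> B" "B \<in> idl G \<beta>" by auto
    have [simp]: "\<beta> = \<alpha>" using X Y XY unfolding edge_set_def by auto
    have "edge_set \<alpha> (inf A B) = edge_set \<alpha> A \<inter> edge_set \<alpha> B"
      unfolding edge_set_def edges_def using X Y ultrafilter_inf_iff[OF idl, OF X(2) _ X(3)] by auto
    then show "\<exists>Z\<in>?S. x \<in> Z \<and> Z \<subseteq> X \<and> Z \<subseteq> Y"
      using X Y XY ba_ideal_inf(1)[OF idl[OF X(2)] X(3)] by (intro bexI[of _ "edge_set \<alpha> (inf A B)"]) auto
  qed
  moreover have "(\<exists>X\<in>?S. P X) \<longleftrightarrow> (\<exists>\<alpha>\<in>labels G. \<exists>B\<in>idl G \<alpha>. P (edge_set \<alpha> B))" for P by auto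
  ultimately show ?thesis by simp
qed

lemma openin_E1_edge_set: "\<alpha> \<in> labels G \<Longrightarrow> B \<in> idl G \<alpha> \<Longrightarrow> openin (E1 G) (edge_set \<alpha> B)"
  unfolding openin_E1_iff by auto

lemma topspace_E1: "topspace (E1 G) = edges"
proof
  show "topspace (E1 G) \<subseteq> edges"
    using openin_topspace[of "E1 G"] unfolding openin_E1_iff by (auto simp: edge_set_def)
  show "edges \<subseteq> topspace (E1 G)"
  proof
    fix e assume e: "e \<in> edges"
    then have l: "fst e \<in> labels G" and u: "snd e \<in> ultrafilters (idl G (fst e))"
      unfolding edges_def by auto
    obtain B where B: "B \<in> snd e" using ultrafilterD(1)[OF idl[OF l] u] by auto
    have "e \<in> edge_set (fst e) B" using e B unfolding edge_set_def by simp
    then show "e \<in> topspace (E1 G)"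
      using openin_subset[OF openin_E1_edge_set[OF l ultrafilterD(2)[OF idl[OF l] u B]]] by auto
  qed
qed

lemma edgesD:
  assumes "e \<in> edges"
  shows "fst e \<in> labels G" "snd e \<in> ultrafilters (idl G (fst e))"
  using assms unfolding edges_def by auto

lemma openin_E1_label: "openin (E1 G) {e \<in> edges. fst e = \<alpha>}"
  unfolding openin_E1_iff
proof
  fix e assume e: "e \<in> {e \<in> edges. fst e = \<alpha>}"
  then have l: "fst e \<in> labels G" and u: "snd e \<in> ultrafilters (idl G (fst e))" using edgesD[of e] by auto
  obtain D where D: "D \<in> snd e" using ultrafilterD(1)[OF idl[OF l] u] by auto
  show "\<exists>\<beta>\<in>labels G. \<exists>D\<in>idl G \<beta>. e \<in> edge_set \<beta> D \<and> edge_set \<beta> D \<subseteq> {e \<in> edges. fst e = \<alpha>}"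
    using l ultrafilterD(2)[OF idl[OF l] u D] D e by (auto simp: edge_set_def)
qed

lemma edge_d_ultrafilter: "e \<in> edges \<Longrightarrow> edge_d e \<in> ultrafilters UNIV"
  unfolding edge_d_eq by (rule up_closure_ultrafilter[OF idl]) (auto dest: edgesD)

lemma mem_edge_d_iff: "e \<in> edges \<Longrightarrow> A \<in> idl G (fst e) \<Longrightarrow> A \<in> edge_d e \<longleftrightarrow> A \<in> snd e"
  unfolding edge_d_eq by (rule mem_up_closure_iff[OF idl]) (auto dest: edgesD)

lemma edge_d_Int: "e \<in> edges \<Longrightarrow> edge_d e \<inter> idl G (fst e) = snd e"
  unfolding edge_d_eq by (rule up_closure_Int[OF idl]) (auto dest: edgesD)

lemma mem_edge_r_iff: "e \<in> edges \<Longrightarrow> A \<in> edge_r G e \<longleftrightarrow> act G (fst e) A \<in> edge_d e"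
  using mem_edge_d_iff[OF _ act_idl[OF edgesD(1)]] unfolding edge_r_def by auto

lemma edge_r_ultrafilter:
  assumes e: "e \<in> edges" and A: "A \<in> edge_r G e"
  shows "edge_r G e \<in> ultrafilters UNIV"
proof -
  have "edge_r G e = {A. act G (fst e) A \<in> edge_d e}" using mem_edge_r_iff[OF e] by auto
  then show ?thesis
    using ultrafilter_preimage[OF act[OF edgesD(1)[OF e]] edge_d_ultrafilter[OF e]] A by auto
qed

lemma edge_exists:
  assumes \<alpha>: "\<alpha> \<in> labels G" and B: "B \<in> idl G \<alpha>" "B \<noteq> bot"
  shows "\<exists>e\<in>edges. fst e = \<alpha> \<and> B \<in> snd e"
proof -
  obtain \<eta> where "\<eta> \<in> ultrafilters (idl G \<alpha>)" "B \<in> \<eta>"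
    using ultrafilter_exists[OF idl[OF \<alpha>] B] by auto
  then show ?thesis using \<alpha> unfolding edges_def by (intro bexI[of _ "(\<alpha>, \<eta>)"]) auto
qed

lemma compactin_edge_set:
  assumes \<alpha>: "\<alpha> \<in> labels G" and B: "B \<in> idl G \<alpha>"
  shows "compactin (E1 G) (edge_set \<alpha> B)"
proof (rule compactin_stone[where e = edge_d and A = B])
  show "edge_set \<alpha> B \<subseteq> topspace (E1 G)" unfolding topspace_E1 edge_set_def by auto
next
  fix \<xi> assume \<xi>: "\<xi> \<in> ultrafilters UNIV" "B \<in> \<xi>"
  then have ne: "\<xi> \<inter> idl G \<alpha> \<noteq> {}" using B by auto
  have "edge_d (\<alpha>, \<xi> \<inter> idl G \<alpha>) = \<xi>" "(\<alpha>, \<xi> \<inter> idl G \<alpha>) \<in> edge_set \<alpha> B"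
    using ultrafilter_restrict[OF idl[OF \<alpha>] \<xi>(1) ne] \<alpha> B \<xi>(2)
    unfolding edge_d_eq edge_set_def edges_def by auto
  then show "\<exists>x\<in>edge_set \<alpha> B. edge_d x = \<xi>" by blast
next
  fix e assume e: "e \<in> edge_set \<alpha> B"
  then have e': "e \<in> edges" "fst e = \<alpha>" "B \<in> snd e" unfolding edge_set_def by auto
  show "edge_d e \<in> ultrafilters UNIV" by (rule edge_d_ultrafilter[OF e'(1)])
  show "B \<in> edge_d e" using mem_edge_d_iff[OF e'(1)] B e' by simp
  fix U assume "openin (E1 G) U" "e \<in> U"
  then obtain \<beta> C where C: "\<beta> \<in> labels G" "C \<in> idl G \<beta>" "e \<in> edge_set \<beta> C" "edge_set \<beta> C \<subseteq> U"
    unfolding openin_E1_iff by meson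
  then have \<beta>: "\<beta> = \<alpha>" using e' unfolding edge_set_def by auto
  have "C \<in> edge_d e" using mem_edge_d_iff[OF e'(1)] C e' \<beta> unfolding edge_set_def by simp
  moreover have "\<forall>y\<in>edge_set \<alpha> B. C \<in> edge_d y \<longrightarrow> y \<in> U"
    using mem_edge_d_iff C \<beta> unfolding edge_set_def by auto
  ultimately show "\<exists>C\<in>edge_d e. \<forall>y\<in>edge_set \<alpha> B. C \<in> edge_d y \<longrightarrow> y \<in> U" by auto
qed

lemma edge_r_meets:
  assumes "\<alpha> \<in> Delta G B"
  shows "\<exists>e\<in>edges. fst e = \<alpha> \<and> B \<in> edge_r G e"
proof -
  have "\<alpha> \<in> labels G" "act G \<alpha> B \<noteq> bot" using assms unfolding Delta_def by auto
  then show ?thesis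
    using edge_exists[OF _ act_idl] unfolding edge_r_def by fastforce
qed

lemma Delta_of_edge_r:
  assumes e: "e \<in> edges" and B: "B \<in> edge_r G e"
  shows "fst e \<in> Delta G B"
proof -
  have "act G (fst e) B \<in> snd e" using B unfolding edge_r_def by simp
  then have "act G (fst e) B \<noteq> bot" using ultrafilterD(3)[OF idl edgesD(2)] edgesD(1) e by metis
  then show ?thesis unfolding Delta_def using edgesD(1)[OF e] by simp
qed

text \<open>Below a regular element \<open>A\<close> every \<open>\<Delta>\<close> is finite, so the
  edges with range in the basic open set of \<open>A\<close> form a finite union of compact sets. It
  is also nonempty, so every vertex in that open set is a limit of ranges of edges.\<close>

lemma regular_imp_F0_rg:
  assumes A: "regular G A" and \<xi>: "\<xi> \<in> ultrafilters UNIV" "A \<in> \<xi>"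
  shows "\<xi> \<in> F0_rg G"
proof -
  have "A \<noteq> bot" using ultrafilter_UNIVD(2)[OF \<xi>(1)] \<xi>(2) by auto
  then have fin: "finite (Delta G A)" using A unfolding regular_def by auto
  have pre: "{e \<in> topspace (E1 G). edge_r G e \<in> stone_set A} = (\<Union>\<alpha>\<in>Delta G A. edge_set \<alpha> (act G \<alpha> A))"
    (is "?L = ?R")
  proof
    show "?L \<subseteq> ?R"
      unfolding topspace_E1 stone_set_def edge_set_def
      using Delta_of_edge_r by (auto simp: edge_r_def)
    show "?R \<subseteq> ?L"
    proof
      fix e assume "e \<in> ?R"
      then have e: "e \<in> edges" "A \<in> edge_r G e" unfolding edge_set_def edge_r_def by auto
      then show "e \<in> ?L" using edge_r_ultrafilter[OF e] by (simp add: topspace_E1 stone_set_def)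
    qed
  qed
  have "compactin (E1 G) ?R"
    by (rule compactin_Union) (use fin compactin_edge_set act_idl in \<open>auto simp: Delta_def\<close>)
  then have "\<xi> \<in> F0_fin G"
    unfolding F0_fin_def using \<xi> topspace_E0_subset_F0 openin_F0_stone_set[of A] pre
      openin_subset[OF openin_F0_stone_set[of A]]
    by (auto simp: topspace_E0 stone_set_def intro!: exI[of _ "stone_set A"])
  moreover have "stone_set A \<inter> F0_sce G = {}"
  proof -
    have "\<zeta> \<in> F0 closure_of (edge_r G ` topspace (E1 G))" if \<zeta>: "\<zeta> \<in> stone_set A" for \<zeta>
      unfolding in_closure_of
    proof (intro conjI allI impI)
      show "\<zeta> \<in> topspace F0" using \<zeta> topspace_E0_subset_F0 by (auto simp: topspace_E0 stone_set_def)
      fix T assume "\<zeta> \<in> T \<and> openin F0 T"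
      then obtain B where B: "B \<in> \<zeta>" "stone_set B \<subseteq> T"
        using F0_neighbourhood[of T \<zeta>] \<zeta> by (auto simp: stone_set_def)
      have AB: "inf A B \<in> \<zeta>" using ultrafilter_UNIVD(3)[of \<zeta> A B] \<zeta> B by (simp add: stone_set_def)
      then have "inf A B \<noteq> bot" using ultrafilter_UNIVD(2)[of \<zeta>] \<zeta> by (auto simp: stone_set_def)
      then have "Delta G (inf A B) \<noteq> {}" using A unfolding regular_def by simp
      then obtain e where e: "e \<in> edges" "inf A B \<in> edge_r G e" using edge_r_meets by blast
      have "edge_r G e \<in> stone_set B"
        using edge_r_ultrafilter[OF e] ultrafilter_UNIVD(4)[OF edge_r_ultrafilter[OF e] e(2) inf_le2]
        by (simp add: stone_set_def)
      then show "\<exists>y. y \<in> edge_r G ` topspace (E1 G) \<and> y \<in> T"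
        using B(2) e(1) by (auto simp: topspace_E1)
    qed
    then show ?thesis unfolding F0_sce_def by auto
  qed
  then have "\<xi> \<notin> F0 closure_of F0_sce G"
    using notin_closure_of_iff[of \<xi> F0 "F0_sce G"] openin_F0_stone_set[of A] \<xi> topspace_E0_subset_F0
    by (auto simp: stone_set_def topspace_E0)
  ultimately show ?thesis unfolding F0_rg_def by simp
qed

text \<open>The edges with a fixed label form an open set, so a compact set of edges involves only
  finitely many labels, which makes every \<open>\<Delta>\<close> below a suitable \<open>A\<close>
  finite. A neighbourhood that avoids \<open>F0_sce G\<close> makes them nonempty, since near each
  of its vertices there is the range of an edge.\<close>

lemma F0_rg_imp_regular:
  assumes rg: "\<xi> \<in> F0_rg G" and \<xi>: "\<xi> \<in> ultrafilters UNIV"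
  shows "\<exists>A\<in>\<xi>. regular G A"
proof -
  obtain U V where U: "openin F0 U" "\<xi> \<in> U" "U \<subseteq> V"
    and V: "compactin (E1 G) {e \<in> topspace (E1 G). edge_r G e \<in> V}"
    using rg unfolding F0_rg_def F0_fin_def by auto
  have \<xi>F: "\<xi> \<in> topspace F0" using \<xi> topspace_E0_subset_F0 by (auto simp: topspace_E0)
  then obtain W where W: "openin F0 W" "\<xi> \<in> W" "W \<inter> F0_sce G = {}"
    using rg notin_closure_of_iff[OF \<xi>F] unfolding F0_rg_def by auto
  obtain A where A: "A \<in> \<xi>" "stone_set A \<subseteq> U \<inter> W"
    using F0_neighbourhood[OF openin_Int[OF U(1) W(1)] _ \<xi>] U(2) W(2) by auto
  have "finite (Delta G B) \<and> Delta G B \<noteq> {}" if B: "B \<noteq> bot" "B \<le> A" for B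
  proof
    have sub: "stone_set B \<subseteq> stone_set A"
      using ultrafilter_UNIVD(4)[OF _ _ B(2)] by (auto simp: stone_set_def)
    obtain \<zeta> where \<zeta>: "\<zeta> \<in> stone_set B"
      using ultrafilter_exists[OF ba_ideal_UNIV _ B(1)] by (auto simp: stone_set_def)
    have "\<zeta> \<notin> F0_sce G" using \<zeta> sub A(2) W(3) by auto
    moreover have "\<zeta> \<in> topspace F0" using \<zeta> openin_subset[OF openin_F0_stone_set[of B]] by auto
    ultimately have "\<zeta> \<in> F0 closure_of (edge_r G ` topspace (E1 G))" unfolding F0_sce_def by simp
    then obtain e where e: "e \<in> edges" "edge_r G e \<in> stone_set B"
      unfolding in_closure_of topspace_E1 using \<zeta> openin_F0_stone_set[of B] by auto
    then have "fst e \<in> Delta G B" using Delta_of_edge_r[OF e(1)] by (simp add: stone_set_def)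
    then show "Delta G B \<noteq> {}" by auto
    let ?K = "{e \<in> topspace (E1 G). edge_r G e \<in> V}"
    let ?C = "\<lambda>\<alpha>. {e \<in> edges. fst e = \<alpha>}"
    have "\<exists>\<F>. finite \<F> \<and> \<F> \<subseteq> range ?C \<and> ?K \<subseteq> \<Union>\<F>"
    proof (rule compactinD[OF V])
      fix U assume "U \<in> range ?C"
      then show "openin (E1 G) U" using openin_E1_label by auto
    next
      show "?K \<subseteq> \<Union>(range ?C)" by (auto simp: topspace_E1)
    qed
    then obtain \<F> where \<F>: "finite \<F>" "\<F> \<subseteq> range ?C" "?K \<subseteq> \<Union>\<F>" by auto
    obtain L where L: "finite L" "\<F> = ?C ` L"
      using finite_subset_image[OF \<F>(1,2)] by auto
    have "Delta G B \<subseteq> L"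
    proof
      fix \<alpha> assume "\<alpha> \<in> Delta G B"
      then obtain e where e: "e \<in> edges" "fst e = \<alpha>" "B \<in> edge_r G e" using edge_r_meets by blast
      then have "edge_r G e \<in> stone_set B" using edge_r_ultrafilter by (simp add: stone_set_def)
      then have "e \<in> ?K" using sub A(2) U(3) e(1) by (auto simp: topspace_E1)
      then show "\<alpha> \<in> L" using \<F>(3) L(2) e(2) by auto
    qed
    then show "finite (Delta G B)" using L(1) finite_subset by auto
  qed
  then have "regular G A" unfolding regular_def by auto
  then show ?thesis using A(1) by auto
qed

text \<open>Through this criterion the boundary paths become a matter of algebra: a path may stop
  only at a vertex without regular elements.\<close>

lemma E0_sg_iff: "\<xi> \<in> E0_sg G \<longleftrightarrow> \<xi> \<in> ultrafilters UNIV \<and> (\<forall>A\<in>\<xi>. \<not> regular G A)"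
proof -
  have "\<xi> \<in> topspace F0" "\<xi> \<in> F0_rg G \<longleftrightarrow> (\<exists>A\<in>\<xi>. regular G A)" if u: "\<xi> \<in> ultrafilters UNIV"
  proof -
    show "\<xi> \<in> topspace F0" using u topspace_E0_subset_F0 by (auto simp: topspace_E0)
    show "\<xi> \<in> F0_rg G \<longleftrightarrow> (\<exists>A\<in>\<xi>. regular G A)"
      using regular_imp_F0_rg[OF _ u] F0_rg_imp_regular[OF _ u] by meson
  qed
  then show ?thesis
    unfolding E0_sg_def topspace_E0 by (cases "\<xi> \<in> ultrafilters UNIV") auto
qed

lemma regular_down: "regular G A \<Longrightarrow> B \<le> A \<Longrightarrow> regular G B"
  unfolding regular_def by (meson order_trans)

end

section \<open>Words and paths\<close>

context gbds
begin

lemma act_word_Nil [simp]: "act_word G [] B = B"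
  and act_word_Cons [simp]: "act_word G (\<alpha> # w) B = act_word G w (act G \<alpha> B)"
  and act_word_append [simp]: "act_word G (w @ v) B = act_word G v (act_word G w B)"
  unfolding act_word_def by simp_all

lemma act_word_sup:
  "w \<in> lists (labels G) \<Longrightarrow> act_word G w (sup A B) = sup (act_word G w A) (act_word G w B)"
  by (induction w arbitrary: A B) (auto simp: act_sup)

lemma act_word_mono: "w \<in> lists (labels G) \<Longrightarrow> A \<le> B \<Longrightarrow> act_word G w A \<le> act_word G w B"
  by (metis act_word_sup sup.absorb_iff2)

lemma idl_word_ideal:
  assumes w: "w \<in> lists (labels G)"
  shows "ba_ideal (idl_word G w)"
proof (cases w)
  case Nil
  then show ?thesis by (simp add: ba_ideal_UNIV)
next
  case (Cons \<alpha> v)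
  then have \<alpha>: "\<alpha> \<in> labels G" and v: "v \<in> lists (labels G)" using w by auto
  have 1: "sup A A' \<in> idl_word G w" if A: "A \<in> idl_word G w" "A' \<in> idl_word G w" for A A'
  proof -
    obtain B B' where B: "B \<in> idl G \<alpha>" "A \<le> act_word G v B" "B' \<in> idl G \<alpha>" "A' \<le> act_word G v B'"
      using A unfolding Cons by auto
    have "sup A A' \<le> act_word G v (sup B B')"
      using sup_mono[OF B(2,4)] by (simp add: act_word_sup[OF v])
    then show ?thesis using ba_ideal_sup[OF idl[OF \<alpha>] B(1,3)] unfolding Cons by auto
  qed
  have 2: "B \<in> idl_word G w" if "A \<in> idl_word G w" "B \<le> A" for A B
    using that unfolding Cons by (auto intro: order_trans)
  have "bot \<in> idl_word G w" unfolding Cons using ba_ideal_bot[OF idl[OF \<alpha>]] by auto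
  then show ?thesis unfolding ba_ideal_def using 1 2 by (auto simp del: idl_word.simps)
qed

lemma idl_word_single: "\<alpha> \<in> labels G \<Longrightarrow> idl_word G [\<alpha>] = idl G \<alpha>"
  using ba_ideal_down[OF idl] by auto

lemma idl_word_act:
  assumes "w \<in> lists (labels G)" "v \<in> lists (labels G)" "D \<in> idl_word G w"
  shows "act_word G v D \<in> idl_word G (w @ v)"
proof (cases w)
  case Nil
  show ?thesis
  proof (cases v)
    case (Cons \<beta> u)
    then show ?thesis using Nil assms act_idl by auto
  qed (use Nil in simp)
next
  case (Cons \<alpha> u)
  then show ?thesis using assms act_word_mono[OF assms(2)] by auto
qed

lemma idl_word_appendD:
  assumes "w \<noteq> []" "C \<in> idl_word G (w @ v)"
  shows "\<exists>D\<in>idl_word G w. C \<le> act_word G v D"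
proof (cases w)
  case (Cons \<alpha> u)
  then obtain B where B: "B \<in> idl G \<alpha>" "C \<le> act_word G v (act_word G u B)" using assms by auto
  then show ?thesis using Cons by (intro bexI[of _ "act_word G u B"]) auto
qed (use assms in simp)

lemma idl_word_suffix:
  assumes "v \<in> lists (labels G)" "v \<noteq> []" "C \<in> idl_word G (w @ v)"
  shows "C \<in> idl_word G v"
proof (cases w)
  case (Cons \<alpha> u)
  then obtain B where B: "C \<le> act_word G v (act_word G u B)" using assms by auto
  obtain \<beta> z where v: "v = \<beta> # z" using assms(2) by (cases v) auto
  then have "act G \<beta> (act_word G u B) \<in> idl G \<beta>" using act_idl assms(1) by simp
  then show ?thesis using B v by auto
qed (use assms in simp)

lemma idl_word_last:
  assumes "w \<in> lists (labels G)" "\<alpha> \<in> labels G" "C \<in> idl_word G (w @ [\<alpha>])"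
  shows "C \<in> idl G \<alpha>"
  using idl_word_suffix[OF _ _ assms(3)] assms(2) idl_word_single by auto

lemma idl_word_ConsD:
  assumes "w \<in> lists (labels G)" "\<alpha> \<in> labels G" "C \<in> idl_word G (\<alpha> # w)"
  shows "\<exists>B\<in>idl G \<alpha>. C \<le> act_word G w B" "C \<in> idl_word G w"
proof -
  show "\<exists>B\<in>idl G \<alpha>. C \<le> act_word G w B" using assms(3) by simp
  show "C \<in> idl_word G w"
    using idl_word_suffix[of w C "[\<alpha>]"] assms by (cases "w = []") auto
qed

lemma idl_common:
  assumes "\<alpha> \<in> labels G" "B \<in> idl G \<alpha>" "B' \<in> idl G \<alpha>"
  shows "\<exists>D\<in>idl G \<alpha>. B \<le> D \<and> B' \<le> D"
  using ba_ideal_sup[OF idl[OF assms(1)] assms(2,3)] by (intro bexI[of _ "sup B B'"]) simp_all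

text \<open>The vertex reached and the label word read after \<open>n\<close> edges. At
  \<open>n = 0\<close> the vertex is the range of the path, which can be the extra point \<open>{}\<close> of
  \<open>F0\<close>; all later vertices are ultrafilters.\<close>

definition vtx :: "('l, 'b) path \<Rightarrow> nat \<Rightarrow> 'b set" where
  "vtx \<mu> n = (if n = 0 then path_r G \<mu> else edge_d (path_edge \<mu> (n - 1)))"

definition wd :: "('l, 'b) path \<Rightarrow> nat \<Rightarrow> 'l list" where
  "wd \<mu> n = map (\<lambda>i. fst (path_edge \<mu> i)) [0..<n]"

lemma length_wd [simp]: "length (wd \<mu> n) = n"
  unfolding wd_def by simp

lemma wd_0 [simp]: "wd \<mu> 0 = []" and wd_Suc: "wd \<mu> (Suc n) = wd \<mu> n @ [fst (path_edge \<mu> n)]"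
  unfolding wd_def by simp_all

text \<open>One notion for vertices, finite and infinite paths, which permits uniform arguments about
  their edges.\<close>

definition is_path :: "('l, 'b) path \<Rightarrow> bool" where
  "is_path \<mu> \<longleftrightarrow> (case \<mu> of Vertex \<xi> \<Rightarrow> \<xi> \<in> ultrafilters UNIV | FinPath es \<Rightarrow> es \<noteq> [] | InfPath f \<Rightarrow> True) \<and>
     (\<forall>i. enat i < path_length \<mu> \<longrightarrow> path_edge \<mu> i \<in> edges) \<and>
     (\<forall>i. enat (Suc i) < path_length \<mu> \<longrightarrow> edge_d (path_edge \<mu> i) = edge_r G (path_edge \<mu> (Suc i)))"

lemma En_set_iff: "es \<in> En_set G n \<longleftrightarrow> length es = n \<and> (\<forall>i<n. es ! i \<in> edges) \<and>
    (\<forall>i. Suc i < n \<longrightarrow> edge_d (es ! i) = edge_r G (es ! Suc i))"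
  unfolding En_set_def topspace_E1 by (auto simp: set_conv_nth)

lemma topspace_En: "topspace (En G n) = En_set G n"
  unfolding En_def topspace_pullback_topology topspace_product_topology topspace_E1
  by (auto simp: En_set_iff)

lemma topspace_Estar: "topspace (Estar G) = {\<mu>. is_path \<mu> \<and> path_length \<mu> \<noteq> \<infinity>}"
proof -
  have "topspace (Estar G) = Vertex ` ultrafilters UNIV \<union> (\<Union>n\<in>{1..}. FinPath ` En_set G n)"
    unfolding Estar_def topology_generated_by_topspace
  proof (rule Set.set_eqI, rule iffI)
    fix x assume "x \<in> \<Union> ({Vertex ` U |U. openin E0 U} \<union> {FinPath ` U |U n. 1 \<le> n \<and> openin (En G n) U})"
    then consider U where "x \<in> Vertex ` U" "openin E0 U"
      | U n where "1 \<le> n" "x \<in> FinPath ` U" "openin (En G n) U" by blast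
    then show "x \<in> Vertex ` ultrafilters UNIV \<union> (\<Union>n\<in>{1..}. FinPath ` En_set G n)"
    proof cases
      case 1
      then show ?thesis using openin_subset[OF 1(2)] unfolding topspace_E0 by auto
    next
      case 2
      then show ?thesis using openin_subset[OF 2(3)] unfolding topspace_En by auto
    qed
  next
    fix x assume "x \<in> Vertex ` ultrafilters UNIV \<union> (\<Union>n\<in>{1..}. FinPath ` En_set G n)"
    then consider "x \<in> Vertex ` ultrafilters UNIV" | n where "1 \<le> n" "x \<in> FinPath ` En_set G n" by auto
    then show "x \<in> \<Union> ({Vertex ` U |U. openin E0 U} \<union> {FinPath ` U |U n. 1 \<le> n \<and> openin (En G n) U})"
    proof cases
      case 1
      then show ?thesis using openin_topspace[of E0] unfolding topspace_E0 by blast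
    next
      case 2
      then show ?thesis using openin_topspace[of "En G n"] unfolding topspace_En by blast
    qed
  qed
  also have "\<dots> = {\<mu>. is_path \<mu> \<and> path_length \<mu> \<noteq> \<infinity>}"
  proof (rule Set.set_eqI)
    fix \<mu> :: "('l, 'b) path"
    show "\<mu> \<in> Vertex ` ultrafilters UNIV \<union> (\<Union>n\<in>{1..}. FinPath ` En_set G n) \<longleftrightarrow>
      \<mu> \<in> {\<mu>. is_path \<mu> \<and> path_length \<mu> \<noteq> \<infinity>}"
      by (cases \<mu>) (auto simp: is_path_def En_set_iff image_iff zero_enat_def Suc_le_eq)
  qed
  finally show ?thesis .
qed

lemma boundary_paths_iff:
  "\<mu> \<in> boundary_paths G \<longleftrightarrow> is_path \<mu> \<and> (path_length \<mu> \<noteq> \<infinity> \<longrightarrow> path_d \<mu> \<in> E0_sg G)"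
proof -
  have "\<mu> \<in> Einf G \<longleftrightarrow> is_path \<mu> \<and> path_length \<mu> = \<infinity>"
    unfolding Einf_def is_path_def topspace_E1 by (cases \<mu>) (auto simp: zero_enat_def)
  then show ?thesis unfolding boundary_paths_def topspace_Estar by auto
qed

lemma path_edge_edges: "is_path \<mu> \<Longrightarrow> enat i < path_length \<mu> \<Longrightarrow> path_edge \<mu> i \<in> edges"
  unfolding is_path_def by auto

lemma vtx_Suc: "vtx \<mu> (Suc i) = edge_d (path_edge \<mu> i)"
  unfolding vtx_def by simp

lemma vtx_edge_r: "is_path \<mu> \<Longrightarrow> enat i < path_length \<mu> \<Longrightarrow> vtx \<mu> i = edge_r G (path_edge \<mu> i)"
proof (cases i)
  case 0
  assume "is_path \<mu>" "enat i < path_length \<mu>"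
  then show ?thesis using 0 unfolding vtx_def is_path_def
    by (cases \<mu>) (auto simp: zero_enat_def hd_conv_nth)
qed (auto simp: vtx_def is_path_def)

lemma mem_vtx_step:
  "is_path \<mu> \<Longrightarrow> enat i < path_length \<mu> \<Longrightarrow>
    A \<in> vtx \<mu> i \<longleftrightarrow> act G (fst (path_edge \<mu> i)) A \<in> vtx \<mu> (Suc i)"
  unfolding vtx_Suc vtx_edge_r by (rule mem_edge_r_iff[OF path_edge_edges])

lemma vtx_ultrafilter_Suc: "is_path \<mu> \<Longrightarrow> enat i < path_length \<mu> \<Longrightarrow> vtx \<mu> (Suc i) \<in> ultrafilters UNIV"
  unfolding vtx_Suc by (rule edge_d_ultrafilter[OF path_edge_edges])

lemma vtx_ultrafilter:
  assumes \<mu>: "is_path \<mu>" and n: "enat n \<le> path_length \<mu>" and A: "A \<in> vtx \<mu> n"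
  shows "vtx \<mu> n \<in> ultrafilters UNIV"
proof (cases n)
  case 0
  show ?thesis
  proof (cases "enat 0 < path_length \<mu>")
    case True
    then show ?thesis
      using vtx_edge_r[OF \<mu> True] edge_r_ultrafilter[OF path_edge_edges[OF \<mu> True]] A 0 by simp
  next
    case False
    then show ?thesis using \<mu> 0 unfolding vtx_def is_path_def
      by (cases \<mu>) (auto simp: zero_enat_def)
  qed
next
  case (Suc m)
  then have "enat m < path_length \<mu>" using n by (simp add: Suc_ile_eq)
  then show ?thesis using vtx_ultrafilter_Suc[OF \<mu>] Suc by simp
qed

lemma ex_nonempty_vtx:
  assumes p: "is_path \<mu>" shows "\<exists>n. enat n \<le> path_length \<mu> \<and> vtx \<mu> n \<noteq> {}"
proof (cases "enat 0 < path_length \<mu>")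
  case True
  then have "vtx \<mu> (Suc 0) \<in> ultrafilters UNIV" by (rule vtx_ultrafilter_Suc[OF p])
  then have "vtx \<mu> (Suc 0) \<noteq> {}" using ultrafilter_UNIVD(1) by blast
  then show ?thesis using True by (intro exI[of _ "Suc 0"]) (simp add: Suc_ile_eq)
next
  case False
  then have "vtx \<mu> 0 \<in> ultrafilters UNIV" using p unfolding is_path_def vtx_def
    by (cases \<mu>) (auto simp: zero_enat_def)
  then have "vtx \<mu> 0 \<noteq> {}" using ultrafilter_UNIVD(1) by blast
  then show ?thesis by (intro exI[of _ 0]) (simp flip: zero_enat_def)
qed

lemma path_d_vtx:
  "is_path \<mu> \<Longrightarrow> path_length \<mu> = enat n \<Longrightarrow> path_d \<mu> = vtx \<mu> n"
  unfolding vtx_def is_path_def by (cases \<mu>) (auto simp: zero_enat_def last_conv_nth)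

lemma wd_labels: "is_path \<mu> \<Longrightarrow> enat n \<le> path_length \<mu> \<Longrightarrow> wd \<mu> n \<in> lists (labels G)"
proof (induction n)
  case (Suc n)
  then have "enat n < path_length \<mu>" by (simp add: Suc_ile_eq)
  then show ?case
    using Suc edgesD(1)[OF path_edge_edges] by (auto simp: wd_Suc)
qed simp

text \<open>Cylinder sets test a vertex only on elements of the ideal of the word read so far. Such
  elements exist in every vertex other than \<open>{}\<close>, and therefore determine it.\<close>

lemma vtx_meets_idl_word:
  "is_path \<mu> \<Longrightarrow> enat n \<le> path_length \<mu> \<Longrightarrow> vtx \<mu> n \<noteq> {} \<Longrightarrow> \<exists>A\<in>vtx \<mu> n. A \<in> idl_word G (wd \<mu> n)"
proof (induction n)
  case 0
  then show ?case by auto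
next
  case (Suc n)
  then have n: "enat n < path_length \<mu>" by (simp add: Suc_ile_eq)
  let ?e = "path_edge \<mu> n"
  have e: "?e \<in> edges" by (rule path_edge_edges[OF Suc.prems(1) n])
  note l = edgesD[OF e]
  show ?case
  proof (cases "n = 0")
    case True
    obtain A where A: "A \<in> snd ?e" using ultrafilterD(1)[OF idl[OF l(1)] l(2)] by auto
    then have "A \<in> idl G (fst ?e)" using ultrafilterD(2)[OF idl[OF l(1)] l(2)] by simp
    then show ?thesis using A mem_edge_d_iff[OF e] True idl_word_single[OF l(1)]
      unfolding vtx_Suc wd_Suc by auto
  next
    case False
    then obtain m where m: "n = Suc m" by (cases n) auto
    then have "enat m < path_length \<mu>" using n by (meson dual_order.strict_trans enat_ord_simps(2) lessI)
    then have "vtx \<mu> n \<noteq> {}"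
      using vtx_ultrafilter_Suc[OF Suc.prems(1)] m ultrafilter_UNIVD(1) by blast
    then obtain A where A: "A \<in> vtx \<mu> n" "A \<in> idl_word G (wd \<mu> n)"
      using Suc.IH[OF Suc.prems(1)] less_imp_le[OF n] by blast
    have "act_word G [fst ?e] A \<in> idl_word G (wd \<mu> n @ [fst ?e])"
      by (rule idl_word_act) (use A l(1) wd_labels[OF Suc.prems(1) less_imp_le[OF n]] in auto)
    then show ?thesis using mem_vtx_step[OF Suc.prems(1) n] A unfolding wd_Suc by auto
  qed
qed

lemma mem_vtx_add:
  assumes \<mu>: "is_path \<mu>"
  shows "enat (i + k) \<le> path_length \<mu> \<Longrightarrow>
    \<exists>v. wd \<mu> (i + k) = wd \<mu> i @ v \<and> (\<forall>A. A \<in> vtx \<mu> i \<longleftrightarrow> act_word G v A \<in> vtx \<mu> (i + k))"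
proof (induction k)
  case 0
  then show ?case by auto
next
  case (Suc k)
  then have n: "enat (i + k) < path_length \<mu>" by (simp add: Suc_ile_eq)
  then obtain v where v: "wd \<mu> (i + k) = wd \<mu> i @ v" "\<And>A. A \<in> vtx \<mu> i \<longleftrightarrow> act_word G v A \<in> vtx \<mu> (i + k)"
    using Suc.IH[OF less_imp_le[OF n]] by blast
  then show ?case
    using mem_vtx_step[OF \<mu> n] by (intro exI[of _ "v @ [fst (path_edge \<mu> (i + k))]"]) (auto simp: wd_Suc)
qed

lemma mem_vtx_append:
  assumes \<mu>: "is_path \<mu>" and n: "enat (length w + length v) \<le> path_length \<mu>"
    and w: "wd \<mu> (length w + length v) = w @ v"
  shows "wd \<mu> (length w) = w" "A \<in> vtx \<mu> (length w) \<longleftrightarrow> act_word G v A \<in> vtx \<mu> (length w + length v)"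
  using mem_vtx_add[OF \<mu> n] w by auto

text \<open>Cylinders are defined by the ultrafilter of the last edge; it contains the same elements
  of its ideal as the end vertex of that edge. In this form the empty word needs no separate
  treatment.\<close>

lemma cylinder_iff:
  assumes w: "w \<in> lists (labels G)" and A: "A \<in> idl_word G w"
  shows "\<mu> \<in> cylinder G w A \<longleftrightarrow> \<mu> \<in> boundary_paths G \<and> enat (length w) \<le> path_length \<mu> \<and>
    wd \<mu> (length w) = w \<and> A \<in> vtx \<mu> (length w)"
proof (cases w rule: rev_cases)
  case Nil
  then show ?thesis unfolding cylinder_def vtx_def by (auto simp flip: zero_enat_def)
next
  case (snoc v \<alpha>)
  have "A \<in> snd (path_edge \<mu> (length v)) \<longleftrightarrow> A \<in> vtx \<mu> (Suc (length v))"
    if \<mu>: "\<mu> \<in> boundary_paths G" "enat (Suc (length v)) \<le> path_length \<mu>" "wd \<mu> (Suc (length v)) = v @ [\<alpha>]"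
  proof -
    have p: "is_path \<mu>" using \<mu>(1) boundary_paths_iff by simp
    have e: "path_edge \<mu> (length v) \<in> edges" using path_edge_edges[OF p] \<mu>(2) by (simp add: Suc_ile_eq)
    have "fst (path_edge \<mu> (length v)) = \<alpha>" using \<mu>(3) by (simp add: wd_Suc)
    moreover have "A \<in> idl G \<alpha>" using idl_word_last[of v \<alpha> A] w A snoc by simp
    ultimately show ?thesis unfolding vtx_Suc using mem_edge_d_iff[OF e] by simp
  qed
  then show ?thesis unfolding cylinder_def snoc wd_def by auto
qed

text \<open>An edge is recovered from its label and its end vertex.\<close>

lemma path_eqI:
  assumes p: "is_path \<mu>" "is_path \<nu>" and len: "path_length \<mu> = path_length \<nu>"
    and wd: "\<And>n. enat n \<le> path_length \<mu> \<Longrightarrow> wd \<mu> n = wd \<nu> n"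
    and vtx: "\<And>n. enat n \<le> path_length \<mu> \<Longrightarrow> vtx \<mu> n = vtx \<nu> n"
  shows "\<mu> = \<nu>"
proof -
  have e: "path_edge \<mu> i = path_edge \<nu> i" if i: "enat i < path_length \<mu>" for i
  proof -
    have i': "enat (Suc i) \<le> path_length \<mu>" using i by (simp add: Suc_ile_eq)
    have f: "fst (path_edge \<mu> i) = fst (path_edge \<nu> i)" using wd[OF i'] by (simp add: wd_Suc)
    have "snd (path_edge \<mu> i) = snd (path_edge \<nu> i)"
      using edge_d_Int[OF path_edge_edges[OF p(1) i]] edge_d_Int[OF path_edge_edges[OF p(2)], of i]
        vtx[OF i'] f i len by (simp add: vtx_Suc)
    then show ?thesis using f by (simp add: prod_eq_iff)
  qed
  have v0: "vtx \<mu> 0 = vtx \<nu> 0" using vtx[of 0] by (simp flip: zero_enat_def)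
  show ?thesis
  proof (cases \<mu>)
    case (Vertex \<xi>)
    then show ?thesis using len v0 p unfolding vtx_def is_path_def by (cases \<nu>) (auto simp: zero_enat_def)
  next
    case (FinPath es)
    then show ?thesis using len e p unfolding is_path_def
      by (cases \<nu>) (auto simp: zero_enat_def intro: nth_equalityI)
  next
    case (InfPath f)
    then show ?thesis using len e p unfolding is_path_def by (cases \<nu>) (auto simp: zero_enat_def)
  qed
qed

text \<open>The cylinders that contain a path tell its length, its label words, and its vertices
  other than \<open>{}\<close>. Only the range can be \<open>{}\<close>, and it is \<open>{}\<close>
  exactly if no cylinder of the empty word contains the path.\<close>

lemma boundary_path_eqI:
  assumes \<mu>: "\<mu> \<in> boundary_paths G" and \<nu>: "\<nu> \<in> boundary_paths G"
    and same: "\<And>w A. w \<in> lists (labels G) \<Longrightarrow> A \<in> idl_word G w \<Longrightarrow> \<mu> \<in> cylinder G w A \<longleftrightarrow> \<nu> \<in> cylinder G w A"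
  shows "\<mu> = \<nu>"
proof -
  have half: "enat n \<le> path_length \<nu> \<and> (vtx \<mu> n \<noteq> {} \<longrightarrow> wd \<mu> n = wd \<nu> n \<and> vtx \<mu> n = vtx \<nu> n)"
    if \<mu>: "\<mu> \<in> boundary_paths G" and \<nu>: "\<nu> \<in> boundary_paths G"
      and same: "\<And>w A. w \<in> lists (labels G) \<Longrightarrow> A \<in> idl_word G w \<Longrightarrow> \<mu> \<in> cylinder G w A \<longleftrightarrow> \<nu> \<in> cylinder G w A"
      and n: "enat n \<le> path_length \<mu>" for n \<mu> \<nu>
  proof (cases "vtx \<mu> n = {}")
    case True
    have p: "is_path \<mu>" using \<mu> boundary_paths_iff by auto
    have "n = 0"
    proof (cases n)
      case (Suc m)
      then have "enat m < path_length \<mu>" using n by (simp add: Suc_ile_eq)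
      then have "vtx \<mu> n \<in> ultrafilters UNIV" using vtx_ultrafilter_Suc[OF p] Suc by simp
      then show ?thesis using ultrafilter_UNIVD(1) True by blast
    qed
    then show ?thesis using True by (simp flip: zero_enat_def)
  next
    case False
    have p: "is_path \<mu>" "is_path \<nu>" using \<mu> \<nu> boundary_paths_iff by auto
    obtain A where A: "A \<in> vtx \<mu> n" "A \<in> idl_word G (wd \<mu> n)"
      using vtx_meets_idl_word[OF p(1) n False] by auto
    have w: "wd \<mu> n \<in> lists (labels G)" by (rule wd_labels[OF p(1) n])
    have "\<nu> \<in> cylinder G (wd \<mu> n) A"
      using same[OF w A(2)] cylinder_iff[OF w A(2)] A(1) \<mu> n by simp
    then have \<nu>': "enat n \<le> path_length \<nu>" "wd \<nu> n = wd \<mu> n" "A \<in> vtx \<nu> n"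
      unfolding cylinder_iff[OF w A(2)] by auto
    have "vtx \<mu> n = vtx \<nu> n"
    proof (rule ultrafilter_eqI[OF idl_word_ideal[OF w]])
      show "vtx \<mu> n \<in> ultrafilters UNIV" by (rule vtx_ultrafilter[OF p(1) n A(1)])
      show "vtx \<nu> n \<in> ultrafilters UNIV" by (rule vtx_ultrafilter[OF p(2) \<nu>'(1,3)])
      show "vtx \<mu> n \<inter> idl_word G (wd \<mu> n) \<noteq> {}" using A by auto
      fix B assume B: "B \<in> idl_word G (wd \<mu> n)"
      show "B \<in> vtx \<mu> n \<longleftrightarrow> B \<in> vtx \<nu> n"
        using same[OF w B] cylinder_iff[OF w B] \<mu> \<nu> n \<nu>' by simp
    qed
    then show ?thesis using \<nu>' by simp
  qed
  have h1: "enat n \<le> path_length \<nu>" if "enat n \<le> path_length \<mu>" for n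
    by (rule conjunct1[OF half[OF \<mu> \<nu> same that]])
  have h2: "enat n \<le> path_length \<mu>" if "enat n \<le> path_length \<nu>" for n
    by (rule conjunct1[OF half[OF \<nu> \<mu> same[symmetric] that]])
  have len: "path_length \<mu> = path_length \<nu>"
  proof (rule order.antisym)
    show "path_length \<mu> \<le> path_length \<nu>"
      using h1 by (cases "path_length \<mu>"; cases "path_length \<nu>") (auto, metis Suc_n_not_le_n)
    show "path_length \<nu> \<le> path_length \<mu>"
      using h2 by (cases "path_length \<mu>"; cases "path_length \<nu>") (auto, metis Suc_n_not_le_n)
  qed
  have vw: "wd \<mu> n = wd \<nu> n \<and> vtx \<mu> n = vtx \<nu> n" if n: "enat n \<le> path_length \<mu>" for n
  proof (cases "vtx \<mu> n = {} \<and> vtx \<nu> n = {}")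
    case True
    have p: "is_path \<mu>" using \<mu> boundary_paths_iff by auto
    have "n = 0"
    proof (cases n)
      case (Suc m)
      then have "enat m < path_length \<mu>" using n by (simp add: Suc_ile_eq)
      then have "vtx \<mu> n \<in> ultrafilters UNIV" using vtx_ultrafilter_Suc[OF p] Suc by simp
      then show ?thesis using ultrafilter_UNIVD(1) True by blast
    qed
    then show ?thesis using True by simp
  next
    case False
    have n': "enat n \<le> path_length \<nu>" using n len by simp
    have "vtx \<mu> n \<noteq> {} \<longrightarrow> wd \<mu> n = wd \<nu> n \<and> vtx \<mu> n = vtx \<nu> n"
      by (rule conjunct2[OF half[OF \<mu> \<nu> same n]])
    moreover have "vtx \<nu> n \<noteq> {} \<longrightarrow> wd \<nu> n = wd \<mu> n \<and> vtx \<nu> n = vtx \<mu> n"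
      by (rule conjunct2[OF half[OF \<nu> \<mu> same[symmetric] n']])
    ultimately show ?thesis using False by metis
  qed
  have p: "is_path \<mu>" "is_path \<nu>" using \<mu> \<nu> boundary_paths_iff by auto
  show ?thesis
    by (rule path_eqI[OF p len]) (use vw in blast)+
qed

end

section \<open>Boundary paths from filters\<close>

context gbds
begin

lemma wd_take: "n \<le> N \<Longrightarrow> take n (wd \<mu> N) = wd \<mu> n"
  unfolding wd_def by (simp add: take_map)

lemma mem_vtx_drop:
  assumes \<mu>: "is_path \<mu>" and N: "enat N \<le> path_length \<mu>" and n: "n \<le> N"
  shows "A \<in> vtx \<mu> n \<longleftrightarrow> act_word G (drop n (wd \<mu> N)) A \<in> vtx \<mu> N"
proof -
  have "n + (N - n) = N" using n by simp
  then obtain v where v: "wd \<mu> N = wd \<mu> n @ v" "\<And>A. A \<in> vtx \<mu> n \<longleftrightarrow> act_word G v A \<in> vtx \<mu> N"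
    using mem_vtx_add[OF \<mu>, of n "N - n"] N by auto
  then have "drop n (wd \<mu> N) = v" by simp
  then show ?thesis using v(2) by simp
qed

lemma act_word_action: "w \<in> lists (labels G) \<Longrightarrow> ba_action (act_word G w)"
proof (induction w)
  case Nil
  then show ?case unfolding ba_action_def by simp
next
  case (Cons \<alpha> w)
  then have "ba_action (act G \<alpha>)" "ba_action (act_word G w)" using act by auto
  then show ?case unfolding ba_action_def by simp
qed

end

text \<open>The elements \<open>(w, A)\<close> with \<open>\<mu> \<in> \<N>(w, A)\<close> of a boundary path \<open>\<mu>\<close> have the properties below,
  and so do those on which a character of the diagonal takes the value 1.\<close>

locale path_filter = gbds G for G :: "('l, 'b::gen_boolean_algebra) gbds" +
  fixes X :: "('l list \<times> 'b) set"
  assumes word: "(w, A) \<in> X \<Longrightarrow> w \<in> lists (labels G)"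
    and elem: "(w, A) \<in> X \<Longrightarrow> A \<in> idl_word G w"
    and nonempty: "\<exists>w A. (w, A) \<in> X"
    and proper: "(w, bot) \<notin> X"
    and comparable: "(w, A) \<in> X \<Longrightarrow> (w', A') \<in> X \<Longrightarrow> \<exists>v. w' = w @ v \<or> w = w' @ v"
    and compatible: "w \<in> lists (labels G) \<Longrightarrow> A \<in> idl_word G w \<Longrightarrow> (w @ v, C) \<in> X \<Longrightarrow>
      (w, A) \<in> X \<longleftrightarrow> (w @ v, inf C (act_word G v A)) \<in> X"
    and prime: "w \<in> lists (labels G) \<Longrightarrow> A \<in> idl_word G w \<Longrightarrow> B \<in> idl_word G w \<Longrightarrow>
      (w, sup A B) \<in> X \<Longrightarrow> (w, A) \<in> X \<or> (w, B) \<in> X"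
    and extend: "(w, A) \<in> X \<Longrightarrow> regular G A \<Longrightarrow> \<exists>\<alpha>\<in>labels G. (w @ [\<alpha>], act G \<alpha> A) \<in> X"
begin

text \<open>The words that occur in \<open>X\<close> are the label words of the path to be
  constructed, and \<open>xi w\<close> is its vertex after \<open>w\<close>. If the empty word does
  not occur, then \<open>xi []\<close> is \<open>{}\<close>, as it should be for a path whose range
  is the extra point.\<close>

definition W where "W = {w. \<exists>A. (w, A) \<in> X}"

definition xi where "xi w = up_closure {A. (w, A) \<in> X}"

lemma W_labels: "w \<in> W \<Longrightarrow> w \<in> lists (labels G)"
  unfolding W_def using word by auto

lemma fibre_ultrafilter:
  assumes w: "w \<in> W" shows "{A. (w, A) \<in> X} \<in> ultrafilters (idl_word G w)"
proof -
  have l: "w \<in> lists (labels G)" by (rule W_labels[OF w])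
  have same: "(w, A) \<in> X \<longleftrightarrow> (w, inf C A) \<in> X" if "A \<in> idl_word G w" "(w, C) \<in> X" for A C
    using compatible[OF l that(1), of "[]" C] that(2) by simp
  show ?thesis
  proof (rule ultrafilterI[OF idl_word_ideal[OF l]]; unfold mem_Collect_eq)
    show "\<exists>A. (w, A) \<in> X" using w unfolding W_def by simp
    show "A \<in> idl_word G w" if "(w, A) \<in> X" for A by (rule elem[OF that])
    show "(w, bot) \<notin> X" by (rule proper)
    show "(w, inf A B) \<in> X" if "(w, A) \<in> X" "(w, B) \<in> X" for A B
      using same[OF elem[OF that(2)] that(1)] that(2) by simp
    show "(w, B) \<in> X" if "(w, A) \<in> X" "B \<in> idl_word G w" "A \<le> B" for A B
      using same[OF that(2,1)] that(1,3) by (simp add: inf_absorb1)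
    show "(w, A) \<in> X \<or> (w, B) \<in> X"
      if "A \<in> idl_word G w" "B \<in> idl_word G w" "(w, sup A B) \<in> X" for A B
      by (rule prime[OF l that])
  qed
qed

lemma xi_ultrafilter: "w \<in> W \<Longrightarrow> xi w \<in> ultrafilters UNIV"
  unfolding xi_def by (rule up_closure_ultrafilter[OF idl_word_ideal[OF W_labels] fibre_ultrafilter])

lemma mem_xi_iff:
  assumes A: "A \<in> idl_word G w" shows "A \<in> xi w \<longleftrightarrow> (w, A) \<in> X"
proof (cases "w \<in> W")
  case True
  then show ?thesis unfolding xi_def
    using mem_up_closure_iff[OF idl_word_ideal[OF W_labels[OF True]] fibre_ultrafilter[OF True] A] by simp
next
  case False
  then show ?thesis unfolding xi_def W_def up_closure_def by auto
qed

lemma W_prefix: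
  assumes wv: "w @ v \<in> W" and w: "w \<noteq> []"
  shows "w \<in> W"
proof -
  obtain C where C: "(w @ v, C) \<in> X" using wv unfolding W_def by auto
  have l: "w \<in> lists (labels G)" using word[OF C] by simp
  obtain D where D: "D \<in> idl_word G w" "C \<le> act_word G v D"
    using idl_word_appendD[OF w elem[OF C]] by auto
  have "(w, D) \<in> X" using compatible[OF l D(1) C] C D(2) by (simp add: inf_absorb1)
  then show ?thesis unfolding W_def by auto
qed

text \<open>For a nonempty word both sides are ultrafilters, which by compatibility agree on the
  ideal of \<open>w\<close>. For the empty word that ideal is everything, so that they agree even if
  both are empty.\<close>

lemma xi_step:
  assumes w: "w @ [\<alpha>] \<in> W"
  shows "xi w = {A. act G \<alpha> A \<in> xi (w @ [\<alpha>])}"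
proof -
  obtain C where C: "(w @ [\<alpha>], C) \<in> X" using w unfolding W_def by auto
  have l: "w \<in> lists (labels G)" "\<alpha> \<in> labels G" "w @ [\<alpha>] \<in> lists (labels G)" using word[OF C] by auto
  note u = ultrafilter_UNIVD[OF xi_ultrafilter[OF w]]
  have CI: "C \<in> idl_word G (w @ [\<alpha>])" by (rule elem[OF C])
  have Cx: "C \<in> xi (w @ [\<alpha>])" using mem_xi_iff[OF CI] C by simp
  have eq: "A \<in> xi w \<longleftrightarrow> act G \<alpha> A \<in> xi (w @ [\<alpha>])" if A: "A \<in> idl_word G w" for A
  proof -
    have I: "inf C (act G \<alpha> A) \<in> idl_word G (w @ [\<alpha>])"
      by (rule ba_ideal_inf(1)[OF idl_word_ideal[OF l(3)] CI])
    have "A \<in> xi w \<longleftrightarrow> (w @ [\<alpha>], inf C (act G \<alpha> A)) \<in> X"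
      using compatible[OF l(1) A C] mem_xi_iff[OF A] by simp
    also have "\<dots> \<longleftrightarrow> inf C (act G \<alpha> A) \<in> xi (w @ [\<alpha>])" using mem_xi_iff[OF I] by simp
    also have "\<dots> \<longleftrightarrow> act G \<alpha> A \<in> xi (w @ [\<alpha>])"
      using u(3)[OF Cx] u(4)[OF _ inf_le2] by blast
    finally show ?thesis .
  qed
  show ?thesis
  proof (cases "w = []")
    case True
    then show ?thesis using eq by auto
  next
    case False
    have wW: "w \<in> W" by (rule W_prefix[OF w False])
    obtain D where D: "(w, D) \<in> X" using wW unfolding W_def by auto
    have DI: "D \<in> idl_word G w" by (rule elem[OF D])
    have Dx: "D \<in> xi w" using mem_xi_iff[OF DI] D by simp
    have "act G \<alpha> D \<in> xi (w @ [\<alpha>])" using eq[OF DI] Dx by simp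
    then have "{A. act G \<alpha> A \<in> xi (w @ [\<alpha>])} \<in> ultrafilters UNIV"
      by (rule ultrafilter_preimage[OF act[OF l(2)] xi_ultrafilter[OF w]])
    then show ?thesis
      by (rule ultrafilter_eqI[OF idl_word_ideal[OF l(1)] xi_ultrafilter[OF wW]])
         (use DI Dx eq in auto)
  qed
qed

definition xedge where "xedge w = (last w, xi w \<inter> idl G (last w))"

lemma xedge:
  assumes w: "w @ [\<alpha>] \<in> W"
  shows "xedge (w @ [\<alpha>]) \<in> edges" "fst (xedge (w @ [\<alpha>])) = \<alpha>"
    "edge_d (xedge (w @ [\<alpha>])) = xi (w @ [\<alpha>])" "edge_r G (xedge (w @ [\<alpha>])) = xi w"
proof -
  obtain C where C: "(w @ [\<alpha>], C) \<in> X" using w unfolding W_def by auto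
  have l: "w \<in> lists (labels G)" "\<alpha> \<in> labels G" using word[OF C] by auto
  have CI: "C \<in> idl_word G (w @ [\<alpha>])" by (rule elem[OF C])
  have "C \<in> xi (w @ [\<alpha>])" using mem_xi_iff[OF CI] C by simp
  then have ne: "xi (w @ [\<alpha>]) \<inter> idl G \<alpha> \<noteq> {}" using idl_word_last[OF l CI] by auto
  note r = ultrafilter_restrict[OF idl[OF l(2)] xi_ultrafilter[OF w] ne]
  show e: "xedge (w @ [\<alpha>]) \<in> edges" using r(1) l(2) unfolding xedge_def edges_def by simp
  show "fst (xedge (w @ [\<alpha>])) = \<alpha>" unfolding xedge_def by simp
  show d: "edge_d (xedge (w @ [\<alpha>])) = xi (w @ [\<alpha>])" unfolding edge_d_eq xedge_def using r(2) by simp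
  show "edge_r G (xedge (w @ [\<alpha>])) = xi w"
    using mem_edge_r_iff[OF e] d xi_step[OF w] unfolding xedge_def by auto
qed

definition reached where "reached n \<longleftrightarrow> (\<exists>w\<in>W. n \<le> length w)"

text \<open>All words in \<open>W\<close> are prefixes of a single word, possibly infinite, whose
  prefix of length \<open>n\<close> this is.\<close>

definition pre where "pre n = take n (SOME w. w \<in> W \<and> n \<le> length w)"

lemma pre_eq:
  assumes w: "w \<in> W" and n: "n \<le> length w" shows "pre n = take n w"
proof -
  let ?u = "SOME w. w \<in> W \<and> n \<le> length w"
  have u: "?u \<in> W \<and> n \<le> length ?u" by (rule someI[of _ w]) (use assms in simp)
  obtain A B where "(w, A) \<in> X" "(?u, B) \<in> X" using w u unfolding W_def by auto
  then obtain v where "?u = w @ v \<or> w = ?u @ v" using comparable by blast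
  then show ?thesis unfolding pre_def
  proof
    assume "?u = w @ v"
    then have "take n ?u = take n w" using n by (metis append_Nil2 diff_is_0_eq take0 take_append)
    then show "take n ?u = take n w" .
  next
    assume "w = ?u @ v"
    then show "take n ?u = take n w" using u by (metis append_Nil2 diff_is_0_eq take0 take_append)
  qed
qed

lemma reached_down: "reached n \<Longrightarrow> m \<le> n \<Longrightarrow> reached m"
  unfolding reached_def by (meson order_trans)

lemma pre_Suc: "reached (Suc n) \<Longrightarrow> \<exists>\<alpha>. pre (Suc n) = pre n @ [\<alpha>]"
  unfolding reached_def using pre_eq take_Suc_conv_app_nth by (metis Suc_le_eq less_imp_le)

lemma length_pre: "reached n \<Longrightarrow> length (pre n) = n"
  unfolding reached_def using pre_eq by fastforce

lemma pre_W:
  assumes "reached (Suc n)" shows "pre (Suc n) \<in> W"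
proof -
  obtain w where w: "w \<in> W" "Suc n \<le> length w" using assms unfolding reached_def by auto
  have "take (Suc n) w @ drop (Suc n) w \<in> W" using w by simp
  then show ?thesis using W_prefix pre_eq[OF w] w(2) by (metis Zero_not_Suc length_pre assms list.size(3))
qed

lemma xedge_pre:
  assumes r: "reached (Suc n)"
  shows "xedge (pre (Suc n)) \<in> edges" "pre (Suc n) = pre n @ [fst (xedge (pre (Suc n)))]"
    "edge_d (xedge (pre (Suc n))) = xi (pre (Suc n))" "edge_r G (xedge (pre (Suc n))) = xi (pre n)"
  using pre_Suc[OF r] pre_W[OF r] xedge by metis+

text \<open>If the construction stops at a vertex, then by the axiom \<open>extend\<close> this
  vertex contains no regular element and is singular. This is what makes a finite path a boundary
  path.\<close>

lemma path_of_reached: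
  assumes \<mu>: "is_path \<mu>" and len: "\<And>n. enat n \<le> path_length \<mu> \<longleftrightarrow> reached n"
    and edge: "\<And>i. enat i < path_length \<mu> \<Longrightarrow> path_edge \<mu> i = xedge (pre (Suc i))"
    and v0: "path_r G \<mu> = xi []"
  shows "\<mu> \<in> boundary_paths G"
    "w \<in> lists (labels G) \<Longrightarrow> A \<in> idl_word G w \<Longrightarrow> (w, A) \<in> X \<longleftrightarrow> \<mu> \<in> cylinder G w A"
proof -
  have less: "reached (Suc i)" if "enat i < path_length \<mu>" for i
    using that len[of "Suc i"] by (simp add: Suc_ile_eq)
  have wd: "wd \<mu> n = pre n" if "enat n \<le> path_length \<mu>" for n
    using that
  proof (induction n)
    case 0
    then show ?case by (simp add: pre_def)
  next
    case (Suc n)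
    then have n: "enat n < path_length \<mu>" by (simp add: Suc_ile_eq)
    show ?case
      using Suc.IH[OF less_imp_le[OF n]] xedge_pre(2)[OF less[OF n]] edge[OF n] by (simp add: wd_Suc)
  qed
  have vtx: "vtx \<mu> n = xi (pre n)" if n: "enat n \<le> path_length \<mu>" for n
  proof (cases n)
    case 0
    then show ?thesis using v0 unfolding vtx_def by (simp add: pre_def)
  next
    case (Suc m)
    then have m: "enat m < path_length \<mu>" using n by (simp add: Suc_ile_eq)
    then show ?thesis using edge[OF m] xedge_pre(3)[OF less[OF m]] unfolding Suc vtx_Suc by simp
  qed
  show b: "\<mu> \<in> boundary_paths G"
    unfolding boundary_paths_iff
  proof (intro conjI impI)
    assume "path_length \<mu> \<noteq> \<infinity>"
    then obtain N where N: "path_length \<mu> = enat N" by auto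
    have d: "path_d \<mu> = xi (pre N)" using path_d_vtx[OF \<mu> N] vtx[of N] N by simp
    have rN: "reached N" using len[of N] N by simp
    have preW: "pre N \<in> W"
    proof (cases N)
      case 0
      obtain w where "w \<in> W" using nonempty unfolding W_def by auto
      moreover have "length w = 0" if "w \<in> W" for w
        using that len[of "length w"] N 0 unfolding reached_def by auto
      ultimately have "[] \<in> W" by (metis length_0_conv)
      then show ?thesis using 0 by (simp add: pre_def)
    qed (use pre_W rN in simp)
    have "\<not> regular G A" if A: "A \<in> xi (pre N)" for A
    proof
      assume "regular G A"
      obtain C where C: "(pre N, C) \<in> X" "C \<le> A" using A unfolding xi_def up_closure_def by auto
      then have "regular G C" using regular_down \<open>regular G A\<close> by auto
      then obtain \<alpha> where "(pre N @ [\<alpha>], act G \<alpha> C) \<in> X" using extend[OF C(1)] by auto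
      then have "pre N @ [\<alpha>] \<in> W" unfolding W_def by auto
      then have "reached (Suc N)" unfolding reached_def using length_pre[OF rN]
        by (intro bexI[of _ "pre N @ [\<alpha>]"]) auto
      then show False using len[of "Suc N"] N by simp
    qed
    then show "path_d \<mu> \<in> E0_sg G" unfolding E0_sg_iff d using xi_ultrafilter[OF preW] by simp
  qed (rule \<mu>)
  assume w: "w \<in> lists (labels G)" and A: "A \<in> idl_word G w"
  show "(w, A) \<in> X \<longleftrightarrow> \<mu> \<in> cylinder G w A"
  proof
    assume wA: "(w, A) \<in> X"
    then have wW: "w \<in> W" unfolding W_def by auto
    then have "enat (length w) \<le> path_length \<mu>" unfolding len reached_def by auto
    then show "\<mu> \<in> cylinder G w A"
      unfolding cylinder_iff[OF w A] using b wd vtx pre_eq[OF wW, of "length w"] mem_xi_iff[OF A] wA by simp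
  next
    assume "\<mu> \<in> cylinder G w A"
    then show "(w, A) \<in> X"
      unfolding cylinder_iff[OF w A] using wd vtx mem_xi_iff[OF A] by metis
  qed
qed

text \<open>The path has as many edges as there are letters to read; a path without edges is the
  vertex \<open>xi []\<close>, which is an ultrafilter because some word occurs in
  \<open>X\<close>.\<close>

lemma ex_boundary_path:
  "\<exists>\<mu>\<in>boundary_paths G. \<forall>w\<in>lists (labels G). \<forall>A\<in>idl_word G w. (w, A) \<in> X \<longleftrightarrow> \<mu> \<in> cylinder G w A"
proof -
  let ?e = "\<lambda>i. xedge (pre (Suc i))"
  have adj: "edge_d (?e i) = edge_r G (?e (Suc i))" if "reached (Suc (Suc i))" for i
    using xedge_pre(3)[OF reached_down[OF that]] xedge_pre(4)[OF that] by simp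
  have pre0: "pre 0 = []" by (simp add: pre_def)
  have r0: "reached 0" using nonempty unfolding reached_def W_def by auto
  have "\<exists>\<mu>. is_path \<mu> \<and> (\<forall>n. enat n \<le> path_length \<mu> \<longleftrightarrow> reached n) \<and>
    (\<forall>i. enat i < path_length \<mu> \<longrightarrow> path_edge \<mu> i = ?e i) \<and> path_r G \<mu> = xi []"
  proof (cases "\<forall>n. reached n")
    case True
    then have "is_path (InfPath ?e)" unfolding is_path_def using xedge_pre(1) adj by simp
    moreover have "edge_r G (?e 0) = xi []" using xedge_pre(4)[of 0] True pre0 by simp
    ultimately show ?thesis using True by (intro exI[of _ "InfPath ?e"]) simp
  next
    case False
    then obtain M where M: "\<not> reached M" by auto
    define N where "N = (GREATEST n. reached n)"
    have bnd: "n \<le> M" if "reached n" for n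
      using M reached_down[OF that, of M] by (meson nat_le_linear)
    have N: "reached N" unfolding N_def by (rule GreatestI_nat[of reached 0 M, OF r0 bnd])
    have N': "reached n \<longleftrightarrow> n \<le> N" for n
      using Greatest_le_nat[of reached n M] bnd reached_down[OF N] unfolding N_def by auto
    show ?thesis
    proof (cases N)
      case 0
      obtain w where w: "w \<in> W" using nonempty unfolding W_def by auto
      then have "reached (length w)" unfolding reached_def by auto
      then have "w = []" using N' 0 by simp
      then have "is_path (Vertex (xi []))"
        using xi_ultrafilter w unfolding is_path_def by (simp add: zero_enat_def)
      then show ?thesis using N' 0 by (intro exI[of _ "Vertex (xi [])"]) (simp add: zero_enat_def)
    next
      case (Suc m)
      let ?\<mu> = "FinPath (map ?e [0..<N])"
      have "is_path ?\<mu>" unfolding is_path_def using Suc N' xedge_pre(1) adj by (simp del: upt_Suc)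
      moreover have "path_r G ?\<mu> = xi []"
        using xedge_pre(4)[of 0] N' Suc pre0 by (simp add: hd_map del: upt_Suc)
      ultimately show ?thesis using N' by (intro exI[of _ ?\<mu>]) simp
    qed
  qed
  then obtain \<mu> where "is_path \<mu>" "\<And>n. enat n \<le> path_length \<mu> \<longleftrightarrow> reached n"
    "\<And>i. enat i < path_length \<mu> \<Longrightarrow> path_edge \<mu> i = ?e i" "path_r G \<mu> = xi []" by auto
  from path_of_reached[OF this] show ?thesis by auto
qed

end

section \<open>The topology of the boundary path space\<close>

context gbds
begin

fun pword :: "('l, 'b) path \<Rightarrow> 'l list" where
  "pword (Vertex \<xi>) = []"
| "pword (FinPath es) = map fst es"
| "pword (InfPath f) = []"

text \<open>The finite counterpart of a cylinder fixes the entire label word and tests the end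
  vertex; these sets are a base of compact open sets of the space of finite paths.\<close>

definition fincyl :: "'l list \<Rightarrow> 'b \<Rightarrow> ('l, 'b) path set" where
  "fincyl w A = {x \<in> topspace (Estar G). pword x = w \<and> A \<in> path_d x}"

lemma finite_pathD:
  assumes "x \<in> topspace (Estar G)"
  shows "is_path x" "path_length x = enat (length (pword x))"
    "wd x (length (pword x)) = pword x" "vtx x (length (pword x)) = path_d x"
    "pword x \<in> lists (labels G)" "path_d x \<in> ultrafilters UNIV"
    "\<exists>A\<in>path_d x. A \<in> idl_word G (pword x)"
proof -
  show p: "is_path x" and "path_length x = enat (length (pword x))"
    using assms unfolding topspace_Estar by (cases x; simp add: zero_enat_def)+
  then have l: "path_length x = enat (length (pword x))" by simp
  show w: "wd x (length (pword x)) = pword x"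
    using l by (cases x) (auto simp: wd_def zero_enat_def map_nth intro: nth_equalityI)
  show v: "vtx x (length (pword x)) = path_d x" using path_d_vtx[OF p l] by simp
  show "pword x \<in> lists (labels G)" using wd_labels[OF p, of "length (pword x)"] l w by simp
  show u: "path_d x \<in> ultrafilters UNIV"
  proof (cases "length (pword x)")
    case 0
    then show ?thesis using p l unfolding is_path_def by (cases x) auto
  next
    case (Suc n)
    then show ?thesis using vtx_ultrafilter_Suc[OF p, of n] v l by simp
  qed
  then have "path_d x \<noteq> {}" using ultrafilter_UNIVD(1) by blast
  then show "\<exists>A\<in>path_d x. A \<in> idl_word G (pword x)"
    using vtx_meets_idl_word[OF p, of "length (pword x)"] l w v by simp
qed

lemma finite_path_vtx:
  assumes x: "x \<in> topspace (Estar G)" and n: "n \<le> length (pword x)"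
  shows "wd x n = take n (pword x)" "A \<in> vtx x n \<longleftrightarrow> act_word G (drop n (pword x)) A \<in> path_d x"
  using wd_take[OF n, of x] mem_vtx_drop[OF finite_pathD(1)[OF x] _ n, of A] finite_pathD(2-4)[OF x] by simp_all

lemma finite_path_eqI:
  assumes x: "x \<in> topspace (Estar G)" and y: "y \<in> topspace (Estar G)"
    and w: "pword x = pword y" and d: "path_d x = path_d y"
  shows "x = y"
proof (rule path_eqI)
  show "path_length x = path_length y" using finite_pathD(2) x y w by simp
  fix n assume n: "enat n \<le> path_length x"
  then have "n \<le> length (pword x)" "n \<le> length (pword y)" using finite_pathD(2)[OF x] w by auto
  then show "wd x n = wd y n" "vtx x n = vtx y n"
    using finite_path_vtx[OF x] finite_path_vtx[OF y] w d by auto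
qed (use finite_pathD(1) x y in auto)

text \<open>Walking backwards from the end vertex, the earlier vertices are its preimages under the
  actions of the remaining words. The element \<open>A\<close> of the ideal of \<open>w\<close>
  keeps all of them, except possibly the range, from being empty.\<close>

lemma ex_finite_path:
  assumes w: "w \<in> lists (labels G)" and \<xi>: "\<xi> \<in> ultrafilters UNIV" and A: "A \<in> \<xi>" "A \<in> idl_word G w"
  shows "\<exists>x\<in>topspace (Estar G). pword x = w \<and> path_d x = \<xi>"
proof (cases "w = []")
  case True
  then show ?thesis using \<xi> unfolding topspace_Estar is_path_def
    by (intro bexI[of _ "Vertex \<xi>"]) (auto simp: zero_enat_def)
next
  case False
  define u where "u i = {B. act_word G (drop (Suc i) w) B \<in> \<xi>}" for i
  define e where "e i = (w ! i, u i \<inter> idl G (w ! i))" for i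
  have e: "e i \<in> edges" "edge_d (e i) = u i" if i: "i < length w" for i
  proof -
    have t: "take (Suc i) w = take i w @ [w ! i]" using i by (rule take_Suc_conv_app_nth)
    have l: "take i w \<in> lists (labels G)" "w ! i \<in> labels G" "drop (Suc i) w \<in> lists (labels G)"
      using w i by (auto dest: in_set_takeD in_set_dropD)
    have "A \<in> idl_word G (take (Suc i) w @ drop (Suc i) w)" using A(2) by simp
    moreover have "take (Suc i) w \<noteq> []" using i by auto
    ultimately obtain D where D: "D \<in> idl_word G (take (Suc i) w)" "A \<le> act_word G (drop (Suc i) w) D"
      using idl_word_appendD by blast
    have Dx: "act_word G (drop (Suc i) w) D \<in> \<xi>" by (rule ultrafilter_UNIVD(4)[OF \<xi> A(1) D(2)])
    have uf: "u i \<in> ultrafilters UNIV"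
      unfolding u_def by (rule ultrafilter_preimage[OF act_word_action[OF l(3)] \<xi> Dx])
    have "D \<in> idl G (w ! i)" using idl_word_last[OF l(1,2)] D(1) t by simp
    then have ne: "u i \<inter> idl G (w ! i) \<noteq> {}" using Dx unfolding u_def by auto
    note r = ultrafilter_restrict[OF idl[OF l(2)] uf ne]
    show "e i \<in> edges" using r(1) l(2) unfolding e_def edges_def by simp
    show "edge_d (e i) = u i" using r(2) unfolding edge_d_eq e_def by simp
  qed
  have adj: "edge_d (e i) = edge_r G (e (Suc i))" if i: "Suc i < length w" for i
  proof -
    have "drop (Suc i) w = w ! Suc i # drop (Suc (Suc i)) w" using i by (simp add: Cons_nth_drop_Suc)
    then have "A \<in> u i \<longleftrightarrow> act G (w ! Suc i) A \<in> u (Suc i)" for A unfolding u_def by simp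
    then show ?thesis using e[of i] e[of "Suc i"] i mem_edge_r_iff[of "e (Suc i)"] unfolding e_def by auto
  qed
  let ?x = "FinPath (map e [0..<length w])"
  have "?x \<in> topspace (Estar G)"
    unfolding topspace_Estar is_path_def using False e adj by simp
  moreover have "pword ?x = w" by (auto simp: e_def intro: nth_equalityI)
  moreover have "path_d ?x = \<xi>"
  proof -
    have "path_d ?x = edge_d (e (length w - 1))" using False by (simp add: last_map)
    also have "\<dots> = \<xi>" using e(2)[of "length w - 1"] False unfolding u_def by simp
    finally show ?thesis .
  qed
  ultimately show ?thesis by blast
qed


lemma openin_fincyl:
  assumes w: "w \<in> lists (labels G)" and A: "A \<in> idl_word G w"
  shows "openin (Estar G) (fincyl w A)"
proof (cases w rule: rev_cases)
  case Nil
  have "fincyl w A = Vertex ` stone_set A"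
  proof (rule Set.set_eqI)
    fix x :: "('l, 'b) path"
    show "x \<in> fincyl w A \<longleftrightarrow> x \<in> Vertex ` stone_set A"
      by (cases x) (auto simp: Nil fincyl_def topspace_Estar is_path_def stone_set_def zero_enat_def)
  qed
  then show ?thesis unfolding Estar_def
    using openin_E0_stone_set[of A] by (auto intro!: topology_generated_by_Basis)
next
  case (snoc v \<alpha>)
  define n where "n = length w"
  have n: "n = Suc (length v)" using snoc by (simp add: n_def)
  have \<alpha>: "\<alpha> \<in> labels G" using w snoc by simp
  have AI: "A \<in> idl G \<alpha>" using idl_word_last[of v \<alpha> A] w A snoc by simp
  define S where "S i = (if i = length v then edge_set \<alpha> A else {e \<in> edges. fst e = w ! i})" for i
  have S: "openin (E1 G) (S i)" for i
    unfolding S_def using openin_E1_edge_set[OF \<alpha> AI] openin_E1_label by simp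
  let ?f = "\<lambda>es. \<lambda>i\<in>{..<n}. es ! i"
  have "openin (product_topology (\<lambda>_. E1 G) {..<n}) (PiE {..<n} S)"
    unfolding openin_PiE_gen using S by simp
  then have op: "openin (En G n) (?f -` PiE {..<n} S \<inter> En_set G n)"
    unfolding En_def openin_pullback_topology by auto
  define T0 where "T0 = ?f -` PiE {..<n} S \<inter> En_set G n"
  have "fincyl w A = FinPath ` T0"
  proof (rule Set.set_eqI)
    fix x :: "('l, 'b) path"
    show "x \<in> fincyl w A \<longleftrightarrow> x \<in> FinPath ` T0"
    proof (cases x)
      case (FinPath es)
      have T: "es \<in> T0 \<longleftrightarrow> es \<in> En_set G n \<and> (\<forall>i<n. fst (es ! i) = w ! i) \<and> A \<in> snd (es ! length v)"
      proof -
        have "es \<in> T0 \<longleftrightarrow> es \<in> En_set G n \<and> (\<forall>i<n. es ! i \<in> S i)" by (auto simp: T0_def PiE_iff)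
        moreover have "(\<forall>i<n. es ! i \<in> S i) \<longleftrightarrow> (\<forall>i<n. fst (es ! i) = w ! i) \<and> A \<in> snd (es ! length v)"
          if "es \<in> En_set G n"
        proof -
          have e: "\<forall>i<n. es ! i \<in> edges" using that En_set_iff by simp
          have "w ! length v = \<alpha>" using snoc by simp
          then show ?thesis using e n unfolding S_def edge_set_def by auto
        qed
        ultimately show ?thesis by auto
      qed
      have "x \<in> fincyl w A \<longleftrightarrow> es \<in> En_set G n \<and> map fst es = w \<and> A \<in> edge_d (last es)"
      proof -
        have "length es = n" if "map fst es = w" using that n_def by (metis length_map)
        then show ?thesis
          unfolding fincyl_def topspace_Estar is_path_def FinPath En_set_iff
          using n by (cases "map fst es = w") auto
      qed
      also have "\<dots> \<longleftrightarrow> es \<in> T0"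
      proof -
        have m: "map fst es = w \<longleftrightarrow> (\<forall>i<n. fst (es ! i) = w ! i)" if "length es = n"
          using that unfolding n_def list_eq_iff_nth_eq by auto
        have d: "A \<in> edge_d (last es) \<longleftrightarrow> A \<in> snd (es ! length v)" if E: "es \<in> En_set G n" "map fst es = w"
        proof -
          have len: "length es = n" using E En_set_iff by simp
          then have l: "last es = es ! length v" using n by (metis diff_Suc_1 last_conv_nth length_greater_0_conv zero_less_Suc)
          have "es ! length v \<in> edges" using E(1) n En_set_iff by simp
          moreover have "fst (es ! length v) = \<alpha>" using E(2) snoc len n by (metis length_append_singleton nth_append_length nth_map lessI)
          ultimately show ?thesis using mem_edge_d_iff[of "es ! length v" A] AI l by simp
        qed
        show ?thesis unfolding T using m d En_set_iff by blast
      qed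
      also have "\<dots> \<longleftrightarrow> x \<in> FinPath ` T0" unfolding FinPath by (simp add: inj_image_mem_iff inj_def)
      finally show ?thesis .
    qed (use snoc in \<open>auto simp: fincyl_def\<close>)
  qed
  moreover have "1 \<le> n" using n by simp
  ultimately show ?thesis unfolding Estar_def using op[folded T0_def] by (auto intro!: topology_generated_by_Basis)
qed

text \<open>A neighbourhood of a finite path constrains each of its edges by one element; pushing these
  elements forward to the end vertex gives a single element.\<close>

lemma fincyl_base_En:
  assumes U: "openin (En G n) U" and es: "es \<in> U" and n: "1 \<le> n"
  shows "\<exists>w\<in>lists (labels G). \<exists>A\<in>idl_word G w. FinPath es \<in> fincyl w A \<and> fincyl w A \<subseteq> FinPath ` U"
proof -
  let ?f = "\<lambda>es. \<lambda>i\<in>{..<n}. es ! i"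
  obtain V where V: "openin (product_topology (\<lambda>_. E1 G) {..<n}) V" "U = ?f -` V \<inter> En_set G n"
    using U unfolding En_def openin_pullback_topology by auto
  have fV: "?f es \<in> V" using es unfolding V(2) by simp
  have "\<forall>x\<in>V. \<exists>S. finite {i \<in> {..<n}. S i \<noteq> topspace (E1 G)} \<and> (\<forall>i\<in>{..<n}. openin (E1 G) (S i)) \<and>
      x \<in> PiE {..<n} S \<and> PiE {..<n} S \<subseteq> V"
    using V(1) unfolding openin_product_topology_alt .
  from bspec[OF this fV] obtain S where S': "\<forall>i\<in>{..<n}. openin (E1 G) (S i)"
    and S2: "?f es \<in> PiE {..<n} S" "PiE {..<n} S \<subseteq> V" by (elim exE conjE)
  have S1: "openin (E1 G) (S i)" if "i < n" for i using S' that by simp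
  note S = S1 S2
  have esE: "es \<in> En_set G n" using es V by simp
  then have len: "length es = n" using En_set_iff by simp
  define x where "x = FinPath es"
  have x: "x \<in> topspace (Estar G)"
    using esE n unfolding topspace_Estar is_path_def x_def En_set_iff by auto
  define w where "w = map fst es"
  have w: "pword x = w" "length w = n" unfolding x_def w_def using len by auto
  note d = finite_pathD[OF x]
  have wl: "w \<in> lists (labels G)" using d(5) w by simp
  have "\<forall>i\<in>{..<n}. \<exists>B. B \<in> idl G (w ! i) \<and> es ! i \<in> edge_set (w ! i) B \<and> edge_set (w ! i) B \<subseteq> S i"
  proof
    fix i assume i: "i \<in> {..<n}"
    then have "es ! i \<in> S i" using S(2) by auto
    then obtain \<alpha> B where B: "\<alpha> \<in> labels G" "B \<in> idl G \<alpha>" "es ! i \<in> edge_set \<alpha> B" "edge_set \<alpha> B \<subseteq> S i"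
      using S(1)[of i] i unfolding openin_E1_iff by (metis lessThan_iff)
    then have "\<alpha> = w ! i" using i len unfolding edge_set_def w_def by auto
    then show "\<exists>B. B \<in> idl G (w ! i) \<and> es ! i \<in> edge_set (w ! i) B \<and> edge_set (w ! i) B \<subseteq> S i" using B by auto
  qed
  then have "\<exists>B. \<forall>i\<in>{..<n}. B i \<in> idl G (w ! i) \<and> es ! i \<in> edge_set (w ! i) (B i) \<and> edge_set (w ! i) (B i) \<subseteq> S i"
    by (rule bchoice)
  then obtain B where B: "\<And>i. i < n \<Longrightarrow> B i \<in> idl G (w ! i)" "\<And>i. i < n \<Longrightarrow> es ! i \<in> edge_set (w ! i) (B i)"
    "\<And>i. i < n \<Longrightarrow> edge_set (w ! i) (B i) \<subseteq> S i" by auto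
  \<comment> \<open>\<open>B i\<close> controls the edge \<open>i\<close> of a path with label word \<open>w\<close> through its end vertex.\<close>
  have ctrl: "act_word G (drop (Suc i) w) (B i) \<in> path_d y \<longleftrightarrow> es' ! i \<in> edge_set (w ! i) (B i)"
    if y: "y \<in> topspace (Estar G)" "y = FinPath es'" "pword y = w" and i: "i < n" for y es' i
  proof -
    have "length es' = n" using y(2,3) w by (metis length_map pword.simps(2))
    then have e: "es' ! i \<in> edges" using path_edge_edges[OF finite_pathD(1)[OF y(1)], of i] finite_pathD(2)[OF y(1)] i w y by simp
    have f: "fst (es' ! i) = w ! i" using y(2,3) i w by (metis length_map nth_map pword.simps(2))
    have "act_word G (drop (Suc i) w) (B i) \<in> path_d y \<longleftrightarrow> B i \<in> vtx y (Suc i)"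
      using finite_path_vtx(2)[OF y(1), of "Suc i" "B i"] i w y(3) by simp
    also have "\<dots> \<longleftrightarrow> B i \<in> edge_d (es' ! i)" unfolding vtx_Suc y(2) by simp
    also have "\<dots> \<longleftrightarrow> es' ! i \<in> edge_set (w ! i) (B i)"
      using mem_edge_d_iff[OF e, of "B i"] B(1)[OF i] e f unfolding edge_set_def by simp
    finally show ?thesis .
  qed
  obtain C where C: "C \<in> path_d x" "C \<in> idl_word G w" using d(7) w by auto
  have "\<exists>A\<in>path_d x. A \<le> C \<and> (\<forall>i<n. A \<le> act_word G (drop (Suc i) w) (B i))"
    by (rule ultrafilter_lower_bound[OF d(6) C(1)]) (use ctrl[OF x x_def w(1)] B(2) in simp)
  then obtain A where A: "A \<in> path_d x" "A \<le> C" "\<And>i. i < n \<Longrightarrow> A \<le> act_word G (drop (Suc i) w) (B i)" by auto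
  have AI: "A \<in> idl_word G w" by (rule ba_ideal_down[OF idl_word_ideal[OF wl] C(2) A(2)])
  have "fincyl w A \<subseteq> FinPath ` U"
  proof
    fix y assume y: "y \<in> fincyl w A"
    then have y': "y \<in> topspace (Estar G)" "pword y = w" "A \<in> path_d y" unfolding fincyl_def by auto
    obtain es' where es': "y = FinPath es'"
      using y'(2) w n finite_pathD(2)[OF y'(1)] by (cases y) auto
    have len': "length es' = n" using y'(2) es' w by (metis length_map pword.simps(2))
    have "es' ! i \<in> S i" if i: "i < n" for i
      using ctrl[OF y'(1) es' y'(2) i] ultrafilter_UNIVD(4)[OF finite_pathD(6)[OF y'(1)] y'(3) A(3)[OF i]] B(3)[OF i]
      by auto
    then have "?f es' \<in> PiE {..<n} S" by (simp add: PiE_iff)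
    then have "?f es' \<in> V" by (rule subsetD[OF S(3)])
    moreover have "es' \<in> En_set G n"
      using finite_pathD(1)[OF y'(1)] len' unfolding is_path_def es' En_set_iff by auto
    ultimately show "y \<in> FinPath ` U" using V(2) es' by auto
  qed
  moreover have "FinPath es \<in> fincyl w A" using x w A(1) unfolding fincyl_def x_def by auto
  ultimately show ?thesis using wl AI by blast
qed

lemma fincyl_base:
  assumes "openin (Estar G) U" "x \<in> U"
  shows "\<exists>w\<in>lists (labels G). \<exists>A\<in>idl_word G w. x \<in> fincyl w A \<and> fincyl w A \<subseteq> U"
proof -
  let ?S = "{Vertex ` U | U. openin E0 U} \<union> {FinPath ` U | U n. n \<ge> 1 \<and> openin (En G n) U}"
  have "generate_topology_on ?S U"
    using assms(1) unfolding Estar_def by (rule openin_topology_generated_by)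
  then have "\<forall>x\<in>U. \<exists>w\<in>lists (labels G). \<exists>A\<in>idl_word G w. x \<in> fincyl w A \<and> fincyl w A \<subseteq> U"
  proof induction
    case (Int a b)
    show ?case
    proof
      fix x assume x: "x \<in> a \<inter> b"
      obtain w A where A: "w \<in> lists (labels G)" "A \<in> idl_word G w" "x \<in> fincyl w A" "fincyl w A \<subseteq> a"
        using Int.IH(1) x by blast
      obtain v B where B: "B \<in> idl_word G v" "x \<in> fincyl v B" "fincyl v B \<subseteq> b"
        using Int.IH(2) x by blast
      have [simp]: "v = w" using A(3) B(2) unfolding fincyl_def by simp
      have "fincyl w (inf A B) = fincyl w A \<inter> fincyl w B"
        unfolding fincyl_def using ultrafilter_inf_iff[OF ba_ideal_UNIV finite_pathD(6)] by auto
      moreover have "inf A B \<in> idl_word G w" by (rule ba_ideal_inf(1)[OF idl_word_ideal[OF A(1)] A(2)])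
      ultimately show "\<exists>w\<in>lists (labels G). \<exists>A\<in>idl_word G w. x \<in> fincyl w A \<and> fincyl w A \<subseteq> a \<inter> b"
        using A B by (intro bexI[of _ w] bexI[of _ "inf A B"]) auto
    qed
  next
    case (UN K)
    then show ?case by (meson Union_iff Union_upper order_trans)
  next
    case (Basis s)
    then consider U where "s = Vertex ` U" "openin E0 U"
      | U n where "1 \<le> n" "s = FinPath ` U" "openin (En G n) U" by blast
    then show ?case
    proof cases
      case 1
      show ?thesis
      proof
        fix x assume "x \<in> s"
        then obtain \<xi> where \<xi>: "x = Vertex \<xi>" "\<xi> \<in> U" using 1 by auto
        then obtain A where A: "\<xi> \<in> stone_set A" "stone_set A \<subseteq> U" using 1(2) unfolding openin_E0_iff by auto
        have "fincyl [] A = Vertex ` stone_set A"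
        proof (rule Set.set_eqI)
          fix x :: "('l, 'b) path"
          show "x \<in> fincyl [] A \<longleftrightarrow> x \<in> Vertex ` stone_set A"
            by (cases x) (auto simp: fincyl_def topspace_Estar is_path_def stone_set_def zero_enat_def)
        qed
        then show "\<exists>w\<in>lists (labels G). \<exists>A\<in>idl_word G w. x \<in> fincyl w A \<and> fincyl w A \<subseteq> s"
          using A \<xi>(1) 1(1) by (intro bexI[of _ "[]"] bexI[of _ A]) auto
      qed
    next
      case 2
      then show ?thesis using fincyl_base_En[OF 2(3) _ 2(1)] by auto
    qed
  qed auto
  then show ?thesis using assms(2) by blast
qed

text \<open>The paths with label word \<open>w\<close> are parametrized by their end
  vertices.\<close>

lemma compactin_fincyl:
  assumes w: "w \<in> lists (labels G)" and A: "A \<in> idl_word G w"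
  shows "compactin (Estar G) (fincyl w A)"
proof (rule compactin_stone[where e = path_d and A = A])
  show "fincyl w A \<subseteq> topspace (Estar G)" unfolding fincyl_def by auto
  show "\<exists>x\<in>fincyl w A. path_d x = \<xi>" if "\<xi> \<in> ultrafilters UNIV" "A \<in> \<xi>" for \<xi>
    using ex_finite_path[OF w that A] that unfolding fincyl_def by auto
next
  fix x assume x: "x \<in> fincyl w A"
  then have x': "x \<in> topspace (Estar G)" unfolding fincyl_def by simp
  show "path_d x \<in> ultrafilters UNIV" by (rule finite_pathD(6)[OF x'])
  show "A \<in> path_d x" using x unfolding fincyl_def by simp
  fix U assume U: "openin (Estar G) U" "x \<in> U"
  obtain v B where B: "x \<in> fincyl v B" "fincyl v B \<subseteq> U" using fincyl_base[OF U] by auto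
  have "v = w" using x B(1) unfolding fincyl_def by simp
  have "y \<in> U" if "y \<in> fincyl w A" "B \<in> path_d y" for y
    using subsetD[OF B(2), of y] that \<open>v = w\<close> by (simp add: fincyl_def)
  moreover have "B \<in> path_d x" using B(1) unfolding fincyl_def by simp
  ultimately show "\<exists>B\<in>path_d x. \<forall>y\<in>fincyl w A. B \<in> path_d y \<longrightarrow> y \<in> U"
    by (intro bexI[of _ B]) simp_all
qed

lemma ex_fincyl:
  assumes "x \<in> topspace (Estar G)"
  shows "\<exists>w\<in>lists (labels G). \<exists>A\<in>idl_word G w. x \<in> fincyl w A"
  using fincyl_base[OF openin_topspace assms] by meson

lemma Hausdorff_Estar: "Hausdorff_space (Estar G)"
  unfolding Hausdorff_space_def
proof (intro allI impI)
  fix x y assume xy: "x \<in> topspace (Estar G) \<and> y \<in> topspace (Estar G) \<and> x \<noteq> y"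
  then have x: "x \<in> topspace (Estar G)" and y: "y \<in> topspace (Estar G)" and ne: "x \<noteq> y" by auto
  obtain w A where A: "w \<in> lists (labels G)" "A \<in> idl_word G w" "x \<in> fincyl w A" using ex_fincyl[OF x] by auto
  obtain v B where B: "v \<in> lists (labels G)" "B \<in> idl_word G v" "y \<in> fincyl v B" using ex_fincyl[OF y] by auto
  show "\<exists>U V. openin (Estar G) U \<and> openin (Estar G) V \<and> x \<in> U \<and> y \<in> V \<and> disjnt U V"
  proof (cases "v = w")
    case False
    then have "disjnt (fincyl w A) (fincyl v B)" unfolding fincyl_def disjnt_iff by auto
    then show ?thesis using openin_fincyl[OF A(1,2)] openin_fincyl[OF B(1,2)] A(3) B(3) by auto
  next
    case True
    have "pword x = pword y" using A(3) B(3) True unfolding fincyl_def by simp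
    then have "path_d x \<noteq> path_d y" using finite_path_eqI[OF x y] ne by auto
    then obtain A' B' where AB: "A' \<in> path_d x" "B' \<in> path_d y" "inf A' B' = bot"
      using ultrafilters_separate[OF finite_pathD(6)[OF x] finite_pathD(6)[OF y]] by auto
    let ?A = "inf A A'" and ?B = "inf B B'"
    have AI: "?A \<in> idl_word G w" "?B \<in> idl_word G v"
      using ba_ideal_inf(1)[OF idl_word_ideal] A B by auto
    have "A \<in> path_d x" "B \<in> path_d y" using A(3) B(3) unfolding fincyl_def by auto
    then have "?A \<in> path_d x" "?B \<in> path_d y"
      using ultrafilter_UNIVD(3)[OF finite_pathD(6)[OF x]] ultrafilter_UNIVD(3)[OF finite_pathD(6)[OF y]] AB by auto
    then have mem: "x \<in> fincyl w ?A" "y \<in> fincyl v ?B" using A(3) B(3) unfolding fincyl_def by auto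
    have "\<not> (z \<in> fincyl w ?A \<and> z \<in> fincyl v ?B)" for z
    proof
      assume z: "z \<in> fincyl w ?A \<and> z \<in> fincyl v ?B"
      then have u: "path_d z \<in> ultrafilters UNIV" "?A \<in> path_d z" "?B \<in> path_d z"
        using finite_pathD(6) unfolding fincyl_def by auto
      have "inf ?A ?B = bot"
        using AB(3) by (metis inf_assoc inf_bot_right inf_left_commute)
      then show False using ultrafilter_UNIVD(2,3)[OF u(1)] u by metis
    qed
    then have "disjnt (fincyl w ?A) (fincyl v ?B)" unfolding disjnt_iff by simp
    then show ?thesis 
      using openin_fincyl[OF A(1) AI(1)] openin_fincyl[OF B(1) AI(2)] mem by auto
  qed
qed

text \<open>The initial vertex counts as the prefix of length 0, which turns \<open>ZZ\<close> into
  a single condition on prefixes.\<close>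

definition pfx :: "nat \<Rightarrow> ('l, 'b) path \<Rightarrow> ('l, 'b) path" where
  "pfx n \<mu> = (if n = 0 then Vertex (path_r G \<mu>) else path_prefix n \<mu>)"

lemma ZZ_iff: "\<mu> \<in> ZZ G S \<longleftrightarrow> \<mu> \<in> boundary_paths G \<and> (\<exists>n. enat n \<le> path_length \<mu> \<and> pfx n \<mu> \<in> S)"
proof -
  have "(\<exists>n. enat n \<le> path_length \<mu> \<and> pfx n \<mu> \<in> S) \<longleftrightarrow>
    Vertex (path_r G \<mu>) \<in> S \<or> (\<exists>i\<ge>1. enat i \<le> path_length \<mu> \<and> path_prefix i \<mu> \<in> S)"
  proof
    assume "\<exists>n. enat n \<le> path_length \<mu> \<and> pfx n \<mu> \<in> S"
    then obtain n where "enat n \<le> path_length \<mu>" "pfx n \<mu> \<in> S" by auto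
    then show "Vertex (path_r G \<mu>) \<in> S \<or> (\<exists>i\<ge>1. enat i \<le> path_length \<mu> \<and> path_prefix i \<mu> \<in> S)"
      by (cases "n = 0") (auto simp: pfx_def Suc_le_eq)
  next
    assume "Vertex (path_r G \<mu>) \<in> S \<or> (\<exists>i\<ge>1. enat i \<le> path_length \<mu> \<and> path_prefix i \<mu> \<in> S)"
    then show "\<exists>n. enat n \<le> path_length \<mu> \<and> pfx n \<mu> \<in> S"
    proof
      assume "Vertex (path_r G \<mu>) \<in> S"
      then show ?thesis by (intro exI[of _ 0]) (simp add: pfx_def flip: zero_enat_def)
    next
      assume "\<exists>i\<ge>1. enat i \<le> path_length \<mu> \<and> path_prefix i \<mu> \<in> S"
      then obtain i where "1 \<le> i" "enat i \<le> path_length \<mu>" "path_prefix i \<mu> \<in> S" by auto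
      then show ?thesis by (intro exI[of _ i]) (simp add: pfx_def)
    qed
  qed
  then show ?thesis unfolding ZZ_def by simp
qed

lemma pfx:
  assumes \<mu>: "is_path \<mu>" and n: "enat n \<le> path_length \<mu>"
  shows "pword (pfx n \<mu>) = wd \<mu> n" "path_d (pfx n \<mu>) = vtx \<mu> n"
    "vtx \<mu> n \<noteq> {} \<Longrightarrow> pfx n \<mu> \<in> topspace (Estar G)"
proof -
  show "pword (pfx n \<mu>) = wd \<mu> n" unfolding pfx_def path_prefix_def wd_def by simp
  show v: "path_d (pfx n \<mu>) = vtx \<mu> n"
    unfolding pfx_def path_prefix_def vtx_def by (simp add: last_map)
  assume "vtx \<mu> n \<noteq> {}"
  then have u: "vtx \<mu> n \<in> ultrafilters UNIV" using vtx_ultrafilter[OF \<mu> n] by auto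
  have lt: "enat i < path_length \<mu>" if "i < n" for i
    using that n by (meson enat_ord_simps(2) less_le_trans)
  show "pfx n \<mu> \<in> topspace (Estar G)"
  proof (cases "n = 0")
    case True
    then show ?thesis using u unfolding topspace_Estar is_path_def pfx_def vtx_def by (simp add: zero_enat_def)
  next
    case False
    then have "is_path (pfx n \<mu>)"
      using \<mu> lt unfolding is_path_def[of "pfx n \<mu>"] pfx_def path_prefix_def by (auto simp: is_path_def)
    then show ?thesis using False unfolding topspace_Estar pfx_def path_prefix_def by simp
  qed
qed

lemma pfx_mem_fincyl_iff:
  assumes \<mu>: "is_path \<mu>" and n: "enat n \<le> path_length \<mu>"
  shows "pfx n \<mu> \<in> fincyl w A \<longleftrightarrow> wd \<mu> n = w \<and> A \<in> vtx \<mu> n"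
  unfolding fincyl_def using pfx[OF \<mu> n] by auto

lemma ZZ_fincyl:
  assumes w: "w \<in> lists (labels G)" and A: "A \<in> idl_word G w"
  shows "ZZ G (fincyl w A) = cylinder G w A"
proof (rule Set.set_eqI)
  fix \<mu>
  show "\<mu> \<in> ZZ G (fincyl w A) \<longleftrightarrow> \<mu> \<in> cylinder G w A"
    unfolding ZZ_iff cylinder_iff[OF w A] using pfx_mem_fincyl_iff boundary_paths_iff by auto
qed

definition cylinder_topology :: "('l, 'b) path topology" where
  "cylinder_topology = topology_generated_by
    ({cylinder G w A | w A. w \<in> lists (labels G) \<and> A \<in> idl_word G w} \<union>
     {boundary_paths G - cylinder G w A | w A. w \<in> lists (labels G) \<and> A \<in> idl_word G w})"

lemma openin_cylinder:
  assumes w: "w \<in> lists (labels G)" and A: "A \<in> idl_word G w"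
  shows "openin cylinder_topology (cylinder G w A)"
    "openin cylinder_topology (boundary_paths G - cylinder G w A)"
  unfolding cylinder_topology_def by (rule topology_generated_by_Basis; use w A in blast)+

lemma topspace_cylinder_topology: "topspace cylinder_topology = boundary_paths G"
proof -
  have "bot \<in> idl_word G []" by simp
  then have "boundary_paths G - cylinder G [] bot \<subseteq> topspace cylinder_topology"
    "cylinder G [] bot \<subseteq> topspace cylinder_topology"
    using openin_subset[OF openin_cylinder(1)[of "[]" bot]] openin_subset[OF openin_cylinder(2)[of "[]" bot]] by auto
  then have "boundary_paths G \<subseteq> topspace cylinder_topology" by auto
  moreover have "topspace cylinder_topology \<subseteq> boundary_paths G"
    unfolding cylinder_topology_def topology_generated_by_topspace using cylinder_iff by blast
  ultimately show ?thesis by auto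
qed

lemma openin_cylinder_ZZ:
  assumes U: "openin (Estar G) U" shows "openin cylinder_topology (ZZ G U)"
proof -
  let ?C = "{cylinder G w A | w A. w \<in> lists (labels G) \<and> A \<in> idl_word G w \<and> fincyl w A \<subseteq> U}"
  have "ZZ G U = \<Union>?C"
  proof
    show "\<Union>?C \<subseteq> ZZ G U"
    proof
      fix \<mu> assume "\<mu> \<in> \<Union>?C"
      then obtain w A where w: "w \<in> lists (labels G)" "A \<in> idl_word G w" "fincyl w A \<subseteq> U" "\<mu> \<in> cylinder G w A"
        by auto
      then have "\<mu> \<in> ZZ G (fincyl w A)" using ZZ_fincyl by simp
      then show "\<mu> \<in> ZZ G U" using w(3) unfolding ZZ_iff by auto
    qed
    show "ZZ G U \<subseteq> \<Union>?C"
    proof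
      fix \<mu> assume \<mu>: "\<mu> \<in> ZZ G U"
      then obtain n where n: "enat n \<le> path_length \<mu>" "pfx n \<mu> \<in> U" unfolding ZZ_iff by auto
      then obtain w A where w: "w \<in> lists (labels G)" "A \<in> idl_word G w" "pfx n \<mu> \<in> fincyl w A" "fincyl w A \<subseteq> U"
        using fincyl_base[OF U n(2)] by auto
      then have "\<mu> \<in> ZZ G (fincyl w A)" using \<mu> n unfolding ZZ_iff by auto
      then have "\<mu> \<in> cylinder G w A" using ZZ_fincyl w by simp
      then show "\<mu> \<in> \<Union>?C" using w by auto
    qed
  qed
  moreover have "openin cylinder_topology (\<Union>?C)"
    by (rule openin_Union) (use openin_cylinder(1) in blast)
  ultimately show ?thesis by simp
qed

text \<open>A compact set of finite paths is closed and lies in finitely many cylinders. Inside one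
  cylinder, having no prefix in \<open>K\<close> means having the prefix of the right length in the open
  complement of \<open>K\<close>.\<close>

lemma openin_cylinder_ZZ_compact:
  assumes K: "compactin (Estar G) K" shows "openin cylinder_topology (boundary_paths G - ZZ G K)"
proof -
  have clK: "closedin (Estar G) K" by (rule compactin_imp_closedin[OF Hausdorff_Estar K])
  let ?C = "{fincyl w A | w A. w \<in> lists (labels G) \<and> A \<in> idl_word G w}"
  have sub: "K \<subseteq> \<Union>?C" using ex_fincyl compactin_subset_topspace[OF K] by blast
  obtain \<F> where \<F>: "finite \<F>" "\<F> \<subseteq> ?C" "K \<subseteq> \<Union>\<F>"
    using compactinD[OF K _ sub] openin_fincyl by blast
  \<comment> \<open>As prefixes of a fixed length are unique, \<open>N F\<close> consists of the paths without a prefix in \<open>F \<inter> K\<close>.\<close>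
  define N where "N F = (boundary_paths G - ZZ G F) \<union> ZZ G (F - K)" for F
  have op: "openin cylinder_topology (N F)" if "F \<in> \<F>" for F
  proof -
    obtain w A where F: "F = fincyl w A" "w \<in> lists (labels G)" "A \<in> idl_word G w"
      using \<F>(2) \<open>F \<in> \<F>\<close> by blast
    have "openin cylinder_topology (boundary_paths G - ZZ G F)"
      using openin_cylinder(2)[OF F(2,3)] ZZ_fincyl[OF F(2,3)] F(1) by simp
    moreover have "openin cylinder_topology (ZZ G (F - K))"
      by (rule openin_cylinder_ZZ) (use openin_diff[OF openin_fincyl[OF F(2,3)] clK] F(1) in simp)
    ultimately show ?thesis unfolding N_def by (rule openin_Un)
  qed
  have "boundary_paths G - ZZ G K = boundary_paths G \<inter> (\<Inter>F\<in>\<F>. N F)"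
  proof (intro subset_antisym subsetI)
    fix \<mu> assume \<mu>: "\<mu> \<in> boundary_paths G - ZZ G K"
    have "\<mu> \<in> N F" if "F \<in> \<F>" for F 
      using \<mu> ZZ_iff[of \<mu> F] ZZ_iff[of \<mu> "F - K"] ZZ_iff[of \<mu> K] unfolding N_def by auto
    then show "\<mu> \<in> boundary_paths G \<inter> (\<Inter>F\<in>\<F>. N F)" using \<mu> by auto
  next
    fix \<mu> assume \<mu>: "\<mu> \<in> boundary_paths G \<inter> (\<Inter>F\<in>\<F>. N F)"
    have p: "is_path \<mu>" using \<mu> boundary_paths_iff by auto
    have False if z: "\<mu> \<in> ZZ G K"
    proof -
      obtain n where n: "enat n \<le> path_length \<mu>" "pfx n \<mu> \<in> K" using z unfolding ZZ_iff by auto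
      then obtain F where F: "F \<in> \<F>" "pfx n \<mu> \<in> F" using \<F>(3) by auto
      then obtain w A where wA: "F = fincyl w A" using \<F>(2) by auto
      have "\<mu> \<in> ZZ G F" using \<mu> n F unfolding ZZ_iff by auto
      then have "\<mu> \<in> ZZ G (F - K)" using \<mu> F unfolding N_def by auto
      then obtain m where m: "enat m \<le> path_length \<mu>" "pfx m \<mu> \<in> F" "pfx m \<mu> \<notin> K" unfolding ZZ_iff by auto
      have "m = n" using pfx_mem_fincyl_iff[OF p m(1), of w A] pfx_mem_fincyl_iff[OF p n(1), of w A] m(2) F(2) wA
        by (metis length_wd)
      then show False using m n by simp
    qed
    then show "\<mu> \<in> boundary_paths G - ZZ G K" using \<mu> by auto
  qed
  moreover have "openin cylinder_topology (boundary_paths G \<inter> (\<Inter>F\<in>\<F>. N F))"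
  proof (cases "\<F> = {}")
    case True
    then show ?thesis using openin_topspace[of cylinder_topology] topspace_cylinder_topology by simp
  next
    case False
    then show ?thesis
      using openin_topspace[of cylinder_topology] topspace_cylinder_topology \<F>(1) op
      by (auto intro!: openin_Int openin_Inter)
  qed
  ultimately show ?thesis by simp
qed

text \<open>Cylinders and their complements are among the generators of the topology of boundary
  paths, because \<open>fincyl w A\<close> is open as well as compact. The converse is covered by
  the two preceding lemmas.\<close>

lemma boundary_topology_eq: "boundary_topology G = cylinder_topology"
  unfolding topology_eq
proof (intro allI iffI)
  fix U assume "openin (boundary_topology G) U"
  then show "openin cylinder_topology U"
    unfolding boundary_topology_def
    by (rule openin_topology_generated_by_mono[rotated])
       (auto intro!: openin_Int openin_cylinder_ZZ openin_cylinder_ZZ_compact)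
next
  let ?S = "{ZZ G U \<inter> (boundary_paths G - ZZ G K) | U K. openin (Estar G) U \<and> compactin (Estar G) K}"
  have gen: "openin (boundary_topology G) (ZZ G U \<inter> (boundary_paths G - ZZ G K))"
    if "openin (Estar G) U" "compactin (Estar G) K" for U K
    unfolding boundary_topology_def by (rule topology_generated_by_Basis) (use that in blast)
  have e: "ZZ G {} = {}" unfolding ZZ_iff by (auto simp: ZZ_def)
  have full: "ZZ G (topspace (Estar G)) = boundary_paths G"
  proof -
    have "\<mu> \<in> ZZ G (topspace (Estar G))" if \<mu>: "\<mu> \<in> boundary_paths G" for \<mu>
    proof -
      have p: "is_path \<mu>" using \<mu> boundary_paths_iff by auto
      show ?thesis using ex_nonempty_vtx[OF p] pfx(3)[OF p] \<mu> unfolding ZZ_iff by auto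
    qed
    then show ?thesis unfolding ZZ_iff by (auto simp: ZZ_iff)
  qed
  fix U assume "openin cylinder_topology U"
  then show "openin (boundary_topology G) U"
    unfolding cylinder_topology_def
  proof (rule openin_topology_generated_by_mono[rotated])
    fix s assume "s \<in> {cylinder G w A | w A. w \<in> lists (labels G) \<and> A \<in> idl_word G w} \<union>
     {boundary_paths G - cylinder G w A | w A. w \<in> lists (labels G) \<and> A \<in> idl_word G w}"
    then obtain w A where w: "w \<in> lists (labels G)" "A \<in> idl_word G w"
      and s: "s = cylinder G w A \<or> s = boundary_paths G - cylinder G w A" by blast
    have "cylinder G w A = ZZ G (fincyl w A) \<inter> (boundary_paths G - ZZ G {})"
      unfolding ZZ_fincyl[OF w] e using cylinder_iff[OF w] by auto
    then have 1: "openin (boundary_topology G) (cylinder G w A)"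
      using gen[OF openin_fincyl[OF w], of "{}"] by simp
    have "boundary_paths G - cylinder G w A = ZZ G (topspace (Estar G)) \<inter> (boundary_paths G - ZZ G (fincyl w A))"
      unfolding ZZ_fincyl[OF w] full by auto
    then have 2: "openin (boundary_topology G) (boundary_paths G - cylinder G w A)"
      using gen[OF openin_topspace compactin_fincyl[OF w]] by simp
    show "openin (boundary_topology G) s" using s 1 2 by auto
  qed
qed

end

section \<open>Square summable functions\<close>

text \<open>The Hilbert space \<open>\<ell>\<^sup>2\<close> of an arbitrary index type. It is made
  an instance of the classes for real inner product spaces, so that the results on bounded linear
  maps apply; the complex scalars enter through the operator \<open>ell2_J\<close> of multiplication
  by \<open>\<i>\<close>.\<close>

typedef 'i ell2 = "{f :: 'i \<Rightarrow> complex. (\<lambda>i. (cmod (f i))\<^sup>2) summable_on UNIV}"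
  morphisms coord Abs_ell2
  by (rule exI[of _ "\<lambda>_. 0"]) simp

lemma coord_summable: "(\<lambda>i. (cmod (coord f i))\<^sup>2) summable_on UNIV"
  using coord[of f] by simp

lemma coord_Abs: "(\<lambda>i. (cmod (f i))\<^sup>2) summable_on UNIV \<Longrightarrow> coord (Abs_ell2 f) = f"
  by (simp add: Abs_ell2_inverse)

lemma ell2_eqI: "(\<And>i. coord f i = coord g i) \<Longrightarrow> f = g"
  by (metis coord_inverse ext)

lemma summable_square_comparison:
  assumes "g summable_on (UNIV :: 'i set)" and "\<And>i. (cmod (f i))\<^sup>2 \<le> (g i :: real)"
  shows "(\<lambda>i. (cmod (f i))\<^sup>2) summable_on UNIV"
  by (rule summable_on_comparison_test[OF assms(1)]) (use assms(2) in auto)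

lemma summable_square_add:
  assumes f: "(\<lambda>i. (cmod (f i))\<^sup>2) summable_on (UNIV :: 'i set)"
    and g: "(\<lambda>i. (cmod (g i))\<^sup>2) summable_on UNIV"
  shows "(\<lambda>i. (cmod (f i + g i))\<^sup>2) summable_on UNIV"
proof (rule summable_square_comparison)
  show "(\<lambda>i. 2 * (cmod (f i))\<^sup>2 + 2 * (cmod (g i))\<^sup>2) summable_on UNIV"
    by (intro summable_on_add summable_on_cmult_right f g)
  fix i
  have "(cmod (f i + g i))\<^sup>2 \<le> (cmod (f i) + cmod (g i))\<^sup>2"
    by (rule power_mono[OF norm_triangle_ineq norm_ge_zero])
  also have "\<dots> \<le> 2 * (cmod (f i))\<^sup>2 + 2 * (cmod (g i))\<^sup>2"
    using sum_squares_bound[of "cmod (f i)" "cmod (g i)"] by (simp add: power2_sum)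
  finally show "(cmod (f i + g i))\<^sup>2 \<le> 2 * (cmod (f i))\<^sup>2 + 2 * (cmod (g i))\<^sup>2" .
qed

lemma summable_square_mult:
  assumes f: "(\<lambda>i. (cmod (f i))\<^sup>2) summable_on (UNIV :: 'i set)"
  shows "(\<lambda>i. (cmod (c * f i))\<^sup>2) summable_on UNIV"
  using summable_on_cmult_right[OF f, of "(cmod c)\<^sup>2"] by (simp add: norm_mult power_mult_distrib)

lemma inner_summable:
  "(\<lambda>i. inner (coord f i) (coord g i)) summable_on UNIV"
proof (rule abs_summable_summable, rule summable_on_comparison_test)
  show "(\<lambda>i. (cmod (coord f i))\<^sup>2 + (cmod (coord g i))\<^sup>2) summable_on UNIV"
    by (intro summable_on_add coord_summable)
  fix i
  have "norm (inner (coord f i) (coord g i)) \<le> cmod (coord f i) * cmod (coord g i)"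
    using Cauchy_Schwarz_ineq2 by simp
  also have "\<dots> \<le> (cmod (coord f i))\<^sup>2 + (cmod (coord g i))\<^sup>2"
  proof -
    have "0 \<le> cmod (coord f i) * cmod (coord g i)" by simp
    moreover have "2 * (cmod (coord f i) * cmod (coord g i)) \<le> (cmod (coord f i))\<^sup>2 + (cmod (coord g i))\<^sup>2"
      using sum_squares_bound[of "cmod (coord f i)" "cmod (coord g i)"] by (simp add: mult.assoc)
    ultimately show ?thesis by linarith
  qed
  finally show "norm (inner (coord f i) (coord g i)) \<le> (cmod (coord f i))\<^sup>2 + (cmod (coord g i))\<^sup>2" .
qed simp

instantiation ell2 :: (type) real_inner
begin

definition zero_ell2 :: "'a ell2" where "zero_ell2 = Abs_ell2 (\<lambda>_. 0)"
definition plus_ell2 :: "'a ell2 \<Rightarrow> 'a ell2 \<Rightarrow> 'a ell2" where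
  "plus_ell2 f g = Abs_ell2 (\<lambda>i. coord f i + coord g i)"
definition uminus_ell2 :: "'a ell2 \<Rightarrow> 'a ell2" where
  "uminus_ell2 f = Abs_ell2 (\<lambda>i. - coord f i)"
definition minus_ell2 :: "'a ell2 \<Rightarrow> 'a ell2 \<Rightarrow> 'a ell2" where
  "minus_ell2 f g = f + (- g)"
definition scaleR_ell2 :: "real \<Rightarrow> 'a ell2 \<Rightarrow> 'a ell2" where
  "scaleR_ell2 r f = Abs_ell2 (\<lambda>i. r *\<^sub>R coord f i)"
definition inner_ell2 :: "'a ell2 \<Rightarrow> 'a ell2 \<Rightarrow> real" where
  "inner_ell2 f g = infsum (\<lambda>i. inner (coord f i) (coord g i)) UNIV"
definition norm_ell2 :: "'a ell2 \<Rightarrow> real" where "norm_ell2 f = sqrt (inner f f)"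
definition dist_ell2 :: "'a ell2 \<Rightarrow> 'a ell2 \<Rightarrow> real" where "dist_ell2 f g = norm (f - g)"
definition sgn_ell2 :: "'a ell2 \<Rightarrow> 'a ell2" where "sgn_ell2 f = inverse (norm f) *\<^sub>R f"
definition uniformity_ell2 :: "('a ell2 \<times> 'a ell2) filter" where
  "uniformity_ell2 = (INF e\<in>{0<..}. principal {(f, g). dist f g < e})"
definition open_ell2 :: "'a ell2 set \<Rightarrow> bool" where
  "open_ell2 U = (\<forall>x\<in>U. \<forall>\<^sub>F (x', y) in uniformity. x' = x \<longrightarrow> y \<in> U)"

lemma coord_zero: "coord 0 i = 0"
  unfolding zero_ell2_def by (simp add: coord_Abs)

lemma coord_add: "coord (f + g) i = coord f i + coord g i"
  unfolding plus_ell2_def by (simp add: coord_Abs summable_square_add coord_summable)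

lemma coord_uminus: "coord (- f) i = - coord f i"
  unfolding uminus_ell2_def by (simp add: coord_Abs coord_summable)

lemma coord_scaleR: "coord (r *\<^sub>R f) i = r *\<^sub>R coord f i"
  unfolding scaleR_ell2_def
  using summable_square_mult[OF coord_summable[of f], of "of_real r"]
  by (simp add: coord_Abs scaleR_conv_of_real)

lemmas coord_simps = coord_zero coord_add coord_uminus coord_scaleR

instance
proof
  fix f g h :: "'a ell2" and a b :: real
  show "f + g + h = f + (g + h)" "f + g = g + f" "0 + f = f" "- f + f = 0"
    by (rule ell2_eqI; simp add: coord_simps)+
  show "f - g = f + - g" by (rule minus_ell2_def)
  show "a *\<^sub>R (f + g) = a *\<^sub>R f + a *\<^sub>R g" "(a + b) *\<^sub>R f = a *\<^sub>R f + b *\<^sub>R f"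
    "a *\<^sub>R b *\<^sub>R f = (a * b) *\<^sub>R f" "1 *\<^sub>R f = f"
    by (rule ell2_eqI; simp add: coord_simps algebra_simps)+
  show "dist f g = norm (f - g)" by (rule dist_ell2_def)
  show "sgn f = inverse (norm f) *\<^sub>R f" by (rule sgn_ell2_def)
  show "norm f = sqrt (inner f f)" by (rule norm_ell2_def)
  show "inner f g = inner g f" unfolding inner_ell2_def by (simp add: inner_commute)
  show "inner (f + g) h = inner f h + inner g h"
    unfolding inner_ell2_def coord_add inner_add_left by (rule infsum_add[OF inner_summable inner_summable])
  show "inner (a *\<^sub>R f) g = a * inner f g"
    unfolding inner_ell2_def coord_scaleR inner_scaleR_left by (rule infsum_cmult_right')
  show "0 \<le> inner f f" unfolding inner_ell2_def by (rule infsum_nonneg) simp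
  show "(inner f f = 0) = (f = 0)"
  proof
    assume "inner f f = 0"
    then have 0: "infsum (\<lambda>i. inner (coord f i) (coord f i)) UNIV \<le> 0" unfolding inner_ell2_def by simp
    have "inner (coord f i) (coord f i) = 0" for i
      by (rule nonneg_infsum_le_0D[OF 0 inner_summable]) auto
    then show "f = 0" by (intro ell2_eqI) (simp add: coord_zero)
  next
    assume "f = 0"
    then show "inner f f = 0" unfolding inner_ell2_def by (simp add: coord_zero)
  qed
next
  show "(uniformity :: ('a ell2 \<times> 'a ell2) filter) = (INF e\<in>{0<..}. principal {(x, y). dist x y < e})"
    by (rule uniformity_ell2_def)
  show "open U \<longleftrightarrow> (\<forall>x\<in>U. \<forall>\<^sub>F (x', y) in uniformity. x' = x \<longrightarrow> y \<in> U)" for U :: "'a ell2 set"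
    by (rule open_ell2_def)
qed

end

lemma coord_minus: "coord (f - g) i = coord f i - coord g i"
  unfolding minus_ell2_def coord_add coord_uminus by simp

lemma norm_ell2_square: "(norm f)\<^sup>2 = infsum (\<lambda>i. (cmod (coord f i))\<^sup>2) UNIV" for f :: "'i ell2"
  unfolding dot_square_norm[symmetric] inner_ell2_def by (simp add: dot_square_norm)

lemma finite_sum_le_norm_ell2:
  assumes "finite F" shows "(\<Sum>i\<in>F. (cmod (coord f i))\<^sup>2) \<le> (norm f)\<^sup>2"
  unfolding norm_ell2_square by (rule finite_sum_le_infsum[OF coord_summable assms]) auto

lemma cmod_coord_le: "cmod (coord f i) \<le> norm f"
proof (rule power2_le_imp_le[OF _ norm_ge_zero])
  show "(cmod (coord f i))\<^sup>2 \<le> (norm f)\<^sup>2" using finite_sum_le_norm_ell2[of "{i}" f] by simp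
qed

lemma Abs_ell2_bounded:
  assumes bd: "\<And>F. finite F \<Longrightarrow> (\<Sum>i\<in>F. (cmod (f i))\<^sup>2) \<le> K\<^sup>2" and K: "0 \<le> K"
  shows "coord (Abs_ell2 f) = f" "norm (Abs_ell2 f) \<le> K"
proof -
  have s: "(\<lambda>i. (cmod (f i))\<^sup>2) summable_on UNIV"
    by (rule nonneg_bdd_above_summable_on) (use bd in \<open>auto intro!: bdd_aboveI2\<close>)
  then show c: "coord (Abs_ell2 f) = f" by (rule coord_Abs)
  have "(norm (Abs_ell2 f))\<^sup>2 \<le> K\<^sup>2"
    unfolding norm_ell2_square c by (rule infsum_le_finite_sums[OF s]) (use bd in auto)
  then show "norm (Abs_ell2 f) \<le> K" using K by (rule power2_le_imp_le)
qed

text \<open>The limit of a Cauchy sequence is formed coordinatewise; finite partial sums carry the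
  Cauchy estimate over to it.\<close>

instance ell2 :: (type) complete_space
proof
  fix X :: "nat \<Rightarrow> 'a ell2" assume X: "Cauchy X"
  have "Cauchy (\<lambda>n. coord (X n) i)" for i
    unfolding Cauchy_iff
  proof (intro allI impI)
    fix e :: real assume "0 < e"
    then obtain N where N: "\<forall>m\<ge>N. \<forall>n\<ge>N. norm (X m - X n) < e" using X unfolding Cauchy_iff by auto
    show "\<exists>N. \<forall>m\<ge>N. \<forall>n\<ge>N. cmod (coord (X m) i - coord (X n) i) < e"
    proof (intro exI allI impI)
      fix m n assume mn: "N \<le> m" "N \<le> n"
      have "cmod (coord (X m) i - coord (X n) i) \<le> norm (X m - X n)"
        using cmod_coord_le[of "X m - X n" i] by (simp add: coord_minus)
      also have "\<dots> < e" using N mn by simp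
      finally show "cmod (coord (X m) i - coord (X n) i) < e" .
    qed
  qed
  then have "\<forall>i. \<exists>l. (\<lambda>n. coord (X n) i) \<longlonglongrightarrow> l" by (simp add: Cauchy_convergent convergent_def[symmetric])
  then obtain l where l: "\<And>i. (\<lambda>n. coord (X n) i) \<longlonglongrightarrow> l i" by metis
  have near: "\<exists>N. \<forall>n\<ge>N. \<forall>F. finite F \<longrightarrow> (\<Sum>i\<in>F. (cmod (coord (X n) i - l i))\<^sup>2) \<le> e\<^sup>2" if e: "e > 0" for e
  proof -
    obtain N where N: "\<forall>m\<ge>N. \<forall>n\<ge>N. norm (X m - X n) < e" using X e unfolding Cauchy_iff by auto
    have "(\<Sum>i\<in>F. (cmod (coord (X n) i - l i))\<^sup>2) \<le> e\<^sup>2" if n: "n \<ge> N" and F: "finite F" for n F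
    proof (rule LIMSEQ_le_const2)
      show "(\<lambda>m. \<Sum>i\<in>F. (cmod (coord (X n) i - coord (X m) i))\<^sup>2) \<longlonglongrightarrow> (\<Sum>i\<in>F. (cmod (coord (X n) i - l i))\<^sup>2)"
        by (intro tendsto_intros l)
      have "(\<Sum>i\<in>F. (cmod (coord (X n) i - coord (X m) i))\<^sup>2) \<le> e\<^sup>2" if m: "m \<ge> N" for m
      proof -
        have "(\<Sum>i\<in>F. (cmod (coord (X n) i - coord (X m) i))\<^sup>2) \<le> (norm (X n - X m))\<^sup>2"
          using finite_sum_le_norm_ell2[OF F, of "X n - X m"] by (simp add: coord_minus)
        also have "\<dots> \<le> e\<^sup>2" using N n m less_imp_le by (intro power_mono) auto
        finally show ?thesis .
      qed
      then show "\<exists>M. \<forall>m\<ge>M. (\<Sum>i\<in>F. (cmod (coord (X n) i - coord (X m) i))\<^sup>2) \<le> e\<^sup>2" by auto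
    qed
    then show ?thesis by auto
  qed
  obtain N where "\<forall>F. finite F \<longrightarrow> (\<Sum>i\<in>F. (cmod (coord (X N) i - l i))\<^sup>2) \<le> 1\<^sup>2"
    using near[of 1] by auto
  then have c: "coord (Abs_ell2 (\<lambda>i. coord (X N) i - l i)) = (\<lambda>i. coord (X N) i - l i)"
    using Abs_ell2_bounded(1)[of "\<lambda>i. coord (X N) i - l i" 1] by simp
  define L where "L = X N - Abs_ell2 (\<lambda>i. coord (X N) i - l i)"
  have L: "coord L i = l i" for i unfolding L_def coord_minus c by simp
  have "X \<longlonglongrightarrow> L"
  proof (rule LIMSEQ_I)
    fix e :: real assume e: "0 < e"
    obtain M where M: "\<forall>n\<ge>M. \<forall>F. finite F \<longrightarrow> (\<Sum>i\<in>F. (cmod (coord (X n) i - l i))\<^sup>2) \<le> (e/2)\<^sup>2"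
      using near[of "e/2"] e by auto
    have "norm (X n - L) < e" if n: "n \<ge> M" for n
    proof -
      have f: "(\<lambda>i. coord (X n - L) i) = (\<lambda>i. coord (X n) i - l i)" by (simp add: coord_minus L)
      have "norm (Abs_ell2 (coord (X n - L))) \<le> e/2"
        unfolding f by (rule Abs_ell2_bounded(2)) (use M n e in auto)
      then show ?thesis using e by (simp add: coord_inverse)
    qed
    then show "\<exists>no. \<forall>n\<ge>no. norm (X n - L) < e" by auto
  qed
  then show "convergent X" unfolding convergent_def by auto
qed

definition ket :: "'i \<Rightarrow> 'i ell2" where "ket i = Abs_ell2 (\<lambda>j. if j = i then 1 else 0)"

lemma coord_ket: "coord (ket i) j = (if j = i then 1 else 0)"
proof -
  have "(\<lambda>j. (cmod (if j = i then 1 else 0))\<^sup>2) summable_on UNIV \<longleftrightarrow>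
    (\<lambda>j. (cmod (if j = i then 1 else 0))\<^sup>2) summable_on {i}"
    by (rule summable_on_cong_neutral) auto
  then show ?thesis unfolding ket_def by (simp add: coord_Abs)
qed

lemma inner_ket: "inner (ket i) f = Re (coord f i)"
proof -
  have "inner (ket i) f = infsum (\<lambda>j. inner (coord (ket i) j) (coord f j)) {i}"
    unfolding inner_ell2_def by (rule infsum_cong_neutral) (auto simp: coord_ket)
  then show ?thesis by (simp add: coord_ket inner_complex_def)
qed

lift_definition ell2_J :: "'i ell2 \<Rightarrow>\<^sub>L 'i ell2" is "\<lambda>f. Abs_ell2 (\<lambda>i. \<i> * coord f i)"
proof -
  define j where "j = (\<lambda>f :: 'i ell2. Abs_ell2 (\<lambda>i. \<i> * coord f i))"
  have c: "coord (j f) i = \<i> * coord f i" for f i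
    unfolding j_def by (simp add: coord_Abs summable_square_mult coord_summable)
  have "bounded_linear j"
  proof (rule bounded_linear_intro[where K = 1])
    fix f g and r :: real
    have "(norm (j f))\<^sup>2 = (norm f)\<^sup>2"
      unfolding norm_ell2_square c by (simp add: norm_mult)
    then show "norm (j f) \<le> norm f * 1" by simp
    show "j (f + g) = j f + j g" by (rule ell2_eqI) (simp add: c coord_simps distrib_left)
    show "j (r *\<^sub>R f) = r *\<^sub>R j f" by (rule ell2_eqI) (simp add: c coord_simps)
  qed
  then show "bounded_linear (\<lambda>f :: 'i ell2. Abs_ell2 (\<lambda>i. \<i> * coord f i))" unfolding j_def .
qed

lemma coord_J: "coord (blinfun_apply ell2_J f) i = \<i> * coord f i"
  by (simp add: ell2_J.rep_eq coord_Abs summable_square_mult coord_summable)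

lemma inner_J_left: "inner (ell2_J f) g = - inner f (ell2_J g)"
proof -
  have "inner (\<i> * z) w = - inner z (\<i> * w)" for z w by (simp add: inner_complex_def)
  then show ?thesis unfolding inner_ell2_def coord_J by (simp add: infsum_uminus)
qed

section \<open>The C*-algebra of operators with an adjoint\<close>

text \<open>The bounded operators that commute with the complex structure and have an adjoint. That
  every bounded operator has one is a consequence of the Riesz representation theorem, which can be
  avoided because the operators of interest come with their adjoints.\<close>

definition ops :: "('i ell2 \<Rightarrow>\<^sub>L 'i ell2) set" where
  "ops = {T. T o\<^sub>L ell2_J = ell2_J o\<^sub>L T \<and> (\<exists>T'. \<forall>x y. inner (blinfun_apply T x) y = inner x (blinfun_apply T' y))}"

definition adj :: "('i ell2 \<Rightarrow>\<^sub>L 'i ell2) \<Rightarrow> 'i ell2 \<Rightarrow>\<^sub>L 'i ell2" where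
  "adj T = (SOME T'. \<forall>x y. inner (blinfun_apply T x) y = inner x (blinfun_apply T' y))"

definition csmult :: "complex \<Rightarrow> ('i ell2 \<Rightarrow>\<^sub>L 'i ell2) \<Rightarrow> 'i ell2 \<Rightarrow>\<^sub>L 'i ell2" where
  "csmult c T = Re c *\<^sub>R T + Im c *\<^sub>R (ell2_J o\<^sub>L T)"

definition operator_algebra :: "('i ell2 \<Rightarrow>\<^sub>L 'i ell2) cstar" where
  "operator_algebra = \<lparr>carrier = ops, monoid.mult = (o\<^sub>L), one = id_blinfun, zero = 0, add = (+),
     smult = csmult, star = adj, nrm = norm\<rparr>"

lemma opsD_J: "T \<in> ops \<Longrightarrow> blinfun_apply T (ell2_J x) = ell2_J (blinfun_apply T x)"
proof -
  assume "T \<in> ops"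
  then have "blinfun_apply (T o\<^sub>L ell2_J) x = blinfun_apply (ell2_J o\<^sub>L T) x" unfolding ops_def by simp
  then show ?thesis by simp
qed

lemma inner_adj: "T \<in> ops \<Longrightarrow> inner (blinfun_apply T x) y = inner x (blinfun_apply (adj T) y)"
proof -
  assume "T \<in> ops"
  then have "\<exists>T'. \<forall>x y. inner (blinfun_apply T x) y = inner x (blinfun_apply T' y)" unfolding ops_def by simp
  then have "\<forall>x y. inner (blinfun_apply T x) y = inner x (blinfun_apply (adj T) y)"
    unfolding adj_def by (rule someI_ex)
  then show ?thesis by blast
qed

lemma opsI:
  assumes "\<And>x. blinfun_apply T (ell2_J x) = ell2_J (blinfun_apply T x)"
    and "\<And>x y. inner (blinfun_apply T x) y = inner x (blinfun_apply T' y)"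
  shows "T \<in> ops"
  unfolding ops_def using assms by (auto intro!: blinfun_eqI)

lemma adj_unique:
  assumes "\<And>x y. inner (blinfun_apply T x) y = inner x (blinfun_apply T' y)"
  shows "adj T = T'"
proof (rule blinfun_eqI)
  fix y
  have "\<forall>x y. inner (blinfun_apply T x) y = inner x (blinfun_apply (adj T) y)"
    unfolding adj_def by (rule someI[of _ T']) (use assms in simp)
  then have "inner x (blinfun_apply (adj T) y - blinfun_apply T' y) = 0" for x
    using assms by (simp add: inner_diff_right)
  then have "inner (blinfun_apply (adj T) y - blinfun_apply T' y) (blinfun_apply (adj T) y - blinfun_apply T' y) = 0" by blast
  then show "blinfun_apply (adj T) y = blinfun_apply T' y" by simp
qed

lemma adj_ops:
  assumes T: "T \<in> ops" shows "adj T \<in> ops" "adj (adj T) = T"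
proof -
  have i: "inner (blinfun_apply (adj T) x) y = inner x (blinfun_apply T y)" for x y
    using inner_adj[OF T, of y x] by (simp add: inner_commute)
  have "blinfun_apply (adj T) (ell2_J x) = ell2_J (blinfun_apply (adj T) x)" for x
  proof -
    have "inner (blinfun_apply (adj T) (ell2_J x) - ell2_J (blinfun_apply (adj T) x)) y = 0" for y
      unfolding inner_diff_left i inner_J_left opsD_J[OF T] by simp
    then have "inner (blinfun_apply (adj T) (ell2_J x) - ell2_J (blinfun_apply (adj T) x))
      (blinfun_apply (adj T) (ell2_J x) - ell2_J (blinfun_apply (adj T) x)) = 0" by blast
    then show ?thesis by simp
  qed
  then show "adj T \<in> ops" using i by (rule opsI)
  show "adj (adj T) = T" by (rule adj_unique) (rule i)
qed

lemma ops_0: "0 \<in> ops"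
  by (rule opsI[where T' = 0]) simp_all

lemma ops_add: "S \<in> ops \<Longrightarrow> T \<in> ops \<Longrightarrow> S + T \<in> ops" "S \<in> ops \<Longrightarrow> T \<in> ops \<Longrightarrow> adj (S + T) = adj S + adj T"
proof -
  assume S: "S \<in> ops" and T: "T \<in> ops"
  have i: "inner (blinfun_apply (S + T) x) y = inner x (blinfun_apply (adj S + adj T) y)" for x y
    using inner_adj[OF S] inner_adj[OF T] by (simp add: blinfun.add_left inner_add_left inner_add_right)
  show "S + T \<in> ops"
    by (rule opsI[OF _ i]) (use opsD_J[OF S] opsD_J[OF T] in \<open>simp add: blinfun.add_left blinfun.add_right\<close>)
  show "adj (S + T) = adj S + adj T" by (rule adj_unique[OF i])
qed

lemma ops_compose:
  "S \<in> ops \<Longrightarrow> T \<in> ops \<Longrightarrow> S o\<^sub>L T \<in> ops" "S \<in> ops \<Longrightarrow> T \<in> ops \<Longrightarrow> adj (S o\<^sub>L T) = adj T o\<^sub>L adj S"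
proof -
  assume S: "S \<in> ops" and T: "T \<in> ops"
  have i: "inner (blinfun_apply (S o\<^sub>L T) x) y = inner x (blinfun_apply (adj T o\<^sub>L adj S) y)" for x y
    using inner_adj[OF S] inner_adj[OF T] by simp
  show "S o\<^sub>L T \<in> ops" by (rule opsI[OF _ i]) (use opsD_J[OF S] opsD_J[OF T] in simp)
  show "adj (S o\<^sub>L T) = adj T o\<^sub>L adj S" by (rule adj_unique[OF i])
qed

lemma csmult_apply: "blinfun_apply (csmult c T) x = Re c *\<^sub>R blinfun_apply T x + Im c *\<^sub>R ell2_J (blinfun_apply T x)"
  unfolding csmult_def by (simp add: blinfun.add_left blinfun.scaleR_left)

lemma coord_csmult: "coord (blinfun_apply (csmult c T) x) i = c * coord (blinfun_apply T x) i"
proof -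
  have "Re c *\<^sub>R z + Im c *\<^sub>R (\<i> * z) = c * z" for z by (simp add: complex_eq_iff algebra_simps)
  then show ?thesis unfolding csmult_apply by (simp add: coord_simps coord_J)
qed

lemma ops_csmult: "T \<in> ops \<Longrightarrow> csmult c T \<in> ops" "T \<in> ops \<Longrightarrow> adj (csmult c T) = csmult (cnj c) (adj T)"
proof -
  assume T: "T \<in> ops"
  have i: "inner (blinfun_apply (csmult c T) x) y = inner x (blinfun_apply (csmult (cnj c) (adj T)) y)" for x y
  proof -
    have "inner x (ell2_J (blinfun_apply (adj T) y)) = - inner (ell2_J (blinfun_apply T x)) y"
      using inner_J_left[of x "blinfun_apply (adj T) y"] inner_adj[OF T, of "ell2_J x" y] opsD_J[OF T] by simp
    then show ?thesis unfolding csmult_apply using inner_adj[OF T]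
      by (simp add: inner_add_left inner_add_right inner_diff_right)
  qed
  show "csmult c T \<in> ops"
    by (rule opsI[OF _ i]) (use opsD_J[OF T] in \<open>simp add: csmult_apply blinfun.add_right blinfun.scaleR_right\<close>)
  show "adj (csmult c T) = csmult (cnj c) (adj T)" by (rule adj_unique[OF i])
qed

lemma norm_csmult: "norm (csmult c T) = cmod c * norm T"
proof -
  have n: "norm (blinfun_apply (csmult c T) x) = cmod c * norm (blinfun_apply T x)" for x
  proof -
    have "(norm (blinfun_apply (csmult c T) x))\<^sup>2 = (cmod c * norm (blinfun_apply T x))\<^sup>2"
      unfolding norm_ell2_square power_mult_distrib coord_csmult by (simp add: norm_mult power_mult_distrib infsum_cmult_right')
    then show ?thesis by (rule power2_eq_imp_eq) simp_all
  qed
  show ?thesis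
  proof (rule order.antisym)
    show "norm (csmult c T) \<le> cmod c * norm T"
    proof (rule norm_blinfun_bound)
      fix x show "norm (blinfun_apply (csmult c T) x) \<le> cmod c * norm T * norm x"
        unfolding n using mult_left_mono[OF norm_blinfun[of T x], of "cmod c"] by (simp add: mult.assoc)
    qed simp
    show "cmod c * norm T \<le> norm (csmult c T)"
    proof (cases "c = 0")
      case False
      have "norm T \<le> norm (csmult c T) / cmod c"
      proof (rule norm_blinfun_bound)
        fix x
        have "cmod c * norm (blinfun_apply T x) \<le> norm (csmult c T) * norm x"
          using norm_blinfun[of "csmult c T" x] unfolding n .
        then show "norm (blinfun_apply T x) \<le> norm (csmult c T) / cmod c * norm x"
          using False by (simp add: field_simps)
      qed simp
      then show ?thesis using False by (simp add: field_simps)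
    qed simp
  qed
qed

lemma norm_adj: "T \<in> ops \<Longrightarrow> norm (adj T) = norm T"
  and norm_adj_compose: "T \<in> ops \<Longrightarrow> norm (adj T o\<^sub>L T) = (norm T)\<^sup>2"
proof -
  assume T: "T \<in> ops"
  have le: "norm T \<le> sqrt (norm (adj T o\<^sub>L T))" if T: "T \<in> ops" for T :: "'i ell2 \<Rightarrow>\<^sub>L 'i ell2"
  proof (rule norm_blinfun_bound)
    fix x
    have "(norm (blinfun_apply T x))\<^sup>2 = inner x (blinfun_apply (adj T o\<^sub>L T) x)"
      using inner_adj[OF T, of x "blinfun_apply T x"] by (simp add: dot_square_norm)
    also have "\<dots> \<le> norm x * norm (blinfun_apply (adj T o\<^sub>L T) x)" by (rule norm_cauchy_schwarz)
    also have "\<dots> \<le> norm x * (norm (adj T o\<^sub>L T) * norm x)" by (rule mult_left_mono[OF norm_blinfun norm_ge_zero])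
    also have "\<dots> = (sqrt (norm (adj T o\<^sub>L T)) * norm x)\<^sup>2" by (simp add: power_mult_distrib power2_eq_square)
    finally show "norm (blinfun_apply T x) \<le> sqrt (norm (adj T o\<^sub>L T)) * norm x"
      by (rule power2_le_imp_le) simp
  qed simp
  have sq: "(norm T)\<^sup>2 \<le> norm (adj T o\<^sub>L T)" if T: "T \<in> ops" for T :: "'i ell2 \<Rightarrow>\<^sub>L 'i ell2"
    using power_mono[OF le[OF T] norm_ge_zero, of 2] by simp
  have adj_le: "norm T \<le> norm (adj T)" if T: "T \<in> ops" for T :: "'i ell2 \<Rightarrow>\<^sub>L 'i ell2"
  proof (cases "norm T = 0")
    case False
    have "norm T * norm T \<le> norm (adj T) * norm T"
      using sq[OF T] norm_blinfun_compose[of "adj T" T] by (simp add: power2_eq_square)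
    then show ?thesis using False by simp
  qed simp
  show n: "norm (adj T) = norm T" using adj_le[OF T] adj_le[OF adj_ops(1)[OF T]] adj_ops(2)[OF T] by simp
  show "norm (adj T o\<^sub>L T) = (norm T)\<^sup>2"
    using n sq[OF T] norm_blinfun_compose[of "adj T" T] by (simp add: power2_eq_square)
qed


instance ell2 :: (type) banach ..

lemma complex_ring_simps [simp]:
  "carrier complex_ring = UNIV" "mult complex_ring = (*)" "one complex_ring = 1"
  "zero complex_ring = 0" "add complex_ring = (+)"
  unfolding complex_ring_def by simp_all

lemma cring_complex_ring: "cring complex_ring"
proof (rule cringI)
  show "abelian_group complex_ring"
    by (rule abelian_groupI) (auto intro: exI[of _ "- _"] simp: add.assoc add.commute intro!: bexI[of _ "- _"])
  show "comm_monoid complex_ring"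
    by unfold_locales (auto simp: mult.assoc mult.commute)
qed (simp add: distrib_right)

lemma operator_algebra_simps [simp]:
  "carrier operator_algebra = ops" "mult operator_algebra = (o\<^sub>L)" "zero operator_algebra = 0"
  "add operator_algebra = (+)" "smult operator_algebra = csmult" "star operator_algebra = adj"
  "nrm operator_algebra = norm"
  unfolding operator_algebra_def by simp_all

lemma ops_uminus: "T \<in> ops \<Longrightarrow> - T \<in> ops"
proof -
  assume "T \<in> ops"
  moreover have "csmult (- 1) T = - T" unfolding csmult_def by simp
  ultimately show ?thesis using ops_csmult(1)[of T "- 1"] by simp
qed

lemma abelian_group_operator_algebra: "abelian_group operator_algebra"
proof (rule abelian_groupI)
  fix x :: "'i ell2 \<Rightarrow>\<^sub>L 'i ell2" assume "x \<in> carrier operator_algebra"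
  then show "\<exists>y\<in>carrier operator_algebra. y \<oplus>\<^bsub>operator_algebra\<^esub> x = \<zero>\<^bsub>operator_algebra\<^esub>"
    using ops_uminus by (intro bexI[of _ "- x"]) simp_all
qed (simp_all add: ops_add ops_0 add.assoc add.commute)

lemma operator_algebra_minus:
  assumes "S \<in> ops" "T \<in> ops" shows "S \<ominus>\<^bsub>operator_algebra\<^esub> T = S - T"
proof -
  have "\<ominus>\<^bsub>operator_algebra\<^esub> T = - T"
    by (rule abelian_group.minus_equality[OF abelian_group_operator_algebra]) (use assms ops_uminus in auto)
  then show ?thesis unfolding a_minus_def by simp
qed

lemma compose_distrib:
  "(S + T) o\<^sub>L R = (S o\<^sub>L R) + (T o\<^sub>L R)" "R o\<^sub>L (S + T) = (R o\<^sub>L S) + (R o\<^sub>L T)"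
  by (rule blinfun_eqI; simp add: blinfun.add_left blinfun.add_right)+

lemma module_operator_algebra: "module complex_ring (operator_algebra :: ('i ell2 \<Rightarrow>\<^sub>L 'i ell2) cstar)"
proof (rule moduleI[OF cring_complex_ring abelian_group_operator_algebra])
  have eqI: "S = T" if "\<And>x i. coord (blinfun_apply S x) i = coord (blinfun_apply T x) i"
    for S T :: "'i ell2 \<Rightarrow>\<^sub>L 'i ell2"
    by (rule blinfun_eqI, rule ell2_eqI) (rule that)
  fix a b and x y :: "'i ell2 \<Rightarrow>\<^sub>L 'i ell2"
  show "(a \<oplus>\<^bsub>complex_ring\<^esub> b) \<odot>\<^bsub>operator_algebra\<^esub> x = a \<odot>\<^bsub>operator_algebra\<^esub> x \<oplus>\<^bsub>operator_algebra\<^esub> b \<odot>\<^bsub>operator_algebra\<^esub> x"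
    by (rule eqI) (simp add: coord_csmult blinfun.add_left coord_simps distrib_right)
  show "a \<odot>\<^bsub>operator_algebra\<^esub> (x \<oplus>\<^bsub>operator_algebra\<^esub> y) = a \<odot>\<^bsub>operator_algebra\<^esub> x \<oplus>\<^bsub>operator_algebra\<^esub> a \<odot>\<^bsub>operator_algebra\<^esub> y"
    by (rule eqI) (simp add: coord_csmult blinfun.add_left coord_simps distrib_left)
  show "(a \<otimes>\<^bsub>complex_ring\<^esub> b) \<odot>\<^bsub>operator_algebra\<^esub> x = a \<odot>\<^bsub>operator_algebra\<^esub> (b \<odot>\<^bsub>operator_algebra\<^esub> x)"
    by (rule eqI) (simp add: coord_csmult)
  show "\<one>\<^bsub>complex_ring\<^esub> \<odot>\<^bsub>operator_algebra\<^esub> x = x"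
    by (rule eqI) (simp add: coord_csmult)
qed (simp add: ops_csmult)

text \<open>Taking adjoints is isometric, so the adjoints of a Cauchy sequence converge as well, and
  their limit is an adjoint of the limit.\<close>

lemma operator_algebra_complete:
  fixes X :: "nat \<Rightarrow> 'i ell2 \<Rightarrow>\<^sub>L 'i ell2"
  assumes X: "\<And>n. X n \<in> ops" and C: "Cauchy X"
  shows "\<exists>T\<in>ops. X \<longlonglongrightarrow> T"
proof -
  have d: "adj (X m - X n) = adj (X m) - adj (X n)" "X m - X n \<in> ops" for m n
  proof -
    have u: "adj (- X n) = - adj (X n)"
      by (rule adj_unique) (use inner_adj[OF X] in \<open>simp add: blinfun.minus_left\<close>)
    show "adj (X m - X n) = adj (X m) - adj (X n)"
      using ops_add(2)[OF X[of m] ops_uminus[OF X[of n]]] u by simp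
    show "X m - X n \<in> ops" using ops_add(1)[OF X[of m] ops_uminus[OF X[of n]]] by simp
  qed
  have "Cauchy (\<lambda>n. adj (X n))"
    using C norm_adj[OF d(2)] unfolding Cauchy_iff d(1) by simp
  then obtain T T' where T: "X \<longlonglongrightarrow> T" and T': "(\<lambda>n. adj (X n)) \<longlonglongrightarrow> T'"
    using C by (auto simp: Cauchy_convergent_iff convergent_def)
  have ap: "(\<lambda>n. blinfun_apply (X n) x) \<longlonglongrightarrow> blinfun_apply T x" for x
    by (intro tendsto_intros T)
  have ap': "(\<lambda>n. blinfun_apply (adj (X n)) x) \<longlonglongrightarrow> blinfun_apply T' x" for x
    by (intro tendsto_intros T')
  have "T \<in> ops"
  proof (rule opsI)
    fix x y
    show "blinfun_apply T (ell2_J x) = ell2_J (blinfun_apply T x)"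
    proof (rule LIMSEQ_unique[OF ap])
      have "(\<lambda>n. blinfun_apply ell2_J (blinfun_apply (X n) x)) \<longlonglongrightarrow> blinfun_apply ell2_J (blinfun_apply T x)"
        by (intro blinfun.tendsto tendsto_const ap)
      then show "(\<lambda>n. blinfun_apply (X n) (ell2_J x)) \<longlonglongrightarrow> blinfun_apply ell2_J (blinfun_apply T x)"
        using opsD_J[OF X] by simp
    qed
    show "inner (blinfun_apply T x) y = inner x (blinfun_apply T' y)"
    proof (rule LIMSEQ_unique)
      show "(\<lambda>n. inner (blinfun_apply (X n) x) y) \<longlonglongrightarrow> inner (blinfun_apply T x) y"
        by (intro tendsto_inner ap tendsto_const)
      show "(\<lambda>n. inner (blinfun_apply (X n) x) y) \<longlonglongrightarrow> inner x (blinfun_apply T' y)"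
        unfolding inner_adj[OF X] by (intro tendsto_inner ap' tendsto_const)
    qed
  qed
  then show ?thesis using T by auto
qed

lemma cstar_operator_algebra: "cstar_algebra (operator_algebra :: ('i ell2 \<Rightarrow>\<^sub>L 'i ell2) cstar)"
proof (rule cstar_algebra.intro[OF module_operator_algebra], unfold_locales)
  let ?A = "operator_algebra :: ('i ell2 \<Rightarrow>\<^sub>L 'i ell2) cstar"
  have eqI: "S = T" if "\<And>x i. coord (blinfun_apply S x) i = coord (blinfun_apply T x) i"
    for S T :: "'i ell2 \<Rightarrow>\<^sub>L 'i ell2"
    by (rule blinfun_eqI, rule ell2_eqI) (rule that)
  fix c and x y z :: "'i ell2 \<Rightarrow>\<^sub>L 'i ell2"
  show "c \<odot>\<^bsub>?A\<^esub> x \<otimes>\<^bsub>?A\<^esub> y = c \<odot>\<^bsub>?A\<^esub> (x \<otimes>\<^bsub>?A\<^esub> y)"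
    by (rule eqI) (simp add: coord_csmult)
  show "x \<otimes>\<^bsub>?A\<^esub> (c \<odot>\<^bsub>?A\<^esub> y) = c \<odot>\<^bsub>?A\<^esub> (x \<otimes>\<^bsub>?A\<^esub> y)" if x: "x \<in> carrier ?A"
  proof -
    have "blinfun_apply x (csmult c y v) = csmult c (x o\<^sub>L y) v" for v
      unfolding csmult_apply using opsD_J[of x] x by (simp add: blinfun.add_right blinfun.scaleR_right)
    then show ?thesis by (simp add: blinfun_eqI)
  qed
  show "x \<otimes>\<^bsub>?A\<^esub> y \<otimes>\<^bsub>?A\<^esub> z = x \<otimes>\<^bsub>?A\<^esub> (y \<otimes>\<^bsub>?A\<^esub> z)" by (simp add: blinfun_eqI)
next
  fix X :: "nat \<Rightarrow> 'i ell2 \<Rightarrow>\<^sub>L 'i ell2"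
  let ?A = "operator_algebra :: ('i ell2 \<Rightarrow>\<^sub>L 'i ell2) cstar"
  assume X: "\<And>n. X n \<in> carrier ?A"
    and C: "\<And>e. e > 0 \<Longrightarrow> \<exists>N. \<forall>m\<ge>N. \<forall>n\<ge>N. nrm ?A (X m \<ominus>\<^bsub>?A\<^esub> X n) < e"
  have X': "\<And>n. X n \<in> ops" using X by simp
  have "Cauchy X" unfolding Cauchy_iff using C operator_algebra_minus[OF X' X'] by simp
  then obtain T where T: "T \<in> ops" "X \<longlonglongrightarrow> T" using operator_algebra_complete[of X, OF X'] by auto
  then have "(\<lambda>n. norm (X n - T)) \<longlonglongrightarrow> 0" by (simp add: LIM_zero tendsto_norm_zero)
  then show "\<exists>x\<in>carrier ?A. (\<lambda>n. nrm ?A (X n \<ominus>\<^bsub>?A\<^esub> x)) \<longlonglongrightarrow> 0"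
    using T(1) operator_algebra_minus[OF X' T(1)] by (intro bexI[of _ T]) simp_all
qed (simp_all add: compose_distrib ops_compose ops_add adj_ops ops_csmult norm_triangle_ineq norm_csmult
    norm_blinfun_compose norm_adj_compose)

section \<open>Transport of C*-algebras along injections\<close>

text \<open>An isomorphic copy of \<open>A\<close> with carrier \<open>g ` carrier A\<close>, for
  \<open>g\<close> injective on the carrier. It moves operators into the type of matrices over which
  the universal property quantifies.\<close>

definition cstar_image :: "('c \<Rightarrow> 'd) \<Rightarrow> 'c cstar \<Rightarrow> 'd cstar" where
  "cstar_image g A = (let h = inv_into (carrier A) g in
     \<lparr>carrier = g ` carrier A, monoid.mult = (\<lambda>x y. g (h x \<otimes>\<^bsub>A\<^esub> h y)), one = undefined,
      zero = g \<zero>\<^bsub>A\<^esub>, add = (\<lambda>x y. g (h x \<oplus>\<^bsub>A\<^esub> h y)), smult = (\<lambda>c x. g (c \<odot>\<^bsub>A\<^esub> h x)),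
      star = (\<lambda>x. g (star A (h x))), nrm = (\<lambda>x. nrm A (h x))\<rparr>)"

context cstar_algebra
begin

lemma cstar_image_simps:
  assumes inj: "inj_on g (carrier A)" and x: "x \<in> carrier A" and y: "y \<in> carrier A"
  shows "mult (cstar_image g A) (g x) (g y) = g (x \<otimes> y)"
    "add (cstar_image g A) (g x) (g y) = g (x \<oplus> y)"
    "smult (cstar_image g A) c (g x) = g (c \<odot> x)"
    "star (cstar_image g A) (g x) = g (star A x)"
    "nrm (cstar_image g A) (g x) = nrm A x"
    "carrier (cstar_image g A) = g ` carrier A" "zero (cstar_image g A) = g \<zero>"
  using inj x y unfolding cstar_image_def by (simp_all add: Let_def)

lemma abelian_group_image:
  assumes inj: "inj_on g (carrier A)" shows "abelian_group (cstar_image g A)"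
proof (rule abelian_groupI)
  note s = cstar_image_simps[OF inj]
  have c: "carrier (cstar_image g A) = g ` carrier A" "zero (cstar_image g A) = g \<zero>"
    using s(6,7)[of \<zero> \<zero>] by simp_all
  show "\<zero>\<^bsub>cstar_image g A\<^esub> \<in> carrier (cstar_image g A)" unfolding c by simp
  fix x y z assume x: "x \<in> carrier (cstar_image g A)"
  then obtain a where a: "a \<in> carrier A" "x = g a" unfolding c by auto
  show "\<zero>\<^bsub>cstar_image g A\<^esub> \<oplus>\<^bsub>cstar_image g A\<^esub> x = x" unfolding a(2) c using s(2)[of \<zero> a] a(1) by simp
  show "\<exists>y\<in>carrier (cstar_image g A). y \<oplus>\<^bsub>cstar_image g A\<^esub> x = \<zero>\<^bsub>cstar_image g A\<^esub>"
    unfolding a(2) c using s(2)[of "\<ominus> a" a] a(1) by (intro bexI[of _ "g (\<ominus> a)"]) (simp_all add: l_neg)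
  assume "y \<in> carrier (cstar_image g A)"
  then obtain b where b: "b \<in> carrier A" "y = g b" unfolding c by auto
  show "x \<oplus>\<^bsub>cstar_image g A\<^esub> y \<in> carrier (cstar_image g A)" unfolding a(2) b(2) c using s(2) a(1) b(1) by simp
  show "x \<oplus>\<^bsub>cstar_image g A\<^esub> y = y \<oplus>\<^bsub>cstar_image g A\<^esub> x" unfolding a(2) b(2) using s(2) a(1) b(1) by (simp add: a_comm)
  assume "z \<in> carrier (cstar_image g A)"
  then obtain d where d: "d \<in> carrier A" "z = g d" unfolding c by auto
  show "x \<oplus>\<^bsub>cstar_image g A\<^esub> y \<oplus>\<^bsub>cstar_image g A\<^esub> z = x \<oplus>\<^bsub>cstar_image g A\<^esub> (y \<oplus>\<^bsub>cstar_image g A\<^esub> z)"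
    unfolding a(2) b(2) d(2) using s(2) a(1) b(1) d(1) by (simp add: a_assoc)
qed

lemma cstar_image_minus:
  assumes inj: "inj_on g (carrier A)" and x: "x \<in> carrier A" and y: "y \<in> carrier A"
  shows "g x \<ominus>\<^bsub>cstar_image g A\<^esub> g y = g (x \<ominus> y)"
proof -
  note s = cstar_image_simps[OF inj]
  have "\<ominus>\<^bsub>cstar_image g A\<^esub> g y = g (\<ominus> y)"
    by (rule abelian_group.minus_equality[OF abelian_group_image[OF inj]])
       (use y s(2)[of "\<ominus> y" y] s(6,7)[of y y] in \<open>simp_all add: l_neg\<close>)
  then show ?thesis unfolding a_minus_def using s(2)[OF x, of "\<ominus> y"] y by simp
qed

lemma cstar_algebra_image:
  assumes inj: "inj_on g (carrier A)" shows "cstar_algebra (cstar_image g A)"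
proof -
  let ?B = "cstar_image g A"
  note s = cstar_image_simps[OF inj]
  have c: "carrier ?B = g ` carrier A" "zero ?B = g \<zero>"
    using s(6,7)[of \<zero> \<zero>] by simp_all
  have sm: "c \<odot> x \<in> carrier A" if "x \<in> carrier A" for c x using smult_closed[of c x] that by simp
  have "module complex_ring ?B"
  proof (rule moduleI[OF cring_complex_ring abelian_group_image[OF inj]])
    fix a b x y assume "x \<in> carrier ?B"
    then obtain u where u: "u \<in> carrier A" "x = g u" unfolding c by auto
    show "a \<odot>\<^bsub>?B\<^esub> x \<in> carrier ?B" unfolding u(2) c using s(3)[OF u(1) u(1)] sm[OF u(1)] by simp
    show "(a \<oplus>\<^bsub>complex_ring\<^esub> b) \<odot>\<^bsub>?B\<^esub> x = a \<odot>\<^bsub>?B\<^esub> x \<oplus>\<^bsub>?B\<^esub> b \<odot>\<^bsub>?B\<^esub> x"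
      unfolding u(2) using s(2,3) u(1) sm smult_l_distr[of a b u] by simp
    show "(a \<otimes>\<^bsub>complex_ring\<^esub> b) \<odot>\<^bsub>?B\<^esub> x = a \<odot>\<^bsub>?B\<^esub> (b \<odot>\<^bsub>?B\<^esub> x)"
      unfolding u(2) using s(3) u(1) sm smult_assoc1[of a b u] by simp
    show "\<one>\<^bsub>complex_ring\<^esub> \<odot>\<^bsub>?B\<^esub> x = x"
      unfolding u(2) using s(3) u(1) smult_one[of u] by simp
    assume "y \<in> carrier ?B"
    then obtain v where v: "v \<in> carrier A" "y = g v" unfolding c by auto
    show "a \<odot>\<^bsub>?B\<^esub> (x \<oplus>\<^bsub>?B\<^esub> y) = a \<odot>\<^bsub>?B\<^esub> x \<oplus>\<^bsub>?B\<^esub> a \<odot>\<^bsub>?B\<^esub> y"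
      unfolding u(2) v(2) using s(2,3) u(1) v(1) sm smult_r_distr[of a u v] by simp
  qed
  then show ?thesis
  proof (rule cstar_algebra.intro, unfold_locales)
    fix x a assume "x \<in> carrier ?B"
    then obtain u where u: "u \<in> carrier A" "x = g u" unfolding c by auto
    show "star ?B x \<in> carrier ?B" "star ?B (star ?B x) = x"
      "star ?B (a \<odot>\<^bsub>?B\<^esub> x) = cnj a \<odot>\<^bsub>?B\<^esub> star ?B x" "0 \<le> nrm ?B x"
      "nrm ?B (a \<odot>\<^bsub>?B\<^esub> x) = cmod a * nrm ?B x"
      "nrm ?B (star ?B x \<otimes>\<^bsub>?B\<^esub> x) = (nrm ?B x)\<^sup>2"
      unfolding u(2) c using s u(1) sm star_closed star_star star_smult nrm_nonneg nrm_smult cstar_identity mult_closed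
      by simp_all
    show "(nrm ?B x = 0) = (x = \<zero>\<^bsub>?B\<^esub>)"
      unfolding u(2) c using s(5)[OF u(1) u(1)] nrm_eq_0[OF u(1)] inj_on_eq_iff[OF inj u(1), of \<zero>] by simp
    fix y assume "y \<in> carrier ?B"
    then obtain v where v: "v \<in> carrier A" "y = g v" unfolding c by auto
    show "x \<otimes>\<^bsub>?B\<^esub> y \<in> carrier ?B" "(a \<odot>\<^bsub>?B\<^esub> x) \<otimes>\<^bsub>?B\<^esub> y = a \<odot>\<^bsub>?B\<^esub> (x \<otimes>\<^bsub>?B\<^esub> y)"
      "x \<otimes>\<^bsub>?B\<^esub> (a \<odot>\<^bsub>?B\<^esub> y) = a \<odot>\<^bsub>?B\<^esub> (x \<otimes>\<^bsub>?B\<^esub> y)"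
      "star ?B (x \<oplus>\<^bsub>?B\<^esub> y) = star ?B x \<oplus>\<^bsub>?B\<^esub> star ?B y"
      "star ?B (x \<otimes>\<^bsub>?B\<^esub> y) = star ?B y \<otimes>\<^bsub>?B\<^esub> star ?B x"
      "nrm ?B (x \<oplus>\<^bsub>?B\<^esub> y) \<le> nrm ?B x + nrm ?B y" "nrm ?B (x \<otimes>\<^bsub>?B\<^esub> y) \<le> nrm ?B x * nrm ?B y"
      unfolding u(2) v(2) c
      using s u(1) v(1) sm mult_closed smult_mult_left smult_mult_right star_add star_mult star_closed
        nrm_triangle nrm_mult by simp_all
    fix z assume "z \<in> carrier ?B"
    then obtain w where w: "w \<in> carrier A" "z = g w" unfolding c by auto
    show "x \<otimes>\<^bsub>?B\<^esub> y \<otimes>\<^bsub>?B\<^esub> z = x \<otimes>\<^bsub>?B\<^esub> (y \<otimes>\<^bsub>?B\<^esub> z)"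
      "(x \<oplus>\<^bsub>?B\<^esub> y) \<otimes>\<^bsub>?B\<^esub> z = x \<otimes>\<^bsub>?B\<^esub> z \<oplus>\<^bsub>?B\<^esub> y \<otimes>\<^bsub>?B\<^esub> z"
      "x \<otimes>\<^bsub>?B\<^esub> (y \<oplus>\<^bsub>?B\<^esub> z) = x \<otimes>\<^bsub>?B\<^esub> y \<oplus>\<^bsub>?B\<^esub> x \<otimes>\<^bsub>?B\<^esub> z"
      unfolding u(2) v(2) w(2)
      using s u(1) v(1) w(1) mult_closed mult_assoc mult_distrib_right mult_distrib_left by simp_all
  next
    fix X :: "nat \<Rightarrow> _" assume X: "\<And>n. X n \<in> carrier ?B"
      and C: "\<And>e. e > 0 \<Longrightarrow> \<exists>N. \<forall>m\<ge>N. \<forall>n\<ge>N. nrm ?B (X m \<ominus>\<^bsub>?B\<^esub> X n) < e"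
    have "\<forall>n. \<exists>y. y \<in> carrier A \<and> X n = g y" using X unfolding c by auto
    then obtain Y where Y: "\<And>n. Y n \<in> carrier A" "\<And>n. X n = g (Y n)" by metis
    have m: "nrm ?B (g x \<ominus>\<^bsub>?B\<^esub> g y) = nrm A (x \<ominus> y)" if "x \<in> carrier A" "y \<in> carrier A" for x y
      using cstar_image_minus[OF inj that] s(5)[of "x \<ominus> y" "x \<ominus> y"] that by simp
    have "\<exists>N. \<forall>m\<ge>N. \<forall>n\<ge>N. nrm A (Y m \<ominus> Y n) < e" if "e > 0" for e
      using C[OF that] Y m by simp
    then obtain y where y: "y \<in> carrier A" "(\<lambda>n. nrm A (Y n \<ominus> y)) \<longlonglongrightarrow> 0"
      using complete[of Y] Y(1) by blast
    show "\<exists>x\<in>carrier ?B. (\<lambda>n. nrm ?B (X n \<ominus>\<^bsub>?B\<^esub> x)) \<longlonglongrightarrow> 0"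
      unfolding c using y Y m by (intro bexI[of _ "g y"]) simp_all
  qed
qed

lemma star_hom_inv_image:
  assumes inj: "inj_on g (carrier A)" shows "star_hom (cstar_image g A) A (inv_into (carrier A) g)"
  unfolding star_hom_def
  using cstar_image_simps[OF inj] inj mult_closed star_closed smult_closed
  by (auto simp: cstar_image_simps(6)[OF inj zero_closed zero_closed])

end

section \<open>Operators of partial injections\<close>

definition pinj :: "('i \<times> 'i) set \<Rightarrow> bool" where
  "pinj R \<longleftrightarrow> single_valued R \<and> single_valued (R\<inverse>)"

lemma pinjD: "pinj R \<Longrightarrow> (i, j) \<in> R \<Longrightarrow> (i, k) \<in> R \<Longrightarrow> j = k"
  "pinj R \<Longrightarrow> (i, j) \<in> R \<Longrightarrow> (k, j) \<in> R \<Longrightarrow> i = k"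
  unfolding pinj_def single_valued_def by blast+

lemma pinj_converse: "pinj R \<Longrightarrow> pinj (R\<inverse>)"
  unfolding pinj_def by simp

lemma pinj_relcomp: "pinj R \<Longrightarrow> pinj S \<Longrightarrow> pinj (R O S)"
  unfolding pinj_def by (simp add: single_valued_relcomp converse_relcomp)

text \<open>The partial isometry that maps the basis vector of \<open>j\<close> to that of
  \<open>i\<close> if \<open>(i, j) \<in> R\<close>, and to 0 if there is no such \<open>i\<close>.
  With this orientation, composition and adjoint of operators become composition and converse of
  relations.\<close>

definition pinj_op :: "('i \<times> 'i) set \<Rightarrow> 'i ell2 \<Rightarrow>\<^sub>L 'i ell2" where
  "pinj_op R = Blinfun (\<lambda>f. Abs_ell2 (\<lambda>i. if i \<in> Domain R then coord f (THE j. (i, j) \<in> R) else 0))"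

context
  fixes R :: "('i \<times> 'i) set"
  assumes R: "pinj R"
begin

lemma the_pinj: "(i, j) \<in> R \<Longrightarrow> (THE j. (i, j) \<in> R) = j"
  using pinjD(1)[OF R] by blast

lemma inj_the_pinj: "inj_on (\<lambda>i. THE j. (i, j) \<in> R) (Domain R)"
  by (rule inj_onI) (use the_pinj pinjD(2)[OF R] in \<open>auto elim!: DomainE\<close>)

lemma coord_pinj_op: "coord (blinfun_apply (pinj_op R) f) i = (if i \<in> Domain R then coord f (THE j. (i, j) \<in> R) else 0)"
proof -
  let ?r = "\<lambda>i. THE j. (i, j) \<in> R"
  define U where "U = (\<lambda>f :: 'i ell2. Abs_ell2 (\<lambda>i. if i \<in> Domain R then coord f (?r i) else 0))"
  have bd: "(\<Sum>i\<in>F. (cmod (if i \<in> Domain R then coord f (?r i) else 0))\<^sup>2) \<le> (norm f)\<^sup>2"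
    if F: "finite F" for F f
  proof -
    have "(\<Sum>i\<in>F. (cmod (if i \<in> Domain R then coord f (?r i) else 0))\<^sup>2) =
      (\<Sum>i\<in>F \<inter> Domain R. (cmod (coord f (?r i)))\<^sup>2)"
      by (rule sum.mono_neutral_cong_right) (use F in auto)
    also have "\<dots> = (\<Sum>j\<in>?r ` (F \<inter> Domain R). (cmod (coord f j))\<^sup>2)"
      by (simp add: sum.reindex[OF inj_on_subset[OF inj_the_pinj]])
    also have "\<dots> \<le> (norm f)\<^sup>2" by (rule finite_sum_le_norm_ell2) (use F in simp)
    finally show ?thesis .
  qed
  have c: "coord (U f) i = (if i \<in> Domain R then coord f (?r i) else 0)" for f i
    unfolding U_def using Abs_ell2_bounded(1)[OF bd norm_ge_zero] by simp
  have "bounded_linear U"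
  proof (rule bounded_linear_intro[where K = 1])
    fix f g and r :: real
    show "norm (U f) \<le> norm f * 1" unfolding U_def using Abs_ell2_bounded(2)[OF bd norm_ge_zero] by simp
    show "U (f + g) = U f + U g" "U (r *\<^sub>R f) = r *\<^sub>R U f" by (rule ell2_eqI; simp add: c coord_simps)+
  qed
  then have "blinfun_apply (pinj_op R) = U" unfolding pinj_op_def U_def by (rule bounded_linear_Blinfun_apply)
  then show ?thesis using c by simp
qed

lemma pinj_op_in: "(i, j) \<in> R \<Longrightarrow> coord (blinfun_apply (pinj_op R) f) i = coord f j"
  unfolding coord_pinj_op using the_pinj by auto

lemma pinj_op_notin: "i \<notin> Domain R \<Longrightarrow> coord (blinfun_apply (pinj_op R) f) i = 0"
  unfolding coord_pinj_op by simp

end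

lemma pinj_op_eqI:
  assumes R: "pinj R" and "\<And>i j x. (i, j) \<in> R \<Longrightarrow> coord (blinfun_apply T x) i = coord x j"
    and "\<And>i x. i \<notin> Domain R \<Longrightarrow> coord (blinfun_apply T x) i = 0"
  shows "T = pinj_op R"
proof (rule blinfun_eqI, rule ell2_eqI)
  fix x i
  show "coord (blinfun_apply T x) i = coord (blinfun_apply (pinj_op R) x) i"
    using assms(2,3) pinj_op_in[OF R] pinj_op_notin[OF R] by (cases "i \<in> Domain R") auto
qed

lemma pinj_op_adjoint:
  assumes R: "pinj R"
  shows "inner (blinfun_apply (pinj_op R) f) g = inner f (blinfun_apply (pinj_op (R\<inverse>)) g)"
proof -
  let ?r = "\<lambda>i. THE j. (i, j) \<in> R"
  have img: "?r ` Domain R = Range R" using the_pinj[OF R] by (force simp: image_iff)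
  have "inner (blinfun_apply (pinj_op R) f) g = infsum (\<lambda>i. inner (coord (blinfun_apply (pinj_op R) f) i) (coord g i)) (Domain R)"
    unfolding inner_ell2_def by (rule infsum_cong_neutral) (auto simp: pinj_op_notin[OF R])
  also have "\<dots> = infsum (\<lambda>i. inner (coord f (?r i)) (coord (blinfun_apply (pinj_op (R\<inverse>)) g) (?r i))) (Domain R)"
  proof (rule infsum_cong)
    fix i assume "i \<in> Domain R"
    then obtain j where j: "(i, j) \<in> R" by auto
    have "coord (blinfun_apply (pinj_op (R\<inverse>)) g) j = coord g i"
      by (rule pinj_op_in[OF pinj_converse[OF R]]) (use j in simp)
    then show "inner (coord (blinfun_apply (pinj_op R) f) i) (coord g i) =
      inner (coord f (?r i)) (coord (blinfun_apply (pinj_op (R\<inverse>)) g) (?r i))"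
      using pinj_op_in[OF R j] the_pinj[OF R j] by simp
  qed
  also have "\<dots> = infsum (\<lambda>j. inner (coord f j) (coord (blinfun_apply (pinj_op (R\<inverse>)) g) j)) (Range R)"
    unfolding img[symmetric] infsum_reindex[OF inj_the_pinj[OF R]] by (simp add: o_def)
  also have "\<dots> = inner f (blinfun_apply (pinj_op (R\<inverse>)) g)"
    unfolding inner_ell2_def by (rule infsum_cong_neutral) (auto simp: pinj_op_notin[OF pinj_converse[OF R]])
  finally show ?thesis .
qed

lemma pinj_op_ops: "pinj R \<Longrightarrow> pinj_op R \<in> ops"
proof (rule opsI)
  assume R: "pinj R"
  show "blinfun_apply (pinj_op R) (ell2_J x) = ell2_J (blinfun_apply (pinj_op R) x)" for x
    by (rule ell2_eqI) (simp add: coord_pinj_op[OF R] coord_J)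
qed (rule pinj_op_adjoint)

lemma adj_pinj_op: "pinj R \<Longrightarrow> adj (pinj_op R) = pinj_op (R\<inverse>)"
  by (rule adj_unique) (rule pinj_op_adjoint)

lemma pinj_op_compose:
  assumes R: "pinj R" and S: "pinj S" shows "pinj_op R o\<^sub>L pinj_op S = pinj_op (R O S)"
proof (rule pinj_op_eqI[OF pinj_relcomp[OF R S]])
  fix i j x assume "(i, j) \<in> R O S"
  then obtain k where "(i, k) \<in> R" "(k, j) \<in> S" by auto
  then show "coord (blinfun_apply (pinj_op R o\<^sub>L pinj_op S) x) i = coord x j"
    using pinj_op_in[OF R] pinj_op_in[OF S] by simp
next
  fix i x assume i: "i \<notin> Domain (R O S)"
  show "coord (blinfun_apply (pinj_op R o\<^sub>L pinj_op S) x) i = 0"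
  proof (cases "i \<in> Domain R")
    case True
    then obtain k where k: "(i, k) \<in> R" by auto
    then have "k \<notin> Domain S" using i by auto
    then show ?thesis using pinj_op_in[OF R k] pinj_op_notin[OF S] by simp
  qed (use pinj_op_notin[OF R] in simp)
qed

lemma pinj_op_empty: "pinj_op {} = 0"
  by (rule pinj_op_eqI[symmetric]) (auto simp: pinj_def coord_zero)

lemma pinj_op_Un:
  assumes "pinj R" "pinj S" "pinj (R \<union> S)" and d: "Domain R \<inter> Domain S = {}"
  shows "pinj_op (R \<union> S) = pinj_op R + pinj_op S"
proof (rule pinj_op_eqI[OF assms(3), symmetric])
  fix i j x assume "(i, j) \<in> R \<union> S"
  then show "coord (blinfun_apply (pinj_op R + pinj_op S) x) i = coord x j"
  proof
    assume j: "(i, j) \<in> R"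
    then have "i \<notin> Domain S" using d by auto
    then show ?thesis using pinj_op_in[OF assms(1) j] pinj_op_notin[OF assms(2)] by (simp add: blinfun.add_left coord_simps)
  next
    assume j: "(i, j) \<in> S"
    then have "i \<notin> Domain R" using d by auto
    then show ?thesis using pinj_op_in[OF assms(2) j] pinj_op_notin[OF assms(1)] by (simp add: blinfun.add_left coord_simps)
  qed
next
  fix i x assume "i \<notin> Domain (R \<union> S)"
  then have "i \<notin> Domain R" "i \<notin> Domain S" by auto
  then show "coord (blinfun_apply (pinj_op R + pinj_op S) x) i = 0"
    using pinj_op_notin[OF assms(1)] pinj_op_notin[OF assms(2)] by (simp add: blinfun.add_left coord_simps)
qed

lemma pinj_op_ket:
  assumes R: "pinj R" shows "(i, j) \<in> R \<Longrightarrow> blinfun_apply (pinj_op R) (ket j) = ket i"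
    "j \<notin> Range R \<Longrightarrow> blinfun_apply (pinj_op R) (ket j) = 0"
proof -
  show "blinfun_apply (pinj_op R) (ket j) = ket i" if ij: "(i, j) \<in> R"
  proof (rule ell2_eqI)
    fix k
    show "coord (blinfun_apply (pinj_op R) (ket j)) k = coord (ket i) k"
    proof (cases "k \<in> Domain R")
      case True
      then obtain l where l: "(k, l) \<in> R" by auto
      then have "l = j \<longleftrightarrow> k = i" using pinjD[OF R] ij by metis
      then show ?thesis using pinj_op_in[OF R l] by (simp add: coord_ket)
    next
      case False
      then have "k \<noteq> i" using ij by auto
      then show ?thesis using pinj_op_notin[OF R False] by (simp add: coord_ket)
    qed
  qed
  show "blinfun_apply (pinj_op R) (ket j) = 0" if j: "j \<notin> Range R"
  proof (rule ell2_eqI)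
    fix k
    show "coord (blinfun_apply (pinj_op R) (ket j)) k = coord 0 k"
    proof (cases "k \<in> Domain R")
      case True
      then obtain l where l: "(k, l) \<in> R" by auto
      then have "l \<noteq> j" using j by auto
      then show ?thesis using pinj_op_in[OF R l] by (simp add: coord_ket coord_zero)
    qed (use pinj_op_notin[OF R] in \<open>simp add: coord_zero\<close>)
  qed
qed

text \<open>The matrix gives the values at the basis vectors, and these determine the adjoint, whose
  coordinates are inner products with them. The adjoint in turn determines the operator.\<close>

lemma inj_on_matrix: "inj_on (\<lambda>T i j. coord (blinfun_apply T (ket j)) i) ops"
proof (rule inj_onI)
  fix S T :: "'i ell2 \<Rightarrow>\<^sub>L 'i ell2"
  assume S: "S \<in> ops" and T: "T \<in> ops"
    and eq: "(\<lambda>i j. coord (blinfun_apply S (ket j)) i) = (\<lambda>i j. coord (blinfun_apply T (ket j)) i)"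
  have e: "coord (blinfun_apply S (ket j)) i = coord (blinfun_apply T (ket j)) i" for i j
    using eq by (metis (no_types))
  \<comment> \<open>Real inner products with a basis vector and with its multiple by \<open>\<i>\<close> give the two parts of a coordinate.\<close>
  have c: "coord (blinfun_apply (adj U) x) j = Complex (inner (blinfun_apply U (ket j)) x) (inner (blinfun_apply U (ell2_J (ket j))) x)"
    if U: "U \<in> ops" for U x j
  proof -
    have re: "inner (blinfun_apply U (ket j)) x = Re (coord (blinfun_apply (adj U) x) j)"
      using inner_adj[OF U] inner_ket by metis
    have "inner (blinfun_apply U (ell2_J (ket j))) x = - inner (ket j) (ell2_J (blinfun_apply (adj U) x))"
      using inner_adj[OF U] inner_J_left by metis
    also have "\<dots> = Im (coord (blinfun_apply (adj U) x) j)" unfolding inner_ket coord_J by simp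
    finally show ?thesis using re by simp
  qed
  have k: "blinfun_apply S (ket j) = blinfun_apply T (ket j)" for j by (rule ell2_eqI) (rule e)
  have "adj S = adj T"
    by (rule blinfun_eqI, rule ell2_eqI) (simp add: c[OF S] c[OF T] opsD_J[OF S] opsD_J[OF T] k)
  then show "S = T" using adj_ops(2)[OF S] adj_ops(2)[OF T] by metis
qed

section \<open>Characters of C*-subalgebras\<close>

lemma continuous_map_times:
  fixes f g :: "'a \<Rightarrow> complex"
  assumes "continuous_map T euclidean f" "continuous_map T euclidean g"
  shows "continuous_map T euclidean (\<lambda>x. f x * g x)"
  using assms unfolding continuous_map_atin limitin_canonical_iff by (blast intro: tendsto_mult)

context cstar_algebra
begin

lemma uminus_eq_smult: "x \<in> carrier A \<Longrightarrow> \<ominus> x = (- 1) \<odot> x"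
proof -
  assume x: "x \<in> carrier A"
  have "(- 1) \<odot> x \<oplus> x = (- 1 + 1) \<odot> x"
    using smult_l_distr[of "- 1" 1 x] smult_one[OF x] x by simp
  also have "\<dots> = \<zero>" using smult_l_null[OF x] by simp
  finally show ?thesis using x by (intro minus_equality) simp_all
qed

lemma nrm_zero: "nrm A \<zero> = 0"
  by (simp add: nrm_eq_0)

lemma nrm_le_0: "x \<in> carrier A \<Longrightarrow> nrm A x \<le> 0 \<Longrightarrow> x = \<zero>"
  using nrm_eq_0 nrm_nonneg by fastforce

lemma mult_zero: "x \<in> carrier A \<Longrightarrow> x \<otimes> \<zero> = \<zero>" "x \<in> carrier A \<Longrightarrow> \<zero> \<otimes> x = \<zero>"
  using nrm_mult[of x \<zero>] nrm_mult[of \<zero> x] nrm_zero mult_closed nrm_le_0 by auto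

lemma star_zero: "star A \<zero> = \<zero>"
  using star_smult[of \<zero> 0] smult_l_null star_closed by simp

lemma mult_minus_right: "x \<in> carrier A \<Longrightarrow> y \<in> carrier A \<Longrightarrow> z \<in> carrier A \<Longrightarrow> x \<otimes> (y \<ominus> z) = x \<otimes> y \<ominus> x \<otimes> z"
  unfolding a_minus_def by (simp add: mult_distrib_left uminus_eq_smult smult_mult_right mult_closed)

lemma mult_minus_left: "x \<in> carrier A \<Longrightarrow> y \<in> carrier A \<Longrightarrow> z \<in> carrier A \<Longrightarrow> (x \<ominus> y) \<otimes> z = x \<otimes> z \<ominus> y \<otimes> z"
  unfolding a_minus_def by (simp add: mult_distrib_right uminus_eq_smult smult_mult_left mult_closed)

lemma star_minus: "x \<in> carrier A \<Longrightarrow> y \<in> carrier A \<Longrightarrow> star A (x \<ominus> y) = star A x \<ominus> star A y"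
  unfolding a_minus_def by (simp add: star_add uminus_eq_smult star_smult star_closed)

lemma smult_minus: "x \<in> carrier A \<Longrightarrow> y \<in> carrier A \<Longrightarrow> c \<odot> (x \<ominus> y) = c \<odot> x \<ominus> c \<odot> y"
  unfolding a_minus_def using smult_r_distr[of c x "\<ominus> y"] by (simp add: smult_r_minus)

lemma add_minus_add:
  "x \<in> carrier A \<Longrightarrow> y \<in> carrier A \<Longrightarrow> u \<in> carrier A \<Longrightarrow> v \<in> carrier A \<Longrightarrow>
    (x \<oplus> y) \<ominus> (u \<oplus> v) = (x \<ominus> u) \<oplus> (y \<ominus> v)"
  unfolding a_minus_def by (simp add: minus_add a_ac)

lemma minus_self: "x \<in> carrier A \<Longrightarrow> x \<ominus> x = \<zero>"
  unfolding a_minus_def by (rule r_neg)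

lemma minus_zero_right: "x \<in> carrier A \<Longrightarrow> x \<ominus> \<zero> = x"
  unfolding a_minus_def by simp

lemma minus_cancel_mid:
  "x \<in> carrier A \<Longrightarrow> y \<in> carrier A \<Longrightarrow> z \<in> carrier A \<Longrightarrow> (x \<ominus> y) \<oplus> (y \<ominus> z) = x \<ominus> z"
  unfolding a_minus_def by (simp add: a_assoc r_neg1)

lemma eq_of_minus_zero:
  assumes "x \<in> carrier A" "y \<in> carrier A" "x \<ominus> y = \<zero>" shows "x = y"
proof -
  have "x = (x \<ominus> y) \<oplus> (y \<ominus> \<zero>)"
    using minus_cancel_mid[OF assms(1,2) zero_closed] minus_zero_right[OF assms(1)] by simp
  then show ?thesis using assms(2,3) minus_zero_right[OF assms(2)] by simp
qed

lemma nrm_uminus: "x \<in> carrier A \<Longrightarrow> nrm A (\<ominus> x) = nrm A x"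
  by (simp add: uminus_eq_smult nrm_smult)

lemma nrm_minus_commute: "x \<in> carrier A \<Longrightarrow> y \<in> carrier A \<Longrightarrow> nrm A (x \<ominus> y) = nrm A (y \<ominus> x)"
proof -
  assume xy: "x \<in> carrier A" "y \<in> carrier A"
  have "\<ominus> (x \<ominus> y) = y \<ominus> x" unfolding a_minus_def using xy by (simp add: minus_add a_comm)
  then show ?thesis using nrm_uminus[of "x \<ominus> y"] xy by simp
qed

lemma nrm_dist_triangle:
  "x \<in> carrier A \<Longrightarrow> y \<in> carrier A \<Longrightarrow> z \<in> carrier A \<Longrightarrow> nrm A (x \<ominus> z) \<le> nrm A (x \<ominus> y) + nrm A (y \<ominus> z)"
  using nrm_triangle[of "x \<ominus> y" "y \<ominus> z"] minus_cancel_mid[of x y z] by simp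

lemma nrm_le_dist: "x \<in> carrier A \<Longrightarrow> y \<in> carrier A \<Longrightarrow> nrm A x \<le> nrm A (x \<ominus> y) + nrm A y"
  using nrm_dist_triangle[of x y \<zero>] by (simp add: minus_zero_right)

lemma nrm_star: assumes x: "x \<in> carrier A" shows "nrm A (star A x) = nrm A x"
proof -
  have le: "nrm A x \<le> nrm A (star A x)" if x: "x \<in> carrier A" for x
  proof (cases "nrm A x = 0")
    case True
    then show ?thesis using nrm_nonneg[OF star_closed[OF x]] by simp
  next
    case False
    have "nrm A x * nrm A x \<le> nrm A (star A x) * nrm A x"
      using cstar_identity[OF x] nrm_mult[OF star_closed[OF x] x] by (simp add: power2_eq_square)
    then show ?thesis using False nrm_nonneg[OF x] by simp
  qed
  show ?thesis using le[OF x] le[OF star_closed[OF x]] star_star[OF x] by simp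
qed

lemma nrm_mult_dist:
  assumes "x \<in> carrier A" "y \<in> carrier A" "u \<in> carrier A" "v \<in> carrier A"
  shows "nrm A (x \<otimes> y \<ominus> u \<otimes> v) \<le> nrm A (x \<ominus> u) * nrm A y + (nrm A (x \<ominus> u) + nrm A x) * nrm A (y \<ominus> v)"
proof -
  have "nrm A (x \<otimes> y \<ominus> u \<otimes> v) \<le> nrm A (x \<otimes> y \<ominus> u \<otimes> y) + nrm A (u \<otimes> y \<ominus> u \<otimes> v)"
    by (rule nrm_dist_triangle) (use assms mult_closed in auto)
  also have "\<dots> = nrm A ((x \<ominus> u) \<otimes> y) + nrm A (u \<otimes> (y \<ominus> v))"
    using assms by (simp add: mult_minus_left mult_minus_right)
  also have "\<dots> \<le> nrm A (x \<ominus> u) * nrm A y + nrm A u * nrm A (y \<ominus> v)"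
    by (intro add_mono nrm_mult) (use assms in auto)
  also have "\<dots> \<le> nrm A (x \<ominus> u) * nrm A y + (nrm A (x \<ominus> u) + nrm A x) * nrm A (y \<ominus> v)"
    using nrm_le_dist[OF assms(3,1)] nrm_minus_commute[OF assms(1,3)] nrm_nonneg[of "y \<ominus> v"] assms
    by (intro add_mono order_refl mult_right_mono) auto
  finally show ?thesis .
qed

lemma subalgebraD:
  assumes "cstar_subalgebra A D"
  shows "x \<in> D \<Longrightarrow> x \<in> carrier A" "\<zero> \<in> D" "x \<in> D \<Longrightarrow> y \<in> D \<Longrightarrow> x \<oplus> y \<in> D"
    "x \<in> D \<Longrightarrow> y \<in> D \<Longrightarrow> x \<otimes> y \<in> D" "x \<in> D \<Longrightarrow> star A x \<in> D" "x \<in> D \<Longrightarrow> c \<odot> x \<in> D"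
    "x \<in> D \<Longrightarrow> y \<in> D \<Longrightarrow> x \<ominus> y \<in> D"
    "x \<in> carrier A \<Longrightarrow> (\<And>e. e > 0 \<Longrightarrow> \<exists>y\<in>D. nrm A (x \<ominus> y) < e) \<Longrightarrow> x \<in> D"
proof -
  have sub: "D \<subseteq> carrier A" and add: "\<And>x y. x \<in> D \<Longrightarrow> y \<in> D \<Longrightarrow> x \<oplus> y \<in> D"
    and sm: "\<And>c x. x \<in> D \<Longrightarrow> c \<odot> x \<in> D"
    using assms unfolding cstar_subalgebra_def by auto
  show "x \<in> D \<Longrightarrow> y \<in> D \<Longrightarrow> x \<ominus> y \<in> D"
    unfolding a_minus_def using uminus_eq_smult[of y] sub add sm by auto
  show "x \<in> D \<Longrightarrow> x \<in> carrier A" "\<zero> \<in> D" "x \<in> D \<Longrightarrow> y \<in> D \<Longrightarrow> x \<oplus> y \<in> D"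
    "x \<in> D \<Longrightarrow> y \<in> D \<Longrightarrow> x \<otimes> y \<in> D" "x \<in> D \<Longrightarrow> star A x \<in> D" "x \<in> D \<Longrightarrow> c \<odot> x \<in> D"
    "x \<in> carrier A \<Longrightarrow> (\<And>e. e > 0 \<Longrightarrow> \<exists>y\<in>D. nrm A (x \<ominus> y) < e) \<Longrightarrow> x \<in> D"
    using assms unfolding cstar_subalgebra_def by auto
qed

lemma cstar_subalgebra_carrier: "cstar_subalgebra A (carrier A)"
  unfolding cstar_subalgebra_def using mult_closed star_closed by auto

lemma cstar_gen_subset: "cstar_subalgebra A D \<Longrightarrow> X \<subseteq> D \<Longrightarrow> cstar_gen A X \<subseteq> D"
  unfolding cstar_gen_def by auto

lemma cstar_gen_superset: "X \<subseteq> cstar_gen A X"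
  unfolding cstar_gen_def by auto

lemma cstar_subalgebra_gen:
  assumes X: "X \<subseteq> carrier A" shows "cstar_subalgebra A (cstar_gen A X)"
proof -
  define S where "S = {D. cstar_subalgebra A D \<and> X \<subseteq> D}"
  have car: "carrier A \<in> S" using X cstar_subalgebra_carrier by (simp add: S_def)
  have D: "cstar_subalgebra A D" if "D \<in> S" for D using that by (simp add: S_def)
  have mem: "x \<in> cstar_gen A X \<longleftrightarrow> (\<forall>D\<in>S. x \<in> D)" for x unfolding cstar_gen_def S_def by simp
  show ?thesis
    unfolding cstar_subalgebra_def
  proof (intro conjI ballI allI impI subsetI)
    show "x \<in> carrier A" if "x \<in> cstar_gen A X" for x using that car unfolding mem by simp
    show "\<zero> \<in> cstar_gen A X" unfolding mem using subalgebraD(2)[OF D] by simp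
    fix x assume x: "x \<in> cstar_gen A X"
    show "star A x \<in> cstar_gen A X" "c \<odot> x \<in> cstar_gen A X" for c
      using x subalgebraD(5,6)[OF D] unfolding mem by simp_all
    fix y assume y: "y \<in> cstar_gen A X"
    show "x \<oplus> y \<in> cstar_gen A X" "x \<otimes> y \<in> cstar_gen A X"
      using x y subalgebraD(3,4)[OF D] unfolding mem by simp_all
  next
    fix x assume x: "x \<in> carrier A" and a: "\<forall>e>0. \<exists>y\<in>cstar_gen A X. nrm A (x \<ominus> y) < e"
    show "x \<in> cstar_gen A X"
      unfolding mem
    proof
      fix E assume E: "E \<in> S"
      then have "cstar_gen A X \<subseteq> E" using mem by auto
      then show "x \<in> E" using subalgebraD(8)[OF D[OF E] x] a by (meson subsetD)
    qed
  qed
qed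

text \<open>Induction over the C*-subalgebra generated by self-adjoint elements, for properties that
  ignore the involution: the elements \<open>x\<close> such that both \<open>x\<close> and its
  adjoint have the property form a C*-subalgebra, which contains the generators.\<close>

lemma cstar_gen_induct:
  assumes X: "X \<subseteq> carrier A" and sa: "\<And>x. x \<in> X \<Longrightarrow> star A x = x"
    and gen: "\<And>x. x \<in> X \<Longrightarrow> Q x" and zero: "Q \<zero>"
    and add: "\<And>x y. x \<in> carrier A \<Longrightarrow> y \<in> carrier A \<Longrightarrow> Q x \<Longrightarrow> Q y \<Longrightarrow> Q (x \<oplus> y)"
    and mult: "\<And>x y. x \<in> carrier A \<Longrightarrow> y \<in> carrier A \<Longrightarrow> Q x \<Longrightarrow> Q y \<Longrightarrow> Q (x \<otimes> y)"
    and smult: "\<And>c x. x \<in> carrier A \<Longrightarrow> Q x \<Longrightarrow> Q (c \<odot> x)"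
    and closed: "\<And>x. x \<in> carrier A \<Longrightarrow> (\<And>e. e > 0 \<Longrightarrow> \<exists>y\<in>carrier A. Q y \<and> nrm A (x \<ominus> y) < e) \<Longrightarrow> Q x"
    and x: "x \<in> cstar_gen A X"
  shows "Q x"
proof -
  let ?D = "{x \<in> carrier A. Q x \<and> Q (star A x)}"
  have "cstar_subalgebra A ?D"
    unfolding cstar_subalgebra_def
  proof (intro conjI ballI allI impI)
    fix x assume x: "x \<in> carrier A" and a: "\<forall>e>0. \<exists>y\<in>?D. nrm A (x \<ominus> y) < e"
    have "Q x" by (rule closed[OF x]) (use a in blast)
    moreover have "Q (star A x)"
    proof (rule closed[OF star_closed[OF x]])
      fix e :: real assume "e > 0"
      then obtain y where y: "y \<in> ?D" "nrm A (x \<ominus> y) < e" using a by blast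
      then have "nrm A (star A x \<ominus> star A y) < e"
        using nrm_star[of "x \<ominus> y"] star_minus[of x y] x by simp
      then show "\<exists>y\<in>carrier A. Q y \<and> nrm A (star A x \<ominus> y) < e"
        using y star_closed by (intro bexI[of _ "star A y"]) auto
    qed
    ultimately show "x \<in> ?D" using x by simp
  qed (auto simp: zero add mult smult star_zero star_add star_mult star_smult star_star star_closed mult_closed)
  moreover have "X \<subseteq> ?D" using X sa gen by auto
  ultimately show ?thesis using cstar_gen_subset x by blast
qed

text \<open>The Neumann series \<open>x + x\<^sup>2 + x\<^sup>3 + \<dots>\<close>, as the limit of
  the iteration \<open>y \<mapsto> x + y x\<close>. In a unital algebra \<open>1 + y\<close> would
  be the inverse of \<open>1 - x\<close>.\<close>

lemma ex_quasi_inverse: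
  assumes D: "cstar_subalgebra A D" and x: "x \<in> D" and r: "nrm A x < 1"
  shows "\<exists>y\<in>D. y = x \<oplus> y \<otimes> x"
proof -
  note S = subalgebraD[OF D]
  have xc: "x \<in> carrier A" by (rule S(1)[OF x])
  let ?r = "nrm A x"
  have r0: "0 \<le> ?r" by (rule nrm_nonneg[OF xc])
  define Y where "Y = rec_nat \<zero> (\<lambda>_ y. x \<oplus> y \<otimes> x)"
  have Y0: "Y 0 = \<zero>" and YS: "Y (Suc n) = x \<oplus> Y n \<otimes> x" for n unfolding Y_def by simp_all
  have YD: "Y n \<in> D" for n by (induction n) (simp_all add: Y0 YS S x)
  have Yc: "Y n \<in> carrier A" for n using S(1) YD by simp
  have step: "Y (Suc m) \<ominus> Y (Suc n) = (Y m \<ominus> Y n) \<otimes> x" for m n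
    unfolding YS add_minus_add[OF xc mult_closed[OF Yc xc] xc mult_closed[OF Yc xc]]
    by (simp add: minus_self xc mult_minus_left Yc mult_closed)
  have bound: "nrm A (Y n) \<le> 1 / (1 - ?r)" for n
  proof (induction n)
    case 0
    then show ?case using r by (simp add: Y0 nrm_zero)
  next
    case (Suc n)
    have "nrm A (Y (Suc n)) \<le> ?r + nrm A (Y n) * ?r"
      unfolding YS using nrm_triangle[OF xc mult_closed[OF Yc xc]] nrm_mult[OF Yc xc] by (meson add_left_mono order_trans)
    also have "\<dots> \<le> ?r + 1 / (1 - ?r) * ?r"
      using Suc.IH r0 by (intro add_left_mono mult_right_mono)
    also have "\<dots> \<le> 1 + 1 / (1 - ?r) * ?r" using r by simp
    also have "\<dots> = 1 / (1 - ?r)" using r by (simp add: field_simps)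
    finally show ?case .
  qed
  have diff: "nrm A (Y (n + k) \<ominus> Y n) \<le> ?r ^ n * (1 / (1 - ?r))" for n k
  proof (induction n)
    case 0
    then show ?case using bound[of k] by (simp add: Y0 minus_zero_right Yc)
  next
    case (Suc n)
    have "nrm A (Y (Suc n + k) \<ominus> Y (Suc n)) \<le> nrm A (Y (n + k) \<ominus> Y n) * ?r"
      using step[of "n + k" n] nrm_mult[of "Y (n + k) \<ominus> Y n" x] Yc xc by simp
    also have "\<dots> \<le> ?r ^ n * (1 / (1 - ?r)) * ?r" by (rule mult_right_mono[OF Suc.IH r0])
    finally show ?case by (simp add: mult_ac)
  qed
  have lim0: "(\<lambda>n. ?r ^ n * (1 / (1 - ?r))) \<longlonglongrightarrow> 0"
    by (rule tendsto_mult_left_zero) (use r r0 in \<open>simp add: LIMSEQ_power_zero\<close>)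
  have cauchy: "\<exists>N. \<forall>m\<ge>N. \<forall>n\<ge>N. nrm A (Y m \<ominus> Y n) < e" if e: "e > 0" for e
  proof -
    obtain N where N: "\<And>n. n \<ge> N \<Longrightarrow> ?r ^ n * (1 / (1 - ?r)) < e"
      using LIMSEQ_D[OF lim0 e] by (metis abs_less_iff diff_zero real_norm_def)
    have half: "nrm A (Y m \<ominus> Y n) < e" if "n \<ge> N" "n \<le> m" for m n
      using diff[of n "m - n"] N[OF that(1)] that(2) by simp
    have "nrm A (Y m \<ominus> Y n) < e" if "m \<ge> N" "n \<ge> N" for m n
      using half[of n m] half[of m n] nrm_minus_commute[OF Yc Yc, of m n] that by (cases "n \<le> m") auto
    then show ?thesis by blast
  qed
  obtain y where y: "y \<in> carrier A" "(\<lambda>n. nrm A (Y n \<ominus> y)) \<longlonglongrightarrow> 0"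
    using complete[OF Yc cauchy] by blast
  have near: "\<exists>n. nrm A (Y n \<ominus> y) < e \<and> nrm A (Y (Suc n) \<ominus> y) < e" if e: "e > 0" for e
  proof -
    obtain N where "\<forall>n\<ge>N. norm (nrm A (Y n \<ominus> y) - 0) < e" using LIMSEQ_D[OF y(2) e] by blast
    then show ?thesis by (intro exI[of _ N]) (metis abs_less_iff diff_zero le_SucI order_refl real_norm_def)
  qed
  have yD: "y \<in> D"
  proof (rule S(8)[OF y(1)])
    fix e :: real assume "e > 0"
    then obtain n where "nrm A (Y n \<ominus> y) < e" using near by blast
    then show "\<exists>z\<in>D. nrm A (y \<ominus> z) < e" using YD nrm_minus_commute[OF y(1) Yc] by metis
  qed
  let ?z = "x \<oplus> y \<otimes> x"
  have zc: "?z \<in> carrier A" using xc y(1) mult_closed by simp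
  have "nrm A (y \<ominus> ?z) \<le> 0"
  proof (rule field_le_epsilon)
    fix e :: real assume e: "e > 0"
    then obtain n where n: "nrm A (Y n \<ominus> y) < e / 2" "nrm A (Y (Suc n) \<ominus> y) < e / 2"
      using near[of "e / 2"] by auto
    have "Y (Suc n) \<ominus> ?z = (Y n \<ominus> y) \<otimes> x"
      unfolding YS add_minus_add[OF xc mult_closed[OF Yc xc] xc mult_closed[OF y(1) xc]]
      by (simp add: minus_self xc mult_minus_left Yc mult_closed y(1))
    then have "nrm A (Y (Suc n) \<ominus> ?z) \<le> nrm A (Y n \<ominus> y) * ?r"
      using nrm_mult[of "Y n \<ominus> y" x] Yc y(1) xc by simp
    also have "\<dots> \<le> nrm A (Y n \<ominus> y) * 1"
      by (rule mult_left_mono) (use r nrm_nonneg Yc y(1) in auto)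
    finally have "nrm A (Y (Suc n) \<ominus> ?z) < e / 2" using n by simp
    then show "nrm A (y \<ominus> ?z) \<le> 0 + e"
      using nrm_dist_triangle[OF y(1) Yc zc, of "Suc n"] nrm_minus_commute[OF y(1) Yc, of "Suc n"] n by simp
  qed
  then have "y = ?z" using eq_of_minus_zero[OF y(1) zc] nrm_le_0[of "y \<ominus> ?z"] y(1) zc by simp
  then show ?thesis using yD by blast
qed

lemma spectrumD:
  assumes "\<phi> \<in> spectrum A D"
  shows "x \<in> D \<Longrightarrow> y \<in> D \<Longrightarrow> \<phi> (x \<oplus> y) = \<phi> x + \<phi> y" "x \<in> D \<Longrightarrow> y \<in> D \<Longrightarrow> \<phi> (x \<otimes> y) = \<phi> x * \<phi> y"
    "x \<in> D \<Longrightarrow> \<phi> (c \<odot> x) = c * \<phi> x" "\<exists>x\<in>D. \<phi> x \<noteq> 0" "\<phi> \<in> extensional D"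
  using assms unfolding spectrum_def by auto

lemma character_minus:
  assumes D: "cstar_subalgebra A D" and \<phi>: "\<phi> \<in> spectrum A D" and xy: "x \<in> D" "y \<in> D"
  shows "\<phi> (x \<ominus> y) = \<phi> x - \<phi> y"
  using spectrumD(1)[OF \<phi> xy(1), of "(- 1) \<odot> y"] spectrumD(3)[OF \<phi> xy(2), of "- 1"]
    subalgebraD(1)[OF D xy(2)] subalgebraD(6)[OF D xy(2)] uminus_eq_smult[of y]
  unfolding a_minus_def by simp

lemma character_zero:
  assumes D: "cstar_subalgebra A D" and \<phi>: "\<phi> \<in> spectrum A D" shows "\<phi> \<zero> = 0"
  using spectrumD(1)[OF \<phi> subalgebraD(2)[OF D] subalgebraD(2)[OF D]] by simp

text \<open>If the bound failed, some \<open>z\<close> of norm less than 1 would have value 1, and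
  applying the character to the equation \<open>y = z + y z\<close> of the quasi-inverse would give
  \<open>\<phi> y = 1 + \<phi> y\<close>.\<close>

lemma character_bound:
  assumes D: "cstar_subalgebra A D" and \<phi>: "\<phi> \<in> spectrum A D" and x: "x \<in> D"
  shows "cmod (\<phi> x) \<le> nrm A x"
proof (rule ccontr)
  assume "\<not> ?thesis"
  then have lt: "nrm A x < cmod (\<phi> x)" by simp
  have xc: "x \<in> carrier A" by (rule subalgebraD(1)[OF D x])
  have ne: "\<phi> x \<noteq> 0" using lt nrm_nonneg[OF xc] by auto
  let ?z = "(1 / \<phi> x) \<odot> x"
  have z: "?z \<in> D" by (rule subalgebraD(6)[OF D x])
  have "nrm A ?z < 1" using lt ne by (simp add: nrm_smult xc norm_divide field_simps)
  then obtain y where y: "y \<in> D" "y = ?z \<oplus> y \<otimes> ?z" using ex_quasi_inverse[OF D z] by blast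
  have "\<phi> ?z = 1" using spectrumD(3)[OF \<phi> x] ne by simp
  then have "\<phi> y = 1 + \<phi> y"
    using arg_cong[OF y(2), of \<phi>] spectrumD(1)[OF \<phi> z subalgebraD(4)[OF D y(1) z]] spectrumD(2)[OF \<phi> y(1) z] by simp
  then show False by simp
qed

context
  fixes X
  assumes X: "X \<subseteq> carrier A" and sa: "\<And>x. x \<in> X \<Longrightarrow> star A x = x"
begin

lemma gen_subalgebra: "cstar_subalgebra A (cstar_gen A X)"
  by (rule cstar_subalgebra_gen[OF X])

lemma gen_closed:
  assumes x: "x \<in> carrier A"
    and a: "\<And>e. e > 0 \<Longrightarrow> \<exists>y\<in>carrier A. (y \<in> cstar_gen A X \<and> P y) \<and> nrm A (x \<ominus> y) < e"
  shows "x \<in> cstar_gen A X" "\<And>e. e > 0 \<Longrightarrow> \<exists>y\<in>cstar_gen A X. P y \<and> nrm A (x \<ominus> y) < e"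
proof -
  show "x \<in> cstar_gen A X" by (rule subalgebraD(8)[OF gen_subalgebra x]) (use a in blast)
  show "\<exists>y\<in>cstar_gen A X. P y \<and> nrm A (x \<ominus> y) < e" if "e > 0" for e using a[OF that] by blast
qed

lemma character_eqI:
  assumes \<phi>: "\<phi> \<in> spectrum A (cstar_gen A X)" and \<psi>: "\<psi> \<in> spectrum A (cstar_gen A X)"
    and eq: "\<And>x. x \<in> X \<Longrightarrow> \<phi> x = \<psi> x"
  shows "\<phi> = \<psi>"
proof (rule extensionalityI[OF spectrumD(5)[OF \<phi>] spectrumD(5)[OF \<psi>]])
  let ?D = "cstar_gen A X"
  note D = gen_subalgebra note S = subalgebraD[OF D] note p = spectrumD[OF \<phi>] note q = spectrumD[OF \<psi>]
  fix x assume "x \<in> ?D"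
  then have "x \<in> ?D \<and> \<phi> x = \<psi> x"
  proof (rule cstar_gen_induct[OF X sa, rotated -1])
    fix x assume x: "x \<in> carrier A"
      and a: "\<And>e. e > 0 \<Longrightarrow> \<exists>y\<in>carrier A. (y \<in> ?D \<and> \<phi> y = \<psi> y) \<and> nrm A (x \<ominus> y) < e"
    note xD = gen_closed(1)[OF x a]
    have "cmod (\<phi> x - \<psi> x) \<le> 0"
    proof (rule field_le_epsilon)
      fix e :: real assume "e > 0"
      then obtain y where y: "y \<in> ?D" "\<phi> y = \<psi> y" "nrm A (x \<ominus> y) < e / 2"
        using gen_closed(2)[OF x a, of "e / 2"] by auto
      have "\<phi> x - \<psi> x = \<phi> (x \<ominus> y) - \<psi> (x \<ominus> y)"
        using character_minus[OF D \<phi> xD y(1)] character_minus[OF D \<psi> xD y(1)] y(2) by simp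
      also have "cmod \<dots> \<le> nrm A (x \<ominus> y) + nrm A (x \<ominus> y)"
        using norm_triangle_ineq4[of "\<phi> (x \<ominus> y)" "\<psi> (x \<ominus> y)"] character_bound[OF D \<phi> S(7)[OF xD y(1)]]
          character_bound[OF D \<psi> S(7)[OF xD y(1)]] by linarith
      finally show "cmod (\<phi> x - \<psi> x) \<le> 0 + e" using y(3) by simp
    qed
    then show "x \<in> ?D \<and> \<phi> x = \<psi> x" using xD by simp
  next
    show "x \<in> ?D \<and> \<phi> x = \<psi> x" if "x \<in> X" for x using subsetD[OF cstar_gen_superset that] eq[OF that] by simp
    show "\<zero> \<in> ?D \<and> \<phi> \<zero> = \<psi> \<zero>" using S(2) character_zero[OF D \<phi>] character_zero[OF D \<psi>] by simp
    fix x y assume x: "x \<in> ?D \<and> \<phi> x = \<psi> x"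
    show "c \<odot> x \<in> ?D \<and> \<phi> (c \<odot> x) = \<psi> (c \<odot> x)" for c using x S(6) p(3) q(3) by simp
    assume y: "y \<in> ?D \<and> \<phi> y = \<psi> y"
    show "x \<oplus> y \<in> ?D \<and> \<phi> (x \<oplus> y) = \<psi> (x \<oplus> y)" using x y S(3) p(1) q(1) by simp
    show "x \<otimes> y \<in> ?D \<and> \<phi> (x \<otimes> y) = \<psi> (x \<otimes> y)" using x y S(4) p(2) q(2) by simp
  qed
  then show "\<phi> x = \<psi> x" by simp
qed

lemma character_nonzero_gen:
  assumes \<phi>: "\<phi> \<in> spectrum A (cstar_gen A X)"
  shows "\<exists>x\<in>X. \<phi> x \<noteq> 0"
proof (rule ccontr)
  let ?D = "cstar_gen A X"
  note D = gen_subalgebra note S = subalgebraD[OF D] note p = spectrumD[OF \<phi>]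
  assume no: "\<not> ?thesis"
  have "x \<in> ?D \<and> \<phi> x = 0" if "x \<in> ?D" for x
    using that
  proof (rule cstar_gen_induct[OF X sa, rotated -1])
    fix x assume x: "x \<in> carrier A"
      and a: "\<And>e. e > 0 \<Longrightarrow> \<exists>y\<in>carrier A. (y \<in> ?D \<and> \<phi> y = 0) \<and> nrm A (x \<ominus> y) < e"
    note xD = gen_closed(1)[OF x a]
    have "cmod (\<phi> x) \<le> 0"
    proof (rule field_le_epsilon)
      fix e :: real assume "e > 0"
      then obtain y where y: "y \<in> ?D" "\<phi> y = 0" "nrm A (x \<ominus> y) < e"
        using gen_closed(2)[OF x a] by blast
      then show "cmod (\<phi> x) \<le> 0 + e"
        using character_minus[OF D \<phi> xD y(1)] character_bound[OF D \<phi> S(7)[OF xD y(1)]] by simp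
    qed
    then show "x \<in> ?D \<and> \<phi> x = 0" using xD by simp
  next
    show "x \<in> ?D \<and> \<phi> x = 0" if "x \<in> X" for x using subsetD[OF cstar_gen_superset that] no that by simp
    show "\<zero> \<in> ?D \<and> \<phi> \<zero> = 0" using S(2) character_zero[OF D \<phi>] by simp
    fix x y assume x: "x \<in> ?D \<and> \<phi> x = 0"
    show "c \<odot> x \<in> ?D \<and> \<phi> (c \<odot> x) = 0" for c using x S(6) p(3) by simp
    assume y: "y \<in> ?D \<and> \<phi> y = 0"
    show "x \<oplus> y \<in> ?D \<and> \<phi> (x \<oplus> y) = 0" using x y S(3) p(1) by simp
    show "x \<otimes> y \<in> ?D \<and> \<phi> (x \<otimes> y) = 0" using x y S(4) p(2) by simp
  qed
  then show False using p(4) by auto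
qed

text \<open>Characters have norm at most 1, so a family of characters that is continuous on the
  generators is a uniform limit of continuous functions at every element.\<close>

lemma continuous_characters:
  assumes \<Phi>: "\<And>\<mu>. \<mu> \<in> topspace T \<Longrightarrow> \<Phi> \<mu> \<in> spectrum A (cstar_gen A X)"
    and gen: "\<And>x. x \<in> X \<Longrightarrow> continuous_map T euclidean (\<lambda>\<mu>. \<Phi> \<mu> x)"
    and x: "x \<in> cstar_gen A X"
  shows "continuous_map T euclidean (\<lambda>\<mu>. \<Phi> \<mu> x)"
proof -
  let ?D = "cstar_gen A X"
  note D = gen_subalgebra note S = subalgebraD[OF D]
  have cong: "continuous_map T euclidean f \<Longrightarrow> continuous_map T euclidean g"
    if "\<And>\<mu>. \<mu> \<in> topspace T \<Longrightarrow> g \<mu> = f \<mu>" for f g :: "_ \<Rightarrow> complex"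
    using continuous_map_eq[of T euclidean f g] that by simp
  have "x \<in> ?D \<and> continuous_map T euclidean (\<lambda>\<mu>. \<Phi> \<mu> x)"
    using x
  proof (rule cstar_gen_induct[OF X sa, rotated -1])
    show "x \<in> ?D \<and> continuous_map T euclidean (\<lambda>\<mu>. \<Phi> \<mu> x)" if "x \<in> X" for x
      using that gen cstar_gen_superset by auto
    show "\<zero> \<in> ?D \<and> continuous_map T euclidean (\<lambda>\<mu>. \<Phi> \<mu> \<zero>)"
      using S(2) cong[of "\<lambda>\<mu>. \<Phi> \<mu> \<zero>" "\<lambda>\<mu>. 0"] character_zero[OF D \<Phi>] by simp
  next
    fix x y assume xy: "x \<in> ?D \<and> continuous_map T euclidean (\<lambda>\<mu>. \<Phi> \<mu> x)" "y \<in> ?D \<and> continuous_map T euclidean (\<lambda>\<mu>. \<Phi> \<mu> y)"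
    show "x \<oplus> y \<in> ?D \<and> continuous_map T euclidean (\<lambda>\<mu>. \<Phi> \<mu> (x \<oplus> y))"
      using xy S(3) spectrumD(1)[OF \<Phi>] by (auto intro!: cong[of "\<lambda>\<mu>. \<Phi> \<mu> (x \<oplus> y)" "\<lambda>\<mu>. \<Phi> \<mu> x + \<Phi> \<mu> y"] continuous_map_add)
    show "x \<otimes> y \<in> ?D \<and> continuous_map T euclidean (\<lambda>\<mu>. \<Phi> \<mu> (x \<otimes> y))"
      using xy S(4) spectrumD(2)[OF \<Phi>] by (auto intro!: cong[of "\<lambda>\<mu>. \<Phi> \<mu> (x \<otimes> y)" "\<lambda>\<mu>. \<Phi> \<mu> x * \<Phi> \<mu> y"] continuous_map_times)
  next
    fix c x assume x: "x \<in> ?D \<and> continuous_map T euclidean (\<lambda>\<mu>. \<Phi> \<mu> x)"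
    show "c \<odot> x \<in> ?D \<and> continuous_map T euclidean (\<lambda>\<mu>. \<Phi> \<mu> (c \<odot> x))"
      using x S(6) spectrumD(3)[OF \<Phi>] by (auto intro!: cong[of "\<lambda>\<mu>. \<Phi> \<mu> (c \<odot> x)" "\<lambda>\<mu>. c * \<Phi> \<mu> x"] continuous_map_times)
  next
    fix x assume x: "x \<in> carrier A"
      and a: "\<And>e. e > 0 \<Longrightarrow> \<exists>y\<in>carrier A. (y \<in> ?D \<and> continuous_map T euclidean (\<lambda>\<mu>. \<Phi> \<mu> y)) \<and> nrm A (x \<ominus> y) < e"
    note xD = gen_closed(1)[OF x a]
    have "openin T {\<mu> \<in> topspace T. \<Phi> \<mu> x \<in> U}" if U: "open U" for U
      unfolding openin_subopen[of T "{\<mu> \<in> topspace T. \<Phi> \<mu> x \<in> U}"]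
    proof
      fix \<nu> assume "\<nu> \<in> {\<mu> \<in> topspace T. \<Phi> \<mu> x \<in> U}"
      then have \<nu>: "\<nu> \<in> topspace T" "\<Phi> \<nu> x \<in> U" by auto
      obtain e where e: "e > 0" "ball (\<Phi> \<nu> x) e \<subseteq> U" using U \<nu>(2) open_contains_ball by blast
      obtain y where y: "y \<in> ?D" "continuous_map T euclidean (\<lambda>\<mu>. \<Phi> \<mu> y)" "nrm A (x \<ominus> y) < e / 3"
        using gen_closed(2)[OF x a, of "e / 3"] e(1) by auto
      let ?V = "{\<mu> \<in> topspace T. \<Phi> \<mu> y \<in> ball (\<Phi> \<nu> y) (e / 3)}"
      have V: "openin T ?V" by (rule openin_continuous_map_preimage[OF y(2)]) simp
      have near: "dist (\<Phi> \<mu> x) (\<Phi> \<mu> y) < e / 3" if "\<mu> \<in> topspace T" for \<mu>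
        using character_minus[OF D \<Phi>[OF that] xD y(1)] character_bound[OF D \<Phi>[OF that] S(7)[OF xD y(1)]] y(3)
        by (simp add: dist_norm)
      have "?V \<subseteq> {\<mu> \<in> topspace T. \<Phi> \<mu> x \<in> U}"
      proof
        fix \<mu> assume "\<mu> \<in> ?V"
        then have \<mu>: "\<mu> \<in> topspace T" "dist (\<Phi> \<nu> y) (\<Phi> \<mu> y) < e / 3" by auto
        have "dist (\<Phi> \<nu> x) (\<Phi> \<mu> x) \<le> dist (\<Phi> \<nu> x) (\<Phi> \<nu> y) + dist (\<Phi> \<nu> y) (\<Phi> \<mu> y) + dist (\<Phi> \<mu> y) (\<Phi> \<mu> x)"
          by (metis add_right_mono dist_triangle order_trans)
        also have "\<dots> < e" using near[OF \<nu>(1)] near[OF \<mu>(1)] \<mu>(2) by (simp add: dist_commute)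
        finally show "\<mu> \<in> {\<mu> \<in> topspace T. \<Phi> \<mu> x \<in> U}" using e(2) \<mu>(1) by auto
      qed
      then show "\<exists>V. openin T V \<and> \<nu> \<in> V \<and> V \<subseteq> {\<mu> \<in> topspace T. \<Phi> \<mu> x \<in> U}"
        using V \<nu>(1) e(1) by (intro exI[of _ ?V]) auto
    qed
    then show "x \<in> ?D \<and> continuous_map T euclidean (\<lambda>\<mu>. \<Phi> \<mu> x)"
      using xD unfolding continuous_map_def by simp
  qed
  then show ?thesis by simp
qed

end

text \<open>The relation \<open>ev\<close> is a multiplicative linear functional that is defined on
  a subalgebra only, not necessarily closed. The bound makes it single-valued and lets it pass to
  limits, hence to everything generated by \<open>X\<close>.\<close>

lemma ex_character:
  fixes ev :: "'c \<Rightarrow> complex \<Rightarrow> bool"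
  assumes X: "X \<subseteq> carrier A" and sa: "\<And>x. x \<in> X \<Longrightarrow> star A x = x"
    and ev_add: "\<And>x y c d. x \<in> carrier A \<Longrightarrow> y \<in> carrier A \<Longrightarrow> ev x c \<Longrightarrow> ev y d \<Longrightarrow> ev (x \<oplus> y) (c + d)"
    and ev_mult: "\<And>x y c d. x \<in> carrier A \<Longrightarrow> y \<in> carrier A \<Longrightarrow> ev x c \<Longrightarrow> ev y d \<Longrightarrow> ev (x \<otimes> y) (c * d)"
    and ev_smult: "\<And>x a c. x \<in> carrier A \<Longrightarrow> ev x c \<Longrightarrow> ev (a \<odot> x) (a * c)"
    and bound: "\<And>x c. x \<in> carrier A \<Longrightarrow> ev x c \<Longrightarrow> cmod c \<le> nrm A x"
    and gen: "\<And>x. x \<in> X \<Longrightarrow> ev x (h x)" and ne: "\<exists>x\<in>X. h x \<noteq> 0"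
  shows "\<exists>\<phi>\<in>spectrum A (cstar_gen A X). \<forall>x\<in>X. \<phi> x = h x"
proof -
  \<comment> \<open>The closure of the relation \<open>ev\<close>.\<close>
  define lim where "lim x c \<longleftrightarrow> (\<exists>Y d. (\<forall>n::nat. Y n \<in> carrier A \<and> ev (Y n) (d n)) \<and>
    (\<lambda>n. nrm A (x \<ominus> Y n)) \<longlonglongrightarrow> 0 \<and> d \<longlonglongrightarrow> c)" for x c
  have limE: "\<exists>Y d. (\<forall>n::nat. Y n \<in> carrier A) \<and> (\<forall>n. ev (Y n) (d n)) \<and>
    (\<lambda>n. nrm A (x \<ominus> Y n)) \<longlonglongrightarrow> 0 \<and> d \<longlonglongrightarrow> c" if "lim x c" for x c
    using that unfolding lim_def by blast
  have limI: "lim x c" if "\<And>n::nat. Y n \<in> carrier A" "\<And>n. ev (Y n) (d n)"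
    "(\<lambda>n. nrm A (x \<ominus> Y n)) \<longlonglongrightarrow> 0" "d \<longlonglongrightarrow> c" for x c Y d
    using that unfolding lim_def by blast
  have lim_ev: "lim x c" if "x \<in> carrier A" "ev x c" for x c
    by (rule limI[of "\<lambda>_. x" "\<lambda>_. c"]) (use that in \<open>simp_all add: minus_self nrm_zero\<close>)
  have squeeze: "f \<longlonglongrightarrow> 0" if "\<And>n. 0 \<le> f n" "\<And>n. f n \<le> g n" "g \<longlonglongrightarrow> 0" for f g :: "nat \<Rightarrow> real"
    by (rule tendsto_sandwich[OF _ _ tendsto_const that(3)]) (use that in auto)
  have lim_add: "lim (x \<oplus> y) (c + d)" if x: "x \<in> carrier A" "lim x c" and y: "y \<in> carrier A" "lim y d" for x y c d
  proof -
    obtain Y a where Y: "\<And>n::nat. Y n \<in> carrier A" "\<And>n. ev (Y n) (a n)" "(\<lambda>n. nrm A (x \<ominus> Y n)) \<longlonglongrightarrow> 0" "a \<longlonglongrightarrow> c"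
      using limE[OF x(2)] by blast
    obtain Z b where Z: "\<And>n::nat. Z n \<in> carrier A" "\<And>n. ev (Z n) (b n)" "(\<lambda>n. nrm A (y \<ominus> Z n)) \<longlonglongrightarrow> 0" "b \<longlonglongrightarrow> d"
      using limE[OF y(2)] by blast
    show ?thesis
    proof (rule limI[of "\<lambda>n. Y n \<oplus> Z n" "\<lambda>n. a n + b n"])
      show "(\<lambda>n. nrm A (x \<oplus> y \<ominus> (Y n \<oplus> Z n))) \<longlonglongrightarrow> 0"
      proof (rule squeeze)
        show "(\<lambda>n. nrm A (x \<ominus> Y n) + nrm A (y \<ominus> Z n)) \<longlonglongrightarrow> 0"
          using tendsto_add[OF Y(3) Z(3)] by simp
        show "nrm A (x \<oplus> y \<ominus> (Y n \<oplus> Z n)) \<le> nrm A (x \<ominus> Y n) + nrm A (y \<ominus> Z n)" for n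
          using add_minus_add[OF x(1) y(1) Y(1) Z(1), of n n] nrm_triangle[of "x \<ominus> Y n" "y \<ominus> Z n"] x(1) y(1) Y(1) Z(1) by simp
      qed (use nrm_nonneg x(1) y(1) Y(1) Z(1) in simp)
      show "(\<lambda>n. a n + b n) \<longlonglongrightarrow> c + d" by (rule tendsto_add[OF Y(4) Z(4)])
    qed (use Y(1,2) Z(1,2) ev_add in simp_all)
  qed
  have lim_mult: "lim (x \<otimes> y) (c * d)" if x: "x \<in> carrier A" "lim x c" and y: "y \<in> carrier A" "lim y d" for x y c d
  proof -
    obtain Y a where Y: "\<And>n::nat. Y n \<in> carrier A" "\<And>n. ev (Y n) (a n)" "(\<lambda>n. nrm A (x \<ominus> Y n)) \<longlonglongrightarrow> 0" "a \<longlonglongrightarrow> c"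
      using limE[OF x(2)] by blast
    obtain Z b where Z: "\<And>n::nat. Z n \<in> carrier A" "\<And>n. ev (Z n) (b n)" "(\<lambda>n. nrm A (y \<ominus> Z n)) \<longlonglongrightarrow> 0" "b \<longlonglongrightarrow> d"
      using limE[OF y(2)] by blast
    show ?thesis
    proof (rule limI[of "\<lambda>n. Y n \<otimes> Z n" "\<lambda>n. a n * b n"])
      show "(\<lambda>n. nrm A (x \<otimes> y \<ominus> (Y n \<otimes> Z n))) \<longlonglongrightarrow> 0"
      proof (rule squeeze)
        have "(\<lambda>n. nrm A (x \<ominus> Y n) * nrm A y + (nrm A (x \<ominus> Y n) + nrm A x) * nrm A (y \<ominus> Z n)) \<longlonglongrightarrow> 0 * nrm A y + (0 + nrm A x) * 0"
          by (intro tendsto_intros Y(3) Z(3))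
        then show "(\<lambda>n. nrm A (x \<ominus> Y n) * nrm A y + (nrm A (x \<ominus> Y n) + nrm A x) * nrm A (y \<ominus> Z n)) \<longlonglongrightarrow> 0" by simp
        show "nrm A (x \<otimes> y \<ominus> (Y n \<otimes> Z n)) \<le> nrm A (x \<ominus> Y n) * nrm A y + (nrm A (x \<ominus> Y n) + nrm A x) * nrm A (y \<ominus> Z n)" for n
          by (rule nrm_mult_dist[OF x(1) y(1) Y(1) Z(1)])
      qed (use nrm_nonneg x(1) y(1) Y(1) Z(1) mult_closed in simp)
      show "(\<lambda>n. a n * b n) \<longlonglongrightarrow> c * d" by (rule tendsto_mult[OF Y(4) Z(4)])
    qed (use Y(1,2) Z(1,2) ev_mult mult_closed in simp_all)
  qed
  have lim_smult: "lim (k \<odot> x) (k * c)" if x: "x \<in> carrier A" "lim x c" for x c k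
  proof -
    obtain Y a where Y: "\<And>n::nat. Y n \<in> carrier A" "\<And>n. ev (Y n) (a n)" "(\<lambda>n. nrm A (x \<ominus> Y n)) \<longlonglongrightarrow> 0" "a \<longlonglongrightarrow> c"
      using limE[OF x(2)] by blast
    show ?thesis
    proof (rule limI[of "\<lambda>n. k \<odot> Y n" "\<lambda>n. k * a n"])
      have "nrm A (k \<odot> x \<ominus> k \<odot> Y n) = cmod k * nrm A (x \<ominus> Y n)" for n
        using smult_minus[OF x(1) Y(1), of k] nrm_smult[of "x \<ominus> Y n" k] x(1) Y(1) by simp
      then show "(\<lambda>n. nrm A (k \<odot> x \<ominus> k \<odot> Y n)) \<longlonglongrightarrow> 0"
        using tendsto_mult_right_zero[OF Y(3)] by simp
      show "(\<lambda>n. k * a n) \<longlonglongrightarrow> k * c" by (rule tendsto_mult[OF tendsto_const Y(4)])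
    qed (use Y(1,2) ev_smult in simp_all)
  qed
  have lim_bound: "cmod c \<le> nrm A x" if x: "x \<in> carrier A" "lim x c" for x c
  proof -
    obtain Y a where Y: "\<And>n::nat. Y n \<in> carrier A" "\<And>n. ev (Y n) (a n)" "(\<lambda>n. nrm A (x \<ominus> Y n)) \<longlonglongrightarrow> 0" "a \<longlonglongrightarrow> c"
      using limE[OF x(2)] by blast
    have "cmod (a n) \<le> nrm A (x \<ominus> Y n) + nrm A x" for n
      using bound[OF Y(1,2)] nrm_le_dist[OF Y(1) x(1), of n] nrm_minus_commute[OF x(1) Y(1), of n]
      by (metis order_trans)
    moreover have "(\<lambda>n. nrm A (x \<ominus> Y n) + nrm A x) \<longlonglongrightarrow> 0 + nrm A x" by (intro tendsto_intros Y(3))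
    ultimately show ?thesis using LIMSEQ_le[OF tendsto_norm[OF Y(4)]] by auto
  qed
  have lim_minus: "lim (x \<ominus> y) (c - d)" if "x \<in> carrier A" "lim x c" "y \<in> carrier A" "lim y d" for x y c d
    using lim_add[OF that(1,2) _ lim_smult[OF that(3,4), of "- 1"]] that unfolding a_minus_def
    by (simp add: uminus_eq_smult)
  have lim_unique: "c = d" if "x \<in> carrier A" "lim x c" "lim x d" for x c d
    using lim_bound[OF _ lim_minus[OF that(1,2,1,3)]] that(1) by (simp add: minus_self nrm_zero)
  have lim_closed: "\<exists>c. lim x c" if x: "x \<in> carrier A"
    and a: "\<And>e. e > 0 \<Longrightarrow> \<exists>y\<in>carrier A. (\<exists>c. lim y c) \<and> nrm A (x \<ominus> y) < e" for x
  proof -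
    \<comment> \<open>The approximants of \<open>x\<close> are themselves only limits, which costs another \<open>1 / real (Suc n)\<close>.\<close>
    have "\<exists>z d. z \<in> carrier A \<and> ev z d \<and> nrm A (x \<ominus> z) < 2 / real (Suc n)" for n
    proof -
      have pos: "1 / real (Suc n) > 0" by simp
      obtain y c where y: "y \<in> carrier A" "lim y c" "nrm A (x \<ominus> y) < 1 / real (Suc n)"
        using a[OF pos] by blast
      obtain Y b where Y: "\<And>n::nat. Y n \<in> carrier A" "\<And>n. ev (Y n) (b n)" "(\<lambda>n. nrm A (y \<ominus> Y n)) \<longlonglongrightarrow> 0"
        using limE[OF y(2)] by blast
      obtain m where "nrm A (y \<ominus> Y m) < 1 / real (Suc n)"
        using LIMSEQ_D[OF Y(3) pos] nrm_nonneg y(1) Y(1) by auto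
      then have "nrm A (x \<ominus> Y m) < 1 / real (Suc n) + 1 / real (Suc n)"
        using nrm_dist_triangle[OF x y(1) Y(1), of m] y(3) by linarith
      then show ?thesis using Y(1,2) by (intro exI[of _ "Y m"] exI[of _ "b m"]) simp
    qed
    then obtain z d where z: "\<And>n. z n \<in> carrier A" "\<And>n. ev (z n) (d n)" "\<And>n. nrm A (x \<ominus> z n) < 2 / real (Suc n)"
      by metis
    have z0: "(\<lambda>n. nrm A (x \<ominus> z n)) \<longlonglongrightarrow> 0"
    proof (rule squeeze)
      show "(\<lambda>n. 2 / real (Suc n)) \<longlonglongrightarrow> 0"
        using tendsto_mult_right_zero[OF LIMSEQ_inverse_real_of_nat, of 2] by (simp add: divide_inverse)
      show "nrm A (x \<ominus> z n) \<le> 2 / real (Suc n)" for n using z(3)[of n] by simp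
    qed (use nrm_nonneg x z(1) in simp)
    have "Cauchy d"
      unfolding Cauchy_iff
    proof (intro allI impI)
      fix e :: real assume "e > 0"
      then have e2: "e / 2 > 0" by simp
      obtain N where N0: "\<forall>n\<ge>N. norm (nrm A (x \<ominus> z n) - 0) < e / 2" using LIMSEQ_D[OF z0 e2] by blast
      have N: "nrm A (x \<ominus> z n) < e / 2" if "n \<ge> N" for n
        using N0[rule_format, OF that] nrm_nonneg[of "x \<ominus> z n"] x z(1) by simp
      have "cmod (d m - d n) < e" if "m \<ge> N" "n \<ge> N" for m n
      proof -
        have "cmod (d m - d n) \<le> nrm A (z m \<ominus> z n)"
          using lim_bound[OF _ lim_minus[OF z(1) lim_ev[OF z(1,2)] z(1) lim_ev[OF z(1,2)]]] z(1) by simp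
        also have "\<dots> \<le> nrm A (x \<ominus> z m) + nrm A (x \<ominus> z n)"
          using nrm_dist_triangle[OF z(1) x z(1), of m n] nrm_minus_commute[OF x z(1), of m] by simp
        finally show ?thesis using N[OF that(1)] N[OF that(2)] by simp
      qed
      then show "\<exists>M. \<forall>m\<ge>M. \<forall>n\<ge>M. cmod (d m - d n) < e" by blast
    qed
    then obtain c where "d \<longlonglongrightarrow> c" by (auto simp: Cauchy_convergent_iff convergent_def)
    then show ?thesis using limI[of z d x c] z(1,2) z0 by blast
  qed
  let ?D = "cstar_gen A X"
  note S = subalgebraD[OF cstar_subalgebra_gen[OF X]]
  have lim_gen: "lim x (h x)" if "x \<in> X" for x
    by (rule lim_ev[OF subsetD[OF X that] gen[OF that]])
  have ex: "\<exists>c. lim x c" if "x \<in> ?D" for x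
  proof (rule cstar_gen_induct[OF X sa _ _ _ _ _ _ that])
    obtain x where x: "x \<in> X" using ne by blast
    have "lim (0 \<odot> x) (0 * h x)" using lim_smult[OF _ lim_gen[OF x]] X x by blast
    moreover have "0 \<odot> x = \<zero>" using smult_l_null[of x] subsetD[OF X x] by simp
    ultimately show "\<exists>c. lim \<zero> c" by metis
    show "\<exists>c. lim x c" if "x \<in> X" for x using lim_gen[OF that] by blast
  qed (use lim_add lim_mult lim_smult lim_closed in blast)+
  define \<phi> where "\<phi> = restrict (\<lambda>x. THE c. lim x c) ?D"
  have \<phi>: "\<phi> x = c" if x: "x \<in> ?D" "lim x c" for x c
  proof -
    have "(THE c. lim x c) = c"
      by (rule the_equality[of "lim x", OF x(2)]) (rule lim_unique[OF S(1)[OF x(1)] _ x(2)])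
    then show ?thesis unfolding \<phi>_def using x(1) by simp
  qed
  have l: "lim x (\<phi> x)" if x: "x \<in> ?D" for x
  proof -
    obtain c where c: "lim x c" using ex[OF x] by (elim exE)
    then show ?thesis using \<phi>[OF x c] by simp
  qed
  have XD: "x \<in> ?D" if "x \<in> X" for x by (rule subsetD[OF cstar_gen_superset that])
  have "\<phi> \<in> spectrum A ?D"
    unfolding spectrum_def
  proof (intro CollectI conjI ballI allI)
    show "\<phi> \<in> extensional ?D" unfolding \<phi>_def by simp
    fix x assume x: "x \<in> ?D"
    show "\<phi> (c \<odot> x) = c * \<phi> x" for c by (rule \<phi>[OF S(6)[OF x] lim_smult[OF S(1)[OF x] l[OF x]]])
    fix y assume y: "y \<in> ?D"
    show "\<phi> (x \<oplus> y) = \<phi> x + \<phi> y"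
      by (rule \<phi>[OF S(3)[OF x y] lim_add[OF S(1)[OF x] l[OF x] S(1)[OF y] l[OF y]]])
    show "\<phi> (x \<otimes> y) = \<phi> x * \<phi> y"
      by (rule \<phi>[OF S(4)[OF x y] lim_mult[OF S(1)[OF x] l[OF x] S(1)[OF y] l[OF y]]])
  next
    obtain x where x: "x \<in> X" "h x \<noteq> 0" using ne by (elim bexE)
    then show "\<exists>x\<in>?D. \<phi> x \<noteq> 0" using XD[OF x(1)] \<phi>[OF XD[OF x(1)] lim_gen[OF x(1)]] by (intro bexI[of _ x]) simp_all
  qed
  moreover have "\<forall>x\<in>X. \<phi> x = h x" using \<phi>[OF XD lim_gen] by simp
  ultimately show ?thesis by (intro bexI[of _ \<phi>])
qed

text \<open>The hypotheses make \<open>(a - b)\<^sup>* (a - b)\<close> vanish, and the C*-identity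
  does the rest.\<close>

lemma eq_of_products:
  assumes ab: "a \<in> carrier A" "b \<in> carrier A"
    and q: "star A a \<otimes> b = star A a \<otimes> a" "star A b \<otimes> a = star A a \<otimes> a" "star A b \<otimes> b = star A a \<otimes> a"
  shows "a = b"
proof -
  have c: "star A a \<in> carrier A" "star A b \<in> carrier A" "star A a \<otimes> a \<in> carrier A"
    using ab star_closed mult_closed by auto
  have "star A (a \<ominus> b) \<otimes> (a \<ominus> b) = (star A a \<ominus> star A b) \<otimes> a \<ominus> (star A a \<ominus> star A b) \<otimes> b"
    using ab c by (simp add: star_minus mult_minus_right)
  also have "\<dots> = \<zero>" using ab c q by (simp add: mult_minus_left minus_self)
  finally have "(nrm A (a \<ominus> b))\<^sup>2 = 0" using cstar_identity[of "a \<ominus> b"] ab nrm_zero by simp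
  then have "a \<ominus> b = \<zero>" using nrm_eq_0[of "a \<ominus> b"] ab by simp
  then show ?thesis by (rule eq_of_minus_zero[OF ab])
qed

lemma finsum_sandwich:
  assumes ab: "a \<in> carrier A" "b \<in> carrier A" and F: "finite F"
  shows "g \<in> F \<rightarrow> carrier A \<Longrightarrow> a \<otimes> finsum A g F \<otimes> b = finsum A (\<lambda>i. a \<otimes> g i \<otimes> b) F"
  using F
proof (induction F)
  case empty
  then show ?case using ab by (simp add: mult_zero)
next
  case (insert i F)
  then have g: "g \<in> F \<rightarrow> carrier A" "g i \<in> carrier A" by auto
  then show ?case
    using insert ab by (simp add: mult_distrib_left mult_distrib_right mult_closed Pi_iff)
qed

lemma character_finsum:
  assumes D: "cstar_subalgebra A D" and \<phi>: "\<phi> \<in> spectrum A D" and F: "finite F"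
  shows "g \<in> F \<rightarrow> D \<Longrightarrow> finsum A g F \<in> D \<and> \<phi> (finsum A g F) = (\<Sum>i\<in>F. \<phi> (g i))"
  using F
proof (induction F)
  case empty
  then show ?case using subalgebraD(2)[OF D] character_zero[OF D \<phi>] by simp
next
  case (insert i F)
  have g: "g \<in> F \<rightarrow> carrier A" "g i \<in> carrier A" "g i \<in> D" using insert.prems subalgebraD(1)[OF D] by auto
  have IH: "finsum A g F \<in> D" "\<phi> (finsum A g F) = (\<Sum>i\<in>F. \<phi> (g i))" using insert by auto
  have e: "finsum A g (insert i F) = g i \<oplus> finsum A g F" using insert(1,2) g by simp
  show ?case
    unfolding e using subalgebraD(3)[OF D g(3) IH(1)] spectrumD(1)[OF \<phi> g(3) IH(1)] IH(2) insert(1,2) by simp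
qed

end

section \<open>Range projections of a representation\<close>

locale gbds_rep = gbds G + cstar_algebra A
  for G :: "('l, 'b::gen_boolean_algebra) gbds" and A :: "'c cstar" (structure) +
  fixes p :: "'b \<Rightarrow> 'c" and s :: "'l \<Rightarrow> 'b \<Rightarrow> 'c"
  assumes rep: "representation G A p s"
begin

lemma p_closed: "p B \<in> carrier A" and p_star: "star A (p B) = p B"
  and p_bot: "p bot = \<zero>" and p_inf: "p (inf B B') = p B \<otimes> p B'"
  and p_sup: "p (sup B B') = p B \<oplus> p B' \<ominus> p (inf B B')"
  and p_regular: "regular G B \<Longrightarrow>
    p B = finsum A (\<lambda>\<alpha>. s \<alpha> (act G \<alpha> B) \<otimes> star A (s \<alpha> (act G \<alpha> B))) (Delta G B)"
  using rep unfolding representation_def projection_def by simp_all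

lemma s_closed: "\<alpha> \<in> labels G \<Longrightarrow> B \<in> idl G \<alpha> \<Longrightarrow> s \<alpha> B \<in> carrier A"
  and p_s: "\<alpha> \<in> labels G \<Longrightarrow> B' \<in> idl G \<alpha> \<Longrightarrow> p B \<otimes> s \<alpha> B' = s \<alpha> B' \<otimes> p (act G \<alpha> B)"
  and s_s: "\<alpha> \<in> labels G \<Longrightarrow> \<alpha>' \<in> labels G \<Longrightarrow> B \<in> idl G \<alpha> \<Longrightarrow> B' \<in> idl G \<alpha>' \<Longrightarrow>
    star A (s \<alpha> B) \<otimes> s \<alpha>' B' = (if \<alpha> = \<alpha>' then p (inf B B') else \<zero>)"
  using rep unfolding representation_def partial_isometry_def by simp_all

text \<open>The products of adjoints with partial isometries are prescribed by the relations of a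
  representation; by the C*-identity they determine the partial isometries themselves.\<close>

lemma s_p:
  assumes \<alpha>: "\<alpha> \<in> labels G" and B: "B \<in> idl G \<alpha>"
  shows "s \<alpha> B \<otimes> p C = s \<alpha> (inf B C)"
proof (rule eq_of_products)
  have B': "inf B C \<in> idl G \<alpha>" by (rule ba_ideal_inf(1)[OF idl[OF \<alpha>] B])
  note c = s_closed[OF \<alpha> B] s_closed[OF \<alpha> B'] p_closed star_closed mult_closed
  show "s \<alpha> B \<otimes> p C \<in> carrier A" "s \<alpha> (inf B C) \<in> carrier A" using c by simp_all
  have st: "star A (s \<alpha> B \<otimes> p C) = p C \<otimes> star A (s \<alpha> B)" using c by (simp add: star_mult p_star)
  have 1: "star A (s \<alpha> B \<otimes> p C) \<otimes> (s \<alpha> B \<otimes> p C) = p (inf B C)"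
  proof -
    have "star A (s \<alpha> B \<otimes> p C) \<otimes> (s \<alpha> B \<otimes> p C) = p C \<otimes> (star A (s \<alpha> B) \<otimes> s \<alpha> B) \<otimes> p C"
      unfolding st using c by (simp add: mult_assoc)
    then show ?thesis using s_s[OF \<alpha> \<alpha> B B] by (simp flip: p_inf) (metis inf_commute inf_left_idem)
  qed
  have 2: "star A (s \<alpha> B \<otimes> p C) \<otimes> s \<alpha> (inf B C) = p (inf B C)"
  proof -
    have "star A (s \<alpha> B \<otimes> p C) \<otimes> s \<alpha> (inf B C) = p C \<otimes> (star A (s \<alpha> B) \<otimes> s \<alpha> (inf B C))"
      unfolding st using c by (simp add: mult_assoc)
    then show ?thesis using s_s[OF \<alpha> \<alpha> B B'] by (simp flip: p_inf) (metis inf_commute inf_left_idem)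
  qed
  have 3: "star A (s \<alpha> (inf B C)) \<otimes> (s \<alpha> B \<otimes> p C) = p (inf B C)"
  proof -
    have "star A (s \<alpha> (inf B C)) \<otimes> (s \<alpha> B \<otimes> p C) = star A (s \<alpha> (inf B C)) \<otimes> s \<alpha> B \<otimes> p C"
      using c by (simp add: mult_assoc)
    then show ?thesis using s_s[OF \<alpha> \<alpha> B' B] by (simp flip: p_inf) (metis inf_commute inf_left_idem)
  qed
  have 4: "star A (s \<alpha> (inf B C)) \<otimes> s \<alpha> (inf B C) = p (inf B C)" using s_s[OF \<alpha> \<alpha> B' B'] by simp
  show "star A (s \<alpha> B \<otimes> p C) \<otimes> s \<alpha> (inf B C) = star A (s \<alpha> B \<otimes> p C) \<otimes> (s \<alpha> B \<otimes> p C)"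
    "star A (s \<alpha> (inf B C)) \<otimes> (s \<alpha> B \<otimes> p C) = star A (s \<alpha> B \<otimes> p C) \<otimes> (s \<alpha> B \<otimes> p C)"
    "star A (s \<alpha> (inf B C)) \<otimes> s \<alpha> (inf B C) = star A (s \<alpha> B \<otimes> p C) \<otimes> (s \<alpha> B \<otimes> p C)"
    unfolding 1 2 3 4 by simp_all
qed

abbreviation sp where "sp \<equiv> s_prod G A s"
abbreviation t where "t \<equiv> s_word G A p s"
abbreviation e where "e \<equiv> range_proj G A p s"

lemma sp_props:
  assumes "w \<in> lists (labels G)" "w \<noteq> []" "B \<in> idl G (hd w)" "C \<in> idl G (last w)"
  shows "sp B w C \<in> carrier A" "p E \<otimes> sp B w C = sp B w C \<otimes> p (act_word G w E)"
    "sp B w C \<otimes> p F = sp B w (inf C F)"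
proof -
  have "sp B w C \<in> carrier A \<and> (\<forall>E. p E \<otimes> sp B w C = sp B w C \<otimes> p (act_word G w E)) \<and>
    (\<forall>F. sp B w C \<otimes> p F = sp B w (inf C F))"
    using assms
  proof (induction w arbitrary: B rule: list.induct)
    case (Cons \<alpha> w)
    show ?case
    proof (cases w)
      case Nil
      then show ?thesis using Cons.prems s_closed p_s s_p by simp
    next
      case (Cons \<beta> v)
      have l: "\<alpha> \<in> labels G" "\<beta> \<in> labels G" "B \<in> idl G \<alpha>" using Cons.prems Cons by auto
      let ?x = "sp (act G \<beta> B) (\<beta> # v) C"
      have IH: "?x \<in> carrier A" "\<And>E. p E \<otimes> ?x = ?x \<otimes> p (act_word G (\<beta> # v) E)"
        "\<And>F. ?x \<otimes> p F = sp (act G \<beta> B) (\<beta> # v) (inf C F)"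
        using Cons.IH[of "act G \<beta> B"] Cons.prems Cons act_idl by auto
      have sc: "s \<alpha> B \<in> carrier A" by (rule s_closed[OF l(1,3)])
      have "p E \<otimes> (s \<alpha> B \<otimes> ?x) = s \<alpha> B \<otimes> ?x \<otimes> p (act_word G (\<alpha> # w) E)" for E
      proof -
        have "p E \<otimes> (s \<alpha> B \<otimes> ?x) = (p E \<otimes> s \<alpha> B) \<otimes> ?x" using sc IH(1) p_closed by (simp add: mult_assoc)
        also have "\<dots> = s \<alpha> B \<otimes> (p (act G \<alpha> E) \<otimes> ?x)" unfolding p_s[OF l(1,3)] using sc IH(1) p_closed by (simp add: mult_assoc)
        also have "\<dots> = s \<alpha> B \<otimes> ?x \<otimes> p (act_word G (\<alpha> # w) E)"
          unfolding IH(2) Cons using sc IH(1) p_closed by (simp add: mult_assoc)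
        finally show ?thesis .
      qed
      moreover have "s \<alpha> B \<otimes> ?x \<otimes> p F = s \<alpha> B \<otimes> sp (act G \<beta> B) (\<beta> # v) (inf C F)" for F
        unfolding IH(3)[symmetric] using sc IH(1) p_closed by (simp add: mult_assoc)
      ultimately show ?thesis unfolding Cons using sc IH(1) mult_closed by simp
    qed
  qed simp
  then show "sp B w C \<in> carrier A" "p E \<otimes> sp B w C = sp B w C \<otimes> p (act_word G w E)"
    "sp B w C \<otimes> p F = sp B w (inf C F)" by auto
qed

lemma sp_absorb:
  assumes "w \<in> lists (labels G)" "w \<noteq> []" "B \<in> idl G (hd w)" "C \<in> idl G (last w)" "C \<le> act_word G w E"
  shows "p E \<otimes> sp B w C = sp B w C"
  using sp_props[OF assms(1-4)] assms(5) by (simp add: inf_absorb1)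

text \<open>The remaining product absorbs \<open>p B\<close> as well as \<open>p B'\<close>, so that
  the first factor may be cut down to \<open>s \<alpha> (inf B B')\<close>.\<close>

lemma sp_independent:
  assumes "w \<in> lists (labels G)" "w \<noteq> []" "B \<in> idl G (hd w)" "B' \<in> idl G (hd w)" "C \<in> idl G (last w)"
    "C \<le> act_word G (tl w) B" "C \<le> act_word G (tl w) B'"
  shows "sp B w C = sp B' w C"
  using assms
proof (induction w arbitrary: B B' rule: list.induct)
  case (Cons \<alpha> w)
  show ?case
  proof (cases w)
    case (Cons \<beta> v)
    have l: "\<alpha> \<in> labels G" "\<beta> \<in> labels G" "B \<in> idl G \<alpha>" "B' \<in> idl G \<alpha>" using Cons.prems Cons by auto
    have w: "w \<in> lists (labels G)" "w \<noteq> []" "C \<in> idl G (last w)" "act G \<beta> B \<in> idl G (hd w)" "act G \<beta> B' \<in> idl G (hd w)"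
      using Cons.prems Cons act_idl by auto
    have le: "C \<le> act_word G w B" "C \<le> act_word G w B'" using Cons.prems by auto
    let ?x = "sp (act G \<beta> B) w C"
    have eq: "sp (act G \<beta> B') w C = ?x"
      using Cons.IH[OF w(1,2,5,4,3)] le Cons by simp
    have xc: "?x \<in> carrier A" by (rule sp_props(1)[OF w(1,2,4,3)])
    have abs: "p B \<otimes> ?x = ?x" "p B' \<otimes> ?x = ?x"
      using sp_absorb[OF w(1,2,4,3)] le by auto
    have "s \<alpha> B \<otimes> ?x = s \<alpha> B \<otimes> p B' \<otimes> ?x"
      using s_closed[OF l(1,3)] p_closed xc abs by (simp add: mult_assoc)
    also have "\<dots> = s \<alpha> B' \<otimes> p B \<otimes> ?x"
      using s_p[OF l(1,3), of B'] s_p[OF l(1,4), of B] by (simp add: inf_commute)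
    also have "\<dots> = s \<alpha> B' \<otimes> ?x"
      using s_closed[OF l(1,4)] p_closed xc abs by (simp add: mult_assoc)
    finally show ?thesis using eq Cons by simp
  qed simp
qed simp

text \<open>The recursion on which all computations with words rest. Any admissible \<open>B\<close>
  may be used, so that two words with the same first letter can be treated with a common
  \<open>B\<close>.\<close>

lemma t_Cons:
  assumes \<alpha>: "\<alpha> \<in> labels G" and w: "w \<in> lists (labels G)"
    and B: "B \<in> idl G \<alpha>" and C: "C \<le> act_word G w B"
  shows "t (\<alpha> # w) C = s \<alpha> B \<otimes> t w C"
proof (cases w)
  case Nil
  then show ?thesis using s_p[OF \<alpha> B, of C] C by (simp add: inf_absorb2)
next
  case (Cons \<beta> v)
  have \<beta>: "\<beta> \<in> labels G" "v \<in> lists (labels G)" using w Cons by auto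
  let ?B0 = "SOME B. B \<in> idl G \<alpha> \<and> C \<le> act_word G w B"
  let ?B1 = "SOME B. B \<in> idl G \<beta> \<and> C \<le> act_word G v B"
  have B0: "?B0 \<in> idl G \<alpha> \<and> C \<le> act_word G w ?B0" by (rule someI[of _ B]) (use B C in simp)
  have B1: "?B1 \<in> idl G \<beta> \<and> C \<le> act_word G v ?B1"
    by (rule someI[of _ "act G \<beta> B"]) (use C Cons act_idl \<beta> in simp)
  have CI: "C \<in> idl G (last w)"
  proof -
    have "C \<in> idl_word G w" unfolding Cons idl_word.simps using B1 by blast
    then have "C \<in> idl_word G (butlast w @ [last w])" using Cons by (metis append_butlast_last_id list.distinct(1))
    moreover have "butlast w \<in> lists (labels G)" "last w \<in> labels G"
      using w Cons by (auto dest: in_set_butlastD simp: in_listsD)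
    ultimately show ?thesis by (rule idl_word_last[rotated 2])
  qed
  have "t (\<alpha> # w) C = sp ?B0 (\<alpha> # w) C" by simp
  also have "\<dots> = sp B (\<alpha> # w) C"
    by (rule sp_independent) (use \<alpha> w B B0 CI C Cons in auto)
  also have "\<dots> = s \<alpha> B \<otimes> sp (act G \<beta> B) w C" unfolding Cons by simp
  also have "sp (act G \<beta> B) w C = sp ?B1 w C"
    by (rule sp_independent) (use w B1 CI C Cons act_idl \<beta> in auto)
  also have "sp ?B1 w C = t w C" unfolding Cons by simp
  finally show ?thesis .
qed

lemma t_closed: "w \<in> lists (labels G) \<Longrightarrow> C \<in> idl_word G w \<Longrightarrow> t w C \<in> carrier A"
proof (induction w)
  case Nil
  then show ?case using p_closed by simp
next
  case (Cons \<alpha> w)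
  then have l: "\<alpha> \<in> labels G" "w \<in> lists (labels G)" by auto
  obtain B where B: "B \<in> idl G \<alpha>" "C \<le> act_word G w B" using idl_word_ConsD(1)[OF l(2,1) Cons.prems(2)] by auto
  show ?case
    unfolding t_Cons[OF l B] by (rule mult_closed[OF s_closed[OF l(1) B(1)] Cons.IH[OF l(2) idl_word_ConsD(2)[OF l(2,1) Cons.prems(2)]]])
qed

lemma t_p: "w \<in> lists (labels G) \<Longrightarrow> C \<in> idl_word G w \<Longrightarrow> t w C \<otimes> p F = t w (inf C F)"
proof (induction w)
  case Nil
  then show ?case using p_inf by simp
next
  case (Cons \<alpha> w)
  then have l: "\<alpha> \<in> labels G" "w \<in> lists (labels G)" by auto
  obtain B where B: "B \<in> idl G \<alpha>" "C \<le> act_word G w B" using idl_word_ConsD(1)[OF l(2,1) Cons.prems(2)] by auto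
  have CI: "C \<in> idl_word G w" by (rule idl_word_ConsD(2)[OF l(2,1) Cons.prems(2)])
  have "inf C F \<le> act_word G w B" using B(2) by (rule le_infI1)
  then show ?case
    unfolding t_Cons[OF l B] using t_Cons[OF l B(1), of "inf C F"] Cons.IH[OF l(2) CI]
      s_closed[OF l(1) B(1)] t_closed[OF l(2) CI] p_closed by (simp add: mult_assoc del: s_word.simps)
qed

lemma p_t: "w \<in> lists (labels G) \<Longrightarrow> C \<in> idl_word G w \<Longrightarrow> p E \<otimes> t w C = t w (inf C (act_word G w E))"
proof (induction w arbitrary: E)
  case Nil
  then show ?case by (simp add: p_inf[symmetric] inf_commute)
next
  case (Cons \<alpha> w)
  then have l: "\<alpha> \<in> labels G" "w \<in> lists (labels G)" by auto
  obtain B where B: "B \<in> idl G \<alpha>" "C \<le> act_word G w B" using idl_word_ConsD(1)[OF l(2,1) Cons.prems(2)] by auto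
  have CI: "C \<in> idl_word G w" by (rule idl_word_ConsD(2)[OF l(2,1) Cons.prems(2)])
  have le: "inf C (act_word G w (act G \<alpha> E)) \<le> act_word G w B" using B(2) by (rule le_infI1)
  note c = s_closed[OF l(1) B(1)] t_closed[OF l(2) CI] p_closed
  have "p E \<otimes> (s \<alpha> B \<otimes> t w C) = (p E \<otimes> s \<alpha> B) \<otimes> t w C" using c by (simp add: mult_assoc)
  also have "\<dots> = s \<alpha> B \<otimes> (p (act G \<alpha> E) \<otimes> t w C)" unfolding p_s[OF l(1) B(1)] using c by (simp add: mult_assoc)
  also have "\<dots> = t (\<alpha> # w) (inf C (act_word G w (act G \<alpha> E)))"
    unfolding Cons.IH[OF l(2) CI] t_Cons[OF l B(1) le] by simp
  finally show ?case unfolding t_Cons[OF l B] act_word_Cons .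
qed

lemma e_closed: "w \<in> lists (labels G) \<Longrightarrow> C \<in> idl_word G w \<Longrightarrow> e w C \<in> carrier A"
  unfolding range_proj_def using t_closed star_closed mult_closed by simp

lemma e_star: "w \<in> lists (labels G) \<Longrightarrow> C \<in> idl_word G w \<Longrightarrow> star A (e w C) = e w C"
  unfolding range_proj_def using t_closed star_closed by (simp add: star_mult star_star)

lemma e_Nil: "e [] C = p C"
  unfolding range_proj_def using p_inf[of C C] by (simp add: p_star)

lemma e_Cons:
  assumes l: "\<alpha> \<in> labels G" "w \<in> lists (labels G)" and B: "B \<in> idl G \<alpha>" "C \<le> act_word G w B"
  shows "e (\<alpha> # w) C = s \<alpha> B \<otimes> e w C \<otimes> star A (s \<alpha> B)"
proof -
  have "C \<in> idl_word G w" using idl_word_ConsD(2)[OF l(2,1), of C] B by auto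
  then show ?thesis
    unfolding range_proj_def t_Cons[OF l B]
    using t_closed[OF l(2)] s_closed[OF l(1) B(1)] star_closed mult_closed by (simp add: star_mult mult_assoc)
qed

lemma e_t_p_t:
  assumes w: "w \<in> lists (labels G)" and C: "C \<in> idl_word G w"
  shows "e w (inf C F) = t w C \<otimes> p F \<otimes> star A (t w C)"
proof -
  note c = t_closed[OF w C] p_closed star_closed mult_closed
  have "e w (inf C F) = t w C \<otimes> p F \<otimes> (p F \<otimes> star A (t w C))"
    unfolding range_proj_def t_p[OF w C, symmetric] using c by (simp add: star_mult p_star)
  also have "\<dots> = t w C \<otimes> (p F \<otimes> p F) \<otimes> star A (t w C)" using c by (simp add: mult_assoc)
  finally show ?thesis using p_inf[of F F] by simp
qed

lemma e_sub:
  assumes w: "w \<in> lists (labels G)" and C: "C \<in> idl_word G w" and F: "F \<le> C"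
  shows "e w F = t w C \<otimes> p F \<otimes> star A (t w C)"
  using e_t_p_t[OF w C, of F] F by (simp add: inf_absorb2)

lemma p_e:
  assumes w: "w \<in> lists (labels G)" and C: "C \<in> idl_word G w"
  shows "p E \<otimes> e w C = e w (inf C (act_word G w E))"
  using e_t_p_t[OF w C] p_t[OF w C] t_p[OF w C] t_closed[OF w C] p_closed star_closed
  unfolding range_proj_def by (simp add: mult_assoc[symmetric])

lemma e_bot: "w \<in> lists (labels G) \<Longrightarrow> e w bot = \<zero>"
  using e_sub[of w bot bot] ba_ideal_bot[OF idl_word_ideal] t_closed star_closed
  by (simp add: p_bot mult_zero)

lemma e_sup:
  assumes w: "w \<in> lists (labels G)" and C: "C \<in> idl_word G w" "C' \<in> idl_word G w"
  shows "e w (sup C C') = e w C \<oplus> e w C' \<ominus> e w (inf C C')"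
proof -
  let ?T = "t w (sup C C')"
  have I: "sup C C' \<in> idl_word G w" by (rule ba_ideal_sup[OF idl_word_ideal[OF w] C])
  note s = e_sub[OF w I]
  note c = t_closed[OF w I] p_closed star_closed mult_closed
  have le: "inf C C' \<le> sup C C'" by (simp add: le_infI1)
  show ?thesis
    unfolding s[of C, OF sup_ge1] s[of C', OF sup_ge2] s[of "sup C C'", OF order_refl] s[of "inf C C'", OF le]
    using c by (simp add: p_sup mult_minus_right mult_minus_left mult_distrib_left mult_distrib_right)
qed

lemma s_e_s_mult:
  assumes \<alpha>: "\<alpha> \<in> labels G" and B: "B \<in> idl G \<alpha>" and w: "v \<in> lists (labels G)" "C \<in> idl_word G v"
    and C: "C \<le> act_word G v B" and x: "x \<in> carrier A"
  shows "(s \<alpha> B \<otimes> x \<otimes> star A (s \<alpha> B)) \<otimes> (s \<alpha> B \<otimes> e v C \<otimes> star A (s \<alpha> B)) =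
    s \<alpha> B \<otimes> (x \<otimes> e v C) \<otimes> star A (s \<alpha> B)"
proof -
  note c = s_closed[OF \<alpha> B] e_closed[OF w] star_closed mult_closed p_closed x
  have pe: "p B \<otimes> e v C = e v C" using p_e[OF w, of B] C by (simp add: inf_absorb1)
  have "(s \<alpha> B \<otimes> x \<otimes> star A (s \<alpha> B)) \<otimes> (s \<alpha> B \<otimes> e v C \<otimes> star A (s \<alpha> B)) =
    s \<alpha> B \<otimes> x \<otimes> ((star A (s \<alpha> B) \<otimes> s \<alpha> B) \<otimes> e v C) \<otimes> star A (s \<alpha> B)"
    using c by (simp add: mult_assoc)
  also have "\<dots> = s \<alpha> B \<otimes> x \<otimes> e v C \<otimes> star A (s \<alpha> B)"
    using s_s[OF \<alpha> \<alpha> B B] pe by simp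
  finally show ?thesis using c by (simp add: mult_assoc)
qed

text \<open>Stripping common first letters reduces this to \<open>w = []\<close>, where it says how
  \<open>p C\<close> moves past the partial isometry of \<open>v\<close>.\<close>

lemma e_mult_prefix:
  "w \<in> lists (labels G) \<Longrightarrow> v \<in> lists (labels G) \<Longrightarrow> C \<in> idl_word G w \<Longrightarrow> C' \<in> idl_word G (w @ v) \<Longrightarrow>
    e w C \<otimes> e (w @ v) C' = e (w @ v) (inf C' (act_word G v C))"
proof (induction w)
  case Nil
  then show ?case using p_e by (simp add: e_Nil)
next
  case (Cons \<alpha> w)
  then have l: "\<alpha> \<in> labels G" "w \<in> lists (labels G)" "w @ v \<in> lists (labels G)" by auto
  have C: "C' \<in> idl_word G (\<alpha> # (w @ v))" using Cons.prems by simp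
  obtain B1 where B1: "B1 \<in> idl G \<alpha>" "C \<le> act_word G w B1" using idl_word_ConsD(1)[OF l(2,1) Cons.prems(3)] by auto
  obtain B2 where B2: "B2 \<in> idl G \<alpha>" "C' \<le> act_word G (w @ v) B2" using idl_word_ConsD(1)[OF l(3,1) C] by auto
  obtain B where B: "B \<in> idl G \<alpha>" "B1 \<le> B" "B2 \<le> B" using idl_common[OF l(1) B1(1) B2(1)] by auto
  have le: "C \<le> act_word G w B" "C' \<le> act_word G (w @ v) B"
    using B1(2) B2(2) act_word_mono[OF l(2) B(2)] act_word_mono[OF l(3) B(3)] by (auto intro: order_trans)
  have I: "C \<in> idl_word G w" "C' \<in> idl_word G (w @ v)"
    using idl_word_ConsD(2)[OF l(2,1) Cons.prems(3)] idl_word_ConsD(2)[OF l(3,1) C] by auto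
  have "inf C' (act_word G v C) \<le> act_word G (w @ v) B" using le(2) by (rule le_infI1)
  then show ?case
    using e_Cons[OF l(1,2) B(1) le(1)] e_Cons[OF l(1,3) B(1) le(2)] e_Cons[OF l(1,3) B(1)]
      s_e_s_mult[OF l(1) B(1) l(3) I(2) le(2) e_closed[OF l(2) I(1)]]
      Cons.IH[OF l(2) Cons.prems(2) I] by simp
qed

text \<open>After common first letters are stripped, the words start with different letters, whose
  partial isometries have orthogonal ranges.\<close>

lemma e_mult_incomparable:
  "w \<in> lists (labels G) \<Longrightarrow> w' \<in> lists (labels G) \<Longrightarrow> C \<in> idl_word G w \<Longrightarrow> C' \<in> idl_word G w' \<Longrightarrow>
    \<not> (\<exists>v. w' = w @ v \<or> w = w' @ v) \<Longrightarrow> e w C \<otimes> e w' C' = \<zero>"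
proof (induction w arbitrary: w')
  case Nil
  then show ?case by (metis append_Nil)
next
  case (Cons \<alpha> w)
  obtain \<beta> v where w': "w' = \<beta> # v" using Cons.prems(5) by (cases w') auto
  have l: "\<alpha> \<in> labels G" "w \<in> lists (labels G)" "\<beta> \<in> labels G" "v \<in> lists (labels G)" using Cons.prems w' by auto
  have C': "C' \<in> idl_word G (\<beta> # v)" using Cons.prems w' by simp
  obtain B1 where B1: "B1 \<in> idl G \<alpha>" "C \<le> act_word G w B1" using idl_word_ConsD(1)[OF l(2,1) Cons.prems(3)] by auto
  obtain B2 where B2: "B2 \<in> idl G \<beta>" "C' \<le> act_word G v B2" using idl_word_ConsD(1)[OF l(4,3) C'] by auto
  have I: "C \<in> idl_word G w" "C' \<in> idl_word G v"
    using idl_word_ConsD(2)[OF l(2,1) Cons.prems(3)] idl_word_ConsD(2)[OF l(4,3) C'] by auto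
  note c = s_closed[OF l(1) B1(1)] s_closed[OF l(3) B2(1)] e_closed[OF l(2) I(1)] e_closed[OF l(4) I(2)] star_closed mult_closed
  show ?case
  proof (cases "\<alpha> = \<beta>")
    case False
    have "e (\<alpha> # w) C \<otimes> e (\<beta> # v) C' =
      s \<alpha> B1 \<otimes> e w C \<otimes> ((star A (s \<alpha> B1) \<otimes> s \<beta> B2) \<otimes> (e v C' \<otimes> star A (s \<beta> B2)))"
      unfolding e_Cons[OF l(1,2) B1] e_Cons[OF l(3,4) B2] using c by (simp add: mult_assoc)
    also have "\<dots> = \<zero>" using s_s[OF l(1,3) B1(1) B2(1)] False c by (simp add: mult_zero)
    finally show ?thesis unfolding w' .
  next
    case True
    obtain B where B: "B \<in> idl G \<alpha>" "B1 \<le> B" "B2 \<le> B" using idl_common[OF l(1) B1(1)] B2(1) True by auto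
    have le: "C \<le> act_word G w B" "C' \<le> act_word G v B"
      using B1(2) B2(2) act_word_mono[OF l(2) B(2)] act_word_mono[OF l(4) B(3)] by (auto intro: order_trans)
    have "e w C \<otimes> e v C' = \<zero>"
      by (rule Cons.IH[OF l(2,4) I]) (use Cons.prems(5) w' True in simp)
    then show ?thesis
      unfolding w' True[symmetric] e_Cons[OF l(1,2) B(1) le(1)] e_Cons[OF l(1,4) B(1) le(2)]
      using s_e_s_mult[OF l(1) B(1) l(4) I(2) le(2) e_closed[OF l(2) I(1)]] s_closed[OF l(1) B(1)] star_closed
      by (simp add: mult_zero)
  qed
qed

lemma t_snoc:
  "w \<in> lists (labels G) \<Longrightarrow> \<alpha> \<in> labels G \<Longrightarrow> C \<in> idl_word G w \<Longrightarrow>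
    t (w @ [\<alpha>]) (act G \<alpha> C) = t w C \<otimes> s \<alpha> (act G \<alpha> C)"
proof (induction w)
  case Nil
  then show ?case using p_s[OF Nil.prems(2) act_idl[OF Nil.prems(2)], of C C] s_p[OF Nil.prems(2) act_idl[OF Nil.prems(2)], of C "act G \<alpha> C"] by simp
next
  case (Cons \<beta> w)
  then have l: "\<beta> \<in> labels G" "w \<in> lists (labels G)" "w @ [\<alpha>] \<in> lists (labels G)" by auto
  obtain B where B: "B \<in> idl G \<beta>" "C \<le> act_word G w B" using idl_word_ConsD(1)[OF l(2,1) Cons.prems(3)] by auto
  have CI: "C \<in> idl_word G w" by (rule idl_word_ConsD(2)[OF l(2,1) Cons.prems(3)])
  have le: "act G \<alpha> C \<le> act_word G (w @ [\<alpha>]) B" using act_mono[OF Cons.prems(2) B(2)] by simp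
  have "t (\<beta> # (w @ [\<alpha>])) (act G \<alpha> C) = s \<beta> B \<otimes> (t w C \<otimes> s \<alpha> (act G \<alpha> C))"
    unfolding t_Cons[OF l(1,3) B(1) le] Cons.IH[OF l(2) Cons.prems(2) CI] ..
  then show ?case
    unfolding t_Cons[OF l(1,2) B] append_Cons
    using s_closed[OF l(1) B(1)] t_closed[OF l(2) CI] s_closed[OF Cons.prems(2) act_idl[OF Cons.prems(2)]]
    by (simp add: mult_assoc)
qed

text \<open>The relation for the regular element \<open>C\<close>, conjugated by the partial
  isometry of \<open>w\<close>.\<close>

lemma e_regular:
  assumes w: "w \<in> lists (labels G)" and C: "C \<in> idl_word G w" and r: "regular G C" and ne: "C \<noteq> bot"
  shows "finite (Delta G C)" "e w C = finsum A (\<lambda>\<alpha>. e (w @ [\<alpha>]) (act G \<alpha> C)) (Delta G C)"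
proof -
  show fin: "finite (Delta G C)" using r ne unfolding regular_def by auto
  have \<alpha>: "\<alpha> \<in> labels G" if "\<alpha> \<in> Delta G C" for \<alpha> using that unfolding Delta_def by simp
  note c = t_closed[OF w C] star_closed mult_closed
  let ?g = "\<lambda>\<alpha>. s \<alpha> (act G \<alpha> C) \<otimes> star A (s \<alpha> (act G \<alpha> C))"
  have g: "?g \<in> Delta G C \<rightarrow> carrier A" using s_closed[OF \<alpha> act_idl[OF \<alpha>]] c by simp
  have "e w C = t w C \<otimes> p C \<otimes> star A (t w C)" by (rule e_sub[OF w C order_refl])
  also have "\<dots> = finsum A (\<lambda>\<alpha>. t w C \<otimes> ?g \<alpha> \<otimes> star A (t w C)) (Delta G C)"
    unfolding p_regular[OF r] by (rule finsum_sandwich[OF c(1) c(2)[OF c(1)] fin g])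
  also have "\<dots> = finsum A (\<lambda>\<alpha>. e (w @ [\<alpha>]) (act G \<alpha> C)) (Delta G C)"
  proof (rule finsum_cong'[OF refl])
    have "act_word G [\<alpha>] C \<in> idl_word G (w @ [\<alpha>])" if "\<alpha> \<in> Delta G C" for \<alpha>
      by (rule idl_word_act[OF w _ C]) (use \<alpha>[OF that] in simp)
    then show "(\<lambda>\<alpha>. e (w @ [\<alpha>]) (act G \<alpha> C)) \<in> Delta G C \<rightarrow> carrier A"
      using e_closed w \<alpha> by simp
    fix \<alpha> assume a: "\<alpha> \<in> Delta G C"
    note sc = s_closed[OF \<alpha>[OF a] act_idl[OF \<alpha>[OF a]], of C]
    show "t w C \<otimes> ?g \<alpha> \<otimes> star A (t w C) = e (w @ [\<alpha>]) (act G \<alpha> C)"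
      unfolding range_proj_def t_snoc[OF w \<alpha>[OF a] C] using c sc by (simp add: star_mult mult_assoc)
  qed
  finally show "e w C = finsum A (\<lambda>\<alpha>. e (w @ [\<alpha>]) (act G \<alpha> C)) (Delta G C)" .
qed

end

section \<open>The representation on boundary paths\<close>

context gbds
begin

fun shift :: "('l, 'b) path \<Rightarrow> ('l, 'b) path" where
  "shift (Vertex \<xi>) = Vertex \<xi>"
| "shift (FinPath es) = (if tl es = [] then Vertex (edge_d (hd es)) else FinPath (tl es))"
| "shift (InfPath f) = InfPath (\<lambda>i. f (Suc i))"

fun prepend :: "('l, 'b) edge \<Rightarrow> ('l, 'b) path \<Rightarrow> ('l, 'b) path" where
  "prepend e (Vertex \<xi>) = FinPath [e]"
| "prepend e (FinPath es) = FinPath (e # es)"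
| "prepend e (InfPath f) = InfPath (\<lambda>i. case i of 0 \<Rightarrow> e | Suc j \<Rightarrow> f j)"

lemma prepend_shift:
  "is_path \<nu> \<Longrightarrow> enat 0 < path_length \<nu> \<Longrightarrow> prepend (path_edge \<nu> 0) (shift \<nu>) = \<nu>"
proof (cases \<nu>)
  case (FinPath es)
  assume "is_path \<nu>"
  then obtain e es' where "es = e # es'" using FinPath unfolding is_path_def by (cases es) auto
  then show ?thesis using FinPath by simp
next
  case (InfPath f)
  have "(\<lambda>i. case i of 0 \<Rightarrow> f 0 | Suc j \<Rightarrow> f (Suc j)) = f"
    by (rule ext) (simp split: nat.split)
  then show ?thesis using InfPath by simp
qed (simp add: zero_enat_def)

lemma shift_length:
  "is_path \<nu> \<Longrightarrow> enat 0 < path_length \<nu> \<Longrightarrow> enat n \<le> path_length (shift \<nu>) \<longleftrightarrow> enat (Suc n) \<le> path_length \<nu>"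
proof (cases \<nu>)
  case (FinPath es)
  assume "is_path \<nu>"
  then obtain e es' where "es = e # es'" using FinPath unfolding is_path_def by (cases es) auto
  then show ?thesis using FinPath by (simp add: zero_enat_def)
qed (simp_all add: zero_enat_def)

lemma shift_edge:
  "is_path \<nu> \<Longrightarrow> enat (Suc i) < path_length \<nu> \<Longrightarrow> path_edge (shift \<nu>) i = path_edge \<nu> (Suc i)"
proof (cases \<nu>)
  case (FinPath es)
  assume "is_path \<nu>" "enat (Suc i) < path_length \<nu>"
  then obtain e es' where es: "es = e # es'" "Suc i < length es" using FinPath unfolding is_path_def by (cases es) auto
  then have "es' \<noteq> []" by auto
  then show ?thesis using FinPath es by simp
qed (simp_all add: zero_enat_def)

lemma shift_r:
  "is_path \<nu> \<Longrightarrow> enat 0 < path_length \<nu> \<Longrightarrow> path_r G (shift \<nu>) = edge_d (path_edge \<nu> 0)"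
proof (cases \<nu>)
  case (FinPath es)
  assume p: "is_path \<nu>" "enat 0 < path_length \<nu>"
  then obtain e es' where es: "es = e # es'" using FinPath unfolding is_path_def by (cases es) auto
  show ?thesis
  proof (cases es')
    case Nil
    then show ?thesis using FinPath es by simp
  next
    case (Cons e' es'')
    have "edge_d (path_edge \<nu> 0) = edge_r G (path_edge \<nu> (Suc 0))"
      using p FinPath es Cons unfolding is_path_def by auto
    then show ?thesis using FinPath es Cons by simp
  qed
qed (auto simp: zero_enat_def is_path_def)

lemma shift_vtx:
  assumes \<nu>: "is_path \<nu>" and n: "enat (Suc n) \<le> path_length \<nu>"
  shows "vtx (shift \<nu>) n = vtx \<nu> (Suc n)"
proof (cases n)
  case 0
  have "enat 0 < path_length \<nu>" using n 0 by (simp add: Suc_ile_eq)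
  then show ?thesis using shift_r[OF \<nu>] 0 unfolding vtx_def by simp
next
  case (Suc m)
  then have "enat (Suc m) < path_length \<nu>" using n by (simp add: Suc_ile_eq)
  then show ?thesis using shift_edge[OF \<nu>] Suc unfolding vtx_def by simp
qed

lemma shift_wd:
  assumes \<nu>: "is_path \<nu>"
  shows "enat (Suc n) \<le> path_length \<nu> \<Longrightarrow> wd \<nu> (Suc n) = fst (path_edge \<nu> 0) # wd (shift \<nu>) n"
proof (induction n)
  case 0
  then show ?case by (simp add: wd_Suc)
next
  case (Suc n)
  then have "enat (Suc n) < path_length \<nu>" by (simp add: Suc_ile_eq)
  then show ?case using Suc.IH[OF less_imp_le] shift_edge[OF \<nu>] by (simp add: wd_Suc)
qed

lemma shift_is_path:
  assumes p: "is_path \<nu>" "enat 0 < path_length \<nu>" shows "is_path (shift \<nu>)"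
proof -
  have lt: "enat (Suc i) < path_length \<nu>" if "enat i < path_length (shift \<nu>)" for i
    using that shift_length[OF p, of "Suc i"] by (simp add: Suc_ile_eq)
  have e: "path_edge (shift \<nu>) i \<in> edges" if "enat i < path_length (shift \<nu>)" for i
    using path_edge_edges[OF p(1) lt[OF that]] shift_edge[OF p(1) lt[OF that]] by simp
  have a: "edge_d (path_edge (shift \<nu>) i) = edge_r G (path_edge (shift \<nu>) (Suc i))"
    if i: "enat (Suc i) < path_length (shift \<nu>)" for i
  proof -
    have i': "enat i < path_length (shift \<nu>)" using i by (meson enat_ord_simps(2) lessI less_trans)
    have "edge_d (path_edge \<nu> (Suc i)) = edge_r G (path_edge \<nu> (Suc (Suc i)))"
      using p(1) lt[OF i] unfolding is_path_def by blast
    then show ?thesis using shift_edge[OF p(1) lt[OF i]] shift_edge[OF p(1) lt[OF i']] by simp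
  qed
  have "case shift \<nu> of Vertex \<xi> \<Rightarrow> \<xi> \<in> ultrafilters UNIV | FinPath es \<Rightarrow> es \<noteq> [] | InfPath f \<Rightarrow> True"
  proof (cases \<nu>)
    case (FinPath es)
    then have "es \<noteq> []" using p unfolding is_path_def by auto
    then have "edge_d (hd es) \<in> ultrafilters UNIV"
      using edge_d_ultrafilter[OF path_edge_edges[OF p]] FinPath by (simp add: hd_conv_nth)
    then show ?thesis using FinPath by simp
  qed (use p in \<open>simp_all add: zero_enat_def\<close>)
  then show ?thesis unfolding is_path_def[of "shift \<nu>"] using e a by blast
qed

lemma shift_path_d:
  "is_path \<nu> \<Longrightarrow> enat 0 < path_length \<nu> \<Longrightarrow> path_length (shift \<nu>) \<noteq> \<infinity> \<Longrightarrow>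
    path_length \<nu> \<noteq> \<infinity> \<and> path_d (shift \<nu>) = path_d \<nu>"
proof (cases \<nu>)
  case (FinPath es)
  assume "is_path \<nu>"
  then obtain e es' where "es = e # es'" using FinPath unfolding is_path_def by (cases es) auto
  then show ?thesis using FinPath by simp
qed (simp_all add: zero_enat_def)

lemma shift_boundary:
  assumes \<nu>: "\<nu> \<in> boundary_paths G" and l: "enat 0 < path_length \<nu>"
  shows "shift \<nu> \<in> boundary_paths G"
proof -
  have p: "is_path \<nu>" using \<nu> boundary_paths_iff by simp
  show ?thesis
    using \<nu> shift_is_path[OF p l] shift_path_d[OF p l] unfolding boundary_paths_iff by auto
qed

lemma prepend_boundary:
  assumes \<mu>: "\<mu> \<in> boundary_paths G" and e: "e \<in> edges" and d: "edge_d e = path_r G \<mu>"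
  shows "prepend e \<mu> \<in> boundary_paths G" "enat 0 < path_length (prepend e \<mu>)"
    "path_edge (prepend e \<mu>) 0 = e" "shift (prepend e \<mu>) = \<mu>"
proof -
  have p: "is_path \<mu>" using \<mu> boundary_paths_iff by simp
  show l: "enat 0 < path_length (prepend e \<mu>)" by (cases \<mu>) (auto simp: zero_enat_def)
  show e0: "path_edge (prepend e \<mu>) 0 = e" by (cases \<mu>) auto
  show s: "shift (prepend e \<mu>) = \<mu>" using p d unfolding is_path_def by (cases \<mu>) auto
  have "is_path (prepend e \<mu>)"
  proof (cases \<mu>)
    case (Vertex \<xi>)
    then show ?thesis using e unfolding is_path_def by (auto simp: zero_enat_def)
  next
    case (FinPath es)
    have es: "es \<noteq> []" "\<And>i. i < length es \<Longrightarrow> es ! i \<in> edges"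
      "\<And>i. Suc i < length es \<Longrightarrow> edge_d (es ! i) = edge_r G (es ! Suc i)"
      using p FinPath unfolding is_path_def by auto
    have "(e # es) ! i \<in> edges" if "i < Suc (length es)" for i using that e es(2) by (cases i) auto
    moreover have "edge_d ((e # es) ! i) = edge_r G ((e # es) ! Suc i)" if "Suc i < Suc (length es)" for i
      using that d es(1,3) FinPath by (cases i) (auto simp: hd_conv_nth)
    ultimately show ?thesis unfolding is_path_def FinPath by simp
  next
    case (InfPath f)
    have f: "\<And>i. f i \<in> edges" "\<And>i. edge_d (f i) = edge_r G (f (Suc i))"
      using p InfPath unfolding is_path_def by auto
    show ?thesis unfolding is_path_def InfPath using e d f InfPath by (auto split: nat.split)
  qed
  moreover have "path_length (prepend e \<mu>) \<noteq> \<infinity> \<longrightarrow> path_length \<mu> \<noteq> \<infinity> \<and> path_d (prepend e \<mu>) = path_d \<mu>"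
    using p d unfolding is_path_def by (cases \<mu>) auto
  ultimately show "prepend e \<mu> \<in> boundary_paths G"
    using \<mu> unfolding boundary_paths_iff by auto
qed

lemma cylinder_Cons_iff:
  assumes \<alpha>: "\<alpha> \<in> labels G" and w: "w \<in> lists (labels G)" and A: "A \<in> idl_word G (\<alpha> # w)"
    and \<mu>: "\<mu> \<in> boundary_paths G" and l: "enat 0 < path_length \<mu>"
  shows "\<mu> \<in> cylinder G (\<alpha> # w) A \<longleftrightarrow> fst (path_edge \<mu> 0) = \<alpha> \<and> shift \<mu> \<in> cylinder G w A"
proof -
  have p: "is_path \<mu>" using \<mu> boundary_paths_iff by simp
  have Aw: "A \<in> idl_word G w"
    using idl_word_suffix[of w A "[\<alpha>]"] w A by (cases "w = []") auto
  have w': "\<alpha> # w \<in> lists (labels G)" using \<alpha> w by simp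
  show ?thesis
    unfolding cylinder_iff[OF w' A] cylinder_iff[OF w Aw] length_Cons
    using \<mu> shift_boundary[OF \<mu> l] shift_length[OF p l, of "length w"] shift_vtx[OF p, of "length w"]
      shift_wd[OF p, of "length w"] by auto
qed

lemma cylinder_Cons_imp:
  assumes \<alpha>: "\<alpha> \<in> labels G" and w: "w \<in> lists (labels G)" and A: "A \<in> idl_word G (\<alpha> # w)"
    and B: "A \<le> act_word G w B" and \<mu>: "\<mu> \<in> cylinder G (\<alpha> # w) A"
  shows "enat 0 < path_length \<mu>" "fst (path_edge \<mu> 0) = \<alpha>" "B \<in> edge_d (path_edge \<mu> 0)"
proof -
  have w': "\<alpha> # w \<in> lists (labels G)" using \<alpha> w by simp
  note c = \<mu>[unfolded cylinder_iff[OF w' A]]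
  have p: "is_path \<mu>" using c boundary_paths_iff by simp
  have n: "enat (Suc (length w)) \<le> path_length \<mu>" using c by simp
  have "enat (Suc 0) \<le> enat (Suc (length w))" by simp
  also note n
  finally show l: "enat 0 < path_length \<mu>" by (simp add: Suc_ile_eq)
  show "fst (path_edge \<mu> 0) = \<alpha>" using shift_wd[OF p n] c by simp
  have Av: "A \<in> vtx \<mu> (Suc (length w))" using c by simp
  have "act_word G w B \<in> vtx \<mu> (Suc (length w))"
    by (rule ultrafilter_UNIVD(4)[OF vtx_ultrafilter[OF p n Av] Av B])
  then have "B \<in> vtx \<mu> (Suc 0)"
    using mem_vtx_append(2)[OF p, of "[\<alpha>]" w B] n c by simp
  then show "B \<in> edge_d (path_edge \<mu> 0)" unfolding vtx_Suc .
qed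

lemma path_r_mem:
  assumes \<mu>: "\<mu> \<in> boundary_paths G"
  shows "bot \<notin> path_r G \<mu>" "inf A B \<in> path_r G \<mu> \<longleftrightarrow> A \<in> path_r G \<mu> \<and> B \<in> path_r G \<mu>"
    "sup A B \<in> path_r G \<mu> \<longleftrightarrow> A \<in> path_r G \<mu> \<or> B \<in> path_r G \<mu>"
proof -
  have p: "is_path \<mu>" using \<mu> boundary_paths_iff by simp
  have v: "path_r G \<mu> = vtx \<mu> 0" by (simp add: vtx_def)
  have u: "path_r G \<mu> \<in> ultrafilters UNIV" if "A \<in> path_r G \<mu>" for A
    using vtx_ultrafilter[OF p, of 0 A] that unfolding v by (simp flip: zero_enat_def)
  show "bot \<notin> path_r G \<mu>" using u ultrafilter_UNIVD(2) by blast
  show "inf A B \<in> path_r G \<mu> \<longleftrightarrow> A \<in> path_r G \<mu> \<and> B \<in> path_r G \<mu>"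
    using u ultrafilter_inf_iff[OF ba_ideal_UNIV u] by auto
  show "sup A B \<in> path_r G \<mu> \<longleftrightarrow> A \<in> path_r G \<mu> \<or> B \<in> path_r G \<mu>"
    using u ultrafilter_UNIVD(5)[OF u] ultrafilter_UNIVD(4)[OF u _ sup_ge1] ultrafilter_UNIVD(4)[OF u _ sup_ge2] by meson
qed

text \<open>This is where boundary paths differ from arbitrary paths: a vertex with a regular
  element is not a boundary path.\<close>

lemma path_r_regular:
  assumes \<mu>: "\<mu> \<in> boundary_paths G" and A: "A \<in> path_r G \<mu>" "regular G A"
  shows "enat 0 < path_length \<mu>"
proof (rule ccontr)
  assume n: "\<not> ?thesis"
  have p: "is_path \<mu>" using \<mu> boundary_paths_iff by simp
  obtain \<xi> where \<xi>: "\<mu> = Vertex \<xi>" using n p unfolding is_path_def by (cases \<mu>) (auto simp: zero_enat_def)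
  then have "\<xi> \<in> E0_sg G" using \<mu> unfolding boundary_paths_iff by simp
  then show False using A \<xi> E0_sg_iff by auto
qed

text \<open>A boundary path is coded by the cylinder sets that contain it. These codes are the
  indices of the matrices over which the universal property quantifies.\<close>

definition code :: "('l, 'b) path \<Rightarrow> ('l list \<times> 'b) set" where
  "code \<mu> = {(w, A). w \<in> lists (labels G) \<and> A \<in> idl_word G w \<and> \<mu> \<in> cylinder G w A}"

lemma code_inj: "\<mu> \<in> boundary_paths G \<Longrightarrow> \<nu> \<in> boundary_paths G \<Longrightarrow> code \<mu> = code \<nu> \<Longrightarrow> \<mu> = \<nu>"
  by (rule boundary_path_eqI) (auto simp: code_def set_eq_iff)

definition vertex_rel :: "'b \<Rightarrow> (('l list \<times> 'b) set \<times> ('l list \<times> 'b) set) set" where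
  "vertex_rel A = (\<lambda>\<mu>. (code \<mu>, code \<mu>)) ` {\<mu> \<in> boundary_paths G. A \<in> path_r G \<mu>}"

definition starting :: "'l \<Rightarrow> 'b \<Rightarrow> ('l, 'b) path set" where
  "starting \<alpha> B = {\<nu> \<in> boundary_paths G. enat 0 < path_length \<nu> \<and> fst (path_edge \<nu> 0) = \<alpha> \<and>
     B \<in> edge_d (path_edge \<nu> 0)}"

text \<open>The partial injection that prepends an edge with label \<open>\<alpha>\<close> and end
  vertex in the basic open set of \<open>B\<close>: in the convention of \<open>pinj_op\<close>, the
  shift of \<open>\<nu>\<close> is sent to \<open>\<nu>\<close>.\<close>

definition edge_rel :: "'l \<Rightarrow> 'b \<Rightarrow> (('l list \<times> 'b) set \<times> ('l list \<times> 'b) set) set" where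
  "edge_rel \<alpha> B = (\<lambda>\<nu>. (code \<nu>, code (shift \<nu>))) ` starting \<alpha> B"

lemma startingD:
  assumes "\<nu> \<in> starting \<alpha> B"
  shows "\<nu> \<in> boundary_paths G" "enat 0 < path_length \<nu>" "fst (path_edge \<nu> 0) = \<alpha>"
    "B \<in> edge_d (path_edge \<nu> 0)" "is_path \<nu>" "path_edge \<nu> 0 \<in> edges" "shift \<nu> \<in> boundary_paths G"
    "path_r G (shift \<nu>) = edge_d (path_edge \<nu> 0)"
proof -
  show b: "\<nu> \<in> boundary_paths G" and l: "enat 0 < path_length \<nu>" "fst (path_edge \<nu> 0) = \<alpha>"
    "B \<in> edge_d (path_edge \<nu> 0)" using assms unfolding starting_def by auto
  show p: "is_path \<nu>" using b boundary_paths_iff by simp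
  show "path_edge \<nu> 0 \<in> edges" by (rule path_edge_edges[OF p l(1)])
  show "shift \<nu> \<in> boundary_paths G" by (rule shift_boundary[OF b l(1)])
  show "path_r G (shift \<nu>) = edge_d (path_edge \<nu> 0)" by (rule shift_r[OF p l(1)])
qed

text \<open>The first edge has a given label, and its end vertex is the range of the shifted
  path.\<close>

lemma starting_eqI:
  assumes \<nu>: "\<nu> \<in> starting \<alpha> B" "\<nu>' \<in> starting \<alpha> B'" and s: "shift \<nu> = shift \<nu>'"
  shows "\<nu> = \<nu>'"
proof -
  note a = startingD[OF \<nu>(1)] note b = startingD[OF \<nu>(2)]
  have "snd (path_edge \<nu> 0) = snd (path_edge \<nu>' 0)"
    using edge_d_Int[OF a(6)] edge_d_Int[OF b(6)] a(3,8) b(3,8) s by metis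
  then have "path_edge \<nu> 0 = path_edge \<nu>' 0" using a(3) b(3) by (simp add: prod_eq_iff)
  then show ?thesis using prepend_shift[OF a(5,2)] prepend_shift[OF b(5,2)] s by metis
qed

lemma ex_starting:
  assumes \<alpha>: "\<alpha> \<in> labels G" and B: "B \<in> idl G \<alpha>" and \<mu>: "\<mu> \<in> boundary_paths G" "B \<in> path_r G \<mu>"
  shows "\<exists>\<nu>\<in>starting \<alpha> B. shift \<nu> = \<mu>"
proof -
  have p: "is_path \<mu>" using \<mu> boundary_paths_iff by simp
  have u: "path_r G \<mu> \<in> ultrafilters UNIV"
    using vtx_ultrafilter[OF p, of 0 B] \<mu>(2) by (simp add: vtx_def flip: zero_enat_def)
  have ne: "path_r G \<mu> \<inter> idl G \<alpha> \<noteq> {}" using B \<mu>(2) by auto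
  note r = ultrafilter_restrict[OF idl[OF \<alpha>] u ne]
  let ?e = "(\<alpha>, path_r G \<mu> \<inter> idl G \<alpha>)"
  have e: "?e \<in> edges" using \<alpha> r(1) unfolding edges_def by simp
  have d: "edge_d ?e = path_r G \<mu>" unfolding edge_d_eq using r(2) by simp
  note pb = prepend_boundary[OF \<mu>(1) e d]
  have "prepend ?e \<mu> \<in> starting \<alpha> B" unfolding starting_def using pb d \<mu>(2) by simp
  then show ?thesis using pb(4) by blast
qed

lemma pinj_vertex_rel: "pinj (vertex_rel A)"
  unfolding pinj_def vertex_rel_def single_valued_def by auto

lemma pinj_edge_rel: "pinj (edge_rel \<alpha> B)"
proof -
  have "single_valued (edge_rel \<alpha> B)"
  proof (rule single_valuedI)
    fix x y z assume "(x, y) \<in> edge_rel \<alpha> B" "(x, z) \<in> edge_rel \<alpha> B"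
    then obtain \<nu> \<nu>' where \<nu>: "\<nu> \<in> starting \<alpha> B" "x = code \<nu>" "y = code (shift \<nu>)"
      "\<nu>' \<in> starting \<alpha> B" "x = code \<nu>'" "z = code (shift \<nu>')" unfolding edge_rel_def by auto
    have "\<nu> = \<nu>'" by (rule code_inj[OF startingD(1)[OF \<nu>(1)] startingD(1)[OF \<nu>(4)]]) (use \<nu> in simp)
    then show "y = z" using \<nu>(3,6) by simp
  qed
  moreover have "single_valued ((edge_rel \<alpha> B)\<inverse>)"
  proof (rule single_valuedI)
    fix x y z assume "(x, y) \<in> (edge_rel \<alpha> B)\<inverse>" "(x, z) \<in> (edge_rel \<alpha> B)\<inverse>"
    then obtain \<nu> \<nu>' where \<nu>: "\<nu> \<in> starting \<alpha> B" "y = code \<nu>" "x = code (shift \<nu>)"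
      "\<nu>' \<in> starting \<alpha> B" "z = code \<nu>'" "x = code (shift \<nu>')" unfolding edge_rel_def by auto
    have "shift \<nu> = shift \<nu>'" by (rule code_inj) (use \<nu> startingD(7) in auto)
    then show "y = z" using starting_eqI[OF \<nu>(1,4)] \<nu>(2,5) by simp
  qed
  ultimately show ?thesis unfolding pinj_def by simp
qed

lemma vertex_rel_converse: "(vertex_rel A)\<inverse> = vertex_rel A"
  unfolding vertex_rel_def by auto

lemma vertex_rel_comp: "vertex_rel A O vertex_rel B = vertex_rel (inf A B)"
proof (intro equalityI subsetI)
  fix z assume "z \<in> vertex_rel A O vertex_rel B"
  then obtain \<mu> \<nu> where m: "\<mu> \<in> boundary_paths G" "A \<in> path_r G \<mu>" "\<nu> \<in> boundary_paths G" "B \<in> path_r G \<nu>"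
    "code \<mu> = code \<nu>" "z = (code \<mu>, code \<nu>)" unfolding vertex_rel_def by auto
  have "\<mu> = \<nu>" by (rule code_inj[OF m(1,3,5)])
  then show "z \<in> vertex_rel (inf A B)" unfolding vertex_rel_def using m path_r_mem(2)[OF m(1)] by auto
next
  fix z assume "z \<in> vertex_rel (inf A B)"
  then obtain \<mu> where m: "\<mu> \<in> boundary_paths G" "inf A B \<in> path_r G \<mu>" "z = (code \<mu>, code \<mu>)"
    unfolding vertex_rel_def by auto
  then have "(code \<mu>, code \<mu>) \<in> vertex_rel A" "(code \<mu>, code \<mu>) \<in> vertex_rel B"
    unfolding vertex_rel_def using path_r_mem(2)[OF m(1)] by auto
  then show "z \<in> vertex_rel A O vertex_rel B" using m(3) by auto
qed

lemma vertex_edge_rel: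
  assumes \<alpha>: "\<alpha> \<in> labels G"
  shows "vertex_rel A O edge_rel \<alpha> B = edge_rel \<alpha> B O vertex_rel (act G \<alpha> A)"
proof -
  have r: "A \<in> path_r G \<nu> \<longleftrightarrow> act G \<alpha> A \<in> path_r G (shift \<nu>)" if \<nu>: "\<nu> \<in> starting \<alpha> B" for \<nu>
    using mem_vtx_step[OF startingD(5,2)[OF \<nu>], of A] startingD(3,8)[OF \<nu>] by (simp add: vtx_Suc) (simp add: vtx_def)
  show ?thesis
  proof (intro equalityI subsetI)
    fix z assume "z \<in> vertex_rel A O edge_rel \<alpha> B"
    then obtain \<mu> \<nu> where m: "\<mu> \<in> boundary_paths G" "A \<in> path_r G \<mu>" "\<nu> \<in> starting \<alpha> B"
      "code \<mu> = code \<nu>" "z = (code \<mu>, code (shift \<nu>))" unfolding vertex_rel_def edge_rel_def by auto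
    have "\<mu> = \<nu>" by (rule code_inj[OF m(1) startingD(1)[OF m(3)] m(4)])
    then have "(code \<mu>, code (shift \<nu>)) \<in> edge_rel \<alpha> B" "(code (shift \<nu>), code (shift \<nu>)) \<in> vertex_rel (act G \<alpha> A)"
      unfolding vertex_rel_def edge_rel_def using m r[OF m(3)] startingD(7)[OF m(3)] by auto
    then show "z \<in> edge_rel \<alpha> B O vertex_rel (act G \<alpha> A)" using m(5) by auto
  next
    fix z assume "z \<in> edge_rel \<alpha> B O vertex_rel (act G \<alpha> A)"
    then obtain \<mu> \<nu> where m: "\<mu> \<in> boundary_paths G" "act G \<alpha> A \<in> path_r G \<mu>" "\<nu> \<in> starting \<alpha> B"
      "code (shift \<nu>) = code \<mu>" "z = (code \<nu>, code \<mu>)" unfolding vertex_rel_def edge_rel_def by auto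
    have "shift \<nu> = \<mu>" by (rule code_inj[OF startingD(7)[OF m(3)] m(1,4)])
    then have "(code \<nu>, code \<nu>) \<in> vertex_rel A" "(code \<nu>, code \<mu>) \<in> edge_rel \<alpha> B"
      unfolding vertex_rel_def edge_rel_def using m r[OF m(3)] startingD(1)[OF m(3)] by auto
    then show "z \<in> vertex_rel A O edge_rel \<alpha> B" using m(5) by auto
  qed
qed

lemma edge_rel_converse_comp:
  assumes \<alpha>: "\<alpha> \<in> labels G" "\<alpha>' \<in> labels G" and B: "B \<in> idl G \<alpha>" "B' \<in> idl G \<alpha>'"
  shows "(edge_rel \<alpha> B)\<inverse> O edge_rel \<alpha>' B' = (if \<alpha> = \<alpha>' then vertex_rel (inf B B') else {})"
proof (intro equalityI subsetI)
  fix z assume "z \<in> (edge_rel \<alpha> B)\<inverse> O edge_rel \<alpha>' B'"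
  then obtain \<nu> \<nu>' where n: "\<nu> \<in> starting \<alpha> B" "\<nu>' \<in> starting \<alpha>' B'" "code \<nu> = code \<nu>'"
    "z = (code (shift \<nu>), code (shift \<nu>'))" unfolding edge_rel_def by auto
  note a = startingD[OF n(1)] note b = startingD[OF n(2)]
  have eq: "\<nu> = \<nu>'" by (rule code_inj[OF a(1) b(1) n(3)])
  then have "\<alpha> = \<alpha>'" using a(3) b(3) by simp
  moreover have "inf B B' \<in> path_r G (shift \<nu>)" using path_r_mem(2)[OF a(7)] a(4,8) b(4) eq by simp
  ultimately show "z \<in> (if \<alpha> = \<alpha>' then vertex_rel (inf B B') else {})"
    using n(4) eq a(7) unfolding vertex_rel_def by auto
next
  fix z assume z: "z \<in> (if \<alpha> = \<alpha>' then vertex_rel (inf B B') else {})"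
  then have eq: "\<alpha>' = \<alpha>" by (auto split: if_splits)
  obtain \<mu> where m: "\<mu> \<in> boundary_paths G" "inf B B' \<in> path_r G \<mu>" "z = (code \<mu>, code \<mu>)"
    using z unfolding vertex_rel_def by (auto split: if_splits)
  have BB: "B \<in> path_r G \<mu>" "B' \<in> path_r G \<mu>" using m(2) path_r_mem(2)[OF m(1)] by auto
  obtain \<nu> where n: "\<nu> \<in> starting \<alpha> B" "shift \<nu> = \<mu>" using ex_starting[OF \<alpha>(1) B(1) m(1) BB(1)] by auto
  then have "\<nu> \<in> starting \<alpha> B'" using BB(2) startingD(8)[OF n(1)] unfolding starting_def by auto
  then have "(code \<mu>, code \<nu>) \<in> (edge_rel \<alpha> B)\<inverse>" "(code \<nu>, code \<mu>) \<in> edge_rel \<alpha> B'"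
    using n unfolding edge_rel_def by auto
  then show "z \<in> (edge_rel \<alpha> B)\<inverse> O edge_rel \<alpha>' B'" using m(3) eq by auto
qed

definition vertex_op where "vertex_op A = pinj_op (vertex_rel A)"

definition edge_op where "edge_op \<alpha> B = pinj_op (edge_rel \<alpha> B)"

lemma coord_vertex_op:
  "coord (blinfun_apply (vertex_op A) f) i = (if \<exists>\<mu>\<in>boundary_paths G. A \<in> path_r G \<mu> \<and> i = code \<mu> then coord f i else 0)"
proof (cases "\<exists>\<mu>\<in>boundary_paths G. A \<in> path_r G \<mu> \<and> i = code \<mu>")
  case True
  then have "(i, i) \<in> vertex_rel A" unfolding vertex_rel_def by auto
  then show ?thesis unfolding vertex_op_def if_P[OF True] by (rule pinj_op_in[OF pinj_vertex_rel])
next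
  case False
  then have "i \<notin> Domain (vertex_rel A)" unfolding vertex_rel_def by auto
  then show ?thesis unfolding vertex_op_def if_not_P[OF False] by (rule pinj_op_notin[OF pinj_vertex_rel])
qed

lemma edge_op_range:
  "edge_op \<alpha> B o\<^sub>L adj (edge_op \<alpha> B) = pinj_op ((\<lambda>\<nu>. (code \<nu>, code \<nu>)) ` starting \<alpha> B)"
proof -
  have "edge_rel \<alpha> B O (edge_rel \<alpha> B)\<inverse> = (\<lambda>\<nu>. (code \<nu>, code \<nu>)) ` starting \<alpha> B"
  proof (intro equalityI subsetI)
    fix z assume "z \<in> edge_rel \<alpha> B O (edge_rel \<alpha> B)\<inverse>"
    then obtain i j k where z: "z = (i, k)" "(i, j) \<in> edge_rel \<alpha> B" "(k, j) \<in> edge_rel \<alpha> B" by auto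
    then have "i = k" using pinjD(2)[OF pinj_edge_rel] by metis
    then show "z \<in> (\<lambda>\<nu>. (code \<nu>, code \<nu>)) ` starting \<alpha> B" using z unfolding edge_rel_def by auto
  qed (auto simp: edge_rel_def)
  then show ?thesis
    unfolding edge_op_def adj_pinj_op[OF pinj_edge_rel] pinj_op_compose[OF pinj_edge_rel pinj_converse[OF pinj_edge_rel]]
    by simp
qed

lemma finsum_edge_op:
  assumes F: "finite F"
  shows "finsum operator_algebra (\<lambda>\<alpha>. edge_op \<alpha> (b \<alpha>) o\<^sub>L adj (edge_op \<alpha> (b \<alpha>))) F =
    pinj_op (\<Union>\<alpha>\<in>F. (\<lambda>\<nu>. (code \<nu>, code \<nu>)) ` starting \<alpha> (b \<alpha>))"
  using F
proof (induction F)
  case empty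
  interpret O: abelian_group "operator_algebra :: (('l list \<times> 'b) set ell2 \<Rightarrow>\<^sub>L ('l list \<times> 'b) set ell2) cstar"
    by (rule abelian_group_operator_algebra)
  show ?case by (simp add: pinj_op_empty)
next
  case (insert \<alpha> F)
  interpret O: abelian_group "operator_algebra :: (('l list \<times> 'b) set ell2 \<Rightarrow>\<^sub>L ('l list \<times> 'b) set ell2) cstar"
    by (rule abelian_group_operator_algebra)
  have diag: "pinj ((\<lambda>\<nu>. (code \<nu>, code \<nu>)) ` N)" for N
    unfolding pinj_def single_valued_def by auto
  have ops: "edge_op \<alpha> (b \<alpha>) o\<^sub>L adj (edge_op \<alpha> (b \<alpha>)) \<in> ops" for \<alpha>
    unfolding edge_op_range by (rule pinj_op_ops[OF diag])
  let ?R = "\<lambda>\<alpha>. (\<lambda>\<nu>. (code \<nu>, code \<nu>)) ` starting \<alpha> (b \<alpha>)"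
  have U: "(\<Union>\<alpha>\<in>F. ?R \<alpha>) = (\<lambda>\<nu>. (code \<nu>, code \<nu>)) ` (\<Union>\<alpha>\<in>F. starting \<alpha> (b \<alpha>))" for F by auto
  have disj: "Domain (?R \<alpha>) \<inter> Domain (\<Union>\<alpha>\<in>F. ?R \<alpha>) = {}"
  proof (rule ccontr)
    assume "\<not> ?thesis"
    then obtain \<nu> \<beta> \<nu>' where n: "\<nu> \<in> starting \<alpha> (b \<alpha>)" "\<beta> \<in> F" "\<nu>' \<in> starting \<beta> (b \<beta>)" "code \<nu> = code \<nu>'" by auto
    have "\<nu> = \<nu>'" by (rule code_inj[OF startingD(1)[OF n(1)] startingD(1)[OF n(3)] n(4)])
    then have "\<alpha> = \<beta>" using startingD(3)[OF n(1)] startingD(3)[OF n(3)] by simp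
    then show False using n(2) insert(2) by simp
  qed
  have "finsum operator_algebra (\<lambda>\<alpha>. edge_op \<alpha> (b \<alpha>) o\<^sub>L adj (edge_op \<alpha> (b \<alpha>))) (insert \<alpha> F) =
    pinj_op (?R \<alpha>) + pinj_op (\<Union>\<alpha>\<in>F. ?R \<alpha>)"
    using O.finsum_insert[OF insert(1,2), of "\<lambda>\<alpha>. edge_op \<alpha> (b \<alpha>) o\<^sub>L adj (edge_op \<alpha> (b \<alpha>))"] ops insert.IH
    by (simp add: edge_op_range)
  also have "\<dots> = pinj_op (?R \<alpha> \<union> (\<Union>\<alpha>\<in>F. ?R \<alpha>))"
    by (rule pinj_op_Un[symmetric, OF diag _ _ disj]) (unfold U image_Un[symmetric], rule diag, rule diag)
  finally show ?case by simp
qed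

text \<open>The relations of a representation become identities between relations on boundary paths.
  For a regular element this uses that a boundary path whose range contains it has a first
  edge.\<close>

lemma representation_operators: "representation G operator_algebra vertex_op edge_op"
  unfolding representation_def projection_def partial_isometry_def operator_algebra_simps
proof (intro conjI allI ballI impI)
  fix A B
  show "vertex_op A \<in> ops" unfolding vertex_op_def by (rule pinj_op_ops[OF pinj_vertex_rel])
  show "adj (vertex_op A) = vertex_op A"
    unfolding vertex_op_def adj_pinj_op[OF pinj_vertex_rel] vertex_rel_converse ..
  show c: "vertex_op (inf A B) = vertex_op A o\<^sub>L vertex_op B" for A B
    unfolding vertex_op_def pinj_op_compose[OF pinj_vertex_rel pinj_vertex_rel] vertex_rel_comp ..
  show "vertex_op A o\<^sub>L vertex_op A = vertex_op A" using c[of A A] by simp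
  have o: "vertex_op A \<in> ops" for A unfolding vertex_op_def by (rule pinj_op_ops[OF pinj_vertex_rel])
  show "vertex_op (sup A B) = (vertex_op A + vertex_op B) \<ominus>\<^bsub>operator_algebra\<^esub> vertex_op (inf A B)"
    unfolding operator_algebra_minus[OF ops_add(1)[OF o o] o]
  proof (rule blinfun_eqI, rule ell2_eqI)
    fix f i
    show "coord (blinfun_apply (vertex_op (sup A B)) f) i =
      coord (blinfun_apply (vertex_op A + vertex_op B - vertex_op (inf A B)) f) i"
    proof (cases "\<exists>\<mu>\<in>boundary_paths G. i = code \<mu>")
      case True
      then obtain \<mu> where \<mu>: "\<mu> \<in> boundary_paths G" "i = code \<mu>" by auto
      have "(\<exists>\<nu>\<in>boundary_paths G. C \<in> path_r G \<nu> \<and> i = code \<nu>) \<longleftrightarrow> C \<in> path_r G \<mu>" for C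
        using \<mu> code_inj by auto
      then show ?thesis
        by (simp add: coord_vertex_op blinfun.add_left blinfun.diff_left coord_simps coord_minus path_r_mem[OF \<mu>(1)])
    next
      case False
      then have "coord (blinfun_apply (vertex_op C) f) i = 0" for C unfolding coord_vertex_op by auto
      then show ?thesis
        by (simp add: blinfun.add_left blinfun.diff_left coord_simps coord_minus)
    qed
  qed
  show "vertex_op A = finsum operator_algebra (\<lambda>\<alpha>. edge_op \<alpha> (act G \<alpha> A) o\<^sub>L adj (edge_op \<alpha> (act G \<alpha> A))) (Delta G A)"
    if r: "regular G A"
  proof -
    have fin: "finite (Delta G A)"
    proof (cases "A = bot")
      case True
      then have "Delta G A = {}" unfolding Delta_def using act_bot by auto
      then show ?thesis by simp
    qed (use r in \<open>auto simp: regular_def\<close>)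
    have "(\<Union>\<alpha>\<in>Delta G A. starting \<alpha> (act G \<alpha> A)) = {\<mu> \<in> boundary_paths G. A \<in> path_r G \<mu>}"
    proof (intro equalityI subsetI)
      fix \<nu> assume "\<nu> \<in> (\<Union>\<alpha>\<in>Delta G A. starting \<alpha> (act G \<alpha> A))"
      then obtain \<alpha> where n: "\<nu> \<in> starting \<alpha> (act G \<alpha> A)" by auto
      note d = startingD[OF n]
      have "A \<in> path_r G \<nu>" using mem_vtx_step[OF d(5,2), of A] d(3,4) by (simp add: vtx_Suc) (simp add: vtx_def)
      then show "\<nu> \<in> {\<mu> \<in> boundary_paths G. A \<in> path_r G \<mu>}" using d(1) by simp
    next
      fix \<mu> assume "\<mu> \<in> {\<mu> \<in> boundary_paths G. A \<in> path_r G \<mu>}"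
      then have \<mu>: "\<mu> \<in> boundary_paths G" "A \<in> path_r G \<mu>" by auto
      have l: "enat 0 < path_length \<mu>" by (rule path_r_regular[OF \<mu> r])
      have p: "is_path \<mu>" using \<mu> boundary_paths_iff by simp
      have e: "path_edge \<mu> 0 \<in> edges" by (rule path_edge_edges[OF p l])
      have A: "A \<in> edge_r G (path_edge \<mu> 0)" using vtx_edge_r[OF p l] \<mu>(2) by (simp add: vtx_def)
      have "fst (path_edge \<mu> 0) \<in> Delta G A" by (rule Delta_of_edge_r[OF e A])
      moreover have "\<mu> \<in> starting (fst (path_edge \<mu> 0)) (act G (fst (path_edge \<mu> 0)) A)"
        using \<mu> l mem_edge_r_iff[OF e] A unfolding starting_def by simp
      ultimately show "\<mu> \<in> (\<Union>\<alpha>\<in>Delta G A. starting \<alpha> (act G \<alpha> A))" by auto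
    qed
    then have "(\<Union>\<alpha>\<in>Delta G A. (\<lambda>\<nu>. (code \<nu>, code \<nu>)) ` starting \<alpha> (act G \<alpha> A)) = vertex_rel A"
      unfolding vertex_rel_def image_UN[symmetric] by simp
    then show ?thesis unfolding finsum_edge_op[OF fin] vertex_op_def by simp
  qed
next
  fix \<alpha> B assume \<alpha>: "\<alpha> \<in> labels G" and B: "B \<in> idl G \<alpha>"
  show "edge_op \<alpha> B \<in> ops" unfolding edge_op_def by (rule pinj_op_ops[OF pinj_edge_rel])
  have "edge_rel \<alpha> B O (edge_rel \<alpha> B)\<inverse> O edge_rel \<alpha> B = edge_rel \<alpha> B"
  proof (intro equalityI subsetI)
    fix z assume "z \<in> edge_rel \<alpha> B O (edge_rel \<alpha> B)\<inverse> O edge_rel \<alpha> B"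
    then obtain i j k m where z: "z = (i, m)" "(i, j) \<in> edge_rel \<alpha> B" "(k, j) \<in> edge_rel \<alpha> B" "(k, m) \<in> edge_rel \<alpha> B"
      by auto
    then have "i = k" using pinjD(2)[OF pinj_edge_rel] by metis
    then show "z \<in> edge_rel \<alpha> B" using z by simp
  qed auto
  then show "edge_op \<alpha> B o\<^sub>L adj (edge_op \<alpha> B) o\<^sub>L edge_op \<alpha> B = edge_op \<alpha> B"
    unfolding edge_op_def adj_pinj_op[OF pinj_edge_rel]
    by (simp add: pinj_op_compose pinj_edge_rel pinj_converse pinj_relcomp O_assoc)
  show "vertex_op A o\<^sub>L edge_op \<alpha> B = edge_op \<alpha> B o\<^sub>L vertex_op (act G \<alpha> A)" for A
    unfolding vertex_op_def edge_op_def pinj_op_compose[OF pinj_vertex_rel pinj_edge_rel]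
      pinj_op_compose[OF pinj_edge_rel pinj_vertex_rel] vertex_edge_rel[OF \<alpha>] ..
  fix \<alpha>' B' assume \<alpha>': "\<alpha>' \<in> labels G" and B': "B' \<in> idl G \<alpha>'"
  show "adj (edge_op \<alpha> B) o\<^sub>L edge_op \<alpha>' B' = (if \<alpha> = \<alpha>' then vertex_op (inf B B') else 0)"
    unfolding vertex_op_def edge_op_def adj_pinj_op[OF pinj_edge_rel]
      pinj_op_compose[OF pinj_converse[OF pinj_edge_rel] pinj_edge_rel] edge_rel_converse_comp[OF \<alpha> \<alpha>' B B']
    by (simp add: pinj_op_empty)
next
  have "vertex_rel bot = {}" unfolding vertex_rel_def using path_r_mem(1) by auto
  then show "vertex_op bot = 0" unfolding vertex_op_def by (simp add: pinj_op_empty)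
qed

end

context cstar_algebra
begin

lemma finsum_image:
  assumes inj: "inj_on g (carrier A)" and F: "finite F"
  shows "f \<in> F \<rightarrow> carrier A \<Longrightarrow> g (finsum A f F) = finsum (cstar_image g A) (\<lambda>i. g (f i)) F"
  using F
proof (induction F)
  case empty
  interpret B: abelian_group "cstar_image g A" by (rule abelian_group_image[OF inj])
  show ?case using cstar_image_simps(7)[OF inj zero_closed zero_closed] by simp
next
  case (insert i F)
  interpret B: abelian_group "cstar_image g A" by (rule abelian_group_image[OF inj])
  have c: "carrier (cstar_image g A) = g ` carrier A" by (rule cstar_image_simps(6)[OF inj zero_closed zero_closed])
  have f: "f \<in> F \<rightarrow> carrier A" "f i \<in> carrier A" "finsum A f F \<in> carrier A"
    using insert.prems finsum_closed[of f F] by auto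
  have "g (finsum A f (insert i F)) = g (f i) \<oplus>\<^bsub>cstar_image g A\<^esub> g (finsum A f F)"
    using insert(1,2) f cstar_image_simps(2)[OF inj f(2,3)] by simp
  also have "\<dots> = finsum (cstar_image g A) (\<lambda>i. g (f i)) (insert i F)"
    using insert f c by (subst B.finsum_insert) auto
  finally show ?case .
qed

lemma representation_image:
  assumes inj: "inj_on g (carrier A)" and rep: "representation G A P S"
    and act: "\<And>\<alpha> B. \<alpha> \<in> labels G \<Longrightarrow> act G \<alpha> B \<in> idl G \<alpha>" and bot: "\<And>\<alpha>. \<alpha> \<in> labels G \<Longrightarrow> act G \<alpha> bot = bot"
  shows "representation G (cstar_image g A) (\<lambda>B. g (P B)) (\<lambda>\<alpha> B. g (S \<alpha> B))"
proof -
  note s = cstar_image_simps[OF inj]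
  note m = cstar_image_minus[OF inj]
  have c: "carrier (cstar_image g A) = g ` carrier A" "zero (cstar_image g A) = g \<zero>"
    using s(6,7)[of \<zero> \<zero>] by simp_all
  have st: "star (cstar_image g A) (g x) = g (star A x)" if "x \<in> carrier A" for x
    by (rule s(4)[OF that that])
  have P: "P B \<in> carrier A" for B using rep unfolding representation_def projection_def by simp
  have S: "S \<alpha> B \<in> carrier A" if "\<alpha> \<in> labels G" "B \<in> idl G \<alpha>" for \<alpha> B
    using rep that unfolding representation_def partial_isometry_def by simp
  have reg: "g (P B) = finsum (cstar_image g A)
      (\<lambda>\<alpha>. g (S \<alpha> (act G \<alpha> B)) \<otimes>\<^bsub>cstar_image g A\<^esub> star (cstar_image g A) (g (S \<alpha> (act G \<alpha> B)))) (Delta G B)"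
    if r: "regular G B" for B
  proof -
    let ?f = "\<lambda>\<alpha>. S \<alpha> (act G \<alpha> B) \<otimes> star A (S \<alpha> (act G \<alpha> B))"
    have fin: "finite (Delta G B)"
    proof (cases "B = bot")
      case True
      then have "Delta G B = {}" unfolding Delta_def using bot by auto
      then show ?thesis by simp
    qed (use r in \<open>auto simp: regular_def\<close>)
    have l: "\<alpha> \<in> labels G" if "\<alpha> \<in> Delta G B" for \<alpha> using that unfolding Delta_def by simp
    have f: "?f \<in> Delta G B \<rightarrow> carrier A" using S l act star_closed mult_closed by auto
    have "P B = finsum A ?f (Delta G B)" using rep r unfolding representation_def by simp
    then have "g (P B) = finsum (cstar_image g A) (\<lambda>\<alpha>. g (?f \<alpha>)) (Delta G B)"
      using finsum_image[OF inj fin f] by simp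
    also have "\<dots> = finsum (cstar_image g A)
      (\<lambda>\<alpha>. g (S \<alpha> (act G \<alpha> B)) \<otimes>\<^bsub>cstar_image g A\<^esub> star (cstar_image g A) (g (S \<alpha> (act G \<alpha> B)))) (Delta G B)"
    proof (rule abelian_monoid.finsum_cong'[OF abelian_group.axioms(1)[OF abelian_group_image[OF inj]] refl])
      show eq: "g (?f \<alpha>) = g (S \<alpha> (act G \<alpha> B)) \<otimes>\<^bsub>cstar_image g A\<^esub> star (cstar_image g A) (g (S \<alpha> (act G \<alpha> B)))"
        if "\<alpha> \<in> Delta G B" for \<alpha>
      proof -
        have sc: "S \<alpha> (act G \<alpha> B) \<in> carrier A" by (rule S[OF l[OF that] act[OF l[OF that]]])
        show ?thesis using s(4)[OF sc sc] s(1)[OF sc star_closed[OF sc]] by simp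
      qed
      show "(\<lambda>\<alpha>. g (S \<alpha> (act G \<alpha> B)) \<otimes>\<^bsub>cstar_image g A\<^esub> star (cstar_image g A) (g (S \<alpha> (act G \<alpha> B)))) \<in> Delta G B \<rightarrow> carrier (cstar_image g A)"
      proof (rule Pi_I)
        fix \<alpha> assume a: "\<alpha> \<in> Delta G B"
        show "g (S \<alpha> (act G \<alpha> B)) \<otimes>\<^bsub>cstar_image g A\<^esub> star (cstar_image g A) (g (S \<alpha> (act G \<alpha> B))) \<in> carrier (cstar_image g A)"
          unfolding eq[OF a, symmetric] c using f a by (intro imageI) auto
      qed
    qed
    finally show ?thesis .
  qed
  note r = rep[unfolded representation_def projection_def partial_isometry_def]
  show ?thesis
    unfolding representation_def
  proof (intro conjI allI ballI impI)
    fix B B'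
    show "projection (cstar_image g A) (g (P B))"
      unfolding projection_def c using s(1) st P r by simp
    show "g (P bot) = \<zero>\<^bsub>cstar_image g A\<^esub>" unfolding c using r by simp
    show "g (P (inf B B')) = g (P B) \<otimes>\<^bsub>cstar_image g A\<^esub> g (P B')" using s(1)[OF P P] r by simp
    show "g (P (sup B B')) = g (P B) \<oplus>\<^bsub>cstar_image g A\<^esub> g (P B') \<ominus>\<^bsub>cstar_image g A\<^esub> g (P (inf B B'))"
    proof -
      have "P (sup B B') = P B \<oplus> P B' \<ominus> P (inf B B')" using r by simp
      then show ?thesis using s(2)[OF P P] m[of "P B \<oplus> P B'" "P (inf B B')"] P by simp
    qed
    show "g (P B) = finsum (cstar_image g A)
      (\<lambda>\<alpha>. g (S \<alpha> (act G \<alpha> B)) \<otimes>\<^bsub>cstar_image g A\<^esub> star (cstar_image g A) (g (S \<alpha> (act G \<alpha> B)))) (Delta G B)"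
      if "regular G B" by (rule reg[OF that])
    fix \<alpha> assume \<alpha>: "\<alpha> \<in> labels G"
    fix C assume C: "C \<in> idl G \<alpha>"
    show "partial_isometry (cstar_image g A) (g (S \<alpha> C))"
      unfolding partial_isometry_def c using s(1) st S[OF \<alpha> C] star_closed mult_closed r \<alpha> C by simp
    show "g (P B) \<otimes>\<^bsub>cstar_image g A\<^esub> g (S \<alpha> C) = g (S \<alpha> C) \<otimes>\<^bsub>cstar_image g A\<^esub> g (P (act G \<alpha> B))"
      using s(1) S[OF \<alpha> C] P r \<alpha> C by simp
    fix \<alpha>' C' assume \<alpha>': "\<alpha>' \<in> labels G" and C': "C' \<in> idl G \<alpha>'"
    show "star (cstar_image g A) (g (S \<alpha> C)) \<otimes>\<^bsub>cstar_image g A\<^esub> g (S \<alpha>' C') =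
      (if \<alpha> = \<alpha>' then g (P (inf C C')) else \<zero>\<^bsub>cstar_image g A\<^esub>)"
      unfolding c using s(1) st S[OF \<alpha> C] S[OF \<alpha>' C'] star_closed r \<alpha> C \<alpha>' C' by simp
  qed
qed

end

lemma star_homD:
  assumes "star_hom A B f"
  shows "x \<in> carrier A \<Longrightarrow> f x \<in> carrier B"
    "x \<in> carrier A \<Longrightarrow> y \<in> carrier A \<Longrightarrow> f (x \<oplus>\<^bsub>A\<^esub> y) = f x \<oplus>\<^bsub>B\<^esub> f y"
    "x \<in> carrier A \<Longrightarrow> y \<in> carrier A \<Longrightarrow> f (x \<otimes>\<^bsub>A\<^esub> y) = f x \<otimes>\<^bsub>B\<^esub> f y"
    "x \<in> carrier A \<Longrightarrow> f (star A x) = star B (f x)"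
    "x \<in> carrier A \<Longrightarrow> f (c \<odot>\<^bsub>A\<^esub> x) = c \<odot>\<^bsub>B\<^esub> f x"
  using assms unfolding star_hom_def by auto

lemma star_hom_compose: "star_hom A B f \<Longrightarrow> star_hom B C h \<Longrightarrow> star_hom A C (\<lambda>x. h (f x))"
  unfolding star_hom_def[of A C] using star_homD[of A B f] star_homD[of B C h] by (simp add: Pi_iff)

text \<open>The universal property speaks of algebras of matrices only; since operators with an
  adjoint are determined by their matrices, it nevertheless yields a homomorphism into the operator
  algebra.\<close>

lemma ex_path_representation:
  fixes G :: "('l, 'b::gen_boolean_algebra) gbds" and A :: "'c cstar"
  assumes G: "generalized_bds G" and u: "universal_representation G A p s"
  shows "\<exists>F. star_hom A operator_algebra F \<and> (\<forall>B. F (p B) = gbds.vertex_op G B) \<and>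
    (\<forall>\<alpha>\<in>labels G. \<forall>B\<in>idl G \<alpha>. F (s \<alpha> B) = gbds.edge_op G \<alpha> B)"
proof -
  interpret gbds G by unfold_locales (rule G)
  let ?O = "operator_algebra :: (('l list \<times> 'b) set ell2 \<Rightarrow>\<^sub>L ('l list \<times> 'b) set ell2) cstar"
  interpret O: cstar_algebra ?O by (rule cstar_operator_algebra)
  let ?g = "\<lambda>(T :: ('l list \<times> 'b) set ell2 \<Rightarrow>\<^sub>L ('l list \<times> 'b) set ell2) i j. coord (blinfun_apply T (ket j)) i"
  let ?C = "cstar_image ?g ?O"
  have inj: "inj_on ?g (carrier ?O)" using inj_on_matrix by simp
  have C: "cstar_algebra ?C" by (rule O.cstar_algebra_image[OF inj])
  have R: "representation G ?C (\<lambda>B. ?g (vertex_op B)) (\<lambda>\<alpha> B. ?g (edge_op \<alpha> B))"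
    by (rule O.representation_image[OF inj representation_operators act_idl act_bot])
  obtain f where f: "star_hom A ?C f" "\<And>B. f (p B) = ?g (vertex_op B)"
    "\<And>\<alpha> B. \<alpha> \<in> labels G \<Longrightarrow> B \<in> idl G \<alpha> \<Longrightarrow> f (s \<alpha> B) = ?g (edge_op \<alpha> B)"
    using u C R unfolding universal_representation_def by blast
  let ?h = "inv_into (carrier ?O) ?g"
  have h: "?h (?g T) = T" if "T \<in> ops" for T using inv_into_f_f[OF inj, of T] that by simp
  have "star_hom A ?O (\<lambda>x. ?h (f x))"
    by (rule star_hom_compose[OF f(1) O.star_hom_inv_image[OF inj]])
  moreover have "vertex_op B \<in> ops" for B unfolding vertex_op_def by (rule pinj_op_ops[OF pinj_vertex_rel])
  moreover have "edge_op \<alpha> B \<in> ops" for \<alpha> B unfolding edge_op_def by (rule pinj_op_ops[OF pinj_edge_rel])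
  ultimately show ?thesis using f(2,3) h by (intro exI[of _ "\<lambda>x. ?h (f x)"]) simp
qed

context gbds
begin

lemma gbds_rep_operators: "gbds_rep G operator_algebra vertex_op edge_op"
proof -
  interpret O: cstar_algebra "operator_algebra :: (('l list \<times> 'b) set ell2 \<Rightarrow>\<^sub>L ('l list \<times> 'b) set ell2) cstar"
    by (rule cstar_operator_algebra)
  show ?thesis by unfold_locales (rule representation_operators)
qed

text \<open>Conjugation by the partial isometry of the first letter removes that letter from the
  word and the first edge from the path; the projection of a word is thus the indicator of its
  cylinder.\<close>

lemma range_proj_ket:
  "w \<in> lists (labels G) \<Longrightarrow> A \<in> idl_word G w \<Longrightarrow> \<mu> \<in> boundary_paths G \<Longrightarrow>
    blinfun_apply (range_proj G operator_algebra vertex_op edge_op w A) (ket (code \<mu>)) =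
      (if \<mu> \<in> cylinder G w A then ket (code \<mu>) else 0)"
proof (induction w arbitrary: \<mu>)
  case Nil
  interpret O: gbds_rep G "operator_algebra :: (('l list \<times> 'b) set ell2 \<Rightarrow>\<^sub>L ('l list \<times> 'b) set ell2) cstar" vertex_op edge_op
    by (rule gbds_rep_operators)
  have "(code \<mu>, code \<mu>) \<in> vertex_rel A" if "A \<in> path_r G \<mu>"
    using that Nil unfolding vertex_rel_def by auto
  moreover have "code \<mu> \<notin> Range (vertex_rel A)" if "A \<notin> path_r G \<mu>"
    using that Nil code_inj unfolding vertex_rel_def by auto
  moreover have "\<mu> \<in> cylinder G [] A \<longleftrightarrow> A \<in> path_r G \<mu>" using Nil unfolding cylinder_def by simp
  ultimately show ?case unfolding O.e_Nil unfolding vertex_op_def using pinj_op_ket[OF pinj_vertex_rel] by auto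
next
  case (Cons \<alpha> w)
  interpret O: gbds_rep G "operator_algebra :: (('l list \<times> 'b) set ell2 \<Rightarrow>\<^sub>L ('l list \<times> 'b) set ell2) cstar" vertex_op edge_op
    by (rule gbds_rep_operators)
  have l: "\<alpha> \<in> labels G" "w \<in> lists (labels G)" using Cons.prems by auto
  obtain B where B: "B \<in> idl G \<alpha>" "A \<le> act_word G w B" using idl_word_ConsD(1)[OF l(2,1) Cons.prems(2)] by auto
  have Aw: "A \<in> idl_word G w" by (rule idl_word_ConsD(2)[OF l(2,1) Cons.prems(2)])
  let ?e = "range_proj G operator_algebra vertex_op edge_op"
  have adj: "adj (edge_op \<alpha> B) = pinj_op ((edge_rel \<alpha> B)\<inverse>)"
    unfolding edge_op_def by (rule adj_pinj_op[OF pinj_edge_rel])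
  have e: "blinfun_apply (?e (\<alpha> # w) A) (ket (code \<mu>)) =
    blinfun_apply (edge_op \<alpha> B) (blinfun_apply (?e w A) (blinfun_apply (pinj_op ((edge_rel \<alpha> B)\<inverse>)) (ket (code \<mu>))))"
    unfolding O.e_Cons[OF l B] by (simp add: adj)
  show ?case
  proof (cases "\<mu> \<in> starting \<alpha> B")
    case True
    note d = startingD[OF True]
    have r: "(code \<mu>, code (shift \<mu>)) \<in> edge_rel \<alpha> B" using True unfolding edge_rel_def by auto
    have 1: "blinfun_apply (pinj_op ((edge_rel \<alpha> B)\<inverse>)) (ket (code \<mu>)) = ket (code (shift \<mu>))"
      by (rule pinj_op_ket(1)[OF pinj_converse[OF pinj_edge_rel]]) (use r in simp)
    have 2: "blinfun_apply (edge_op \<alpha> B) (ket (code (shift \<mu>))) = ket (code \<mu>)"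
      unfolding edge_op_def by (rule pinj_op_ket(1)[OF pinj_edge_rel r])
    show ?thesis
      unfolding e 1 Cons.IH[OF l(2) Aw d(7)]
      using 2 cylinder_Cons_iff[OF l Cons.prems(2,3) d(2)] d(3) by (simp add: blinfun.zero_right)
  next
    case False
    have "code \<mu> \<notin> Domain (edge_rel \<alpha> B)"
    proof
      assume "code \<mu> \<in> Domain (edge_rel \<alpha> B)"
      then obtain \<nu> where \<nu>: "\<nu> \<in> starting \<alpha> B" "code \<mu> = code \<nu>" unfolding edge_rel_def by auto
      then have "\<mu> = \<nu>" using code_inj[OF Cons.prems(3) startingD(1)] by simp
      then show False using False \<nu> by simp
    qed
    then have 1: "blinfun_apply (pinj_op ((edge_rel \<alpha> B)\<inverse>)) (ket (code \<mu>)) = 0"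
      by (intro pinj_op_ket(2)[OF pinj_converse[OF pinj_edge_rel]]) simp
    have "\<mu> \<notin> cylinder G (\<alpha> # w) A"
      using cylinder_Cons_imp[OF l Cons.prems(2) B(2)] False Cons.prems(3) unfolding starting_def by blast
    then show ?thesis unfolding e 1 by (simp add: blinfun.zero_right)
  qed
qed

lemma ex_cylinder:
  assumes \<mu>: "\<mu> \<in> boundary_paths G"
  shows "\<exists>w\<in>lists (labels G). \<exists>A\<in>idl_word G w. \<mu> \<in> cylinder G w A"
proof -
  have p: "is_path \<mu>" using \<mu> boundary_paths_iff by auto
  obtain n where n: "enat n \<le> path_length \<mu>" "vtx \<mu> n \<noteq> {}" using ex_nonempty_vtx[OF p] by auto
  obtain A where A: "A \<in> vtx \<mu> n" "A \<in> idl_word G (wd \<mu> n)" using vtx_meets_idl_word[OF p n] by auto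
  have w: "wd \<mu> n \<in> lists (labels G)" by (rule wd_labels[OF p n(1)])
  have "\<mu> \<in> cylinder G (wd \<mu> n) A" unfolding cylinder_iff[OF w A(2)] using \<mu> n A by simp
  then show ?thesis using w A(2) by blast
qed

end

section \<open>Characters and boundary paths\<close>

context gbds_rep
begin

definition diag_gen where "diag_gen = {e w C | w C. w \<in> lists (labels G) \<and> C \<in> idl_word G w}"

lemma diag_genI: "w \<in> lists (labels G) \<Longrightarrow> C \<in> idl_word G w \<Longrightarrow> e w C \<in> diag_gen"
  unfolding diag_gen_def by auto

lemma diag_gen_carrier: "diag_gen \<subseteq> carrier A"
  unfolding diag_gen_def using e_closed by auto

lemma diag_gen_star: "x \<in> diag_gen \<Longrightarrow> star A x = x"
  unfolding diag_gen_def using e_star by auto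

lemma diagonal_eq: "diagonal G A p s = cstar_gen A diag_gen"
  unfolding diagonal_def diag_gen_def ..

abbreviation D where "D \<equiv> diagonal G A p s"

lemma D_subalgebra: "cstar_subalgebra A D"
  unfolding diagonal_eq by (rule cstar_subalgebra_gen[OF diag_gen_carrier])

lemma e_D: "w \<in> lists (labels G) \<Longrightarrow> C \<in> idl_word G w \<Longrightarrow> e w C \<in> D"
  unfolding diagonal_eq using cstar_gen_superset diag_genI by blast

text \<open>The product that defines \<open>s_word\<close> involves a choice, but not one that its
  value depends on; the recursion \<open>t_Cons\<close> lets a homomorphism be followed letter by
  letter.\<close>

lemma hom_range_proj:
  assumes f: "star_hom A B f" and B: "gbds_rep G B P S"
    and fp: "\<And>C. f (p C) = P C" and fs: "\<And>\<alpha> C. \<alpha> \<in> labels G \<Longrightarrow> C \<in> idl G \<alpha> \<Longrightarrow> f (s \<alpha> C) = S \<alpha> C"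
    and w: "w \<in> lists (labels G)" and C: "C \<in> idl_word G w"
  shows "f (e w C) = range_proj G B P S w C"
proof -
  interpret B: gbds_rep G B P S by (rule B)
  note h = star_homD[OF f]
  have "f (t w C) = s_word G B P S w C"
    using w C
  proof (induction w rule: list.induct)
    case Nil
    then show ?case using fp by simp
  next
    case (Cons \<alpha> w)
    then have l: "\<alpha> \<in> labels G" "w \<in> lists (labels G)" by auto
    obtain E where E: "E \<in> idl G \<alpha>" "C \<le> act_word G w E" using idl_word_ConsD(1)[OF l(2,1) Cons.prems(2)] by auto
    have CI: "C \<in> idl_word G w" by (rule idl_word_ConsD(2)[OF l(2,1) Cons.prems(2)])
    show ?case
      unfolding t_Cons[OF l E] B.t_Cons[OF l E]
      using h(3)[OF s_closed[OF l(1) E(1)] t_closed[OF l(2) CI]] fs[OF l(1) E(1)] Cons.IH[OF l(2) CI] by simp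
  qed
  then show ?thesis
    unfolding range_proj_def using h(3,4) t_closed[OF w C] star_closed by simp
qed

text \<open>The elements whose image in the path representation has the basis vector of
  \<open>\<mu>\<close> as an eigenvector form a subalgebra that contains the generators, on which
  the eigenvalue is a multiplicative linear functional. It is bounded by the norm: the quasi-inverse
  of an element \<open>z\<close> of norm less than 1 rules out the eigenvalue 1.\<close>

lemma ex_path_character:
  assumes u: "universal_representation G A p s" and \<mu>: "\<mu> \<in> boundary_paths G"
  shows "\<exists>\<phi>\<in>spectrum A D. \<forall>w\<in>lists (labels G). \<forall>C\<in>idl_word G w.
    \<phi> (e w C) = (if \<mu> \<in> cylinder G w C then 1 else 0)"
proof -
  obtain F where F: "star_hom A operator_algebra F" "\<And>B. F (p B) = vertex_op B"
    "\<And>\<alpha> B. \<alpha> \<in> labels G \<Longrightarrow> B \<in> idl G \<alpha> \<Longrightarrow> F (s \<alpha> B) = edge_op \<alpha> B"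
    using ex_path_representation[OF gbds u] by auto
  note h = star_homD[OF F(1), unfolded operator_algebra_simps]
  define \<delta> where "\<delta> = (ket (code \<mu>) :: ('l list \<times> 'b) set ell2)"
  define ev where "ev x c \<longleftrightarrow> (\<forall>i. coord (blinfun_apply (F x) \<delta>) i = c * coord \<delta> i)" for x c
  have \<delta>1: "coord \<delta> (code \<mu>) = 1" unfolding \<delta>_def by (simp add: coord_ket)
  \<comment> \<open>\<open>csmult c id_blinfun\<close> multiplies vectors by the complex number \<open>c\<close>.\<close>
  have scale: "coord (blinfun_apply (F x) (csmult c id_blinfun \<delta>)) i = c * coord (blinfun_apply (F x) \<delta>) i"
    if "x \<in> carrier A" for x c i
  proof -
    have "blinfun_apply (F x) (csmult c id_blinfun \<delta>) = blinfun_apply (csmult c (F x)) \<delta>"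
      unfolding csmult_apply using opsD_J[OF h(1)[OF that]] by (simp add: blinfun.add_right blinfun.scaleR_right)
    then show ?thesis by (simp add: coord_csmult)
  qed
  have ev_vec: "blinfun_apply (F x) \<delta> = csmult c id_blinfun \<delta>" if "ev x c" for x c
    by (rule ell2_eqI) (use that in \<open>simp add: ev_def coord_csmult\<close>)
  have ev_add: "ev (x \<oplus> y) (c + d)" if "x \<in> carrier A" "y \<in> carrier A" "ev x c" "ev y d" for x y c d
    using that h(2)[OF that(1,2)] unfolding ev_def by (simp add: blinfun.add_left coord_simps distrib_right)
  have ev_mult: "ev (x \<otimes> y) (c * d)" if "x \<in> carrier A" "y \<in> carrier A" "ev x c" "ev y d" for x y c d
    unfolding ev_def
  proof
    fix i
    have "coord (blinfun_apply (F (x \<otimes> y)) \<delta>) i = d * coord (blinfun_apply (F x) \<delta>) i"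
      using h(3)[OF that(1,2)] ev_vec[OF that(4)] scale[OF that(1)] by simp
    then show "coord (blinfun_apply (F (x \<otimes> y)) \<delta>) i = c * d * coord \<delta> i" using that(3) unfolding ev_def by simp
  qed
  have ev_smult: "ev (a \<odot> x) (a * c)" if "x \<in> carrier A" "ev x c" for x a c
    using that h(5)[OF that(1)] unfolding ev_def by (simp add: coord_csmult)
  have bound: "cmod c \<le> nrm A x" if x: "x \<in> carrier A" "ev x c" for x c
  proof (rule ccontr)
    assume "\<not> ?thesis"
    then have lt: "nrm A x < cmod c" by simp
    have c0: "c \<noteq> 0" using lt nrm_nonneg[OF x(1)] by auto
    let ?z = "(1 / c) \<odot> x"
    have z: "?z \<in> carrier A" "nrm A ?z < 1"
      using lt c0 x(1) by (simp_all add: nrm_smult norm_divide field_simps)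
    have z1: "ev ?z 1" using ev_smult[OF x, of "1 / c"] c0 by simp
    obtain y where y: "y \<in> carrier A" "y = ?z \<oplus> y \<otimes> ?z"
      using ex_quasi_inverse[OF cstar_subalgebra_carrier z] by blast
    have "blinfun_apply (F ?z) \<delta> = \<delta>" by (rule ell2_eqI) (use z1 in \<open>simp add: ev_def\<close>)
    then have "blinfun_apply (F y) \<delta> = \<delta> + blinfun_apply (F y) \<delta>"
      using arg_cong[OF y(2), of "\<lambda>x. blinfun_apply (F x) \<delta>"] h(2)[OF z(1) mult_closed[OF y(1) z(1)]] h(3)[OF y(1) z(1)]
      by (simp add: blinfun.add_left)
    then have "\<delta> = 0" by simp
    then show False using \<delta>1 by (simp add: coord_zero)
  qed
  have gen: "ev (e w C) (if \<mu> \<in> cylinder G w C then 1 else 0)"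
    if "w \<in> lists (labels G)" "C \<in> idl_word G w" for w C
    using hom_range_proj[OF F(1) gbds_rep_operators F(2,3) that] range_proj_ket[OF that \<mu>]
    unfolding ev_def \<delta>_def by (simp add: coord_zero)
  have uniq: "c = d" if "ev x c" "ev x d" for x c d
  proof -
    have "c * coord \<delta> (code \<mu>) = d * coord \<delta> (code \<mu>)" using that unfolding ev_def by metis
    then show ?thesis using \<delta>1 by simp
  qed
  define val where "val x = (SOME c. ev x c)" for x
  have val: "val x = c" if "ev x c" for x c 
    unfolding val_def by (rule some_equality[of "ev x", OF that uniq[OF _ that]])
  have "\<exists>\<phi>\<in>spectrum A (cstar_gen A diag_gen). \<forall>x\<in>diag_gen. \<phi> x = val x"
  proof (rule ex_character[of diag_gen ev val, OF diag_gen_carrier diag_gen_star ev_add ev_mult ev_smult bound])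
    show "ev x (val x)" if x: "x \<in> diag_gen" for x
    proof -
      obtain c where "ev x c" using x gen unfolding diag_gen_def by blast
      then show ?thesis using val by simp
    qed
    obtain w C where wC: "w \<in> lists (labels G)" "C \<in> idl_word G w" "\<mu> \<in> cylinder G w C" using ex_cylinder[OF \<mu>] by auto
    then show "\<exists>x\<in>diag_gen. val x \<noteq> 0"
      using val[OF gen[OF wC(1,2)]] diag_genI[OF wC(1,2)] by (intro bexI[of _ "e w C"]) simp_all
  qed
  then obtain \<phi> where \<phi>: "\<phi> \<in> spectrum A D" "\<And>x. x \<in> diag_gen \<Longrightarrow> \<phi> x = val x" unfolding diagonal_eq by blast
  have "\<phi> (e w C) = (if \<mu> \<in> cylinder G w C then 1 else 0)"
    if "w \<in> lists (labels G)" "C \<in> idl_word G w" for w C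
    using \<phi>(2)[OF diag_genI[OF that]] val[OF gen[OF that]] by simp
  then show ?thesis using \<phi>(1) by blast
qed

lemma D_character_eqI:
  assumes \<phi>: "\<phi> \<in> spectrum A D" "\<psi> \<in> spectrum A D"
    and eq: "\<And>w C. w \<in> lists (labels G) \<Longrightarrow> C \<in> idl_word G w \<Longrightarrow> \<phi> (e w C) = \<psi> (e w C)"
  shows "\<phi> = \<psi>"
  by (rule character_eqI[OF diag_gen_carrier diag_gen_star])
     (use \<phi> eq in \<open>auto simp: diagonal_eq diag_gen_def\<close>)

text \<open>Projections have values 0 and 1 only, and each axiom of a path filter reflects one
  relation between the generating projections; \<open>extend\<close> holds because a sum with value
  1 has a nonzero term.\<close>

lemma character_path_filter:
  assumes \<phi>: "\<phi> \<in> spectrum A D"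
  shows "path_filter G {(w, C). w \<in> lists (labels G) \<and> C \<in> idl_word G w \<and> \<phi> (e w C) = 1}"
    and "w \<in> lists (labels G) \<Longrightarrow> C \<in> idl_word G w \<Longrightarrow> \<phi> (e w C) = 0 \<or> \<phi> (e w C) = 1"
proof -
  note sp = spectrumD[OF \<phi>]
  note z = character_zero[OF D_subalgebra \<phi>]
  have mult: "\<phi> (e w C) * \<phi> (e v B) = \<phi> (e w C \<otimes> e v B)"
    if "w \<in> lists (labels G)" "C \<in> idl_word G w" "v \<in> lists (labels G)" "B \<in> idl_word G v" for w C v B
    using sp(2)[OF e_D[OF that(1,2)] e_D[OF that(3,4)]] by simp
  have idem: "\<phi> (e w C) = 0 \<or> \<phi> (e w C) = 1" if w: "w \<in> lists (labels G)" "C \<in> idl_word G w" for w C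
  proof -
    have "e w C \<otimes> e w C = e w C" using e_mult_prefix[OF w(1) _ w(2), of "[]" C] w by simp
    then have "\<phi> (e w C) * \<phi> (e w C) = \<phi> (e w C)" using mult[OF w w] by simp
    then show ?thesis by simp
  qed
  then show "w \<in> lists (labels G) \<Longrightarrow> C \<in> idl_word G w \<Longrightarrow> \<phi> (e w C) = 0 \<or> \<phi> (e w C) = 1" .
  let ?X = "{(w, C). w \<in> lists (labels G) \<and> C \<in> idl_word G w \<and> \<phi> (e w C) = 1}"
  show "path_filter G ?X"
  proof (unfold_locales; unfold mem_Collect_eq case_prod_conv)
    obtain x where x: "x \<in> diag_gen" "\<phi> x \<noteq> 0"
      using character_nonzero_gen[OF diag_gen_carrier diag_gen_star] \<phi> unfolding diagonal_eq by blast
    then obtain w C where "x = e w C" "w \<in> lists (labels G)" "C \<in> idl_word G w" unfolding diag_gen_def by blast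
    then show "\<exists>w C. w \<in> lists (labels G) \<and> C \<in> idl_word G w \<and> \<phi> (e w C) = 1" using idem x(2) by metis
  next
    fix w
    show "\<not> (w \<in> lists (labels G) \<and> bot \<in> idl_word G w \<and> \<phi> (e w bot) = 1)" using e_bot[of w] z by auto
  next
    fix w C w' C'
    assume a: "w \<in> lists (labels G) \<and> C \<in> idl_word G w \<and> \<phi> (e w C) = 1"
      and b: "w' \<in> lists (labels G) \<and> C' \<in> idl_word G w' \<and> \<phi> (e w' C') = 1"
    show "\<exists>v. w' = w @ v \<or> w = w' @ v"
    proof (rule ccontr)
      assume "\<not> ?thesis"
      then have "e w C \<otimes> e w' C' = \<zero>" using e_mult_incomparable a b by blast
      then show False using mult[of w C w' C'] a b z by simp
    qed
  next
    fix w B v C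
    assume w: "w \<in> lists (labels G)" and B: "B \<in> idl_word G w"
      and C: "w @ v \<in> lists (labels G) \<and> C \<in> idl_word G (w @ v) \<and> \<phi> (e (w @ v) C) = 1"
    have v: "v \<in> lists (labels G)" using C by simp
    have I: "inf C (act_word G v B) \<in> idl_word G (w @ v)"
      by (rule ba_ideal_inf(1)[OF idl_word_ideal]) (use C in auto)
    have "\<phi> (e w B) = \<phi> (e (w @ v) (inf C (act_word G v B)))"
      using mult[OF w B, of "w @ v" C] e_mult_prefix[OF w v B, of C] C by simp
    then show "(w \<in> lists (labels G) \<and> B \<in> idl_word G w \<and> \<phi> (e w B) = 1) \<longleftrightarrow>
      (w @ v \<in> lists (labels G) \<and> inf C (act_word G v B) \<in> idl_word G (w @ v) \<and> \<phi> (e (w @ v) (inf C (act_word G v B))) = 1)"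
      using w B C I by simp
  next
    fix w B C
    assume w: "w \<in> lists (labels G)" and B: "B \<in> idl_word G w" and C: "C \<in> idl_word G w"
      and s: "w \<in> lists (labels G) \<and> sup B C \<in> idl_word G w \<and> \<phi> (e w (sup B C)) = 1"
    have I: "inf B C \<in> idl_word G w" by (rule ba_ideal_inf(1)[OF idl_word_ideal[OF w] B])
    have "\<phi> (e w (sup B C)) = \<phi> (e w B) + \<phi> (e w C) - \<phi> (e w (inf B C))"
      unfolding e_sup[OF w B C]
      using character_minus[OF D_subalgebra \<phi> subalgebraD(3)[OF D_subalgebra e_D[OF w B] e_D[OF w C]] e_D[OF w I]]
        sp(1)[OF e_D[OF w B] e_D[OF w C]] by simp
    then have "\<phi> (e w B) = 1 \<or> \<phi> (e w C) = 1"
      using s idem[OF w B] idem[OF w C] idem[OF w I] by auto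
    then show "(w \<in> lists (labels G) \<and> B \<in> idl_word G w \<and> \<phi> (e w B) = 1) \<or>
      (w \<in> lists (labels G) \<and> C \<in> idl_word G w \<and> \<phi> (e w C) = 1)" using w B C by simp
  next
    fix w C assume C: "w \<in> lists (labels G) \<and> C \<in> idl_word G w \<and> \<phi> (e w C) = 1" and r: "regular G C"
    have w: "w \<in> lists (labels G)" "C \<in> idl_word G w" using C by auto
    have ne: "C \<noteq> bot" using C e_bot[OF w(1)] z by auto
    note er = e_regular[OF w r ne]
    have l: "\<alpha> \<in> labels G" if "\<alpha> \<in> Delta G C" for \<alpha> using that unfolding Delta_def by simp
    have I: "act G \<alpha> C \<in> idl_word G (w @ [\<alpha>])" "w @ [\<alpha>] \<in> lists (labels G)" if "\<alpha> \<in> Delta G C" for \<alpha>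
      using idl_word_act[OF w(1) _ w(2), of "[\<alpha>]"] l[OF that] w(1) by auto
    have g: "(\<lambda>\<alpha>. e (w @ [\<alpha>]) (act G \<alpha> C)) \<in> Delta G C \<rightarrow> D" using e_D I by auto
    have "\<phi> (e w C) = (\<Sum>\<alpha>\<in>Delta G C. \<phi> (e (w @ [\<alpha>]) (act G \<alpha> C)))"
      using character_finsum[OF D_subalgebra \<phi> er(1) g] er(2) by simp
    then have "(\<Sum>\<alpha>\<in>Delta G C. \<phi> (e (w @ [\<alpha>]) (act G \<alpha> C))) \<noteq> 0" using C by simp
    then obtain \<alpha> where \<alpha>: "\<alpha> \<in> Delta G C" "\<phi> (e (w @ [\<alpha>]) (act G \<alpha> C)) \<noteq> 0" by (rule sum.not_neutral_contains_not_neutral)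
    then show "\<exists>\<alpha>\<in>labels G. w @ [\<alpha>] \<in> lists (labels G) \<and> act G \<alpha> C \<in> idl_word G (w @ [\<alpha>]) \<and> \<phi> (e (w @ [\<alpha>]) (act G \<alpha> C)) = 1"
      using idem[OF I(2,1)[OF \<alpha>(1)]] I[OF \<alpha>(1)] l[OF \<alpha>(1)] by auto
  qed auto
qed

lemma topspace_spectrum: "topspace (spectrum_topology A D) = spectrum A D"
  unfolding spectrum_topology_def spectrum_def by (auto simp: PiE_def)

lemma continuous_evaluation:
  assumes "x \<in> D" shows "continuous_map (spectrum_topology A D) euclidean (\<lambda>\<phi>. \<phi> x)"
  unfolding spectrum_topology_def
  by (rule continuous_map_from_subtopology[OF continuous_map_product_projection[OF assms]])

text \<open>Continuity in both directions is a statement about cylinders and generating projections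
  only: an evaluation at a generator is the indicator of a cylinder, and its values 0 and 1 are
  isolated from each other.\<close>

lemma homeomorphic_path_characters:
  assumes \<Phi>: "\<And>\<mu>. \<mu> \<in> boundary_paths G \<Longrightarrow> \<Phi> \<mu> \<in> spectrum A D"
    and val: "\<And>\<mu> w C. \<mu> \<in> boundary_paths G \<Longrightarrow> w \<in> lists (labels G) \<Longrightarrow> C \<in> idl_word G w \<Longrightarrow>
      \<Phi> \<mu> (e w C) = (if \<mu> \<in> cylinder G w C then 1 else 0)"
  shows "homeomorphic_map (boundary_topology G) (spectrum_topology A D) \<Phi>"
proof -
  let ?T = "boundary_topology G" and ?S = "spectrum_topology A D"
  have topT: "topspace ?T = boundary_paths G"
    unfolding boundary_topology_eq by (rule topspace_cylinder_topology)
  have cont: "continuous_map ?T ?S \<Phi>"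
  proof -
    have "continuous_map ?T euclidean (\<lambda>\<mu>. \<Phi> \<mu> x)" if x: "x \<in> D" for x
    proof (rule continuous_characters[OF diag_gen_carrier diag_gen_star])
      show "\<Phi> \<mu> \<in> spectrum A (cstar_gen A diag_gen)" if "\<mu> \<in> topspace ?T" for \<mu>
        using \<Phi> that topT unfolding diagonal_eq by simp
      show "x \<in> cstar_gen A diag_gen" using x unfolding diagonal_eq .
      fix y assume "y \<in> diag_gen"
      then obtain w C where y: "y = e w C" "w \<in> lists (labels G)" "C \<in> idl_word G w" unfolding diag_gen_def by blast
      note op = openin_cylinder[OF y(2,3), folded boundary_topology_eq]
      have sub: "cylinder G w C \<subseteq> boundary_paths G" using cylinder_iff[OF y(2,3)] by auto
      show "continuous_map ?T euclidean (\<lambda>\<mu>. \<Phi> \<mu> y)"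
        unfolding continuous_map_def topT
      proof (intro conjI allI impI)
        fix U :: "complex set"
        have "{\<mu> \<in> boundary_paths G. \<Phi> \<mu> y \<in> U} =
          (if 1 \<in> U then cylinder G w C else {}) \<union> (if 0 \<in> U then boundary_paths G - cylinder G w C else {})"
          using val[OF _ y(2,3)] sub unfolding y(1) by (auto split: if_splits)
        then show "openin ?T {\<mu> \<in> boundary_paths G. \<Phi> \<mu> y \<in> U}" using op by (simp add: openin_Un)
      qed simp
    qed
    then show ?thesis
      unfolding spectrum_topology_def continuous_map_in_subtopology continuous_map_componentwise topT
      using \<Phi> spectrumD(5) by blast
  qed
  have inj: "inj_on \<Phi> (boundary_paths G)"
  proof (rule inj_onI)
    fix \<mu> \<nu> assume m: "\<mu> \<in> boundary_paths G" "\<nu> \<in> boundary_paths G" "\<Phi> \<mu> = \<Phi> \<nu>"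
    show "\<mu> = \<nu>"
    proof (rule boundary_path_eqI[OF m(1,2)])
      fix w C assume w: "w \<in> lists (labels G)" "C \<in> idl_word G w"
      show "\<mu> \<in> cylinder G w C \<longleftrightarrow> \<nu> \<in> cylinder G w C"
        using val[OF m(1) w] val[OF m(2) w] m(3) by (metis zero_neq_one)
    qed
  qed
  have surj: "\<Phi> ` boundary_paths G = spectrum A D"
  proof (intro equalityI subsetI)
    fix \<phi> assume \<phi>: "\<phi> \<in> spectrum A D"
    let ?X = "{(w, C). w \<in> lists (labels G) \<and> C \<in> idl_word G w \<and> \<phi> (e w C) = 1}"
    interpret X: path_filter G ?X by (rule character_path_filter(1)[OF \<phi>])
    obtain \<mu> where \<mu>: "\<mu> \<in> boundary_paths G"
      "\<forall>w\<in>lists (labels G). \<forall>C\<in>idl_word G w. (w, C) \<in> ?X \<longleftrightarrow> \<mu> \<in> cylinder G w C"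
      using X.ex_boundary_path by blast
    have "\<phi> = \<Phi> \<mu>"
    proof (rule D_character_eqI[OF \<phi> \<Phi>[OF \<mu>(1)]])
      fix w C assume w: "w \<in> lists (labels G)" "C \<in> idl_word G w"
      have "\<phi> (e w C) = 1 \<longleftrightarrow> \<mu> \<in> cylinder G w C" using \<mu>(2) w by simp
      then show "\<phi> (e w C) = \<Phi> \<mu> (e w C)"
        using val[OF \<mu>(1) w] character_path_filter(2)[OF \<phi> w] by auto
    qed
    then show "\<phi> \<in> \<Phi> ` boundary_paths G" using \<mu>(1) by simp
  qed (use \<Phi> in auto)
  define g where "g = inv_into (boundary_paths G) \<Phi>"
  have g\<Phi>: "g (\<Phi> \<mu>) = \<mu>" if "\<mu> \<in> boundary_paths G" for \<mu> unfolding g_def by (rule inv_into_f_f[OF inj that])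
  have \<Phi>g: "g \<phi> \<in> boundary_paths G" "\<Phi> (g \<phi>) = \<phi>" if "\<phi> \<in> spectrum A D" for \<phi>
    unfolding g_def using that surj inv_into_into[of \<phi> \<Phi>] f_inv_into_f[of \<phi> \<Phi>] by auto
  have "continuous_map ?S ?T g"
    unfolding boundary_topology_eq cylinder_topology_def
  proof (rule continuous_on_generated_topo)
    fix U assume "U \<in> {cylinder G w C | w C. w \<in> lists (labels G) \<and> C \<in> idl_word G w} \<union>
     {boundary_paths G - cylinder G w C | w C. w \<in> lists (labels G) \<and> C \<in> idl_word G w}"
    then obtain w C where w: "w \<in> lists (labels G)" "C \<in> idl_word G w"
      and U: "U = cylinder G w C \<or> U = boundary_paths G - cylinder G w C" by blast
    have v: "\<phi> (e w C) = (if g \<phi> \<in> cylinder G w C then 1 else 0)" if "\<phi> \<in> spectrum A D" for \<phi>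
      using val[OF \<Phi>g(1)[OF that] w] \<Phi>g(2)[OF that] by simp
    have pre: "openin ?S {\<phi> \<in> topspace ?S. \<phi> (e w C) \<in> V}" if "open V" for V
      by (rule openin_continuous_map_preimage[OF continuous_evaluation[OF e_D[OF w]]]) (use that in simp)
    have "g -` cylinder G w C \<inter> topspace ?S = {\<phi> \<in> topspace ?S. \<phi> (e w C) \<in> - {0}}"
      "g -` (boundary_paths G - cylinder G w C) \<inter> topspace ?S = {\<phi> \<in> topspace ?S. \<phi> (e w C) \<in> - {1}}"
    proof -
      have mem: "\<phi> \<in> g -` cylinder G w C \<inter> spectrum A D \<longleftrightarrow> \<phi> \<in> {\<phi> \<in> spectrum A D. \<phi> (e w C) \<in> - {0}}"
        "\<phi> \<in> g -` (boundary_paths G - cylinder G w C) \<inter> spectrum A D \<longleftrightarrow> \<phi> \<in> {\<phi> \<in> spectrum A D. \<phi> (e w C) \<in> - {1}}" for \<phi>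
        using v[of \<phi>] \<Phi>g(1)[of \<phi>] by (cases "\<phi> \<in> spectrum A D"; simp)+
      show "g -` cylinder G w C \<inter> topspace ?S = {\<phi> \<in> topspace ?S. \<phi> (e w C) \<in> - {0}}"
        unfolding topspace_spectrum by (rule Set.set_eqI) (rule mem(1))
      show "g -` (boundary_paths G - cylinder G w C) \<inter> topspace ?S = {\<phi> \<in> topspace ?S. \<phi> (e w C) \<in> - {1}}"
        unfolding topspace_spectrum by (rule Set.set_eqI) (rule mem(2))
    qed
    then show "openin ?S (g -` U \<inter> topspace ?S)" 
      using U pre[of "- {0}", OF open_Compl[OF closed_singleton]] pre[of "- {1}", OF open_Compl[OF closed_singleton]] by auto
  next
    have "boundary_paths G \<subseteq> \<Union> ({cylinder G w C | w C. w \<in> lists (labels G) \<and> C \<in> idl_word G w} \<union>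
     {boundary_paths G - cylinder G w C | w C. w \<in> lists (labels G) \<and> C \<in> idl_word G w})"
      using topspace_cylinder_topology unfolding cylinder_topology_def topology_generated_by_topspace by simp
    then show "g ` topspace ?S \<subseteq> \<Union> ({cylinder G w C | w C. w \<in> lists (labels G) \<and> C \<in> idl_word G w} \<union>
     {boundary_paths G - cylinder G w C | w C. w \<in> lists (labels G) \<and> C \<in> idl_word G w})"
      using \<Phi>g(1) unfolding topspace_spectrum by blast
  qed
  then have "homeomorphic_maps ?T ?S \<Phi> g"
    unfolding homeomorphic_maps_def topT topspace_spectrum using cont g\<Phi> \<Phi>g(2) by simp
  then show ?thesis unfolding homeomorphic_map_maps by blast
qed

end

theorem theorem3p5:
  fixes G :: "('l, 'b::gen_boolean_algebra) gbds"
    and A :: "'c cstar" and p :: "'b \<Rightarrow> 'c" and s :: "'l \<Rightarrow> 'b \<Rightarrow> 'c"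
  assumes "generalized_bds G"
    and "universal_representation G A p s"
  defines "D \<equiv> diagonal G A p s"
  shows "(\<forall>\<mu>\<in>boundary_paths G. \<exists>!\<phi>. \<phi> \<in> spectrum A D \<and>
            (\<forall>w\<in>lists (labels G). \<forall>B\<in>idl_word G w.
               \<phi> (range_proj G A p s w B) = (if \<mu> \<in> cylinder G w B then 1 else 0))) \<and>
         (\<forall>\<Phi>. (\<forall>\<mu>\<in>boundary_paths G. \<Phi> \<mu> \<in> spectrum A D \<and>
            (\<forall>w\<in>lists (labels G). \<forall>B\<in>idl_word G w.
               \<Phi> \<mu> (range_proj G A p s w B) = (if \<mu> \<in> cylinder G w B then 1 else 0))) \<longrightarrow>
            homeomorphic_map (boundary_topology G) (spectrum_topology A D) \<Phi>)"
proof -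
  interpret gbds G by unfold_locales (rule assms(1))
  interpret cstar_algebra A using assms(2) unfolding universal_representation_def by simp
  interpret gbds_rep G A p s
    by unfold_locales (use assms(2) in \<open>simp add: universal_representation_def\<close>)
  show ?thesis
    unfolding D_def
  proof (intro conjI ballI allI impI)
    fix \<mu> assume \<mu>: "\<mu> \<in> boundary_paths G"
    obtain \<phi> where \<phi>: "\<phi> \<in> spectrum A (diagonal G A p s)"
      "\<forall>w\<in>lists (labels G). \<forall>B\<in>idl_word G w. \<phi> (range_proj G A p s w B) = (if \<mu> \<in> cylinder G w B then 1 else 0)"
      using ex_path_character[OF assms(2) \<mu>] by blast
    show "\<exists>!\<phi>. \<phi> \<in> spectrum A (diagonal G A p s) \<and> (\<forall>w\<in>lists (labels G). \<forall>B\<in>idl_word G w.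
      \<phi> (range_proj G A p s w B) = (if \<mu> \<in> cylinder G w B then 1 else 0))"
    proof (rule ex1I[of _ \<phi>])
      fix \<psi> assume \<psi>: "\<psi> \<in> spectrum A (diagonal G A p s) \<and> (\<forall>w\<in>lists (labels G). \<forall>B\<in>idl_word G w.
        \<psi> (range_proj G A p s w B) = (if \<mu> \<in> cylinder G w B then 1 else 0))"
      show "\<psi> = \<phi>" by (rule D_character_eqI) (use \<psi> \<phi> in auto)
    qed (use \<phi> in simp)
  next
    fix \<Phi> assume \<Phi>: "\<forall>\<mu>\<in>boundary_paths G. \<Phi> \<mu> \<in> spectrum A (diagonal G A p s) \<and>
      (\<forall>w\<in>lists (labels G). \<forall>B\<in>idl_word G w. \<Phi> \<mu> (range_proj G A p s w B) = (if \<mu> \<in> cylinder G w B then 1 else 0))"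
    show "homeomorphic_map (boundary_topology G) (spectrum_topology A (diagonal G A p s)) \<Phi>"
      by (rule homeomorphic_path_characters) (use \<Phi> in auto)
  qed
qed

end
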